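(* Let $\Omega_x=(x_-,x_+)$, $\Omega_z=(z_-,z_+)$, $z_\iota\in(z_-,z_+)$, the coefficients $A_x,A_z$ and the data $f,g_+,g_-$ be fixed, and let $(\varepsilon_\delta)$ be a family of anisotropy functions with $\varepsilon_\delta(z_\iota)=\delta$, $\delta\in(0,\delta_0]$, such that Hypothesis B (see context) holds for every $\delta$ with the same bound $\varepsilon_M$. For $\varepsilon=\varepsilon_\delta$, let $(\overline u,u_1',\xi_2')\in\mathcal W\times\mathcal V_1\times\mathcal V_2$ be the solution of the (AP/AP)-model and $(\overline v,v_1',0)\in\mathcal W\times\mathcal V_1\times\mathcal V_2$ the solution of the (AP/L)-model (see context for both). Then, as $\varepsilon(z_\iota)=\delta\to0$, $$\overline u\to\overline v\ \text{ in }\mathcal W\qquad\text{and}\qquad u_1'\to v_1'\ \text{ in }\mathcal V_1 ,$$ that is, $\|\overline u-\overline v\|_{\mathcal W}\to0$ and $\|u_1'-v_1'\|_{\mathcal V_1}\to0$. If moreover $u_1'(\cdot,z_\iota)\in H^2(\Omega_x)$ (for every $\delta$), then there exists a constant $c>0$, independent of $\varepsilon(z_\iota)=\delta$, such that $$\|\partial_x(\overline u-\overline v)\|_{L^2(\Omega_x)}+\|\partial_x(u_1'-v_1')\|_{L^2(\Omega_1)}+\|\partial_z(u_1'-v_1')\|_{L^2(\Omega_1)}\le c\,\sqrt{\varepsilon(z_\iota)} .$$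
   Context: **Domain.** $\Omega_x=(x_-,x_+)$, $\Omega_z=(z_-,z_+)$ are bounded open intervals, $L_z=z_+-z_-$, $\Omega=\Omega_x\times\Omega_z$. For $z_\iota\in(z_-,z_+)$ put $\Omega_z^1=(z_\iota,z_+)$, $\Omega_z^2=(z_-,z_\iota)$, $\Omega_1=\Omega_x\times\Omega_z^1$, $\Omega_2=\Omega_x\times\Omega_z^2$, $|\Omega_z^2|=z_\iota-z_-$. For a function $\phi$ on $\Omega$, $\overline\phi(x)=\frac1{L_z}\int_{\Omega_z}\phi(x,z)\,dz$ and $\phi'=\phi-\overline\phi$ (so a prime denotes the fluctuation in $z$, not a derivative); in particular $A_x'=A_x-\overline{A_x}$. **Hypothesis B.** $A_x,A_z\in W^{1,\infty}(\Omega)$ with $0<m_x\le A_x\le M_x$ and $0<m_z\le A_z\le M_z$ for constants $m_x,M_x,m_z,M_z$; $f\in H^1(\Omega)$; $g_+,g_-\in H^1(\Omega_x)$; $\varepsilon\in W^{1,\infty}(\Omega_z)$ is strictly increasing, $0<\varepsilon_{min}\le\varepsilon(z)\le\varepsilon_{max}\le1$ for some constants, and $\|\varepsilon\|_{W^{1,\infty}(\Omega_z)}\le\varepsilon_M$. (When $\varepsilon$ varies in a family, $\varepsilon_{min}>0$ may depend on the member of the family; $\varepsilon_M$ may not.) **Spaces.** $\mathcal W=\{\psi\in H^1(\Omega_x):\psi(x_\pm)=0\}$ with norm $\|\partial_x\psi\|_{L^2(\Omega_x)}$; $\mathcal V_1=\{\psi\in H^1(\Omega_1):\psi(x_\pm,\cdot)=0\}$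 and $\mathcal V_2=\{\psi\in H^1(\Omega_2):\psi(x_\pm,\cdot)=0,\ \psi(\cdot,z_\iota)=0\}$ with norms given by $\|\psi\|^2=\|\partial_x\psi\|^2_{L^2}+\|\partial_z\psi\|^2_{L^2}$ on $\Omega_1$, resp. $\Omega_2$. **(AP/AP)-model.** Find $(\overline u,u_1',\xi_2')\in\mathcal W\times\mathcal V_1\times\mathcal V_2$ satisfying (in the usual weak/trace sense): (i) in $\Omega_x$: $$-\partial_x(\overline{A_x}\,\partial_x\overline u)=\overline f+\tfrac{g_+}{L_z}-\tfrac{g_-}{L_z}+\tfrac1{L_z}\partial_x\Big(\int_{\Omega_z^1}A_x'\,\partial_xu_1'\,dz+\int_{\Omega_z^2}A_x'\,\partial_xu_1'(x,z_\iota)\,dz+\int_{\Omega_z^2}A_x'\,\partial_x\xi_2'\,dz\Big),\quad \overline u(x_\pm)=0;$$ (ii) in $\Omega_1$: $-\partial_x(A_x\partial_xu_1')-\partial_z\big(\frac{A_z}{\varepsilon}\partial_zu_1'\big)=f+\partial_x(A_x\partial_x\overline u)$, with $\frac{A_z(x,z_+)}{\varepsilon(z_+)}\partial_zu_1'(x,z_+)=g_+(x)$, $u_1'(x_\pm,z)=0$, $\frac{A_z(x,z_\iota)}{\varepsilon(z_\iota)}\partial_zu_1'(x,z_\iota)=\frac{A_z(x,z_\iota)}{\varepsilon(z_\iota)}\partial_z\xi_2'(x,z_\iota)$, and the constraint $\int_{\Omega_z^1}u_1'(x,z)\,dz+|\Omega_z^2|\,u_1'(x,z_\iota)+\int_{\Omega_z^2}\xi_2'(x,z)\,dz=0$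 for $x\in\Omega_x$; (iii) in $\Omega_2$: $-\partial_x(A_x\partial_x\xi_2')-\partial_z\big(\frac{A_z}{\varepsilon}\partial_z\xi_2'\big)=f+\partial_x(A_x\partial_xu_1'(x,z_\iota))+\partial_x(A_x\partial_x\overline u)$, with $\frac{A_z(x,z_-)}{\varepsilon(z_-)}\partial_z\xi_2'(x,z_-)=g_-(x)$, $\xi_2'(x_\pm,z)=0$, $\xi_2'(x,z_\iota)=0$. This model is an equivalent reformulation of the elliptic problem $-\partial_x(A_x\partial_xu)-\partial_z(\frac{A_z}{\varepsilon}\partial_zu)=f$ in $\Omega$, $\frac{A_z(x,z_\pm)}{\varepsilon(z_\pm)}\partial_zu(x,z_\pm)=g_\pm(x)$ on $\Omega_x$, $u(x_\pm,z)=0$ on $\Omega_z$: its unique solution is given by $\overline u$ = the $z$-average of $u$, $u_1'=u'|_{\Omega_1}$, and $\xi_2'(x,z)=u'(x,z)-u'(x,z_\iota)$ on $\Omega_2$. **(AP/L)-model.** $(\overline v,v_1',0)$ with $\overline v\in\mathcal W$, $v_1'\in\mathcal V_1$ satisfying (in the usual weak/trace sense; here $v_1'$ is simply the name of an unknown on $\Omega_1$): (i) in $\Omega_x$: $$-\partial_x(\overline{A_x}\,\partial_x\overline v)=\overline f+\tfrac{g_+}{L_z}-\tfrac{g_-}{L_z}+\tfrac1{L_z}\partial_x\Big(\int_{\Omega_z^1}A_x'\,\partial_xv_1'\,dz+\int_{\Omega_z^2}A_x'\,\partial_xv_1'(x,z_\iota)\,dz\Big),\quad \overline v(x_\pm)=0;$$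 (ii) in $\Omega_1$: $-\partial_x(A_x\partial_xv_1')-\partial_z\big(\frac{A_z}{\varepsilon}\partial_zv_1'\big)=f+\partial_x(A_x\partial_x\overline v)$, with $\frac{A_z(x,z_+)}{\varepsilon(z_+)}\partial_zv_1'(x,z_+)=g_+(x)$, $v_1'(x_\pm,z)=0$, $\frac{A_z(x,z_\iota)}{\varepsilon(z_\iota)}\partial_zv_1'(x,z_\iota)=0$, and the constraint $\int_{\Omega_z^1}v_1'(x,z)\,dz+|\Omega_z^2|\,v_1'(x,z_\iota)=0$ for $x\in\Omega_x$; (iii) the third component (the analogue of $\xi_2'$) is $0$. *)

theory Defs
  imports "HOL-Analysis.Analysis"
begin

section \<open>Function spaces\<close>

text \<open>
  Elements of Lebesgue and Sobolev spaces are represented by functions on the whole type of which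
  only the values almost everywhere in the given open set matter.
\<close>

primrec C_k :: "nat \<Rightarrow> ('a::euclidean_space \<Rightarrow> real) \<Rightarrow> bool" where
  "C_k 0 \<phi> \<longleftrightarrow> continuous_on UNIV \<phi>"
| "C_k (Suc k) \<phi> \<longleftrightarrow> (\<forall>y. \<phi> differentiable (at y)) \<and>
     (\<forall>i\<in>Basis. C_k k (\<lambda>y. frechet_derivative \<phi> (at y) i))"

definition test_function :: "'a::euclidean_space set \<Rightarrow> ('a \<Rightarrow> real) \<Rightarrow> bool" where
  "test_function S \<phi> \<longleftrightarrow>
     (\<forall>k. C_k k \<phi>) \<and> (\<exists>K. compact K \<and> K \<subseteq> S \<and> (\<forall>y. y \<notin> K \<longrightarrow> \<phi> y = 0))"

definition locally_integrable :: "'a::euclidean_space set \<Rightarrow> ('a \<Rightarrow> real) \<Rightarrow> bool" where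
  "locally_integrable S f \<longleftrightarrow> (\<forall>K. compact K \<and> K \<subseteq> S \<longrightarrow> set_integrable lborel K f)"

definition has_weak_partial ::
  "'a::euclidean_space set \<Rightarrow> 'a \<Rightarrow> ('a \<Rightarrow> real) \<Rightarrow> ('a \<Rightarrow> real) \<Rightarrow> bool" where
  "has_weak_partial S i f g \<longleftrightarrow> locally_integrable S f \<and> locally_integrable S g \<and>
     (\<forall>\<phi>. test_function S \<phi> \<longrightarrow>
        (LINT y:S|lborel. f y * frechet_derivative \<phi> (at y) i) = - (LINT y:S|lborel. g y * \<phi> y))"

definition weak_partial :: "'a::euclidean_space set \<Rightarrow> 'a \<Rightarrow> ('a \<Rightarrow> real) \<Rightarrow> 'a \<Rightarrow> real" where
  "weak_partial S i f = (SOME g. has_weak_partial S i f g)"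

abbreviation wD :: "real set \<Rightarrow> (real \<Rightarrow> real) \<Rightarrow> real \<Rightarrow> real" where
  "wD X \<equiv> weak_partial X 1"

abbreviation wDx :: "(real \<times> real) set \<Rightarrow> (real \<times> real \<Rightarrow> real) \<Rightarrow> real \<times> real \<Rightarrow> real" where
  "wDx R \<equiv> weak_partial R (1, 0)"

abbreviation wDz :: "(real \<times> real) set \<Rightarrow> (real \<times> real \<Rightarrow> real) \<Rightarrow> real \<times> real \<Rightarrow> real" where
  "wDz R \<equiv> weak_partial R (0, 1)"

definition L2 :: "'a::euclidean_space set \<Rightarrow> ('a \<Rightarrow> real) set" where
  "L2 S = {f. set_borel_measurable lborel S f \<and> set_integrable lborel S (\<lambda>y. (f y)\<^sup>2)}"

definition L2_norm :: "'a::euclidean_space set \<Rightarrow> ('a \<Rightarrow> real) \<Rightarrow> real" where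
  "L2_norm S f = sqrt (LINT y:S|lborel. (f y)\<^sup>2)"

definition H1 :: "'a::euclidean_space set \<Rightarrow> ('a \<Rightarrow> real) set" where
  "H1 S = {f \<in> L2 S. \<forall>i\<in>Basis. \<exists>g\<in>L2 S. has_weak_partial S i f g}"

definition H2 :: "'a::euclidean_space set \<Rightarrow> ('a \<Rightarrow> real) set" where
  "H2 S = {f \<in> H1 S. \<forall>i\<in>Basis. weak_partial S i f \<in> H1 S}"

text \<open>
  The assertion that the \<open>W\<^sup>1\<^sup>,\<^sup>\<infinity>\<close> norm, taken as the maximum of the
  essential suprema of the function and of its first partial derivatives, is at most \<open>M\<close>.
\<close>

definition W1inf_le :: "'a::euclidean_space set \<Rightarrow> ('a \<Rightarrow> real) \<Rightarrow> real \<Rightarrow> bool" where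
  "W1inf_le S f M \<longleftrightarrow> set_borel_measurable lborel S f \<and>
     (AE y in lborel. y \<in> S \<longrightarrow> \<bar>f y\<bar> \<le> M) \<and>
     (\<forall>i\<in>Basis. \<exists>g. has_weak_partial S i f g \<and> (AE y in lborel. y \<in> S \<longrightarrow> \<bar>g y\<bar> \<le> M))"

definition W1inf :: "'a::euclidean_space set \<Rightarrow> ('a \<Rightarrow> real) set" where
  "W1inf S = {f. \<exists>M. W1inf_le S f M}"


section \<open>Traces\<close>

text \<open>
  On a rectangle, \<open>H\<^sup>1\<close> embeds into the continuous functions of one variable (up to the
  end points) with values in \<open>L\<^sup>2\<close> of the other variable.  The trace on a side is therefore
  the \<open>L\<^sup>2\<close> limit of the parallel slices; slices are defined only up to a null set of
  parameters, whence the exceptional set \<open>N\<close>.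
\<close>

definition has_slice_trace ::
  "real set \<Rightarrow> real set \<Rightarrow> real \<Rightarrow> (real \<Rightarrow> real \<Rightarrow> real) \<Rightarrow> (real \<Rightarrow> real) \<Rightarrow> bool" where
  "has_slice_trace I J c F \<tau> \<longleftrightarrow> \<tau> \<in> L2 J \<and>
     (\<exists>N\<in>null_sets lborel.
        ((\<lambda>s. \<integral>\<^sup>+t\<in>J. ennreal ((F s t - \<tau> t)\<^sup>2) \<partial>lborel) \<longlongrightarrow> 0) (at c within I - N))"

definition has_trace_x ::
  "real set \<Rightarrow> real set \<Rightarrow> real \<Rightarrow> (real \<times> real \<Rightarrow> real) \<Rightarrow> (real \<Rightarrow> real) \<Rightarrow> bool" where
  "has_trace_x X Z c \<psi> \<tau> \<longleftrightarrow> has_slice_trace X Z c (\<lambda>x z. \<psi> (x, z)) \<tau>"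

definition has_trace_z ::
  "real set \<Rightarrow> real set \<Rightarrow> real \<Rightarrow> (real \<times> real \<Rightarrow> real) \<Rightarrow> (real \<Rightarrow> real) \<Rightarrow> bool" where
  "has_trace_z X Z c \<psi> \<tau> \<longleftrightarrow> has_slice_trace Z X c (\<lambda>z x. \<psi> (x, z)) \<tau>"

definition trace_z :: "real set \<Rightarrow> real set \<Rightarrow> real \<Rightarrow> (real \<times> real \<Rightarrow> real) \<Rightarrow> real \<Rightarrow> real" where
  "trace_z X Z c \<psi> = (SOME \<tau>. has_trace_z X Z c \<psi> \<tau>)"

definition vanishes_at :: "real set \<Rightarrow> real \<Rightarrow> (real \<Rightarrow> real) \<Rightarrow> bool" where
  "vanishes_at X c \<psi> \<longleftrightarrow> (\<exists>N\<in>null_sets lborel. (\<psi> \<longlongrightarrow> 0) (at c within X - N))"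


section \<open>The spaces of the unknowns\<close>

definition space_W :: "real \<Rightarrow> real \<Rightarrow> (real \<Rightarrow> real) set" where
  "space_W xm xp = {\<psi> \<in> H1 {xm<..<xp}.
     vanishes_at {xm<..<xp} xm \<psi> \<and> vanishes_at {xm<..<xp} xp \<psi>}"

definition space_V :: "real \<Rightarrow> real \<Rightarrow> real set \<Rightarrow> (real \<times> real \<Rightarrow> real) set" where
  "space_V xm xp Z = {\<psi> \<in> H1 ({xm<..<xp} \<times> Z).
     has_trace_x {xm<..<xp} Z xm \<psi> (\<lambda>z. 0) \<and> has_trace_x {xm<..<xp} Z xp \<psi> (\<lambda>z. 0)}"

definition space_V0 :: "real \<Rightarrow> real \<Rightarrow> real set \<Rightarrow> real \<Rightarrow> (real \<times> real \<Rightarrow> real) set" where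
  "space_V0 xm xp Z c = {\<psi> \<in> space_V xm xp Z. has_trace_z {xm<..<xp} Z c \<psi> (\<lambda>x. 0)}"

abbreviation space_V1 :: "real \<Rightarrow> real \<Rightarrow> real \<Rightarrow> real \<Rightarrow> (real \<times> real \<Rightarrow> real) set" where
  "space_V1 xm xp zi zp \<equiv> space_V xm xp {zi<..<zp}"

abbreviation space_V2 :: "real \<Rightarrow> real \<Rightarrow> real \<Rightarrow> real \<Rightarrow> (real \<times> real \<Rightarrow> real) set" where
  "space_V2 xm xp zm zi \<equiv> space_V0 xm xp {zm<..<zi} zi"

definition W_norm :: "real set \<Rightarrow> (real \<Rightarrow> real) \<Rightarrow> real" where
  "W_norm X \<psi> = L2_norm X (wD X \<psi>)"

definition V_norm :: "(real \<times> real) set \<Rightarrow> (real \<times> real \<Rightarrow> real) \<Rightarrow> real" where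
  "V_norm R \<psi> = sqrt ((L2_norm R (wDx R \<psi>))\<^sup>2 + (L2_norm R (wDz R \<psi>))\<^sup>2)"


section \<open>Data\<close>

definition z_mean :: "real \<Rightarrow> real \<Rightarrow> (real \<times> real \<Rightarrow> real) \<Rightarrow> real \<Rightarrow> real" where
  "z_mean zm zp \<phi> x = (1 / (zp - zm)) * (LINT z:{zm<..<zp}|lborel. \<phi> (x, z))"

definition z_fluct :: "real \<Rightarrow> real \<Rightarrow> (real \<times> real \<Rightarrow> real) \<Rightarrow> real \<times> real \<Rightarrow> real" where
  "z_fluct zm zp \<phi> y = \<phi> y - z_mean zm zp \<phi> (fst y)"

text \<open>
  No choice of a representative of \<open>\<epsilon>\<close> is hidden in the pointwise conditions: a monotone
  function on an open interval that agrees almost everywhere with a continuous one is equal to it.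
\<close>

definition hypothesis_B ::
  "real set \<Rightarrow> real set \<Rightarrow> (real \<times> real \<Rightarrow> real) \<Rightarrow> (real \<times> real \<Rightarrow> real) \<Rightarrow> (real \<times> real \<Rightarrow> real) \<Rightarrow>
   (real \<Rightarrow> real) \<Rightarrow> (real \<Rightarrow> real) \<Rightarrow> (real \<Rightarrow> real) \<Rightarrow> real \<Rightarrow> bool" where
  "hypothesis_B X Z Ax Az f gp gm \<epsilon> \<epsilon>M \<longleftrightarrow>
     Ax \<in> W1inf (X \<times> Z) \<and> Az \<in> W1inf (X \<times> Z) \<and>
     (\<exists>mx Mx. 0 < mx \<and> (AE y in lborel. y \<in> X \<times> Z \<longrightarrow> mx \<le> Ax y \<and> Ax y \<le> Mx)) \<and>
     (\<exists>mz Mz. 0 < mz \<and> (AE y in lborel. y \<in> X \<times> Z \<longrightarrow> mz \<le> Az y \<and> Az y \<le> Mz)) \<and>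
     f \<in> H1 (X \<times> Z) \<and> gp \<in> H1 X \<and> gm \<in> H1 X \<and>
     strict_mono_on Z \<epsilon> \<and>
     (\<exists>\<epsilon>min \<epsilon>max. 0 < \<epsilon>min \<and> \<epsilon>max \<le> 1 \<and> (\<forall>z\<in>Z. \<epsilon>min \<le> \<epsilon> z \<and> \<epsilon> z \<le> \<epsilon>max)) \<and>
     W1inf_le Z \<epsilon> \<epsilon>M"


section \<open>The two models\<close>

text \<open>
  Weak form of
  \<open>- (a u')' = F + (1/L) S'\<close> in \<open>(x\<^sub>-, x\<^sub>+)\<close> with \<open>u = 0\<close> at both ends.
\<close>

definition mean_equation ::
  "real \<Rightarrow> real \<Rightarrow> real \<Rightarrow> (real \<Rightarrow> real) \<Rightarrow> (real \<Rightarrow> real) \<Rightarrow> (real \<Rightarrow> real) \<Rightarrow> (real \<Rightarrow> real) \<Rightarrow> bool" where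
  "mean_equation xm xp L a F S u \<longleftrightarrow>
     (\<forall>\<psi>\<in>space_W xm xp.
        (LINT x:{xm<..<xp}|lborel. a x * wD {xm<..<xp} u x * wD {xm<..<xp} \<psi> x) =
        (LINT x:{xm<..<xp}|lborel. F x * \<psi> x)
        - (1 / L) * (LINT x:{xm<..<xp}|lborel. S x * wD {xm<..<xp} \<psi> x))"

text \<open>
  If \<open>- \<partial>\<^sub>x p - \<partial>\<^sub>z q = h\<close> in the rectangle \<open>R\<close> and \<open>\<psi>\<close>
  vanishes on its lateral sides, Green's formula gives for this quantity the integral of
  \<open>q \<psi>\<close> over the top side minus the integral of \<open>q \<psi>\<close> over the bottom side.
  It thus gives a meaning to the boundary values of the flux \<open>q\<close>, which is only in \<open>L\<^sup>2\<close>.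
\<close>

definition boundary_flux ::
  "(real \<times> real) set \<Rightarrow> (real \<times> real \<Rightarrow> real) \<Rightarrow> (real \<times> real \<Rightarrow> real) \<Rightarrow> (real \<times> real \<Rightarrow> real) \<Rightarrow>
   (real \<times> real \<Rightarrow> real) \<Rightarrow> real" where
  "boundary_flux R p q h \<psi> =
     (LINT y:R|lborel. p y * wDx R \<psi> y + q y * wDz R \<psi> y - h y * \<psi> y)"

text \<open>
  In both models the trace of the first fluctuation on the interface occurs under \<open>\<partial>\<^sub>x\<close>
  in the integrands; membership of this trace in \<open>H\<^sup>1\<close> is what makes these terms (and hence
  the weak formulation) meaningful.

  Test functions vanishing on the interface yield the partial differential equation in the
  respective rectangle together with the flux condition on its outer side.  In the first model the
  fluxes at the interface agree as functionals: after subtraction of the outer flux, both sides give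
  the same value on test functions having a common trace on the interface.  In the second model the
  test functions are unrestricted on the interface, which makes the flux there zero.
\<close>

definition AP_AP_solution ::
  "real \<Rightarrow> real \<Rightarrow> real \<Rightarrow> real \<Rightarrow> real \<Rightarrow>
   (real \<times> real \<Rightarrow> real) \<Rightarrow> (real \<times> real \<Rightarrow> real) \<Rightarrow> (real \<times> real \<Rightarrow> real) \<Rightarrow>
   (real \<Rightarrow> real) \<Rightarrow> (real \<Rightarrow> real) \<Rightarrow> (real \<Rightarrow> real) \<Rightarrow>
   (real \<Rightarrow> real) \<Rightarrow> (real \<times> real \<Rightarrow> real) \<Rightarrow> (real \<times> real \<Rightarrow> real) \<Rightarrow> bool" where
  "AP_AP_solution xm xp zm zi zp Ax Az f gp gm \<epsilon> u u1 \<xi> \<longleftrightarrow>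
    (let X = {xm<..<xp}; Z1 = {zi<..<zp}; Z2 = {zm<..<zi}; R1 = X \<times> Z1; R2 = X \<times> Z2;
         L = zp - zm; Ax' = z_fluct zm zp Ax;
         t = trace_z X Z1 zi u1;
         p1 = (\<lambda>y. Ax y * (wDx R1 u1 y + wD X u (fst y)));
         q1 = (\<lambda>y. Az y / \<epsilon> (snd y) * wDz R1 u1 y);
         p2 = (\<lambda>y. Ax y * (wDx R2 \<xi> y + wD X t (fst y) + wD X u (fst y)));
         q2 = (\<lambda>y. Az y / \<epsilon> (snd y) * wDz R2 \<xi> y)
     in u \<in> space_W xm xp \<and> u1 \<in> space_V1 xm xp zi zp \<and> \<xi> \<in> space_V2 xm xp zm zi \<and>
        t \<in> H1 X \<and>
        mean_equation xm xp L (z_mean zm zp Ax)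
          (\<lambda>x. z_mean zm zp f x + gp x / L - gm x / L)
          (\<lambda>x. (LINT z:Z1|lborel. Ax' (x, z) * wDx R1 u1 (x, z))
             + (LINT z:Z2|lborel. Ax' (x, z) * wD X t x)
             + (LINT z:Z2|lborel. Ax' (x, z) * wDx R2 \<xi> (x, z)))
          u \<and>
        (\<forall>\<psi>\<in>space_V0 xm xp Z1 zi.
           boundary_flux R1 p1 q1 f \<psi> = (LINT x:X|lborel. gp x * trace_z X Z1 zp \<psi> x)) \<and>
        (\<forall>\<psi>\<in>space_V0 xm xp Z2 zi.
           boundary_flux R2 p2 q2 f \<psi> = - (LINT x:X|lborel. gm x * trace_z X Z2 zm \<psi> x)) \<and>
        (\<forall>\<psi>1\<in>space_V xm xp Z1. \<forall>\<psi>2\<in>space_V xm xp Z2.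
           (AE x in lborel. x \<in> X \<longrightarrow> trace_z X Z1 zi \<psi>1 x = trace_z X Z2 zi \<psi>2 x) \<longrightarrow>
           (LINT x:X|lborel. gp x * trace_z X Z1 zp \<psi>1 x) - boundary_flux R1 p1 q1 f \<psi>1 =
           boundary_flux R2 p2 q2 f \<psi>2 + (LINT x:X|lborel. gm x * trace_z X Z2 zm \<psi>2 x)) \<and>
        (AE x in lborel. x \<in> X \<longrightarrow>
           (LINT z:Z1|lborel. u1 (x, z)) + (zi - zm) * t x + (LINT z:Z2|lborel. \<xi> (x, z)) = 0))"

definition AP_L_solution ::
  "real \<Rightarrow> real \<Rightarrow> real \<Rightarrow> real \<Rightarrow> real \<Rightarrow>
   (real \<times> real \<Rightarrow> real) \<Rightarrow> (real \<times> real \<Rightarrow> real) \<Rightarrow> (real \<times> real \<Rightarrow> real) \<Rightarrow>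
   (real \<Rightarrow> real) \<Rightarrow> (real \<Rightarrow> real) \<Rightarrow> (real \<Rightarrow> real) \<Rightarrow>
   (real \<Rightarrow> real) \<Rightarrow> (real \<times> real \<Rightarrow> real) \<Rightarrow> (real \<times> real \<Rightarrow> real) \<Rightarrow> bool" where
  "AP_L_solution xm xp zm zi zp Ax Az f gp gm \<epsilon> v v1 \<zeta> \<longleftrightarrow>
    (let X = {xm<..<xp}; Z1 = {zi<..<zp}; Z2 = {zm<..<zi}; R1 = X \<times> Z1; R2 = X \<times> Z2;
         L = zp - zm; Ax' = z_fluct zm zp Ax;
         t = trace_z X Z1 zi v1;
         p1 = (\<lambda>y. Ax y * (wDx R1 v1 y + wD X v (fst y)));
         q1 = (\<lambda>y. Az y / \<epsilon> (snd y) * wDz R1 v1 y)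
     in v \<in> space_W xm xp \<and> v1 \<in> space_V1 xm xp zi zp \<and> \<zeta> \<in> space_V2 xm xp zm zi \<and>
        t \<in> H1 X \<and>
        mean_equation xm xp L (z_mean zm zp Ax)
          (\<lambda>x. z_mean zm zp f x + gp x / L - gm x / L)
          (\<lambda>x. (LINT z:Z1|lborel. Ax' (x, z) * wDx R1 v1 (x, z))
             + (LINT z:Z2|lborel. Ax' (x, z) * wD X t x))
          v \<and>
        (\<forall>\<psi>\<in>space_V xm xp Z1.
           boundary_flux R1 p1 q1 f \<psi> = (LINT x:X|lborel. gp x * trace_z X Z1 zp \<psi> x)) \<and>
        (AE x in lborel. x \<in> X \<longrightarrow> (LINT z:Z1|lborel. v1 (x, z)) + (zi - zm) * t x = 0) \<and>
        (AE y in lborel. y \<in> R2 \<longrightarrow> \<zeta> y = 0))"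

end

theory Submission
  imports Defs
begin

text \<open>
  The limit model determines its solution twice: testing its equation above the interface with
  functions of \<open>x\<close> alone and subtracting the result from the mean equation gives
  \<open>- (a \<tau>')' = F - g\<^sub>-\<close> in \<open>\<Omega>\<^sub>x\<close> for the sum \<open>\<tau>\<close> of \<open>v\<close> and the interface trace of \<open>v\<^sub>1'\<close>, where
  \<open>a\<close> and \<open>F\<close> are the integrals of \<open>A\<^sub>x\<close> and \<open>f\<close> over \<open>\<Omega>\<^sub>z\<^sup>2\<close>.  Since \<open>\<epsilon>\<close> does not occur here,
  \<open>A\<^sub>x \<tau>'\<close> is Lipschitz continuous in \<open>x\<close> uniformly in \<open>\<delta>\<close>.

  Let \<open>e\<close> be the difference of the solutions of the two models, reassembled as functions on
  \<open>\<Omega>\<close>.  Testing with \<open>e\<close> expresses its energy through the functional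
  \<open>\<xi> \<mapsto> \<integral> f \<xi> - \<integral> A\<^sub>x \<tau>' \<partial>\<^sub>x \<xi> - \<integral> g\<^sub>- \<xi>(\<cdot>, z\<^sub>-)\<close> of the second fluctuation, which after integration by
  parts in \<open>x\<close> is at most \<open>C \<parallel>\<partial>\<^sub>z \<xi>\<parallel>\<close>, as \<open>\<xi>\<close> vanishes on the interface.  Since \<open>\<epsilon> \<le> \<delta>\<close> below the
  interface, the energy also dominates \<open>\<parallel>\<partial>\<^sub>z \<xi>\<parallel>\<^sup>2 / \<delta>\<close>; hence it is \<open>O(\<delta>)\<close>.
\<close>

section \<open>Smooth bump functions\<close>

text \<open>The functional of the second fluctuation \<xi> contains \<partial>_x \<xi>, which the
  energy controls only with the weight A_x and not with the large weight A_z / \<epsilon>; estimated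
  directly it would give boundedness only. Hence the derivative is moved onto A_x \<tau>', whose
  Lipschitz constant has to be uniform in \<delta>. The equation for \<tau> determines a \<tau>' up
  to one constant, and since \<tau> vanishes at both ends of \<Omega>_x, \<tau>' has mean zero,
  which bounds this constant by the data. The models place the interface trace only in H^1; that it
  vanishes at the ends is recovered from the lateral condition by an estimate at the corners.

  The energy bounds the derivatives of the sum of mean and fluctuation. The two are separated by the
  constraints, differentiated in x.

  Weak derivatives and traces are known only up to null sets. They are handled by writing a function
  as its value on a side plus the primitive of its derivative along almost every line.\<close>

lemma C_k_lower: "C_k (Suc k) \<phi> \<Longrightarrow> C_k k \<phi>"
proof (induction k arbitrary: \<phi>)
  case 0
  then show ?case
    by (auto simp: continuous_on_eq_continuous_within intro: differentiable_imp_continuous_within)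
next
  case (Suc k)
  then show ?case by (metis C_k.simps(2))
qed

lemma C_k_const: "C_k k (\<lambda>y. c)"
  by (induction k arbitrary: c) (auto simp: frechet_derivative_const)

lemma C_k_add:
  assumes "C_k k \<phi>" "C_k k \<theta>" shows "C_k k (\<lambda>y. \<phi> y + \<theta> y)"
  using assms
proof (induction k arbitrary: \<phi> \<theta>)
  case 0 then show ?case by (auto intro: continuous_on_add)
next
  case (Suc k)
  then have d: "\<phi> differentiable (at y)" "\<theta> differentiable (at y)" for y by auto
  have "frechet_derivative (\<lambda>y. \<phi> y + \<theta> y) (at y) =
      (\<lambda>h. frechet_derivative \<phi> (at y) h + frechet_derivative \<theta> (at y) h)" for y
    using has_derivative_add[OF frechet_derivative_works[THEN iffD1, OF d(1)]
        frechet_derivative_works[THEN iffD1, OF d(2)]]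
    by (rule frechet_derivative_at[symmetric])
  then show ?case using Suc d by auto
qed

lemma C_k_cmult:
  assumes "C_k k \<phi>" shows "C_k k (\<lambda>y. c * \<phi> y)"
  using assms
proof (induction k arbitrary: \<phi>)
  case 0 then show ?case by (auto intro: continuous_intros)
next
  case (Suc k)
  then have d: "\<phi> differentiable (at y)" for y by auto
  have "frechet_derivative (\<lambda>y. c * \<phi> y) (at y) = (\<lambda>h. c * frechet_derivative \<phi> (at y) h)" for y
    using has_derivative_mult_right[OF frechet_derivative_works[THEN iffD1, OF d], of c]
    by (rule frechet_derivative_at[symmetric])
  then show ?case using Suc d by auto
qed

lemma C_k_sum:
  assumes "\<And>i. i \<in> A \<Longrightarrow> C_k k (\<phi> i)" shows "C_k k (\<lambda>y. \<Sum>i\<in>A. \<phi> i y)"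
  using assms by (induction A rule: infinite_finite_induct) (auto intro: C_k_const C_k_add)

text \<open>With both factors smooth of all orders, every summand of the product rule is again a
  product of such factors, so the induction needs no bookkeeping of the order that a factor loses by
  differentiation.\<close>

lemma C_k_mult:
  assumes "\<And>k. C_k k \<phi>" "\<And>k. C_k k \<theta>" shows "C_k k (\<lambda>y. \<phi> y * \<theta> y)"
  using assms
proof (induction k arbitrary: \<phi> \<theta>)
  case 0
  from 0(1)[of 0] 0(2)[of 0] show ?case by (auto intro: continuous_on_mult)
next
  case (Suc k)
  have c: "C_k (Suc j) \<phi>" "C_k (Suc j) \<theta>" for j using Suc by blast+
  then have d: "\<phi> differentiable (at y)" "\<theta> differentiable (at y)" for y by auto
  have "frechet_derivative (\<lambda>y. \<phi> y * \<theta> y) (at y) =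
      (\<lambda>h. \<phi> y * frechet_derivative \<theta> (at y) h + frechet_derivative \<phi> (at y) h * \<theta> y)" for y
    using has_derivative_mult[OF frechet_derivative_works[THEN iffD1, OF d(1)]
        frechet_derivative_works[THEN iffD1, OF d(2)]]
    by (rule frechet_derivative_at[symmetric])
  moreover have "C_k k (\<lambda>y. \<phi> y * frechet_derivative \<theta> (at y) i + frechet_derivative \<phi> (at y) i * \<theta> y)"
    if "i \<in> Basis" for i
  proof (intro C_k_add Suc.IH)
    show "C_k j (\<lambda>y. frechet_derivative \<theta> (at y) i)" "C_k j (\<lambda>y. frechet_derivative \<phi> (at y) i)" for j
      using c[of j] that by auto
  qed (use Suc in auto)
  ultimately show ?case using d by auto
qed

lemma C_k_affine:
  fixes L :: "'a::euclidean_space \<Rightarrow> 'b::euclidean_space"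
  assumes L: "bounded_linear L" and "C_k k \<phi>" shows "C_k k (\<lambda>y. \<phi> (c + L y))"
  using assms(2)
proof (induction k arbitrary: \<phi>)
  case 0
  have "continuous_on UNIV (\<lambda>y. c + L y)"
    using L by (intro continuous_intros) (rule linear_continuous_on)
  then show ?case using 0 by (auto intro!: continuous_on_compose2[of UNIV \<phi> UNIV "\<lambda>y. c + L y"])
next
  case (Suc k)
  then have d: "\<phi> differentiable (at y)" for y by auto
  have 1: "((\<lambda>y. c + L y) has_derivative L) (at y)" for y
    using has_derivative_add[OF has_derivative_const bounded_linear_imp_has_derivative[OF L]] by simp
  have D: "((\<lambda>y. \<phi> (c + L y)) has_derivative (\<lambda>h. frechet_derivative \<phi> (at (c + L y)) (L h))) (at y)" for y
    using diff_chain_at[OF 1 frechet_derivative_works[THEN iffD1, OF d]] by (simp add: o_def)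
  \<comment> \<open>\<open>C_k\<close> speaks of derivatives in basis directions only, so the
    direction \<open>L i\<close> is expanded in the basis; the result is a linear combination to
    which the induction hypothesis applies.\<close>
  have E: "frechet_derivative (\<lambda>y. \<phi> (c + L y)) (at y) i =
     (\<Sum>j\<in>Basis. (L i \<bullet> j) * frechet_derivative \<phi> (at (c + L y)) j)" for y i
  proof -
    have lin: "linear (frechet_derivative \<phi> (at (c + L y)))"
      by (rule linear_frechet_derivative[OF d])
    have "frechet_derivative (\<lambda>y. \<phi> (c + L y)) (at y) i = frechet_derivative \<phi> (at (c + L y)) (L i)"
      by (simp add: frechet_derivative_at[OF D, symmetric])
    also have "\<dots> = frechet_derivative \<phi> (at (c + L y)) (\<Sum>j\<in>Basis. (L i \<bullet> j) *\<^sub>R j)"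
      by (simp add: euclidean_representation)
    also have "\<dots> = (\<Sum>j\<in>Basis. (L i \<bullet> j) * frechet_derivative \<phi> (at (c + L y)) j)"
      using lin by (simp add: linear_sum linear_cmul)
    finally show ?thesis .
  qed
  have "C_k k (\<lambda>y. \<Sum>j\<in>Basis. (L i \<bullet> j) * frechet_derivative \<phi> (at (c + L y)) j)" for i
    by (intro C_k_sum C_k_cmult Suc.IH) (use Suc in auto)
  then show ?case using D by (auto simp: E differentiable_def)
qed

lemma C_k_prod:
  assumes "\<And>i k. i \<in> A \<Longrightarrow> C_k k (\<phi> i)" shows "C_k k (\<lambda>y. \<Prod>i\<in>A. \<phi> i y)"
  using assms
  by (induction A arbitrary: k rule: infinite_finite_induct) (auto intro: C_k_const C_k_mult)

lemma frechet_derivative_real_eq: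
  fixes f :: "real \<Rightarrow> real"
  assumes "(f has_real_derivative D) (at x)" shows "frechet_derivative f (at x) h = D * h"
  using frechet_derivative_at[of f "(*) D" x] assms by (simp add: has_field_derivative_def)

lemma C_k_SucI_real:
  fixes f :: "real \<Rightarrow> real"
  assumes "\<And>x. (f has_real_derivative f' x) (at x)" "C_k k f'" shows "C_k (Suc k) f"
proof -
  have "(\<lambda>y. frechet_derivative f (at y) 1) = f'"
    using frechet_derivative_real_eq[OF assms(1)] by auto
  moreover have "f differentiable (at y)" for y
    using assms(1)[of y] by (auto simp: differentiable_def has_field_derivative_def)
  ultimately show ?thesis using assms(2) by simp
qed

text \<open>The power in front of the classical exp (-1/x) makes the family closed under
  differentiation up to linear combinations, which is what an induction on the order of smoothness
  requires.\<close>

definition smooth_exp :: "nat \<Rightarrow> real \<Rightarrow> real" where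
  "smooth_exp n x = (if x \<le> 0 then 0 else inverse x ^ n * exp (- inverse x))"

lemma smooth_exp_deriv:
  "(smooth_exp n has_real_derivative (smooth_exp (n + 2) x - of_nat n * smooth_exp (n + 1) x)) (at x)"
proof (cases x "0::real" rule: linorder_cases)
  case neg: less
  have "((\<lambda>x. 0) has_real_derivative 0) (at x)" by simp
  then have "(smooth_exp n has_real_derivative 0) (at x)"
    by (rule DERIV_cong_ev[THEN iffD1, rotated -1])
      (use neg in \<open>auto simp: smooth_exp_def intro!: eventually_mono[OF eventually_nhds_in_open[of "{..<0}" x]]\<close>)
  then show ?thesis using neg by (simp add: smooth_exp_def)
next
  case zero: equal
  \<comment> \<open>The substitution t = 1 / h turns this into t^m / exp t tending to 0 at infinity.
    With m = n + 1 it is the right-hand difference quotient at 0.\<close>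
  have lim: "((\<lambda>h. inverse h ^ m * exp (- inverse h)) \<longlongrightarrow> 0) (at_right (0::real))" for m
  proof -
    have "((\<lambda>t. t ^ m / exp t) \<longlongrightarrow> (0::real)) at_top" by (rule tendsto_power_div_exp_0)
    from filterlim_compose[OF this filterlim_inverse_at_top_right]
    show ?thesis by (simp add: exp_minus divide_inverse)
  qed
  have "((\<lambda>h. smooth_exp n h / h) \<longlongrightarrow> 0) (at_right 0)"
    by (rule tendsto_cong[THEN iffD2, OF _ lim[of "Suc n"]])
      (auto simp: smooth_exp_def eventually_at_right_field divide_inverse intro!: exI[of _ 1])
  moreover have "((\<lambda>h. smooth_exp n h / h) \<longlongrightarrow> 0) (at_left 0)"
    by (rule tendsto_cong[THEN iffD2, OF _ tendsto_const])
      (auto simp: smooth_exp_def eventually_at_left_field intro!: exI[of _ "-1"])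
  ultimately have "((\<lambda>h. smooth_exp n h / h) \<longlongrightarrow> 0) (at 0)"
    by (simp add: filterlim_split_at)
  then have "(smooth_exp n has_real_derivative 0) (at 0)"
    unfolding DERIV_def by (simp add: smooth_exp_def)
  then show ?thesis using zero by (simp add: smooth_exp_def)
next
  case pos: greater
  have r: "(inverse has_real_derivative - (inverse x ^ 2)) (at x)"
    using DERIV_inverse[of x UNIV] pos by (simp add: numeral_2_eq_2)
  have "((\<lambda>x. inverse x ^ n * exp (- inverse x)) has_real_derivative
     (smooth_exp (n + 2) x - of_nat n * smooth_exp (n + 1) x)) (at x)"
    using DERIV_mult[OF DERIV_power[OF r, of n] DERIV_fun_exp[OF DERIV_minus[OF r]]]
  proof (rule DERIV_cong)
    show "of_nat n * (- (inverse x)\<^sup>2 * inverse x ^ (n - Suc 0)) * exp (- inverse x) +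
        exp (- inverse x) * (- (- (inverse x)\<^sup>2)) * inverse x ^ n =
        smooth_exp (n + 2) x - of_nat n * smooth_exp (n + 1) x"
    proof (cases n)
      case (Suc m)
      then show ?thesis using pos by (simp add: smooth_exp_def algebra_simps power2_eq_square)
    qed (use pos in \<open>simp add: smooth_exp_def power2_eq_square\<close>)
  qed
  then show ?thesis
    by (rule DERIV_cong_ev[THEN iffD1, rotated -1])
      (use pos in \<open>auto simp: smooth_exp_def intro!: eventually_mono[OF eventually_nhds_in_open[of "{0<..}" x]]\<close>)
qed

lemma C_k_smooth_exp: "C_k k (smooth_exp n)"
proof (induction k arbitrary: n)
  case 0
  show ?case
    using DERIV_isCont[OF smooth_exp_deriv] by (auto simp: continuous_on_eq_continuous_within)
next
  case (Suc k)
  have "C_k k (\<lambda>x. smooth_exp (n + 2) x + (- of_nat n) * smooth_exp (n + 1) x)"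
    by (intro C_k_add C_k_cmult Suc)
  then show ?case
    by (intro C_k_SucI_real[OF smooth_exp_deriv]) simp
qed

text \<open>The shift by 1 confines the support to [a + 1/n, b - 1/n], a compact subset of the open
  interval. As n grows the arguments tend to infinity inside the interval, so the values tend to 1
  and indicators of intervals are approximated without normalisation.\<close>

definition bump :: "real \<Rightarrow> real \<Rightarrow> nat \<Rightarrow> real \<Rightarrow> real" where
  "bump a b n x = smooth_exp 0 (of_nat n * (x - a) - 1) * smooth_exp 0 (of_nat n * (b - x) - 1)"

lemma smooth_exp_0_le_1: "smooth_exp 0 x \<le> 1" and smooth_exp_nonneg: "0 \<le> smooth_exp n x"
  by (auto simp: smooth_exp_def)

lemma bump_bounds: "0 \<le> bump a b n x" "bump a b n x \<le> 1"
  unfolding bump_def by (auto intro!: mult_nonneg_nonneg smooth_exp_nonneg mult_le_one smooth_exp_0_le_1)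

lemma test_function_bump: "test_function {a<..<b} (bump a b n)"
proof (cases "n = 0")
  \<comment> \<open>For n = 0 the interval used below would be [a, b] by the convention 1 / 0 = 0,
    which does not lie in the open interval. Here both factors are \<open>smooth_exp 0 (-1)\<close>,
    hence zero.\<close>
  case True
  then have "bump a b n = (\<lambda>x. 0)" by (auto simp: bump_def smooth_exp_def)
  then show ?thesis by (auto simp: test_function_def C_k_const)
next
  case False
  have "C_k k (\<lambda>x. smooth_exp 0 ((- of_nat n * a - 1) + of_nat n * x) * smooth_exp 0 ((of_nat n * b - 1) + (- of_nat n * x)))" for k
    by (intro C_k_mult C_k_affine C_k_smooth_exp bounded_linear_mult_right)
  then have "C_k k (bump a b n)" for k by (simp add: bump_def[abs_def] algebra_simps)
  moreover have "bump a b n y = 0" if y: "y \<notin> {a + 1 / n..b - 1 / n}" for y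
  proof -
    have "real n * (y - a) \<le> 1 \<or> real n * (b - y) \<le> 1"
    proof (cases "y < a + 1 / n")
      case True
      then have "y - a \<le> 1 / n" by simp
      from mult_left_mono[OF this, of "real n"] show ?thesis using False by simp
    next
      case F: False
      then have "b - y \<le> 1 / n" using y by simp
      from mult_left_mono[OF this, of "real n"] show ?thesis using False by simp
    qed
    then show ?thesis by (auto simp: bump_def smooth_exp_def)
  qed
  moreover have "{a + 1 / n..b - 1 / n} \<subseteq> {a<..<b}"
  proof -
    define r where "r = 1 / real n"
    have "0 < r" using False by (simp add: r_def)
    then show ?thesis unfolding r_def[symmetric] by auto
  qed
  ultimately show ?thesis unfolding test_function_def by (intro conjI allI exI[of _ "{a + 1 / n..b - 1 / n}"]) auto
qed

lemma bump_tendsto: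
  assumes "x \<in> {a<..<b}" shows "(\<lambda>n. bump a b n x) \<longlonglongrightarrow> 1"
proof -
  have *: "(\<lambda>n. smooth_exp 0 (of_nat n * c - 1)) \<longlonglongrightarrow> 1" if "c > 0" for c
  proof -
    have "filterlim (\<lambda>n. of_nat n * c - 1 :: real) at_top sequentially"
      using filterlim_tendsto_add_at_top[OF tendsto_const[of "-1"]
        filterlim_at_top_mult_tendsto_pos[OF tendsto_const[of c] that filterlim_real_sequentially]]
      by simp
    then have "(\<lambda>n. exp (- inverse (of_nat n * c - 1))) \<longlonglongrightarrow> exp (- 0)"
      by (intro tendsto_intros) (rule tendsto_inverse_0_at_top)
    moreover have "eventually (\<lambda>n. of_nat n * c - 1 > 0) sequentially"
      using \<open>filterlim _ at_top sequentially\<close> by (rule filterlim_at_top_dense[THEN iffD1, rule_format])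
    then have "eventually (\<lambda>n. exp (- inverse (of_nat n * c - 1)) = smooth_exp 0 (of_nat n * c - 1)) sequentially"
      by eventually_elim (auto simp: smooth_exp_def)
    ultimately show ?thesis by (simp add: tendsto_cong)
  qed
  have "(\<lambda>n. smooth_exp 0 (of_nat n * (x - a) - 1) * smooth_exp 0 (of_nat n * (b - x) - 1)) \<longlonglongrightarrow> 1 * 1"
    by (intro tendsto_mult *) (use assms in auto)
  then show ?thesis by (simp add: bump_def)
qed

section \<open>Uniqueness of weak derivatives\<close>

lemma test_function_continuous: "test_function S \<phi> \<Longrightarrow> continuous_on UNIV \<phi>"
  unfolding test_function_def by (metis C_k.simps(1))

lemma test_function_differentiable: "test_function S \<phi> \<Longrightarrow> \<phi> differentiable (at y)"
  unfolding test_function_def by (metis C_k.simps(2))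

lemma test_function_borel: "test_function S \<phi> \<Longrightarrow> \<phi> \<in> borel_measurable borel"
  by (rule borel_measurable_continuous_onI) (rule test_function_continuous)

lemma test_function_deriv:
  assumes "test_function S \<phi>" "i \<in> Basis"
  shows "test_function S (\<lambda>y. frechet_derivative \<phi> (at y) i)"
proof -
  obtain K where K: "compact K" "K \<subseteq> S" "\<And>y. y \<notin> K \<Longrightarrow> \<phi> y = 0"
    using assms unfolding test_function_def by auto
  have "C_k k (\<lambda>y. frechet_derivative \<phi> (at y) i)" for k
    using assms unfolding test_function_def by (metis C_k.simps(2))
  moreover have "frechet_derivative \<phi> (at y) i = 0" if "y \<notin> K" for y
  proof -
    have "((\<lambda>y. 0) has_derivative (\<lambda>h. 0)) (at y)" by simp
    then have "(\<phi> has_derivative (\<lambda>h. 0)) (at y)"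
      by (rule has_derivative_transform_within_open[of _ _ _ _ "- K"])
        (use K that in \<open>auto simp: compact_imp_closed open_Compl\<close>)
    then show ?thesis by (metis frechet_derivative_at)
  qed
  ultimately show ?thesis using K unfolding test_function_def by blast
qed

lemma test_function_bounded:
  assumes "test_function S \<phi>" obtains B where "\<And>y. \<bar>\<phi> y\<bar> \<le> B" "0 \<le> B"
proof -
  obtain K where K: "compact K" "K \<subseteq> S" "\<And>y. y \<notin> K \<Longrightarrow> \<phi> y = 0"
    using assms unfolding test_function_def by auto
  have "compact (\<phi> ` K)"
    using K test_function_continuous[OF assms] by (metis compact_continuous_image continuous_on_subset subset_UNIV)
  then obtain B where "\<And>y. y \<in> K \<Longrightarrow> \<bar>\<phi> y\<bar> \<le> B"
    using compact_imp_bounded bounded_iff by (metis imageI real_norm_def)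
  then have "\<bar>\<phi> y\<bar> \<le> max B 0" for y using K by (cases "y \<in> K") (auto simp: le_max_iff_disj)
  then show ?thesis using that[of "max B 0"] by auto
qed

lemma locally_integrable_mult_test:
  assumes "locally_integrable S g" "test_function S \<phi>"
  shows "set_integrable lborel S (\<lambda>y. g y * \<phi> y)"
proof -
  obtain K where K: "compact K" "K \<subseteq> S" "\<And>y. y \<notin> K \<Longrightarrow> \<phi> y = 0"
    using assms unfolding test_function_def by auto
  obtain B where B: "\<And>y. \<bar>\<phi> y\<bar> \<le> B" using test_function_bounded[OF assms(2)] by blast
  have int: "integrable lborel (\<lambda>y. indicator K y *\<^sub>R g y)"
    using assms K unfolding locally_integrable_def set_integrable_def by blast
  have "integrable lborel (\<lambda>y. (indicator K y *\<^sub>R g y) * \<phi> y)"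
  proof (rule Bochner_Integration.integrable_bound[OF integrable_mult_left[OF int, of B]])
    show "(\<lambda>y. (indicator K y *\<^sub>R g y) * \<phi> y) \<in> borel_measurable lborel"
      using int test_function_borel[OF assms(2)] by measurable
    show "AE x in lborel. norm (indicator K x *\<^sub>R g x * \<phi> x) \<le> norm (indicator K x *\<^sub>R g x * B)"
      using order_trans[OF B abs_ge_self] by (auto simp: abs_mult intro!: mult_left_mono)
  qed
  moreover have "(\<lambda>y. (indicator K y *\<^sub>R g y) * \<phi> y) = (\<lambda>y. indicator S y *\<^sub>R (g y * \<phi> y))"
    using K by (auto simp: indicator_def fun_eq_iff)
  ultimately show ?thesis unfolding set_integrable_def by simp
qed

text \<open>An open set is a countable union of closed boxes, on each of which local integrability
  supplies measurability; the pieces are glued together with the complement of the set.\<close>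

lemma locally_integrable_measurable:
  assumes "open S" "locally_integrable S g"
  shows "set_borel_measurable lborel S g"
proof -
  obtain D where D: "countable D" "D \<subseteq> Pow S" "\<And>X. X \<in> D \<Longrightarrow> \<exists>a b. X = cbox a b" "\<Union>D = S"
    using open_countable_Union_open_cbox[OF assms(1)] by metis
  show ?thesis unfolding set_borel_measurable_def
  proof (rule measurable_piecewise_restrict[of "insert (- S) D"])
    show "countable (insert (- S) D)" using D by simp
    show "\<Omega> \<inter> space lborel \<in> sets lborel" if "\<Omega> \<in> insert (- S) D" for \<Omega>
      using that D(3) assms(1) by (auto dest!: D(3))
    show "space lborel \<subseteq> \<Union> (insert (- S) D)" using D by auto
    show "(\<lambda>x. indicat_real S x *\<^sub>R g x) \<in> borel_measurable (restrict_space lborel \<Omega>)" if "\<Omega> \<in> insert (- S) D" for \<Omega>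
    proof (cases "\<Omega> = - S")
      case True
      have "(\<lambda>x. 0) \<in> borel_measurable (restrict_space lborel \<Omega>)" by simp
      then show ?thesis
        by (rule measurable_cong[THEN iffD1, rotated]) (auto simp: space_restrict_space True)
    next
      case False
      then have "\<Omega> \<in> D" using that by auto
      then have "compact \<Omega>" "\<Omega> \<subseteq> S" using D by (auto, metis compact_cbox)
      then have "(\<lambda>x. indicat_real \<Omega> x *\<^sub>R g x) \<in> borel_measurable lborel"
        using assms(2) unfolding locally_integrable_def set_integrable_def by blast
      then have "(\<lambda>x. indicat_real \<Omega> x *\<^sub>R g x) \<in> borel_measurable (restrict_space lborel \<Omega>)"
        by (rule measurable_restrict_space1)
      then show ?thesis
        by (rule measurable_cong[THEN iffD1, rotated])
          (use \<open>\<Omega> \<subseteq> S\<close> in \<open>auto simp: space_restrict_space indicator_def\<close>)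
    qed
  qed
qed

text \<open>
  Products suffice, and their primitives in one variable are again products; no primitive of a
  genuinely multivariate test function has to be constructed.
\<close>

lemma AE_zero_if_orthogonal_to_products:
  fixes g :: "'a::euclidean_space \<Rightarrow> real"
  assumes S: "open S" and g: "locally_integrable S g"
    and orth: "\<And>a b \<phi>. cbox a b \<subseteq> S \<Longrightarrow> (\<And>i. i \<in> Basis \<Longrightarrow> test_function {a \<bullet> i<..<b \<bullet> i} (\<phi> i)) \<Longrightarrow>
      (LINT y:S|lborel. g y * (\<Prod>i\<in>Basis. \<phi> i (y \<bullet> i))) = 0"
  shows "AE y in lborel. y \<in> S \<longrightarrow> g y = 0"
proof -
  \<comment> \<open>Products of bumps are bounded by 1 and tend to the indicator of the open box,
    whose boundary is a null set. Dominated convergence therefore turns the orthogonality into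
    vanishing integrals over boxes.\<close>
  have box0: "(LINT y:cbox a b|lborel. g y) = 0" if ab: "cbox a b \<subseteq> S" for a b
  proof -
    define P where "P n y = (\<Prod>i\<in>Basis. bump (a \<bullet> i) (b \<bullet> i) n (y \<bullet> i))" for n and y :: 'a
    have P01: "0 \<le> P n y" "P n y \<le> 1" for n y
      unfolding P_def by (auto intro!: prod_nonneg prod_le_1 bump_bounds)
    have P_out: "P n y = 0" if "y \<notin> box a b" for n y
    proof -
      from that obtain i where i: "i \<in> Basis" "y \<bullet> i \<notin> {a \<bullet> i<..<b \<bullet> i}" by (auto simp: mem_box)
      have "bump (a \<bullet> i) (b \<bullet> i) n (y \<bullet> i) = 0"
        using test_function_bump[of "a \<bullet> i" "b \<bullet> i" n] i(2) unfolding test_function_def by blast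
      then show ?thesis unfolding P_def using i by (intro prod_zero) auto
    qed
    have P_lim: "(\<lambda>n. P n y) \<longlonglongrightarrow> 1" if "y \<in> box a b" for y
    proof -
      have "(\<lambda>n. P n y) \<longlonglongrightarrow> (\<Prod>i\<in>(Basis::'a set). 1)"
        unfolding P_def by (intro tendsto_prod bump_tendsto) (use that in \<open>auto simp: mem_box\<close>)
      then show ?thesis by simp
    qed
    have P_meas: "P n \<in> borel_measurable lborel" for n
      unfolding P_def[abs_def] using test_function_borel[OF test_function_bump]
      by (intro borel_measurable_prod) (auto intro: measurable_compose[rotated])
    have int: "integrable lborel (\<lambda>y. indicator (cbox a b) y * g y)"
      using g ab unfolding locally_integrable_def set_integrable_def by auto
    have null: "AE y in lborel. y \<notin> cbox a b - box a b"
    proof -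
      have "negligible (cbox a b - box a b)" by (rule negligible_frontier_interval)
      then have "AE y in lebesgue. y \<notin> cbox a b - box a b"
        by (intro AE_not_in) (simp add: negligible_iff_null_sets)
      then show ?thesis by (simp add: AE_completion_iff)
    qed
    have "(\<lambda>n. LINT y|lborel. (indicator (cbox a b) y * g y) * P n y)
        \<longlonglongrightarrow> (LINT y|lborel. indicator (cbox a b) y * g y)"
    proof (rule integral_dominated_convergence[where w = "\<lambda>y. \<bar>indicator (cbox a b) y * g y\<bar>"])
      show "AE x in lborel. (\<lambda>n. indicator (cbox a b) x * g x * P n x) \<longlonglongrightarrow> indicator (cbox a b) x * g x"
        using null
      proof eventually_elim
        case (elim x)
        then consider "x \<in> box a b" | "x \<notin> cbox a b" by blast
        then show ?case
          by cases (use tendsto_mult[OF tendsto_const P_lim, of x "indicator (cbox a b) x * g x"] in auto)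
      qed
      show "AE x in lborel. norm (indicator (cbox a b) x * g x * P n x) \<le> \<bar>indicator (cbox a b) x * g x\<bar>" for n
        using P01 by (auto simp: abs_mult intro!: mult_right_le_one_le)
    qed (use int P_meas in auto)
    moreover have "(LINT y|lborel. (indicator (cbox a b) y * g y) * P n y) = 0" for n
    proof -
      have "(LINT y|lborel. (indicator (cbox a b) y * g y) * P n y) = (LINT y:S|lborel. g y * P n y)"
        unfolding set_lebesgue_integral_def using P_out ab box_subset_cbox[of a b]
        by (intro Bochner_Integration.integral_cong) (auto simp: indicator_def)
      also have "\<dots> = 0" unfolding P_def by (rule orth[OF ab]) (rule test_function_bump)
      finally show ?thesis .
    qed
    ultimately show ?thesis by (simp add: set_lebesgue_integral_def LIMSEQ_const_iff)
  qed
  have main: "AE y in lborel. y \<in> C \<longrightarrow> g y = 0" if C: "C = cbox A B" "C \<subseteq> S" for C A B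
  proof -
    \<comment> \<open>Cutting off by a box makes the function integrable on the whole space. Its
      integrals over boxes still vanish because two boxes meet in a box.\<close>
    define h where "h = (\<lambda>y. indicator (cbox A B) y * g y)"
    have int: "integrable lborel h"
      using g C unfolding locally_integrable_def set_integrable_def h_def by auto
    have sint: "set_integrable lborel (cbox a b) h" for a b
      unfolding set_integrable_def using integrable_mult_indicator[OF _ int, of "cbox a b"] by simp
    have zero: "integral (cbox a b) h = 0" for a b
    proof -
      obtain c d where cd: "cbox a b \<inter> cbox A B = cbox c d"
        using Int_interval[of a b A B] by blast
      have "integral (cbox a b) h = (LINT y:cbox a b|lborel. h y)"
        using set_borel_integral_eq_integral(2)[OF sint] by simp
      also have "\<dots> = (LINT y:cbox c d|lborel. g y)"
        unfolding set_lebesgue_integral_def h_def cd[symmetric]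
        by (intro Bochner_Integration.integral_cong) (auto simp: indicator_def)
      also have "\<dots> = 0" by (rule box0) (use cd C in auto)
      finally show ?thesis .
    qed
    \<comment> \<open>Lebesgue differentiation along the cubes with lower corner \<open>x\<close>
      and side \<open>k\<close>: off a null set the averages, all zero here, converge to the value
      of \<open>h\<close>.\<close>
    obtain N where N: "negligible N" "\<And>x e. \<lbrakk>x \<notin> N; 0 < e\<rbrakk> \<Longrightarrow> \<exists>d>0. \<forall>k. 0 < k \<and> k < d \<longrightarrow>
        norm (integral (cbox x (x + k *\<^sub>R One)) h /\<^sub>R k ^ DIM('a) - h x) < e"
      using integrable_ccontinuous_explicit[of h] set_borel_integral_eq_integral(1)[OF sint] by metis
    have "h x = 0" if xN: "x \<notin> N" for x
    proof (rule ccontr)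
      assume "h x \<noteq> 0"
      then obtain d where "d > 0" "\<And>k. 0 < k \<and> k < d \<Longrightarrow>
          norm (integral (cbox x (x + k *\<^sub>R One)) h /\<^sub>R k ^ DIM('a) - h x) < \<bar>h x\<bar>"
        using N(2)[OF xN, of "\<bar>h x\<bar>"] by auto
      from this(2)[of "d / 2"] \<open>d > 0\<close> show False by (simp add: zero)
    qed
    moreover have "AE x in lborel. x \<notin> N"
    proof -
      have "AE y in lebesgue. y \<notin> N"
        using N(1) by (intro AE_not_in) (simp add: negligible_iff_null_sets)
      then show ?thesis by (simp add: AE_completion_iff)
    qed
    ultimately show ?thesis
    proof (elim eventually_mono, intro impI)
      fix x assume *: "\<And>x. x \<notin> N \<Longrightarrow> h x = 0" "x \<notin> N" "x \<in> C"
      then have "h x = 0" by blast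
      then show "g x = 0" using *(3) by (simp add: h_def C)
    qed
  qed
  obtain D where D: "countable D" "D \<subseteq> Pow S" "\<And>X. X \<in> D \<Longrightarrow> \<exists>a b. X = cbox a b" "\<Union>D = S"
    using open_countable_Union_open_cbox[OF S] by metis
  have "AE y in lborel. y \<in> C \<longrightarrow> g y = 0" if CD: "C \<in> D" for C
  proof -
    obtain a b where "C = cbox a b" using D(3)[OF CD] by blast
    moreover have "C \<subseteq> S" using D(2) CD by blast
    ultimately show ?thesis by (rule main)
  qed
  then have "AE y in lborel. \<forall>C\<in>D. y \<in> C \<longrightarrow> g y = 0"
    by (intro AE_ball_countable[THEN iffD2] D(1) ballI)
  then show ?thesis using D(4) by (auto elim!: eventually_mono)
qed

lemma test_function_Basis_prod:
  fixes a b :: "'a::euclidean_space"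
  assumes "cbox a b \<subseteq> S" "\<And>i. i \<in> Basis \<Longrightarrow> test_function {a \<bullet> i<..<b \<bullet> i} (\<phi> i)"
  shows "test_function S (\<lambda>y. \<Prod>i\<in>Basis. \<phi> i (y \<bullet> i))"
proof -
  from assms(2) have "\<forall>i\<in>Basis. \<exists>K. compact K \<and> K \<subseteq> {a \<bullet> i<..<b \<bullet> i} \<and> (\<forall>y. y \<notin> K \<longrightarrow> \<phi> i y = 0)"
    unfolding test_function_def by blast
  then obtain K where K: "\<And>i. i \<in> Basis \<Longrightarrow> compact (K i) \<and> K i \<subseteq> {a \<bullet> i<..<b \<bullet> i} \<and> (\<forall>y. y \<notin> K i \<longrightarrow> \<phi> i y = 0)"
    by metis
  have "C_k k (\<lambda>y. \<phi> i (0 + y \<bullet> i))" if "i \<in> Basis" for i k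
    by (rule C_k_affine) (use assms(2)[OF that] in \<open>auto simp: test_function_def intro: bounded_linear_inner_left\<close>)
  then have "C_k k (\<lambda>y. \<Prod>i\<in>Basis. \<phi> i (y \<bullet> i))" for k
    by (intro C_k_prod) auto
  \<comment> \<open>The preimages of the compact sets \<open>K i\<close> are closed cylinders; the
    box supplies the boundedness.\<close>
  moreover have "compact (cbox a b \<inter> (\<Inter>i\<in>Basis. (\<lambda>y. y \<bullet> i) -` K i))"
    using K by (intro compact_Int_closed compact_cbox closed_INT ballI closed_vimage) (auto intro!: continuous_intros dest: compact_imp_closed)
  moreover have "(\<Prod>i\<in>Basis. \<phi> i (y \<bullet> i)) = 0" if "y \<notin> cbox a b \<inter> (\<Inter>i\<in>Basis. (\<lambda>y. y \<bullet> i) -` K i)" for y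
  proof -
    have "\<exists>i\<in>Basis. y \<bullet> i \<notin> K i"
    proof (rule ccontr)
      assume "\<not> ?thesis"
      then have "\<And>i. i \<in> Basis \<Longrightarrow> y \<bullet> i \<in> K i" by blast
      moreover from this have "y \<in> cbox a b" using K by (fastforce simp: mem_box)
      ultimately show False using that by blast
    qed
    then show ?thesis using K by (intro prod_zero) auto
  qed
  ultimately show ?thesis using assms(1) unfolding test_function_def by blast
qed

lemma has_weak_partial_unique:
  assumes S: "open S" and i: "i \<in> Basis" and "has_weak_partial S i f g" "has_weak_partial S i f h"
  shows "AE y in lborel. y \<in> S \<longrightarrow> g y = h y"
proof -
  have li: "locally_integrable S g" "locally_integrable S h"
    using assms unfolding has_weak_partial_def by auto
  then have li': "locally_integrable S (\<lambda>y. g y - h y)"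
    unfolding locally_integrable_def by (auto intro: set_integral_diff)
  have "AE y in lborel. y \<in> S \<longrightarrow> g y - h y = 0"
  proof (rule AE_zero_if_orthogonal_to_products[OF S li'])
    fix a b and \<phi> :: "'a \<Rightarrow> real \<Rightarrow> real"
    assume *: "cbox a b \<subseteq> S" "\<And>i. i \<in> Basis \<Longrightarrow> test_function {a \<bullet> i<..<b \<bullet> i} (\<phi> i)"
    let ?P = "\<lambda>y. \<Prod>i\<in>Basis. \<phi> i (y \<bullet> i)"
    have P: "test_function S ?P" by (rule test_function_Basis_prod[OF *])
    have "(LINT y:S|lborel. (g y - h y) * ?P y) = (LINT y:S|lborel. g y * ?P y) - (LINT y:S|lborel. h y * ?P y)"
      using set_integral_diff(2)[OF locally_integrable_mult_test[OF li(1) P] locally_integrable_mult_test[OF li(2) P]]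
      by (simp add: left_diff_distrib)
    then show "(LINT y:S|lborel. (g y - h y) * ?P y) = 0"
      using assms P unfolding has_weak_partial_def by fastforce
  qed
  then show ?thesis by simp
qed

lemma weak_partial_works:
  assumes "has_weak_partial S i f g" shows "has_weak_partial S i f (weak_partial S i f)"
  unfolding weak_partial_def by (rule someI[of "has_weak_partial S i f", OF assms])

lemma weak_partial_AE_eq:
  assumes "open S" "i \<in> Basis" "has_weak_partial S i f g"
  shows "AE y in lborel. y \<in> S \<longrightarrow> weak_partial S i f y = g y"
  using has_weak_partial_unique[OF assms(1,2) weak_partial_works[OF assms(3)] assms(3)] .

lemma has_weak_partial_add:
  assumes "i \<in> Basis" "has_weak_partial S i f g" "has_weak_partial S i f' g'"
  shows "has_weak_partial S i (\<lambda>y. f y + f' y) (\<lambda>y. g y + g' y)"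
  unfolding has_weak_partial_def
proof (intro conjI allI impI)
  have li: "locally_integrable S f" "locally_integrable S f'" "locally_integrable S g" "locally_integrable S g'"
    using assms unfolding has_weak_partial_def by auto
  then show "locally_integrable S (\<lambda>y. f y + f' y)" "locally_integrable S (\<lambda>y. g y + g' y)"
    unfolding locally_integrable_def by (auto intro: set_integral_add)
  fix \<phi> assume p: "test_function S \<phi>"
  let ?D = "\<lambda>y. frechet_derivative \<phi> (at y) i"
  have d: "test_function S ?D" using test_function_deriv[OF p assms(1)] .
  have "(LINT y:S|lborel. (f y + f' y) * ?D y) = (LINT y:S|lborel. f y * ?D y) + (LINT y:S|lborel. f' y * ?D y)"
    using set_integral_add(2)[OF locally_integrable_mult_test[OF li(1) d] locally_integrable_mult_test[OF li(2) d]]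
    by (simp add: distrib_right)
  moreover have "(LINT y:S|lborel. (g y + g' y) * \<phi> y) = (LINT y:S|lborel. g y * \<phi> y) + (LINT y:S|lborel. g' y * \<phi> y)"
    using set_integral_add(2)[OF locally_integrable_mult_test[OF li(3) p] locally_integrable_mult_test[OF li(4) p]]
    by (simp add: distrib_right)
  ultimately show "(LINT y:S|lborel. (f y + f' y) * ?D y) = - (LINT y:S|lborel. (g y + g' y) * \<phi> y)"
    using assms p unfolding has_weak_partial_def by simp
qed

lemma has_weak_partial_cmult:
  assumes "has_weak_partial S i f g"
  shows "has_weak_partial S i (\<lambda>y. c * f y) (\<lambda>y. c * g y)"
  using assms unfolding has_weak_partial_def locally_integrable_def
  by (auto simp: mult.assoc)

lemma has_weak_partial_diff:
  assumes "i \<in> Basis" "has_weak_partial S i f g" "has_weak_partial S i f' g'"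
  shows "has_weak_partial S i (\<lambda>y. f y - f' y) (\<lambda>y. g y - g' y)"
  using has_weak_partial_add[OF assms(1,2) has_weak_partial_cmult[OF assms(3), of "-1"]] by simp

section \<open>Square-integrable functions\<close>

lemma set_borel_measurable_mult:
  fixes f g :: "_ \<Rightarrow> real"
  assumes "set_borel_measurable M S f" "set_borel_measurable M S g"
  shows "set_borel_measurable M S (\<lambda>y. f y * g y)"
proof -
  have "(\<lambda>y. (indicator S y *\<^sub>R f y) * (indicator S y *\<^sub>R g y)) \<in> borel_measurable M"
    using assms unfolding set_borel_measurable_def by (rule borel_measurable_times)
  also have "(\<lambda>y. (indicator S y *\<^sub>R f y) * (indicator S y *\<^sub>R g y)) = (\<lambda>y. indicator S y *\<^sub>R (f y * g y))"
    by (auto simp: indicator_def fun_eq_iff)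
  finally show ?thesis unfolding set_borel_measurable_def .
qed

lemma set_borel_measurable_add:
  fixes f g :: "_ \<Rightarrow> real"
  assumes "set_borel_measurable M S f" "set_borel_measurable M S g"
  shows "set_borel_measurable M S (\<lambda>y. f y + g y)"
  using borel_measurable_add[OF assms[unfolded set_borel_measurable_def]]
  unfolding set_borel_measurable_def by (simp add: algebra_simps)

lemma L2_integrable_mult:
  assumes "f \<in> L2 S" "g \<in> L2 S" shows "set_integrable lborel S (\<lambda>y. f y * g y)"
proof -
  have "set_integrable lborel S (\<lambda>y. (f y)\<^sup>2 + (g y)\<^sup>2)"
    using assms unfolding L2_def by (auto intro: set_integral_add)
  then show ?thesis
  proof (rule set_integrable_bound)
    show "set_borel_measurable lborel S (\<lambda>y. f y * g y)"
      using assms unfolding L2_def by (auto intro: set_borel_measurable_mult)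
    have "\<bar>a * b\<bar> \<le> a\<^sup>2 + b\<^sup>2" for a b :: real
    proof -
      have "2 * \<bar>a * b\<bar> \<le> a\<^sup>2 + b\<^sup>2"
        using sum_squares_bound[of "\<bar>a\<bar>" "\<bar>b\<bar>"] by (simp add: abs_mult mult.assoc)
      then show ?thesis using abs_ge_zero[of "a * b"] by linarith
    qed
    then show "AE x in lborel. x \<in> S \<longrightarrow> norm (f x * g x) \<le> norm ((f x)\<^sup>2 + (g x)\<^sup>2)" by auto
  qed
qed

lemma L2_cmult: "f \<in> L2 S \<Longrightarrow> (\<lambda>y. c * f y) \<in> L2 S"
  unfolding L2_def set_borel_measurable_def
  by (auto simp: power_mult_distrib mult.left_commute[of _ c])

lemma L2_add:
  assumes "f \<in> L2 S" "g \<in> L2 S" shows "(\<lambda>y. f y + g y) \<in> L2 S"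
proof -
  have "set_integrable lborel S (\<lambda>y. (f y)\<^sup>2 + (g y)\<^sup>2 + 2 * (f y * g y))"
    using assms L2_integrable_mult[OF assms] unfolding L2_def by (auto intro!: set_integral_add)
  then have "set_integrable lborel S (\<lambda>y. (f y + g y)\<^sup>2)" by (simp add: power2_sum mult.assoc)
  then show ?thesis using assms unfolding L2_def by (auto intro: set_borel_measurable_add)
qed

lemma L2_diff: "f \<in> L2 S \<Longrightarrow> g \<in> L2 S \<Longrightarrow> (\<lambda>y. f y - g y) \<in> L2 S"
  using L2_add[OF _ L2_cmult[of g S "-1"], of f] by simp

lemma L2_const:
  assumes "bounded S" "open S" shows "(\<lambda>y. c) \<in> L2 S"
proof -
  have "integrable lborel (indicat_real S)"
    using assms(2) emeasure_bounded_finite[OF assms(1)]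
    by (intro integrable_real_indicator) (auto simp: infinity_ennreal_def)
  then show ?thesis
    using assms unfolding L2_def set_borel_measurable_def set_integrable_def by auto
qed

lemma L2_subset:
  fixes f :: "'a::euclidean_space \<Rightarrow> real"
  assumes f: "f \<in> L2 S" and T: "T \<subseteq> S" "T \<in> sets borel"
  shows "f \<in> L2 T"
  using f T set_borel_measurable_subset[of lborel S f T] unfolding L2_def
  by (auto intro: set_integrable_subset[of lborel S])

lemma L2_integrable:
  assumes "bounded S" "open S" "f \<in> L2 S" shows "set_integrable lborel S f"
  using L2_integrable_mult[OF assms(3) L2_const[OF assms(1,2), of 1]] by simp

lemma L2_imp_locally_integrable:
  assumes "bounded S" "open S" "f \<in> L2 S" shows "locally_integrable S f"
  unfolding locally_integrable_def
  using set_integrable_subset[OF L2_integrable[OF assms]] by (auto intro: borel_compact)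

lemma set_integrable_cong_AE_real:
  fixes f g :: "_ \<Rightarrow> real"
  assumes "set_integrable M S f" "set_borel_measurable M S g" "AE y in M. y \<in> S \<longrightarrow> g y = f y"
  shows "set_integrable M S g"
  using assms unfolding set_integrable_def set_borel_measurable_def
  by (elim integrable_cong_AE_imp) (auto simp: indicator_def elim!: eventually_mono)

lemma set_integral_cong_AE_real:
  fixes f g :: "_ \<Rightarrow> real"
  assumes "AE y in M. y \<in> S \<longrightarrow> f y = g y" "set_borel_measurable M S f" "set_borel_measurable M S g"
  shows "(LINT y:S|M. f y) = (LINT y:S|M. g y)"
  using assms unfolding set_lebesgue_integral_def set_borel_measurable_def
  by (intro integral_cong_AE) (auto simp: indicator_def elim!: eventually_mono)

lemma L2_cong:
  assumes "f \<in> L2 S" "set_borel_measurable lborel S g" "AE y in lborel. y \<in> S \<longrightarrow> g y = f y"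
  shows "g \<in> L2 S"
proof -
  have "set_integrable lborel S (\<lambda>y. (g y)\<^sup>2)"
    using assms set_borel_measurable_mult[OF assms(2,2)] unfolding L2_def power2_eq_square mem_Collect_eq
    by (elim conjE set_integrable_cong_AE_real) (auto elim!: eventually_mono)
  then show ?thesis using assms unfolding L2_def by auto
qed

lemma L2_abs: "f \<in> L2 S \<Longrightarrow> (\<lambda>y. \<bar>f y\<bar>) \<in> L2 S"
proof -
  assume f: "f \<in> L2 S"
  have "(\<lambda>y. \<bar>indicator S y *\<^sub>R f y\<bar>) \<in> borel_measurable lborel"
    using f unfolding L2_def set_borel_measurable_def by (auto intro!: borel_measurable_abs)
  also have "(\<lambda>y. \<bar>indicator S y *\<^sub>R f y\<bar>) = (\<lambda>y. indicator S y *\<^sub>R \<bar>f y\<bar>)" by (auto simp: indicator_def)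
  finally show "(\<lambda>y. \<bar>f y\<bar>) \<in> L2 S" using f unfolding L2_def set_borel_measurable_def by auto
qed

lemma L2_bounded_mult:
  assumes "f \<in> L2 S" "set_borel_measurable lborel S k" "AE y in lborel. y \<in> S \<longrightarrow> \<bar>k y\<bar> \<le> M"
  shows "(\<lambda>y. k y * f y) \<in> L2 S"
proof -
  have m: "set_borel_measurable lborel S (\<lambda>y. k y * f y)"
    using assms unfolding L2_def by (auto intro: set_borel_measurable_mult)
  have "set_integrable lborel S (\<lambda>y. M\<^sup>2 * (f y)\<^sup>2)"
    using assms unfolding L2_def by auto
  then have "set_integrable lborel S (\<lambda>y. (k y * f y)\<^sup>2)"
  proof (rule set_integrable_bound)
    show "set_borel_measurable lborel S (\<lambda>y. (k y * f y)\<^sup>2)"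
      unfolding power2_eq_square using m by (rule set_borel_measurable_mult[OF m])
    show "AE x in lborel. x \<in> S \<longrightarrow> norm ((k x * f x)\<^sup>2) \<le> norm (M\<^sup>2 * (f x)\<^sup>2)"
      using assms(3)
    proof eventually_elim
      case (elim x)
      show ?case
      proof
        assume "x \<in> S"
        then have "(k x)\<^sup>2 \<le> M\<^sup>2" using elim by (intro abs_le_square_iff[THEN iffD1]) auto
        then show "norm ((k x * f x)\<^sup>2) \<le> norm (M\<^sup>2 * (f x)\<^sup>2)"
          by (simp add: power_mult_distrib mult_right_mono)
      qed
    qed
  qed
  then show ?thesis using m unfolding L2_def by auto
qed

lemma L2_norm_power2: "(L2_norm S f)\<^sup>2 = (LINT y:S|lborel. (f y)\<^sup>2)" and L2_norm_nonneg: "0 \<le> L2_norm S f"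
  unfolding L2_norm_def set_lebesgue_integral_def by auto

lemma L2_norm_cong_AE:
  assumes "AE y in lborel. y \<in> S \<longrightarrow> f y = g y"
    "set_borel_measurable lborel S f" "set_borel_measurable lborel S g"
  shows "L2_norm S f = L2_norm S g"
proof -
  have "(LINT y:S|lborel. f y * f y) = (LINT y:S|lborel. g y * g y)"
    using assms by (intro set_integral_cong_AE_real set_borel_measurable_mult)
      (auto elim!: eventually_mono)
  then show ?thesis by (simp add: L2_norm_def power2_eq_square)
qed

lemma L2_Cauchy_Schwarz:
  assumes f: "f \<in> L2 S" and g: "g \<in> L2 S"
  shows "\<bar>LINT y:S|lborel. f y * g y\<bar> \<le> L2_norm S f * L2_norm S g"
proof -
  define A B C where "A = (LINT y:S|lborel. (f y)\<^sup>2)" and "B = (LINT y:S|lborel. f y * g y)"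
    and "C = (LINT y:S|lborel. (g y)\<^sup>2)"
  have "0 \<le> A * t\<^sup>2 + 2 * B * t + C" for t
  proof -
    have "0 \<le> (LINT y:S|lborel. (t * f y + g y)\<^sup>2)" unfolding set_lebesgue_integral_def by simp
    also have "\<dots> = (LINT y:S|lborel. (t\<^sup>2 * (f y)\<^sup>2 + (2 * t) * (f y * g y)) + (g y)\<^sup>2)"
      by (simp add: power2_sum power_mult_distrib mult.assoc)  (simp add: algebra_simps)
    also have "\<dots> = A * t\<^sup>2 + 2 * B * t + C"
      unfolding A_def B_def C_def using f g L2_integrable_mult[OF f g]
      by (subst set_integral_add(2), auto simp: L2_def intro!: set_integral_add(1))+ 
    finally show ?thesis .
  qed note q = this
  have nn: "0 \<le> A" "0 \<le> C" unfolding A_def C_def set_lebesgue_integral_def by simp_all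
  have "B\<^sup>2 \<le> A * C"
  proof (cases "A = 0")
    case True
    have "B = 0"
    proof (rule ccontr)
      assume "B \<noteq> 0"
      \<comment> \<open>In the degenerate case the quadratic is the affine function 2 B t + C, and
        this value of t makes it equal to -1.\<close>
      with q[of "- (C + 1) / (2 * B)"] True show False by simp
    qed
    then show ?thesis using True by simp
  next
    case False
    then have A: "A > 0" using nn by simp
    have "A * (- B / A)\<^sup>2 + 2 * B * (- B / A) + C = C - B\<^sup>2 / A"
      using A by (simp add: power2_eq_square field_simps)
    then have "B\<^sup>2 / A \<le> C" using q[of "- B / A"] by simp
    then show ?thesis using A by (simp add: pos_divide_le_eq mult.commute)
  qed
  then have "\<bar>B\<bar> \<le> sqrt (A * C)" by (intro real_le_rsqrt) simp
  then show ?thesis unfolding L2_norm_def A_def B_def C_def by (simp add: real_sqrt_mult)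
qed

lemma L2_integral_le:
  assumes "bounded S" "open S" "f \<in> L2 S"
  shows "\<bar>LINT y:S|lborel. f y\<bar> \<le> sqrt (measure lborel S) * L2_norm S f"
  using L2_Cauchy_Schwarz[OF L2_const[OF assms(1,2), of 1] assms(3)] assms(2)
  by (simp add: L2_norm_def set_lebesgue_integral_def)

section \<open>Rectangles\<close>

lemma set_integrable_Times_fst:
  fixes f :: "real \<times> real \<Rightarrow> real"
  assumes "set_integrable lborel (I \<times> J) f"
  shows "AE x in lborel. x \<in> I \<longrightarrow> set_integrable lborel J (\<lambda>z. f (x, z))"
    and "set_integrable lborel I (\<lambda>x. LINT z:J|lborel. f (x, z))"
    and "(LINT x:I|lborel. LINT z:J|lborel. f (x, z)) = (LINT y:I \<times> J|lborel. f y)"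
proof -
  have int: "integrable (lborel \<Otimes>\<^sub>M lborel) (\<lambda>y. indicator (I \<times> J) y *\<^sub>R f y)"
    using assms unfolding set_integrable_def by (simp add: lborel_prod)
  show "AE x in lborel. x \<in> I \<longrightarrow> set_integrable lborel J (\<lambda>z. f (x, z))"
    using lborel_pair.AE_integrable_fst'[OF int]
    by eventually_elim (auto simp: set_integrable_def indicator_times)
  have eq: "indicator I x *\<^sub>R (LINT z:J|lborel. f (x, z)) = (LINT z|lborel. indicator (I \<times> J) (x, z) *\<^sub>R f (x, z))" for x
    by (simp add: set_lebesgue_integral_def indicator_times mult.assoc)
  show "set_integrable lborel I (\<lambda>x. LINT z:J|lborel. f (x, z))"
    unfolding set_integrable_def eq by (rule lborel_pair.integrable_fst'[OF int])
  show "(LINT x:I|lborel. LINT z:J|lborel. f (x, z)) = (LINT y:I \<times> J|lborel. f y)"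
    using lborel_pair.integral_fst'[OF int]
    unfolding set_lebesgue_integral_def[of _ I] set_lebesgue_integral_def[of _ "I \<times> J"] eq
    by (simp add: lborel_prod)
qed

lemma set_borel_measurable_swap:
  fixes f :: "real \<times> real \<Rightarrow> real"
  assumes "set_borel_measurable lborel (I \<times> J) f"
  shows "set_borel_measurable lborel (J \<times> I) (f \<circ> prod.swap)"
proof -
  have m: "(\<lambda>y. indicator (I \<times> J) y *\<^sub>R f y) \<in> borel_measurable (borel \<Otimes>\<^sub>M borel)"
    using assms unfolding set_borel_measurable_def by (simp add: borel_prod)
  have "(\<lambda>y. indicator (I \<times> J) (snd y, fst y) *\<^sub>R f (snd y, fst y)) \<in> borel_measurable (borel \<Otimes>\<^sub>M borel)"
    by (rule measurable_compose[OF _ m]) measurable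
  moreover have "(\<lambda>y. indicator (I \<times> J) (snd y, fst y) *\<^sub>R f (snd y, fst y)) = (\<lambda>y. indicator (J \<times> I) y *\<^sub>R (f \<circ> prod.swap) y)"
    by (auto simp: indicator_def fun_eq_iff prod.swap_def)
  ultimately show ?thesis unfolding set_borel_measurable_def by (simp add: borel_prod)
qed

lemma set_integrable_swap:
  fixes f :: "real \<times> real \<Rightarrow> real"
  assumes "set_integrable lborel (I \<times> J) f"
  shows "set_integrable lborel (J \<times> I) (f \<circ> prod.swap)"
    and "(LINT y:J \<times> I|lborel. (f \<circ> prod.swap) y) = (LINT y:I \<times> J|lborel. f y)"
proof -
  let ?F = "\<lambda>y. indicator (I \<times> J) y *\<^sub>R f y"
  have int: "integrable (lborel \<Otimes>\<^sub>M lborel) ?F"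
    using assms unfolding set_integrable_def by (simp add: lborel_prod)
  have eq: "(\<lambda>(x, y). ?F (y, x)) = (\<lambda>y. indicator (J \<times> I) y *\<^sub>R (f \<circ> prod.swap) y)"
    by (auto simp: indicator_def fun_eq_iff)
  show "set_integrable lborel (J \<times> I) (f \<circ> prod.swap)"
    using lborel_pair.integrable_product_swap[OF int] unfolding set_integrable_def eq by (simp add: lborel_prod)
  show "(LINT y:J \<times> I|lborel. (f \<circ> prod.swap) y) = (LINT y:I \<times> J|lborel. f y)"
    using lborel_pair.integral_product_swap[OF borel_measurable_integrable[OF int]]
    unfolding set_lebesgue_integral_def eq by (simp add: lborel_prod)
qed

lemma set_integrable_Times_snd:
  fixes f :: "real \<times> real \<Rightarrow> real"
  assumes "set_integrable lborel (I \<times> J) f"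
  shows "AE z in lborel. z \<in> J \<longrightarrow> set_integrable lborel I (\<lambda>x. f (x, z))"
    and "set_integrable lborel J (\<lambda>z. LINT x:I|lborel. f (x, z))"
    and "(LINT z:J|lborel. LINT x:I|lborel. f (x, z)) = (LINT y:I \<times> J|lborel. f y)"
  using set_integrable_Times_fst[OF set_integrable_swap(1)[OF assms]] set_integrable_swap(2)[OF assms]
  by (simp_all add: prod.swap_def)

lemma AE_Times_fst:
  assumes "AE y in (lborel :: (real \<times> real) measure). y \<in> I \<times> J \<longrightarrow> P y"
  shows "AE x in lborel. x \<in> I \<longrightarrow> (AE z in lborel. z \<in> J \<longrightarrow> P (x, z))"
proof -
  have "AE y in lborel \<Otimes>\<^sub>M lborel. y \<in> I \<times> J \<longrightarrow> P y"
    using assms by (subst lborel_prod)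
  from lborel_pair.AE_pair[OF this] show ?thesis
    by eventually_elim (auto elim!: eventually_mono)
qed

lemma AE_swap:
  assumes "AE y in (lborel :: (real \<times> real) measure). P y"
  shows "AE y in (lborel :: (real \<times> real) measure). P (prod.swap y)"
proof -
  from assms obtain N where N: "N \<in> null_sets (lborel :: (real \<times> real) measure)" "{y. \<not> P y} \<subseteq> N"
    by (auto simp: eventually_ae_filter)
  have swap_eq: "prod.swap = (\<lambda>y::real \<times> real. (snd y, fst y))" by (auto simp: fun_eq_iff)
  have sw: "prod.swap \<in> measurable (lborel :: (real \<times> real) measure) lborel"
    unfolding swap_eq by (simp add: borel_prod[symmetric] lborel_prod[symmetric])
  have "(AE y in distr (lborel :: (real \<times> real) measure) lborel prod.swap. y \<notin> N)"
  proof -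
    have d: "distr (lborel :: (real \<times> real) measure) lborel prod.swap = lborel"
      using lborel_pair.distr_pair_swap[where 'a=real and 'b=real]
      unfolding swap_eq by (simp add: lborel_prod case_prod_beta')
    show ?thesis unfolding d by (rule AE_not_in[OF N(1)])
  qed
  then have "AE y in (lborel :: (real \<times> real) measure). prod.swap y \<notin> N"
    using N(1) by (subst (asm) AE_distr_iff[OF sw]) auto
  then show ?thesis using N(2) by (auto elim!: eventually_mono)
qed

lemma AE_Times_snd:
  assumes "AE y in (lborel :: (real \<times> real) measure). y \<in> I \<times> J \<longrightarrow> P y"
  shows "AE z in lborel. z \<in> J \<longrightarrow> (AE x in lborel. x \<in> I \<longrightarrow> P (x, z))"
proof -
  have "AE y in (lborel :: (real \<times> real) measure). y \<in> J \<times> I \<longrightarrow> P (prod.swap y)"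
    using AE_swap[OF assms] by (auto elim!: eventually_mono)
  from AE_Times_fst[OF this] show ?thesis by simp
qed

lemma AE_Times_fstI:
  assumes "AE x in lborel. x \<in> I \<longrightarrow> P x"
  shows "AE y in (lborel :: (real \<times> real) measure). y \<in> I \<times> J \<longrightarrow> P (fst y)"
proof -
  from assms obtain N where N: "N \<in> null_sets lborel" "{x. \<not> (x \<in> I \<longrightarrow> P x)} \<subseteq> N"
    by (auto simp: eventually_ae_filter)
  have "N \<times> UNIV \<in> null_sets (lborel \<Otimes>\<^sub>M (lborel :: real measure))"
    using N(1) by (intro lborel.times_in_null_sets1) auto
  then have "N \<times> UNIV \<in> null_sets (lborel :: (real \<times> real) measure)" by (simp add: lborel_prod)
  from AE_not_in[OF this] show ?thesis using N(2) by (auto elim!: eventually_mono)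
qed

lemma set_borel_measurable_section:
  fixes f :: "real \<times> real \<Rightarrow> real"
  assumes "set_borel_measurable lborel (I \<times> J) f" "x \<in> I"
  shows "set_borel_measurable lborel J (\<lambda>z. f (x, z))"
proof -
  have m: "(\<lambda>y. indicator (I \<times> J) y *\<^sub>R f y) \<in> borel_measurable (borel \<Otimes>\<^sub>M borel)"
    using assms unfolding set_borel_measurable_def by (simp add: borel_prod)
  have "(\<lambda>z. indicator (I \<times> J) (x, z) *\<^sub>R f (x, z)) \<in> borel_measurable borel"
    by (rule measurable_compose[OF _ m]) measurable
  then show ?thesis using assms(2) unfolding set_borel_measurable_def by (simp add: indicator_times)
qed

lemma set_borel_measurable_fst:
  fixes f :: "real \<Rightarrow> real"
  assumes "set_borel_measurable lborel I f" "J \<in> sets lborel"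
  shows "set_borel_measurable lborel (I \<times> J) (\<lambda>y. f (fst y))"
proof -
  have m: "(\<lambda>y. indicator I y *\<^sub>R f y) \<in> borel_measurable borel"
    using assms unfolding set_borel_measurable_def by simp
  have [measurable]: "J \<in> sets borel" using assms(2) by simp
  have "(\<lambda>y. (indicator I (fst y) *\<^sub>R f (fst y)) * indicator J (snd y)) \<in> borel_measurable (borel \<Otimes>\<^sub>M borel)"
    using assms(2) by (intro borel_measurable_times measurable_compose[OF _ m]) measurable
  moreover have "(\<lambda>y. (indicator I (fst y) *\<^sub>R f (fst y)) * indicator J (snd y)) = (\<lambda>y. indicator (I \<times> J) y *\<^sub>R f (fst y))"
    by (auto simp: indicator_def fun_eq_iff)
  ultimately show ?thesis unfolding set_borel_measurable_def by (simp add: borel_prod)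
qed

lemma set_integrable_fst:
  fixes f :: "real \<Rightarrow> real"
  assumes f: "set_integrable lborel I f" and J: "bounded J" "open J"
  shows "set_integrable lborel (I \<times> J) (\<lambda>y. f (fst y))"
proof -
  have m: "set_borel_measurable lborel I f"
    using f unfolding set_integrable_def set_borel_measurable_def by auto
  have m2: "(\<lambda>y. indicator (I \<times> J) y *\<^sub>R f (fst y)) \<in> borel_measurable (lborel \<Otimes>\<^sub>M lborel)"
    using set_borel_measurable_fst[OF m, of J] J(2) unfolding set_borel_measurable_def by (simp add: lborel_prod)
  have J1: "integrable lborel (indicat_real J)"
    using J(2) emeasure_bounded_finite[OF J(1)] by (intro integrable_real_indicator) (auto simp: infinity_ennreal_def)
  have "integrable (lborel \<Otimes>\<^sub>M lborel) (\<lambda>y. indicator (I \<times> J) y *\<^sub>R f (fst y))"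
  proof (rule lborel_pair.Fubini_integrable[OF m2])
    have "(\<lambda>x. LINT y|lborel. norm (indicator (I \<times> J) (x, y) *\<^sub>R f (fst (x, y)))) =
        (\<lambda>x. \<bar>indicator I x *\<^sub>R f x\<bar> * measure lborel J)"
      using J(2) by (auto simp: indicator_times abs_mult fun_eq_iff)
    then show "integrable lborel (\<lambda>x. LINT y|lborel. norm (indicator (I \<times> J) (x, y) *\<^sub>R f (fst (x, y))))"
      using f unfolding set_integrable_def by auto
    show "AE x in lborel. integrable lborel (\<lambda>y. indicator (I \<times> J) (x, y) *\<^sub>R f (fst (x, y)))"
      using J1 by (auto simp: indicator_times)
  qed
  then show ?thesis unfolding set_integrable_def by (simp add: lborel_prod)
qed

lemma bounded_Ioo [simp]: "bounded {a<..<b::real}"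
  by (rule bounded_subset[of "{a..b}"]) auto

lemma L2_fst:
  fixes f :: "real \<Rightarrow> real"
  assumes f: "f \<in> L2 I" and J: "bounded J" "open J"
  shows "(\<lambda>y. f (fst y)) \<in> L2 (I \<times> J)"
  using assms set_integrable_fst[OF _ J, of I "\<lambda>x. (f x)\<^sup>2"] unfolding L2_def
  by (auto intro: set_borel_measurable_fst)

lemma L2_swap:
  fixes f :: "real \<times> real \<Rightarrow> real"
  assumes "f \<in> L2 (I \<times> J)" shows "f \<circ> prod.swap \<in> L2 (J \<times> I)"
  using assms set_integrable_swap(1)[of I J "\<lambda>y. (f y)\<^sup>2"] unfolding L2_def
  by (auto simp: o_def intro: set_borel_measurable_swap[unfolded o_def])

text \<open>Cauchy-Schwarz on almost every section bounds the square of the inner integral by the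
  measure of \<open>J\<close> times the integral of the squares; Fubini integrates this
  bound.\<close>

lemma L2_integral_snd:
  fixes f :: "real \<times> real \<Rightarrow> real"
  assumes f: "f \<in> L2 (I \<times> J)" and I: "bounded I" "open I" and J: "bounded J" "open J"
  shows "(\<lambda>x. LINT z:J|lborel. f (x, z)) \<in> L2 I"
    and "L2_norm I (\<lambda>x. LINT z:J|lborel. f (x, z)) \<le> sqrt (measure lborel J) * L2_norm (I \<times> J) f"
proof -
  have b: "bounded (I \<times> J)" "open (I \<times> J)" using I J by (auto intro: bounded_Times open_Times)
  have int: "set_integrable lborel (I \<times> J) f" by (rule L2_integrable[OF b f])
  have int2: "set_integrable lborel (I \<times> J) (\<lambda>y. (f y)\<^sup>2)" using f unfolding L2_def by auto
  note F = set_integrable_Times_fst[OF int] and F2 = set_integrable_Times_fst[OF int2]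
  have m: "set_borel_measurable lborel I (\<lambda>x. LINT z:J|lborel. f (x, z))"
    using F(2) unfolding set_integrable_def set_borel_measurable_def by auto
  have le: "AE x in lborel. x \<in> I \<longrightarrow> (LINT z:J|lborel. f (x, z))\<^sup>2 \<le> measure lborel J * (LINT z:J|lborel. (f (x, z))\<^sup>2)"
    using F2(1)
  proof eventually_elim
    case (elim x)
    show ?case
    proof
      assume x: "x \<in> I"
      have "(\<lambda>z. f (x, z)) \<in> L2 J"
        using elim x set_borel_measurable_section[of I J f x] f unfolding L2_def by auto
      from L2_integral_le[OF J this]
      have "\<bar>LINT z:J|lborel. f (x, z)\<bar>\<^sup>2 \<le> (sqrt (measure lborel J) * L2_norm J (\<lambda>z. f (x, z)))\<^sup>2"
        by (intro power_mono) auto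
      then show "(LINT z:J|lborel. f (x, z))\<^sup>2 \<le> measure lborel J * (LINT z:J|lborel. (f (x, z))\<^sup>2)"
        by (simp add: power_mult_distrib L2_norm_power2)
    qed
  qed
  have int3: "set_integrable lborel I (\<lambda>x. measure lborel J * (LINT z:J|lborel. (f (x, z))\<^sup>2))"
    using F2(2) by auto
  have int4: "set_integrable lborel I (\<lambda>x. (LINT z:J|lborel. f (x, z))\<^sup>2)"
    using int3
  proof (rule set_integrable_bound)
    show "set_borel_measurable lborel I (\<lambda>x. (LINT z:J|lborel. f (x, z))\<^sup>2)"
      unfolding power2_eq_square by (rule set_borel_measurable_mult[OF m m])
    show "AE x in lborel. x \<in> I \<longrightarrow> norm ((LINT z:J|lborel. f (x, z))\<^sup>2)
        \<le> norm (measure lborel J * (LINT z:J|lborel. (f (x, z))\<^sup>2))"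
      using le by eventually_elim (auto intro: order_trans[OF _ abs_ge_self])
  qed
  then show "(\<lambda>x. LINT z:J|lborel. f (x, z)) \<in> L2 I" using m unfolding L2_def by auto
  have "(LINT x:I|lborel. (LINT z:J|lborel. f (x, z))\<^sup>2)
      \<le> (LINT x:I|lborel. measure lborel J * (LINT z:J|lborel. (f (x, z))\<^sup>2))"
    using le by (intro set_integral_mono_AE int3 int4) (auto elim!: eventually_mono)
  also have "\<dots> = measure lborel J * (LINT y:I \<times> J|lborel. (f y)\<^sup>2)" using F2(3) by simp
  finally show "L2_norm I (\<lambda>x. LINT z:J|lborel. f (x, z)) \<le> sqrt (measure lborel J) * L2_norm (I \<times> J) f"
    unfolding L2_norm_def by (simp flip: real_sqrt_mult)
qed

section \<open>Test functions of one and two variables\<close>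

lemma frechet_derivative_1D:
  fixes f :: "real \<Rightarrow> real"
  assumes "f differentiable (at x)"
  shows "(f has_real_derivative frechet_derivative f (at x) 1) (at x)"
proof -
  have "frechet_derivative f (at x) h = frechet_derivative f (at x) 1 * h" for h
    using linear_cmul[OF linear_frechet_derivative[OF assms], of h 1] by (simp add: mult.commute)
  then have "frechet_derivative f (at x) = (*) (frechet_derivative f (at x) 1)" by blast
  then show ?thesis
    using frechet_derivative_works[THEN iffD1, OF assms] unfolding has_field_derivative_def by simp
qed

lemma test_function_mono: "test_function S \<phi> \<Longrightarrow> S \<subseteq> T \<Longrightarrow> test_function T \<phi>"
  unfolding test_function_def by (meson order_trans)

lemma test_function_outside: "test_function S \<phi> \<Longrightarrow> y \<notin> S \<Longrightarrow> \<phi> y = 0"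
  unfolding test_function_def by blast

lemma test_function_slice:
  fixes \<phi> :: "real \<times> real \<Rightarrow> real"
  assumes p: "test_function (I \<times> J) \<phi>"
  shows "test_function I (\<lambda>x. \<phi> (x, z))"
    and "frechet_derivative (\<lambda>x. \<phi> (x, z)) (at x) 1 = frechet_derivative \<phi> (at (x, z)) (1, 0)"
proof -
  obtain K where K: "compact K" "K \<subseteq> I \<times> J" "\<And>y. y \<notin> K \<Longrightarrow> \<phi> y = 0"
    using p unfolding test_function_def by auto
  have bl: "bounded_linear (\<lambda>x::real. (x, 0::real))"
    by (intro bounded_linear_Pair bounded_linear_ident bounded_linear_zero)
  have "C_k k (\<lambda>x. \<phi> ((0, z) + (x, 0)))" for k
    by (rule C_k_affine[OF bl]) (use p in \<open>auto simp: test_function_def\<close>)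
  moreover have "compact (fst ` K)" using K(1) by (intro compact_continuous_image continuous_intros)
  moreover have "fst ` K \<subseteq> I" using K(2) by auto
  moreover have "\<phi> (x, z) = 0" if "x \<notin> fst ` K" for x
    using K(3)[of "(x, z)"] that by (metis fst_conv imageI)
  ultimately show "test_function I (\<lambda>x. \<phi> (x, z))"
    unfolding test_function_def by (intro conjI allI exI[of _ "fst ` K"]) auto
  have "((\<lambda>x. (x, z)) has_derivative (\<lambda>h. (h, 0))) (at x)"
    by (auto intro!: derivative_eq_intros)
  from diff_chain_at[OF this frechet_derivative_works[THEN iffD1, OF test_function_differentiable[OF p]]]
  have "((\<lambda>x. \<phi> (x, z)) has_derivative (\<lambda>h. frechet_derivative \<phi> (at (x, z)) (h, 0))) (at x)"
    by (simp add: o_def)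
  from frechet_derivative_at[OF this]
  show "frechet_derivative (\<lambda>x. \<phi> (x, z)) (at x) 1 = frechet_derivative \<phi> (at (x, z)) (1, 0)"
    by (metis)
qed

lemma test_function_swap:
  fixes \<phi> :: "real \<times> real \<Rightarrow> real"
  assumes p: "test_function (I \<times> J) \<phi>"
  shows "test_function (J \<times> I) (\<phi> \<circ> prod.swap)"
    and "frechet_derivative (\<phi> \<circ> prod.swap) (at y) (u, v) = frechet_derivative \<phi> (at (prod.swap y)) (v, u)"
proof -
  obtain K where K: "compact K" "K \<subseteq> I \<times> J" "\<And>y. y \<notin> K \<Longrightarrow> \<phi> y = 0"
    using p unfolding test_function_def by auto
  have bl: "bounded_linear (\<lambda>y::real \<times> real. (snd y, fst y))"
    by (intro bounded_linear_Pair bounded_linear_fst bounded_linear_snd)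
  have "C_k k (\<lambda>y. \<phi> (0 + (snd y, fst y)))" for k
    by (rule C_k_affine[OF bl]) (use p in \<open>auto simp: test_function_def\<close>)
  moreover have "compact (prod.swap ` K)"
    using K(1) unfolding prod.swap_def by (intro compact_continuous_image continuous_intros)
  moreover have "prod.swap ` K \<subseteq> J \<times> I" using K(2) by auto
  moreover have "\<phi> (prod.swap y) = 0" if "y \<notin> prod.swap ` K" for y
    using K(3)[of "prod.swap y"] that by (metis imageI swap_swap)
  ultimately show "test_function (J \<times> I) (\<phi> \<circ> prod.swap)"
    unfolding test_function_def by (intro conjI allI exI[of _ "prod.swap ` K"]) (auto simp: o_def prod.swap_def)
  have "(prod.swap has_derivative (\<lambda>y. (snd y, fst y))) (at y)" for y :: "real \<times> real"
    unfolding prod.swap_def by (rule bounded_linear_imp_has_derivative[OF bl])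
  from diff_chain_at[OF this frechet_derivative_works[THEN iffD1, OF test_function_differentiable[OF p]], of y]
  have "((\<phi> \<circ> prod.swap) has_derivative (\<lambda>h. frechet_derivative \<phi> (at (prod.swap y)) (snd h, fst h))) (at y)"
    by (simp add: o_def)
  from frechet_derivative_at[OF this, THEN fun_cong, of "(u, v)"]
  show "frechet_derivative (\<phi> \<circ> prod.swap) (at y) (u, v) = frechet_derivative \<phi> (at (prod.swap y)) (v, u)"
    by simp
qed

lemma test_function_tensor:
  fixes \<phi> \<theta> :: "real \<Rightarrow> real"
  assumes p: "test_function I \<phi>" and t: "test_function J \<theta>"
  shows "test_function (I \<times> J) (\<lambda>y. \<phi> (fst y) * \<theta> (snd y))"
    and "frechet_derivative (\<lambda>y. \<phi> (fst y) * \<theta> (snd y)) (at y) (1, 0) = frechet_derivative \<phi> (at (fst y)) 1 * \<theta> (snd y)"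
proof -
  obtain K where K: "compact K" "K \<subseteq> I" "\<And>y. y \<notin> K \<Longrightarrow> \<phi> y = 0"
    using p unfolding test_function_def by auto
  obtain M where M: "compact M" "M \<subseteq> J" "\<And>y. y \<notin> M \<Longrightarrow> \<theta> y = 0"
    using t unfolding test_function_def by auto
  have "C_k k (\<lambda>y::real \<times> real. \<phi> (0 + fst y))" "C_k k (\<lambda>y::real \<times> real. \<theta> (0 + snd y))" for k
    by (rule C_k_affine; use p t in \<open>auto simp: test_function_def intro: bounded_linear_fst bounded_linear_snd\<close>)+
  then have "C_k k (\<lambda>y. \<phi> (fst y) * \<theta> (snd y))" for k by (intro C_k_mult) auto
  moreover have "\<phi> (fst y) * \<theta> (snd y) = 0" if "y \<notin> K \<times> M" for y
    using that K(3)[of "fst y"] M(3)[of "snd y"] by (cases y) auto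
  moreover have "compact (K \<times> M)" "K \<times> M \<subseteq> I \<times> J"
    using K M by (auto intro: compact_Times)
  ultimately show "test_function (I \<times> J) (\<lambda>y. \<phi> (fst y) * \<theta> (snd y))"
    unfolding test_function_def by blast
  have d1: "((\<lambda>y. \<phi> (fst y)) has_derivative (\<lambda>h. frechet_derivative \<phi> (at (fst y)) (fst h))) (at y)" for y :: "real \<times> real"
    using diff_chain_at[OF bounded_linear_imp_has_derivative[OF bounded_linear_fst]
        frechet_derivative_works[THEN iffD1, OF test_function_differentiable[OF p]], of y]
    by (simp add: o_def)
  have d2: "((\<lambda>y. \<theta> (snd y)) has_derivative (\<lambda>h. frechet_derivative \<theta> (at (snd y)) (snd h))) (at y)" for y :: "real \<times> real"
    using diff_chain_at[OF bounded_linear_imp_has_derivative[OF bounded_linear_snd]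
        frechet_derivative_works[THEN iffD1, OF test_function_differentiable[OF t]], of y]
    by (simp add: o_def)
  have "frechet_derivative \<theta> (at (snd y)) 0 = 0"
    by (rule linear_0[OF linear_frechet_derivative[OF test_function_differentiable[OF t]]])
  then show "frechet_derivative (\<lambda>y. \<phi> (fst y) * \<theta> (snd y)) (at y) (1, 0) = frechet_derivative \<phi> (at (fst y)) 1 * \<theta> (snd y)"
    using frechet_derivative_at[OF has_derivative_mult[OF d1 d2], THEN fun_cong, of y "(1, 0)"] by simp
qed

lemma set_integral_Icc_Ioo:
  fixes f :: "real \<Rightarrow> real"
  shows "(LINT x:{a..b}|lborel. f x) = (LINT x:{a<..<b}|lborel. f x)"
  unfolding set_lebesgue_integral_def
  by (rule integral_discrete_difference[of "{a, b}"]) (auto simp: indicator_def)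

lemma FTC_Ioo:
  fixes F :: "real \<Rightarrow> real"
  assumes "a \<le> b" "\<And>x. (F has_real_derivative f x) (at x)" "continuous_on UNIV f"
  shows "(LINT x:{a<..<b}|lborel. f x) = F b - F a" "set_integrable lborel {a<..<b} f"
proof -
  have c: "isCont f x" for x using assms(3) by (simp add: continuous_on_eq_continuous_within)
  have h: "has_bochner_integral lborel (\<lambda>x. f x * indicator {a .. b} x) (F b - F a)"
    by (rule has_bochner_integral_FTC_Icc_real[OF assms(1)]) (use assms c in auto)
  then have "(LINT x:{a..b}|lborel. f x) = F b - F a"
    unfolding set_lebesgue_integral_def using has_bochner_integral_integral_eq[OF h] by (simp add: mult.commute)
  then show "(LINT x:{a<..<b}|lborel. f x) = F b - F a" by (simp add: set_integral_Icc_Ioo)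
  have "set_integrable lborel {a..b} f"
    unfolding set_integrable_def using integrable.intros[OF h] by (simp add: mult.commute)
  then show "set_integrable lborel {a<..<b} f" by (rule set_integrable_subset) auto
qed

lemma test_function_FTC:
  assumes p: "test_function {a<..<b::real} \<phi>" and "s \<in> {a..b}"
  shows "(LINT x:{s<..<b}|lborel. frechet_derivative \<phi> (at x) 1) = - \<phi> s"
proof -
  have "(LINT x:{s<..<b}|lborel. frechet_derivative \<phi> (at x) 1) = \<phi> b - \<phi> s"
    by (rule FTC_Ioo(1)[OF _ frechet_derivative_1D[OF test_function_differentiable[OF p]]
          test_function_continuous[OF test_function_deriv[OF p]]]) (use assms in auto)
  then show ?thesis using test_function_outside[OF p, of b] by simp
qed

text \<open>The primitive that starts at \<open>a\<close> is constant on both sides of the support,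
  and the vanishing total integral makes the constant on the right zero as well. This is the
  one-variable core of the argument that a vanishing weak derivative leaves no dependence on the
  variable.\<close>

lemma test_function_primitive:
  fixes \<eta> :: "real \<Rightarrow> real"
  assumes ab: "a < b" and p: "test_function {a<..<b} \<eta>" and zero: "(LINT x:{a<..<b}|lborel. \<eta> x) = 0"
  obtains \<Phi> where "test_function {a<..<b} \<Phi>" "\<And>x. frechet_derivative \<Phi> (at x) 1 = \<eta> x"
proof -
  obtain K where K: "compact K" "K \<subseteq> {a<..<b}" "\<And>y. y \<notin> K \<Longrightarrow> \<eta> y = 0"
    using p unfolding test_function_def by auto
  obtain l r where lr: "a < l" "l \<le> r" "r < b" "K \<subseteq> {l..r}"
  proof (cases "K = {}")
    \<comment> \<open>An empty support is enclosed in the degenerate interval at the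
      midpoint.\<close>
    case True
    then show ?thesis using that[of "(a + b) / 2" "(a + b) / 2"] ab by auto
  next
    case False
    obtain l where l: "l \<in> K" "\<And>x. x \<in> K \<Longrightarrow> l \<le> x" using compact_attains_inf[OF K(1) False] by blast
 obtain r where r: "r \<in> K" "\<And>x. x \<in> K \<Longrightarrow> x \<le> r" using compact_attains_sup[OF K(1) False] by blast
    have "a < l" "r < b" "l \<le> r" using l r K(2) by auto
    moreover have "K \<subseteq> {l..r}" using l(2) r(2) by auto
    ultimately show ?thesis using that by blast
  qed
  have z: "\<eta> y = 0" if "y \<notin> {l..r}" for y using K(3) lr that by blast
  have cont: "continuous_on UNIV \<eta>" by (rule test_function_continuous[OF p])
  then have "isCont \<eta> x" for x by (simp add: continuous_on_eq_continuous_within)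
  then obtain F where F: "\<And>x. (F has_vector_derivative \<eta> x) (at x)"
    using einterval_antiderivative[of "-\<infinity>" "\<infinity>" \<eta>] by auto
  define \<Phi> where "\<Phi> = (\<lambda>x. F x - F a)"
  have D: "(\<Phi> has_real_derivative \<eta> x) (at x)" for x
    unfolding \<Phi>_def using F[of x] by (auto intro!: derivative_eq_intros simp: has_real_derivative_iff_has_vector_derivative)
  have ftc: "\<Phi> y = \<Phi> x" if "x \<le> y" "\<And>t. t \<in> {x<..<y} \<Longrightarrow> \<eta> t = 0" for x y
  proof -
    have "(LINT t:{x<..<y}|lborel. \<eta> t) = (LINT t:{x<..<y}|lborel. 0)"
      using that(2) by (intro set_lebesgue_integral_cong) auto
    then show ?thesis using FTC_Ioo(1)[OF that(1) D cont] by simp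
  qed
  have "\<Phi> a = 0" by (simp add: \<Phi>_def)
  have "\<Phi> b = 0" using FTC_Ioo(1)[OF less_imp_le[OF ab] D cont] zero \<open>\<Phi> a = 0\<close> by simp
  have out: "\<Phi> x = 0" if "x \<notin> {l..r}" for x
  proof (cases "x < l")
    case True
    show ?thesis
    proof (cases "x \<le> a")
      case le: True
      have "\<Phi> a = \<Phi> x" by (rule ftc[OF le]) (use z lr in auto)
      then show ?thesis using \<open>\<Phi> a = 0\<close> by simp
    next
      case le: False
      have "\<Phi> x = \<Phi> a" by (rule ftc) (use z True le in auto)
      then show ?thesis using \<open>\<Phi> a = 0\<close> by simp
    qed
  next
    case False
    then have "x > r" using that by auto
    show ?thesis
    proof (cases "x \<le> b")
      case le: True
      have "\<Phi> b = \<Phi> x" by (rule ftc[OF le]) (use z \<open>x > r\<close> in auto)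
      then show ?thesis using \<open>\<Phi> b = 0\<close> by simp
    next
      case le: False
      have "\<Phi> x = \<Phi> b" by (rule ftc) (use z lr le in auto)
      then show ?thesis using \<open>\<Phi> b = 0\<close> by simp
    qed
  qed
  have "C_k (Suc k) \<Phi>" for k
    by (rule C_k_SucI_real[OF D]) (use p in \<open>auto simp: test_function_def\<close>)
  then have "C_k k \<Phi>" for k by (rule C_k_lower)
  then have "test_function {a<..<b} \<Phi>"
    unfolding test_function_def using out lr by (intro conjI allI exI[of _ "{l..r}"]) auto
  moreover have "frechet_derivative \<Phi> (at x) 1 = \<eta> x" for x
    using frechet_derivative_real_eq[OF D] by simp
  ultimately show ?thesis using that by blast
qed

lemma set_integrable_mult_bounded:
  fixes f g :: "_ \<Rightarrow> real"
  assumes "set_integrable M S f" "set_borel_measurable M S g" "\<And>y. y \<in> S \<Longrightarrow> \<bar>g y\<bar> \<le> B"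
  shows "set_integrable M S (\<lambda>y. f y * g y)"
proof -
  have "set_integrable M S (\<lambda>y. f y * B)" using assms by auto
  then show ?thesis
  proof (rule set_integrable_bound)
    show "set_borel_measurable M S (\<lambda>y. f y * g y)"
      using assms unfolding set_integrable_def
      by (intro set_borel_measurable_mult) (auto simp: set_borel_measurable_def)
    show "AE x in M. x \<in> S \<longrightarrow> norm (f x * g x) \<le> norm (f x * B)"
      using assms(3) by (fastforce simp: abs_mult intro!: AE_I2 mult_left_mono)
  qed
qed

lemma set_integrable_mult_tensor:
  fixes f g :: "real \<Rightarrow> real"
  assumes f: "set_integrable lborel I f" and g: "g \<in> borel_measurable borel" "\<And>y. y \<in> J \<Longrightarrow> \<bar>g y\<bar> \<le> B"
    and J: "bounded J" "open J"
  shows "set_integrable lborel (I \<times> J) (\<lambda>y. f (fst y) * g (snd y))"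
proof -
  have I: "set_integrable lborel (I \<times> J) (\<lambda>y. f (fst y))" by (rule set_integrable_fst[OF f J])
  have [measurable]: "g \<in> borel_measurable borel" by (rule g(1))
  have "integrable (lborel \<Otimes>\<^sub>M lborel) (\<lambda>y. (indicator (I \<times> J) y *\<^sub>R f (fst y)) * g (snd y))"
  proof (rule Bochner_Integration.integrable_bound)
    show "integrable (lborel \<Otimes>\<^sub>M lborel) (\<lambda>y. (indicator (I \<times> J) y *\<^sub>R f (fst y)) * B)"
      using I unfolding set_integrable_def by (simp add: lborel_prod)
    then have [measurable]: "(\<lambda>y. indicator (I \<times> J) y *\<^sub>R f (fst y)) \<in> borel_measurable (lborel \<Otimes>\<^sub>M lborel)"
      using I unfolding set_integrable_def by (auto simp add: lborel_prod)
    show "(\<lambda>y. (indicator (I \<times> J) y *\<^sub>R f (fst y)) * g (snd y)) \<in> borel_measurable (lborel \<Otimes>\<^sub>M lborel)"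
      by measurable
    show "AE y in lborel \<Otimes>\<^sub>M lborel. norm ((indicator (I \<times> J) y *\<^sub>R f (fst y)) * g (snd y)) \<le> norm ((indicator (I \<times> J) y *\<^sub>R f (fst y)) * B)"
      using order_trans[OF g(2) abs_ge_self]
      by (intro AE_I2) (auto simp: abs_mult indicator_def intro!: mult_left_mono)
  qed
  then show ?thesis unfolding set_integrable_def by (simp add: lborel_prod mult.assoc)
qed

section \<open>Representation by primitives\<close>

text \<open>Only the first variable is treated; statements about the second one are obtained by
  exchanging the coordinates.\<close>

definition primitive_from :: "real \<Rightarrow> (real \<times> real \<Rightarrow> real) \<Rightarrow> real \<times> real \<Rightarrow> real" where
  "primitive_from a g y = (LINT s:{a<..<fst y}|lborel. g (s, snd y))"

lemma set_integrable_imp_measurable: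
  fixes f :: "_ \<Rightarrow> real"
  shows "set_integrable M S f \<Longrightarrow> set_borel_measurable M S f"
  unfolding set_integrable_def set_borel_measurable_def by auto

lemma set_integrable_snd:
  fixes f :: "real \<Rightarrow> real" and I :: "real set"
  assumes f: "set_integrable lborel J f" and I: "bounded I" "open I"
  shows "set_integrable lborel (I \<times> J) (\<lambda>y. f (snd y))"
  using set_integrable_swap(1)[OF set_integrable_fst[OF f I]] by (simp add: o_def)

lemma set_integral_split:
  fixes f :: "real \<Rightarrow> real"
  assumes "set_integrable lborel {a<..<b} f" "a < x" "x < b"
  shows "(LINT s:{a<..<b}|lborel. f s) = (LINT s:{a<..<x}|lborel. f s) + (LINT s:{x<..<b}|lborel. f s)"
proof -
  have "(LINT s:{a<..<b}|lborel. f s) = (LINT s:{a<..<x} \<union> {x<..<b}|lborel. f s)"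
    unfolding set_lebesgue_integral_def
    by (rule integral_discrete_difference[of "{x}"]) (use assms in \<open>auto simp: indicator_def\<close>)
  also have "\<dots> = (LINT s:{a<..<x}|lborel. f s) + (LINT s:{x<..<b}|lborel. f s)"
    using assms by (intro set_integral_Un) (auto intro: set_integrable_subset)
  finally show ?thesis .
qed

lemma set_integral_abs_le_subset:
  fixes f :: "_ \<Rightarrow> real"
  assumes "set_integrable M S f" "T \<in> sets M" "T \<subseteq> S"
  shows "\<bar>LINT s:T|M. f s\<bar> \<le> (LINT s:S|M. \<bar>f s\<bar>)"
proof -
  have T: "set_integrable M T f" using assms by (auto intro: set_integrable_subset)
  have "\<bar>LINT s:T|M. f s\<bar> \<le> (LINT s:T|M. \<bar>f s\<bar>)"
    using integral_norm_bound[of M "\<lambda>x. indicator T x *\<^sub>R f x"] by (simp add: set_lebesgue_integral_def abs_mult)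
  also have "\<dots> \<le> (LINT s:S|M. \<bar>f s\<bar>)"
    unfolding set_lebesgue_integral_def
    using set_integrable_abs[OF T] set_integrable_abs[OF assms(1)] assms(3)
    by (intro integral_mono) (auto simp: set_integrable_def indicator_def)
  finally show ?thesis .
qed

text \<open>Cauchy-Schwarz with the length of the subinterval kept explicit: this factor is the
  modulus of continuity behind all traces and end values below.\<close>

lemma L2_interval_integral_le:
  assumes "g \<in> L2 {a<..<b::real}" "a \<le> p" "p \<le> q" "q \<le> b"
  shows "(LINT s:{p<..<q}|lborel. g s)\<^sup>2 \<le> (q - p) * (LINT s:{a<..<b}|lborel. (g s)\<^sup>2)"
proof -
  have sub: "{p<..<q} \<subseteq> {a<..<b}" using assms by auto
  have g: "g \<in> L2 {p<..<q}" by (rule L2_subset[OF assms(1) sub]) simp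
  have "\<bar>LINT s:{p<..<q}|lborel. g s\<bar>\<^sup>2 \<le> (sqrt (measure lborel {p<..<q}) * L2_norm {p<..<q} g)\<^sup>2"
    using L2_integral_le[OF _ _ g] by (intro power_mono) auto
  also have "\<dots> = (q - p) * (LINT s:{p<..<q}|lborel. (g s)\<^sup>2)"
    using assms(3) by (simp add: power_mult_distrib L2_norm_power2)
  also have "\<dots> \<le> (q - p) * (LINT s:{a<..<b}|lborel. (g s)\<^sup>2)"
    using set_integral_abs_le_subset[of lborel "{a<..<b}" "\<lambda>s. (g s)\<^sup>2" "{p<..<q}"] assms(1,3) sub
    by (intro mult_left_mono) (auto simp: L2_def)
  finally show ?thesis by simp
qed

lemma AE_imp_ex:
  assumes "AE x in lborel. x \<in> {a<..<b::real} \<longrightarrow> P x" "a < b"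
  obtains x where "x \<in> {a<..<b}" "P x"
proof -
  have "\<exists>x. x \<in> {a<..<b} \<and> P x"
  proof (rule ccontr)
    assume "\<not> ?thesis"
    then have "AE x in lborel. x \<notin> {a<..<b}" using assms(1) by (auto elim!: eventually_mono)
    then have "{a<..<b} \<in> null_sets lborel" by (subst AE_iff_null_sets) auto
    then show False using assms(2) by (auto simp: null_sets_def)
  qed
  then show ?thesis using that by blast
qed

lemma primitive_from_measurable:
  assumes "set_borel_measurable lborel ({a<..<b} \<times> J) g"
    "J \<in> sets borel"
  shows "set_borel_measurable lborel ({a<..<b} \<times> J) (primitive_from a g)"
proof -
  let ?G = "\<lambda>y. indicator ({a<..<b} \<times> J) y *\<^sub>R g y"
  have [measurable]: "?G \<in> borel_measurable (borel \<Otimes>\<^sub>M borel)"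
    using assms unfolding set_borel_measurable_def by (simp add: borel_prod)
  have [measurable]: "J \<in> sets borel" by fact
  \<comment> \<open>The variable upper limit becomes a condition in the integrand, so that the
    measurability of parameter integrals over the whole line applies.\<close>
  have "(\<lambda>y. LINT s|lborel. (if a < s \<and> s < fst y then ?G (s, snd y) else 0)) \<in> borel_measurable (borel \<Otimes>\<^sub>M borel)"
    by measurable
  then have "(\<lambda>y. indicator ({a<..<b} \<times> J) y * (LINT s|lborel. (if a < s \<and> s < fst y then ?G (s, snd y) else 0))) \<in> borel_measurable (borel \<Otimes>\<^sub>M borel)"
    by measurable
  also have "(\<lambda>y. indicator ({a<..<b} \<times> J) y * (LINT s|lborel. (if a < s \<and> s < fst y then ?G (s, snd y) else 0)))
     = (\<lambda>y. indicator ({a<..<b} \<times> J) y *\<^sub>R primitive_from a g y)"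
    unfolding primitive_from_def set_lebesgue_integral_def
    by (auto simp: fun_eq_iff indicator_def intro!: Bochner_Integration.integral_cong)
  finally show ?thesis unfolding set_borel_measurable_def by (simp add: borel_prod)
qed

text \<open>The integral of the absolute value over the whole line in the first variable is a
  majorant that depends on the second variable alone.\<close>

lemma primitive_from_integrable:
  assumes g: "set_integrable lborel ({a<..<b} \<times> J) g" and J: "open J"
  shows "set_integrable lborel ({a<..<b} \<times> J) (primitive_from a g)"
proof -
  let ?A = "\<lambda>z. LINT s:{a<..<b}|lborel. \<bar>g (s, z)\<bar>"
  have m: "set_borel_measurable lborel ({a<..<b} \<times> J) (primitive_from a g)"
    using g J by (intro primitive_from_measurable set_integrable_imp_measurable) auto
  have "set_integrable lborel J ?A"
    using set_integrable_Times_snd(2)[OF set_integrable_abs[OF g]] .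
  then have "set_integrable lborel ({a<..<b} \<times> J) (\<lambda>y. ?A (snd y))" by (intro set_integrable_snd) auto
  then show ?thesis
  proof (rule set_integrable_bound[OF _ m])
    have "AE y in lborel. y \<in> J \<times> {a<..<b} \<longrightarrow> set_integrable lborel {a<..<b} (\<lambda>s. g (s, fst y))"
      using AE_Times_fstI[OF set_integrable_Times_snd(1)[OF g]] .
    from AE_swap[OF this] show "AE y in lborel. y \<in> {a<..<b} \<times> J \<longrightarrow> norm (primitive_from a g y) \<le> norm (?A (snd y))"
    proof eventually_elim
      case (elim y)
      show ?case
      proof
        assume y: "y \<in> {a<..<b} \<times> J"
        then have "set_integrable lborel {a<..<b} (\<lambda>s. g (s, snd y))" using elim by (auto simp: mem_Times_iff)
        moreover have "{a<..<fst y} \<subseteq> {a<..<b}" using y by (auto simp: mem_Times_iff)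
        ultimately have "\<bar>LINT s:{a<..<fst y}|lborel. g (s, snd y)\<bar> \<le> ?A (snd y)"
          by (intro set_integral_abs_le_subset) auto
        then show "norm (primitive_from a g y) \<le> norm (?A (snd y))"
          unfolding primitive_from_def by simp
      qed
    qed
  qed
qed

text \<open>Fubini on the triangle s < x: integrating g(s) d(x) first in s produces the primitive of
  \<open>g\<close>, integrating first in x produces \<phi>(b) - \<phi>(s). No regularity of
  \<open>g\<close> beyond integrability enters.\<close>

lemma primitive_by_parts_C1:
  fixes g :: "real \<Rightarrow> real"
  assumes g: "set_integrable lborel {a<..<b} g"
    and p: "\<And>x. (\<phi> has_real_derivative d x) (at x)" and d: "continuous_on UNIV d"
  shows "set_integrable lborel {a<..<b} (\<lambda>x. (LINT s:{a<..<x}|lborel. g s) * d x)"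
    and "(LINT x:{a<..<b}|lborel. (LINT s:{a<..<x}|lborel. g s) * d x)
       = (LINT x:{a<..<b}|lborel. g x) * \<phi> b - (LINT x:{a<..<b}|lborel. g x * \<phi> x)"
proof -
  let ?I = "{a<..<b}"
  have db: "d \<in> borel_measurable borel" by (rule borel_measurable_continuous_onI[OF d])
  have cp: "continuous_on UNIV \<phi>"
    using p by (meson DERIV_isCont continuous_at_imp_continuous_on)
  have bnd: "\<exists>B. \<forall>x\<in>?I. \<bar>h x\<bar> \<le> B" if "continuous_on UNIV h" for h :: "real \<Rightarrow> real"
  proof -
    have "compact (h ` {a..b})"
      by (rule compact_continuous_image[OF continuous_on_subset[OF that]]) auto
    then obtain B where "\<And>x. x \<in> {a..b} \<Longrightarrow> \<bar>h x\<bar> \<le> B"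
      using compact_imp_bounded bounded_iff by (metis imageI real_norm_def)
    then show ?thesis by (intro exI[of _ B]) auto
  qed
  obtain B where B: "\<And>x. x \<in> ?I \<Longrightarrow> \<bar>d x\<bar> \<le> B" using bnd[OF d] by blast
  obtain B' where B': "\<And>x. x \<in> ?I \<Longrightarrow> \<bar>\<phi> x\<bar> \<le> B'" using bnd[OF cp] by blast
  define h where "h = (\<lambda>y. (g (snd y) * d (fst y)) * indicator {y. snd y < fst y} y :: real)"
  have "set_integrable lborel (?I \<times> ?I) (\<lambda>y. g (fst y) * d (snd y))"
    by (rule set_integrable_mult_tensor[OF g db B]) auto
  from set_integrable_swap(1)[OF this]
  have "set_integrable lborel (?I \<times> ?I) (\<lambda>y. g (snd y) * d (fst y))" by (simp add: o_def)
  then have hint: "set_integrable lborel (?I \<times> ?I) h"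
    unfolding h_def
  proof (rule set_integrable_mult_bounded[where B = 1])
    have "{y. snd y < fst y} \<in> sets (borel :: (real \<times> real) measure)"
      by (intro borel_open open_Collect_less continuous_intros)
    moreover have "?I \<times> ?I \<in> sets borel" by (intro borel_open open_Times) auto
    ultimately show "set_borel_measurable lborel (?I \<times> ?I) (indicat_real {y. snd y < fst y})"
      unfolding set_borel_measurable_def by (intro borel_measurable_scaleR borel_measurable_indicator) auto
  qed (auto simp: indicator_def)
  have in1: "(LINT s:?I|lborel. h (x, s)) = (LINT s:{a<..<x}|lborel. g s) * d x" if "x \<in> ?I" for x
  proof -
    have "(LINT s:?I|lborel. h (x, s)) = (LINT s:{a<..<x}|lborel. g s * d x)"
      using that unfolding set_lebesgue_integral_def h_def
      by (intro Bochner_Integration.integral_cong) (auto simp: indicator_def)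
    then show ?thesis by simp
  qed
  have in2: "(LINT x:?I|lborel. h (x, s)) = g s * \<phi> b - g s * \<phi> s" if "s \<in> ?I" for s
  proof -
    have "(LINT x:?I|lborel. h (x, s)) = (LINT x:{s<..<b}|lborel. g s * d x)"
      using that unfolding set_lebesgue_integral_def h_def
      by (intro Bochner_Integration.integral_cong) (auto simp: indicator_def)
    then show ?thesis using FTC_Ioo(1)[OF _ p d, of s b] that by (simp add: right_diff_distrib)
  qed
  have gp: "set_integrable lborel ?I (\<lambda>s. g s * \<phi> s)"
    by (rule set_integrable_mult_bounded[OF g _ B'])
      (use borel_measurable_continuous_onI[OF cp] in \<open>simp add: set_borel_measurable_def\<close>)
  show "set_integrable lborel ?I (\<lambda>x. (LINT s:{a<..<x}|lborel. g s) * d x)"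
    using set_integrable_Times_fst(2)[OF hint] in1 by (subst set_integrable_cong[OF refl refl in1[symmetric]]) auto
  have "(LINT x:?I|lborel. (LINT s:{a<..<x}|lborel. g s) * d x) = (LINT x:?I|lborel. LINT s:?I|lborel. h (x, s))"
    by (rule set_lebesgue_integral_cong) (auto simp: in1)
  also have "\<dots> = (LINT s:?I|lborel. LINT x:?I|lborel. h (x, s))"
    using set_integrable_Times_fst(3)[OF hint] set_integrable_Times_snd(3)[OF hint] by simp
  also have "\<dots> = (LINT s:?I|lborel. g s * \<phi> b - g s * \<phi> s)"
    by (rule set_lebesgue_integral_cong) (auto simp: in2)
  also have "\<dots> = (LINT x:?I|lborel. g x) * \<phi> b - (LINT x:?I|lborel. g x * \<phi> x)"
    using g gp by (subst set_integral_diff(2)) auto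
  finally show "(LINT x:?I|lborel. (LINT s:{a<..<x}|lborel. g s) * d x)
       = (LINT x:?I|lborel. g x) * \<phi> b - (LINT x:?I|lborel. g x * \<phi> x)" .
qed

lemma primitive_by_parts:
  fixes g :: "real \<Rightarrow> real"
  assumes g: "set_integrable lborel {a<..<b} g" and p: "test_function {a<..<b} \<phi>"
  shows "(LINT x:{a<..<b}|lborel. (k + (LINT s:{a<..<x}|lborel. g s)) * frechet_derivative \<phi> (at x) 1)
       = - (LINT x:{a<..<b}|lborel. g x * \<phi> x)"
proof (cases "a < b")
  case False
  then show ?thesis by (simp add: set_lebesgue_integral_def)
next
  case ab: True
  let ?I = "{a<..<b}" and ?d = "\<lambda>x. frechet_derivative \<phi> (at x) 1"
  have d: "test_function ?I ?d" using test_function_deriv[OF p] by simp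
  note D = frechet_derivative_1D[OF test_function_differentiable[OF p]] test_function_continuous[OF d]
  note parts = primitive_by_parts_C1[OF g D]
  have "(LINT x:?I|lborel. k * ?d x) = 0"
    using test_function_FTC[OF p, of a] test_function_outside[OF p, of a] ab by simp
  moreover have "(LINT x:?I|lborel. k * ?d x + (LINT s:{a<..<x}|lborel. g s) * ?d x) =
     (LINT x:?I|lborel. k * ?d x) + (LINT x:?I|lborel. (LINT s:{a<..<x}|lborel. g s) * ?d x)"
    using FTC_Ioo(2)[OF less_imp_le[OF ab] D] parts(1) by (intro set_integral_add(2)) auto
  ultimately show ?thesis
    using parts(2) test_function_outside[OF p, of b] by (simp add: distrib_right)
qed

lemma set_integrable_imp_locally_integrable:
  "set_integrable lborel S f \<Longrightarrow> locally_integrable S f"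
  unfolding locally_integrable_def by (auto intro!: set_integrable_subset[of lborel S f] simp: borel_compact)

lemma primitive_has_weak_partial:
  assumes c: "set_integrable lborel J c" and g: "set_integrable lborel ({a<..<b} \<times> J) g" and J: "open J" "bounded J"
  shows "has_weak_partial ({a<..<b} \<times> J) (1, 0) (\<lambda>y. c (snd y) + primitive_from a g y) g"
  unfolding has_weak_partial_def
proof (intro conjI allI impI)
  let ?I = "{a<..<b}"
  have F: "set_integrable lborel (?I \<times> J) (\<lambda>y. c (snd y) + primitive_from a g y)"
    using set_integrable_snd[OF c] primitive_from_integrable[OF g J(1)] by (intro set_integral_add) auto
  then show li: "locally_integrable (?I \<times> J) (\<lambda>y. c (snd y) + primitive_from a g y)"
    by (rule set_integrable_imp_locally_integrable)
  show lg: "locally_integrable (?I \<times> J) g" using g by (rule set_integrable_imp_locally_integrable)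
  fix \<phi> assume p: "test_function (?I \<times> J) \<phi>"
  let ?d = "\<lambda>y. frechet_derivative \<phi> (at y) (1, 0)"
  have d: "test_function (?I \<times> J) ?d" using test_function_deriv[OF p] by (simp add: Basis_prod_def)
  have i1: "set_integrable lborel (?I \<times> J) (\<lambda>y. (c (snd y) + primitive_from a g y) * ?d y)"
    by (rule locally_integrable_mult_test[OF li d])
  have i2: "set_integrable lborel (?I \<times> J) (\<lambda>y. g y * \<phi> y)"
    by (rule locally_integrable_mult_test[OF lg p])
  have "(LINT y:?I \<times> J|lborel. (c (snd y) + primitive_from a g y) * ?d y)
      = (LINT z:J|lborel. LINT x:?I|lborel. (c z + primitive_from a g (x, z)) * ?d (x, z))"
    using set_integrable_Times_snd(3)[OF i1] by simp
  also have "\<dots> = (LINT z:J|lborel. - (LINT x:?I|lborel. g (x, z) * \<phi> (x, z)))"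
  proof (rule set_integral_cong_AE_real)
    show "AE z in lborel. z \<in> J \<longrightarrow> (LINT x:?I|lborel. (c z + primitive_from a g (x, z)) * ?d (x, z)) = - (LINT x:?I|lborel. g (x, z) * \<phi> (x, z))"
      using set_integrable_Times_snd(1)[OF g]
    proof eventually_elim
      case (elim z)
      show ?case
      proof
        assume "z \<in> J"
        then have "set_integrable lborel ?I (\<lambda>x. g (x, z))" using elim by blast
        from primitive_by_parts[OF this test_function_slice(1)[OF p, of z], of "c z"]
        show "(LINT x:?I|lborel. (c z + primitive_from a g (x, z)) * ?d (x, z)) = - (LINT x:?I|lborel. g (x, z) * \<phi> (x, z))"
          unfolding primitive_from_def test_function_slice(2)[OF p] by simp
      qed
    qed
    show "set_borel_measurable lborel J (\<lambda>z. LINT x:?I|lborel. (c z + primitive_from a g (x, z)) * ?d (x, z))"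
      using set_integrable_imp_measurable[OF set_integrable_Times_snd(2)[OF i1]] by simp
    show "set_borel_measurable lborel J (\<lambda>z. - (LINT x:?I|lborel. g (x, z) * \<phi> (x, z)))"
      using set_integrable_imp_measurable[OF set_integrable_Times_snd(2)[OF i2]]
      unfolding set_borel_measurable_def by simp
  qed
  also have "\<dots> = - (LINT z:J|lborel. LINT x:?I|lborel. g (x, z) * \<phi> (x, z))"
    by (simp add: set_lebesgue_integral_def)
  also have "\<dots> = - (LINT y:?I \<times> J|lborel. g y * \<phi> y)"
    using set_integrable_Times_snd(3)[OF i2] by simp
  finally show "(LINT y:?I \<times> J|lborel. (c (snd y) + primitive_from a g y) * ?d y) = - (LINT y:?I \<times> J|lborel. g y * \<phi> y)" .
qed

lemma AE_zero_if_orthogonal_to_tensors: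
  fixes g :: "real \<times> real \<Rightarrow> real"
  assumes "open I" "open J" and g: "locally_integrable (I \<times> J) g"
    and orth: "\<And>\<phi> \<theta>. test_function I \<phi> \<Longrightarrow> test_function J \<theta> \<Longrightarrow>
      (LINT y:I \<times> J|lborel. g y * (\<phi> (fst y) * \<theta> (snd y))) = 0"
  shows "AE y in lborel. y \<in> I \<times> J \<longrightarrow> g y = 0"
proof (rule AE_zero_if_orthogonal_to_products[OF open_Times[OF assms(1,2)] g])
  fix a b :: "real \<times> real" and \<phi> :: "real \<times> real \<Rightarrow> real \<Rightarrow> real"
  assume sub: "cbox a b \<subseteq> I \<times> J" and p: "\<And>i. i \<in> Basis \<Longrightarrow> test_function {a \<bullet> i<..<b \<bullet> i} (\<phi> i)"
  have prod: "(\<Prod>i\<in>Basis. \<phi> i (y \<bullet> i)) = \<phi> (1, 0) (fst y) * \<phi> (0, 1) (snd y)" for y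
  proof -
    have B: "(Basis :: (real \<times> real) set) = {(1, 0), (0, 1)}" by (auto simp: Basis_prod_def)
    show ?thesis unfolding B by (subst prod.insert) (auto simp: inner_prod_def)
  qed
  have p1: "test_function {fst a<..<fst b} (\<phi> (1, 0))" and p2: "test_function {snd a<..<snd b} (\<phi> (0, 1))"
    using p[of "(1, 0)"] p[of "(0, 1)"] by (auto simp: Basis_prod_def inner_prod_def)
  show "(LINT y:I \<times> J|lborel. g y * (\<Prod>i\<in>Basis. \<phi> i (y \<bullet> i))) = 0"
  \<comment> \<open>A nondegenerate box in \<open>I \<times> J\<close> forces its sides into
    \<open>I\<close> and \<open>J\<close>. In a degenerate one some side has no interior, so the
    corresponding factor, and with it the product, is zero.\<close>
  proof (cases "fst a < fst b \<and> snd a < snd b")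
    case True
    have "(x, snd a) \<in> I \<times> J" if "x \<in> {fst a<..<fst b}" for x
      by (rule subsetD[OF sub]) (use that True in \<open>cases a; cases b; auto simp: cbox_Pair_eq\<close>)
    then have "{fst a<..<fst b} \<subseteq> I" by blast
    moreover have "(fst a, z) \<in> I \<times> J" if "z \<in> {snd a<..<snd b}" for z
      by (rule subsetD[OF sub]) (use that True in \<open>cases a; cases b; auto simp: cbox_Pair_eq\<close>)
    then have "{snd a<..<snd b} \<subseteq> J" by blast
    ultimately show ?thesis unfolding prod
      by (intro orth test_function_mono[OF p1] test_function_mono[OF p2])
  next
    case False
    then have z: "\<phi> (1, 0) (fst y) * \<phi> (0, 1) (snd y) = 0" for y
      using test_function_outside[OF p1, of "fst y"] test_function_outside[OF p2, of "snd y"] by auto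
    show ?thesis unfolding prod z by (simp add: set_lebesgue_integral_def)
  qed
qed

text \<open>The integrals of the bumps tend to b - a, so at least one of them is nonzero and can be
  normalised.\<close>

lemma test_function_unit_integral:
  assumes "a < b"
  obtains \<theta> where "test_function {a<..<b::real} \<theta>" "(LINT x:{a<..<b}|lborel. \<theta> x) = 1"
proof -
  let ?I = "{a<..<b}"
  have "(\<lambda>n. LINT x|lborel. indicator ?I x * bump a b n x) \<longlonglongrightarrow> (LINT x|lborel. indicator ?I x)"
  proof (rule integral_dominated_convergence[where w = "indicator ?I"])
    show "AE x in lborel. (\<lambda>n. indicator ?I x * bump a b n x) \<longlonglongrightarrow> indicat_real ?I x"
      using bump_tendsto[of _ a b] by (intro AE_I2) (auto simp: indicator_def)
    show "AE x in lborel. norm (indicator ?I x * bump a b n x) \<le> indicat_real ?I x" for n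
      using bump_bounds[of a b n] by (auto simp: indicator_def)
    show "(\<lambda>x. indicat_real ?I x * bump a b n x) \<in> borel_measurable lborel" for n
      using test_function_borel[OF test_function_bump] by (intro borel_measurable_times) auto
    show "integrable lborel (indicat_real ?I)" using assms by (intro integrable_real_indicator) auto
  qed auto
  moreover have "(LINT x|lborel. indicator ?I x) = b - a" using assms by simp
  ultimately have lim: "(\<lambda>n. LINT x|lborel. indicator ?I x * bump a b n x) \<longlonglongrightarrow> b - a" by simp
  have "\<exists>n. (LINT x|lborel. indicator ?I x * bump a b n x) \<noteq> 0"
  proof (rule ccontr)
    assume "\<not> ?thesis"
    then show False using lim assms by (simp add: LIMSEQ_const_iff)
  qed
  then obtain n where n: "(LINT x:?I|lborel. bump a b n x) \<noteq> 0" by (auto simp: set_lebesgue_integral_def)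
  let ?c = "1 / (LINT x:?I|lborel. bump a b n x)"
  show ?thesis
  proof (rule that)
    show "test_function ?I (\<lambda>x. ?c * bump a b n x)"
    proof -
      obtain K where K: "compact K" "K \<subseteq> ?I" "\<And>y. y \<notin> K \<Longrightarrow> bump a b n y = 0"
        using test_function_bump[of a b n] unfolding test_function_def by auto
      have "C_k k (\<lambda>x. ?c * bump a b n x)" for k
        by (rule C_k_cmult) (use test_function_bump[of a b n] in \<open>simp add: test_function_def\<close>)
      then show ?thesis using K unfolding test_function_def by (intro conjI allI exI[of _ K]) auto
    qed
    show "(LINT x:?I|lborel. ?c * bump a b n x) = 1" using n by simp
  qed
qed

text \<open>Du Bois-Reymond with a parameter. Subtracting the primitive of \<open>g\<close> leaves a
  function \<open>D\<close> with vanishing weak derivative in x. Every test function of x differs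
  from a multiple of a fixed one, \<theta>0, by the derivative of a test function, so that
  \<open>D\<close> is determined by its integral against \<theta>0, which depends on z only.\<close>

lemma weak_partial_representation:
  assumes ab: "a < b" and J: "open J" "bounded J"
    and f: "set_integrable lborel ({a<..<b} \<times> J) f" and g: "set_integrable lborel ({a<..<b} \<times> J) g"
    and w: "has_weak_partial ({a<..<b} \<times> J) (1, 0) f g"
  obtains c where "set_integrable lborel J c"
    "AE y in lborel. y \<in> {a<..<b} \<times> J \<longrightarrow> f y = c (snd y) + primitive_from a g y"
proof -
  let ?I = "{a<..<b}"
  let ?R = "?I \<times> J"
  have B10: "(1, 0) \<in> (Basis :: (real \<times> real) set)" by (simp add: Basis_prod_def)
  obtain \<theta>0 where t0: "test_function ?I \<theta>0" "(LINT x:?I|lborel. \<theta>0 x) = 1"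
    using test_function_unit_integral[OF ab] by blast
  define D where "D = (\<lambda>y. f y - primitive_from a g y)"
  have z: "set_integrable lborel J (\<lambda>z. 0)" by (simp add: set_integrable_def)
  have "has_weak_partial ?R (1, 0) D (\<lambda>y. g y - g y)"
    unfolding D_def using has_weak_partial_diff[OF B10 w primitive_has_weak_partial[OF z g J]] by simp
  then have wD: "(LINT y:?R|lborel. D y * frechet_derivative \<phi> (at y) (1, 0)) = 0" if "test_function ?R \<phi>" for \<phi>
    using that unfolding has_weak_partial_def by (simp add: set_lebesgue_integral_def)
  have Dint: "set_integrable lborel ?R D"
    unfolding D_def using f primitive_from_integrable[OF g J(1)] by (rule set_integral_diff)
  have measT: "set_borel_measurable lborel ?R (\<lambda>y. \<phi> (fst y) * \<theta> (snd y))"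
    if "test_function K \<phi>" "test_function L \<theta>" for \<phi> \<theta> :: "real \<Rightarrow> real" and K L
  proof -
    have [measurable]: "\<phi> \<in> borel_measurable borel" "\<theta> \<in> borel_measurable borel" "J \<in> sets borel"
      using that test_function_borel J by auto
    have "(\<lambda>y. indicator ?R y *\<^sub>R (\<phi> (fst y) * \<theta> (snd y))) \<in> borel_measurable (borel \<Otimes>\<^sub>M borel)" by measurable
    then show ?thesis unfolding set_borel_measurable_def by (simp add: borel_prod)
  qed
  have Dt: "set_integrable lborel ?R (\<lambda>y. D y * (\<phi> (fst y) * \<theta> (snd y)))"
    if p: "test_function K \<phi>" and t: "test_function L \<theta>" for \<phi> \<theta> :: "real \<Rightarrow> real" and K L
  proof -
    obtain B1 where B1: "\<And>y. \<bar>\<phi> y\<bar> \<le> B1" "0 \<le> B1" using test_function_bounded[OF p] by blast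
    obtain B2 where B2: "\<And>y. \<bar>\<theta> y\<bar> \<le> B2" "0 \<le> B2" using test_function_bounded[OF t] by blast
    show ?thesis
      by (rule set_integrable_mult_bounded[OF Dint measT[OF p t], of "B1 * B2"])
        (use B1 B2 in \<open>auto simp: abs_mult intro!: mult_mono\<close>)
  qed
  have D0: "set_integrable lborel ?R (\<lambda>y. D y * \<theta>0 (fst y))"
  proof -
    obtain B1 where B1: "\<And>y. \<bar>\<theta>0 y\<bar> \<le> B1" "0 \<le> B1" using test_function_bounded[OF t0(1)] by blast
    have [measurable]: "\<theta>0 \<in> borel_measurable borel" "J \<in> sets borel"
      using t0(1) test_function_borel J by auto
    have "(\<lambda>y. indicator ?R y *\<^sub>R \<theta>0 (fst y)) \<in> borel_measurable (borel \<Otimes>\<^sub>M borel)" by measurable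
    then have "set_borel_measurable lborel ?R (\<lambda>y. \<theta>0 (fst y))" unfolding set_borel_measurable_def by (simp add: borel_prod)
    from set_integrable_mult_bounded[OF Dint this] show ?thesis using B1 by blast
  qed
  define c where "c = (\<lambda>z. LINT x:?I|lborel. D (x, z) * \<theta>0 x)"
  have c: "set_integrable lborel J c"
    unfolding c_def using set_integrable_Times_snd(2)[OF D0] by simp
  have cR: "set_integrable lborel ?R (\<lambda>y. c (snd y))" by (rule set_integrable_snd[OF c]) auto
  have "AE y in lborel. y \<in> ?R \<longrightarrow> D y - c (snd y) = 0"
  proof (rule AE_zero_if_orthogonal_to_tensors)
    show "locally_integrable ?R (\<lambda>y. D y - c (snd y))"
      by (intro set_integrable_imp_locally_integrable set_integral_diff Dint cR)
    fix \<phi> \<theta> assume p: "test_function ?I \<phi>" and t: "test_function J \<theta>"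
    define m where "m = (LINT x:?I|lborel. \<phi> x)"
    have pint: "set_integrable lborel ?I \<phi>" "set_integrable lborel ?I \<theta>0"
      using locally_integrable_mult_test[OF L2_imp_locally_integrable[OF _ _ L2_const[of ?I 1]] p]
        locally_integrable_mult_test[OF L2_imp_locally_integrable[OF _ _ L2_const[of ?I 1]] t0(1)] by auto
    \<comment> \<open>Subtracting \<open>m\<close> times \<theta>0 makes the integral zero, so that
      \<eta> has a compactly supported primitive to test with.\<close>
    define \<eta> where "\<eta> = (\<lambda>x. \<phi> x + (- m) * \<theta>0 x)"
    have e: "test_function ?I \<eta>"
    proof -
      obtain K where K: "compact K" "K \<subseteq> ?I" "\<And>y. y \<notin> K \<Longrightarrow> \<phi> y = 0"
        using p unfolding test_function_def by auto
      obtain M where M: "compact M" "M \<subseteq> ?I" "\<And>y. y \<notin> M \<Longrightarrow> \<theta>0 y = 0"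
        using t0(1) unfolding test_function_def by auto
      have "C_k k \<eta>" for k unfolding \<eta>_def
        by (intro C_k_add C_k_cmult) (use p t0(1) in \<open>auto simp: test_function_def\<close>)
      then show ?thesis using K M unfolding test_function_def
        by (intro conjI allI exI[of _ "K \<union> M"]) (auto simp: \<eta>_def)
    qed
    have "(LINT x:?I|lborel. \<eta> x) = 0"
    proof -
      have i: "set_integrable lborel ?I (\<lambda>x. (- m) * \<theta>0 x)" by (rule set_integrable_mult_right) (rule pint(2))
      show ?thesis
        unfolding \<eta>_def set_integral_add(2)[OF pint(1) i] set_integral_mult_right t0(2) by (simp add: m_def)
    qed
    from test_function_primitive[OF ab e this] obtain \<Phi> where
      P: "test_function ?I \<Phi>" "\<And>x. frechet_derivative \<Phi> (at x) 1 = \<eta> x" by blast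
    have "0 = (LINT y:?R|lborel. D y * (\<eta> (fst y) * \<theta> (snd y)))"
      using wD[OF test_function_tensor(1)[OF P(1) t]] unfolding test_function_tensor(2)[OF P(1) t] P(2) by simp
    also have "\<dots> = (LINT y:?R|lborel. D y * (\<phi> (fst y) * \<theta> (snd y)) - m * (D y * (\<theta>0 (fst y) * \<theta> (snd y))))"
      by (simp add: \<eta>_def algebra_simps)
    also have "\<dots> = (LINT y:?R|lborel. D y * (\<phi> (fst y) * \<theta> (snd y))) - m * (LINT y:?R|lborel. D y * (\<theta>0 (fst y) * \<theta> (snd y)))"
      using Dt[OF p t] Dt[OF t0(1) t] by (subst set_integral_diff(2)) auto
    also have "(LINT y:?R|lborel. D y * (\<theta>0 (fst y) * \<theta> (snd y))) = (LINT z:J|lborel. c z * \<theta> z)"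
      using set_integrable_Times_snd(3)[OF Dt[OF t0(1) t]] by (simp add: c_def mult.assoc[symmetric])
    finally have A: "(LINT y:?R|lborel. D y * (\<phi> (fst y) * \<theta> (snd y))) = m * (LINT z:J|lborel. c z * \<theta> z)" by simp
    obtain B1 where B1: "\<And>y. \<bar>\<phi> y\<bar> \<le> B1" "0 \<le> B1" using test_function_bounded[OF p] by blast
    obtain B2 where B2: "\<And>y. \<bar>\<theta> y\<bar> \<le> B2" "0 \<le> B2" using test_function_bounded[OF t] by blast
    have ct: "set_integrable lborel ?R (\<lambda>y. c (snd y) * (\<phi> (fst y) * \<theta> (snd y)))"
      by (rule set_integrable_mult_bounded[OF cR measT[OF p t], of "B1 * B2"])
        (use B1 B2 in \<open>auto simp: abs_mult intro!: mult_mono\<close>)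
    have "(LINT y:?R|lborel. c (snd y) * (\<phi> (fst y) * \<theta> (snd y))) = (LINT z:J|lborel. LINT x:?I|lborel. c z * (\<phi> x * \<theta> z))"
      using set_integrable_Times_snd(3)[OF ct] by simp
    also have "\<dots> = (LINT z:J|lborel. LINT x:?I|lborel. (c z * \<theta> z) * \<phi> x)" by (simp add: ac_simps)
    also have "\<dots> = m * (LINT z:J|lborel. c z * \<theta> z)"
      by (simp only: set_integral_mult_right set_integral_mult_left m_def mult.commute)
    finally have "(LINT y:?R|lborel. D y * (\<phi> (fst y) * \<theta> (snd y)) - c (snd y) * (\<phi> (fst y) * \<theta> (snd y))) = 0"
      using A Dt[OF p t] ct by (subst set_integral_diff(2)) auto
    then show "(LINT y:?R|lborel. (D y - c (snd y)) * (\<phi> (fst y) * \<theta> (snd y))) = 0"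
      by (simp add: left_diff_distrib)
  qed (use J in auto)
  then show ?thesis using that[OF c] unfolding D_def by (auto elim!: eventually_mono simp: algebra_simps)
qed

section \<open>Traces\<close>

lemma nn_set_integral_real:
  assumes "set_integrable M J h" "AE t in M. t \<in> J \<longrightarrow> 0 \<le> h t"
  shows "(\<integral>\<^sup>+t\<in>J. ennreal (h t) \<partial>M) = ennreal (LINT t:J|M. h t)"
proof -
  have "(\<integral>\<^sup>+t\<in>J. ennreal (h t) \<partial>M) = (\<integral>\<^sup>+t. ennreal (indicator J t *\<^sub>R h t) \<partial>M)"
    by (intro nn_integral_cong) (auto simp: indicator_def)
  also have "\<dots> = ennreal (LINT t:J|M. h t)"
    unfolding set_lebesgue_integral_def using assms unfolding set_integrable_def
    by (intro nn_integral_eq_integral) (auto simp: indicator_def elim!: eventually_mono)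
  finally show ?thesis .
qed

lemma nn_set_integral_mono_AE:
  assumes "AE t in M. t \<in> J \<longrightarrow> f t \<le> g t"
  shows "(\<integral>\<^sup>+t\<in>J. f t \<partial>M) \<le> (\<integral>\<^sup>+t\<in>J. g t \<partial>M)"
  using assms by (intro nn_integral_mono_AE) (auto simp: indicator_def elim!: eventually_mono)

lemma AE_lborel_null_set:
  assumes "AE x in lborel. P x"
  obtains N where "N \<in> null_sets lborel" "\<And>x. x \<notin> N \<Longrightarrow> P x"
  using assms by (auto simp: eventually_ae_filter)

lemma has_slice_traceI:
  assumes t: "\<tau> \<in> L2 J" and G: "set_integrable lborel J G"
    and le: "AE s in lborel. s \<in> I \<longrightarrow> (AE t in lborel. t \<in> J \<longrightarrow> (F s t - \<tau> t)\<^sup>2 \<le> \<bar>s - c\<bar> * G t)"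
  shows "has_slice_trace I J c F \<tau>"
  unfolding has_slice_trace_def
proof (intro conjI t)
  obtain N where N: "N \<in> null_sets lborel"
    "\<And>s. s \<notin> N \<Longrightarrow> s \<in> I \<longrightarrow> (AE t in lborel. t \<in> J \<longrightarrow> (F s t - \<tau> t)\<^sup>2 \<le> \<bar>s - c\<bar> * G t)"
    using AE_lborel_null_set[OF le] by blast
  let ?K = "LINT t:J|lborel. \<bar>G t\<bar>"
  have ub: "(\<integral>\<^sup>+t\<in>J. ennreal ((F s t - \<tau> t)\<^sup>2) \<partial>lborel) \<le> ennreal (\<bar>s - c\<bar> * ?K)" if "s \<in> I - N" for s
  proof -
    have Gi: "set_integrable lborel J (\<lambda>t. \<bar>s - c\<bar> * \<bar>G t\<bar>)" using set_integrable_abs[OF G] by auto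
    have "AE t in lborel. t \<in> J \<longrightarrow> (F s t - \<tau> t)\<^sup>2 \<le> \<bar>s - c\<bar> * G t" using N(2) that by blast
    then have "(\<integral>\<^sup>+t\<in>J. ennreal ((F s t - \<tau> t)\<^sup>2) \<partial>lborel) \<le> (\<integral>\<^sup>+t\<in>J. ennreal (\<bar>s - c\<bar> * \<bar>G t\<bar>) \<partial>lborel)"
    proof (intro nn_set_integral_mono_AE, eventually_elim)
      case (elim t)
      have "\<bar>s - c\<bar> * G t \<le> \<bar>s - c\<bar> * \<bar>G t\<bar>" by (intro mult_left_mono) auto
      then show ?case using elim by (auto intro!: ennreal_leI)
    qed
    also have "\<dots> = ennreal (LINT t:J|lborel. \<bar>s - c\<bar> * \<bar>G t\<bar>)" by (rule nn_set_integral_real[OF Gi]) auto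
    finally show ?thesis by simp
  qed
  have "((\<lambda>s. ennreal (\<bar>s - c\<bar> * ?K)) \<longlongrightarrow> ennreal (\<bar>c - c\<bar> * ?K)) (at c within I - N)"
    by (intro tendsto_intros)
  then have lim: "((\<lambda>s. ennreal (\<bar>s - c\<bar> * ?K)) \<longlongrightarrow> 0) (at c within I - N)" by simp
  have "((\<lambda>s. \<integral>\<^sup>+t\<in>J. ennreal ((F s t - \<tau> t)\<^sup>2) \<partial>lborel) \<longlongrightarrow> 0) (at c within I - N)"
    by (rule tendsto_sandwich[OF _ _ tendsto_const lim]) (auto simp: eventually_at_filter intro!: always_eventually ub)
  with N(1) show "\<exists>N\<in>null_sets lborel. ((\<lambda>s. \<integral>\<^sup>+t\<in>J. ennreal ((F s t - \<tau> t)\<^sup>2) \<partial>lborel) \<longlongrightarrow> 0) (at c within I - N)"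
    by blast
qed

text \<open>Traces and end values are limits along an interval with a null set removed; their
  uniqueness rests on this filter being proper.\<close>

lemma null_set_at_within_nontrivial:
  assumes "a < b" "c \<in> {a, b}" "N \<in> null_sets (lborel :: real measure)"
  shows "at c within {a<..<b} - N \<noteq> bot"
proof -
  have ae: "AE x in lborel. x \<notin> N" by (rule AE_not_in[OF assms(3)])
  have "c islimpt ({a<..<b} - N)"
    unfolding islimpt_approachable
  proof (intro allI impI)
    fix e :: real assume e: "e > 0"
    define l r where "l = (if c = a then a else max a (b - e))" and "r = (if c = a then min b (a + e) else b)"
    have lr: "l < r" "{l<..<r} \<subseteq> {a<..<b}" using assms(1,2) e by (auto simp: l_def r_def)
    have dist: "x \<noteq> c \<and> dist x c < e" if "x \<in> {l<..<r}" for x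
      using that assms(1,2) by (auto simp: l_def r_def dist_real_def split: if_splits)
    have "AE x in lborel. x \<in> {l<..<r} \<longrightarrow> x \<notin> N" using ae by (auto elim!: eventually_mono)
    then obtain x where "x \<in> {l<..<r}" "x \<notin> N" using AE_imp_ex[OF _ lr(1)] by metis
    then show "\<exists>x'\<in>{a<..<b} - N. x' \<noteq> c \<and> dist x' c < e" using dist lr(2) by (intro bexI[of _ x]) auto
  qed
  then show ?thesis by (simp add: trivial_limit_within)
qed

text \<open>The exceptional sets of the two functions are united. Measurability of the slices is
  what allows the integral of the upper bound to be split into two.\<close>

lemma has_slice_trace_add_cmult:
  assumes F: "has_slice_trace I J c F \<tau>" and G: "has_slice_trace I J c G \<sigma>" and J: "J \<in> sets lborel"
    and mF: "\<And>s. s \<in> I \<Longrightarrow> set_borel_measurable lborel J (F s)"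
    and mG: "\<And>s. s \<in> I \<Longrightarrow> set_borel_measurable lborel J (G s)"
  shows "has_slice_trace I J c (\<lambda>s t. F s t + k * G s t) (\<lambda>t. \<tau> t + k * \<sigma> t)"
proof -
  obtain N where N: "N \<in> null_sets lborel"
    "((\<lambda>s. \<integral>\<^sup>+t\<in>J. ennreal ((F s t - \<tau> t)\<^sup>2) \<partial>lborel) \<longlongrightarrow> 0) (at c within I - N)"
    using F unfolding has_slice_trace_def by blast
  obtain M where M: "M \<in> null_sets lborel"
    "((\<lambda>s. \<integral>\<^sup>+t\<in>J. ennreal ((G s t - \<sigma> t)\<^sup>2) \<partial>lborel) \<longlongrightarrow> 0) (at c within I - M)"
    using G unfolding has_slice_trace_def by blast
  let ?A = "\<lambda>s. \<integral>\<^sup>+t\<in>J. ennreal ((F s t - \<tau> t)\<^sup>2) \<partial>lborel"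
  let ?B = "\<lambda>s. \<integral>\<^sup>+t\<in>J. ennreal ((G s t - \<sigma> t)\<^sup>2) \<partial>lborel"
  let ?C = "\<lambda>s. \<integral>\<^sup>+t\<in>J. ennreal ((F s t + k * G s t - (\<tau> t + k * \<sigma> t))\<^sup>2) \<partial>lborel"
  have mt: "set_borel_measurable lborel J \<tau>" "set_borel_measurable lborel J \<sigma>"
    using F G unfolding has_slice_trace_def L2_def by auto
  have ub: "?C s \<le> ennreal 2 * ?A s + ennreal (2 * k\<^sup>2) * ?B s" if "s \<in> I" for s
  proof -
    let ?f = "\<lambda>t. indicator J t *\<^sub>R F s t" and ?g = "\<lambda>t. indicator J t *\<^sub>R G s t"
    let ?t = "\<lambda>t. indicator J t *\<^sub>R \<tau> t" and ?s = "\<lambda>t. indicator J t *\<^sub>R \<sigma> t"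
    have [measurable]: "?f \<in> borel_measurable lborel" "?g \<in> borel_measurable lborel"
      "?t \<in> borel_measurable lborel" "?s \<in> borel_measurable lborel"
      using mF[OF that] mG[OF that] mt unfolding set_borel_measurable_def by auto
    \<comment> \<open>The difference of the two sides is the square of x - k y.\<close>
    have sq: "(x + k * y)\<^sup>2 \<le> 2 * x\<^sup>2 + (2 * k\<^sup>2) * y\<^sup>2" for x y :: real
      using zero_le_power2[of "x - k * y"] by (simp add: power2_eq_square algebra_simps)
    have A: "?A s = (\<integral>\<^sup>+t. ennreal ((?f t - ?t t)\<^sup>2) \<partial>lborel)"
      by (intro nn_integral_cong) (auto simp: indicator_def)
    have B: "?B s = (\<integral>\<^sup>+t. ennreal ((?g t - ?s t)\<^sup>2) \<partial>lborel)"
      by (intro nn_integral_cong) (auto simp: indicator_def)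
    have "?C s \<le> (\<integral>\<^sup>+t. ennreal 2 * ennreal ((?f t - ?t t)\<^sup>2) + ennreal (2 * k\<^sup>2) * ennreal ((?g t - ?s t)\<^sup>2) \<partial>lborel)"
    proof (intro nn_integral_mono)
      fix t
      have "ennreal ((F s t + k * G s t - (\<tau> t + k * \<sigma> t))\<^sup>2)
          \<le> ennreal (2 * (F s t - \<tau> t)\<^sup>2 + (2 * k\<^sup>2) * (G s t - \<sigma> t)\<^sup>2)"
        using sq[of "F s t - \<tau> t" "G s t - \<sigma> t"] by (intro ennreal_leI) (simp add: algebra_simps)
      then show "ennreal ((F s t + k * G s t - (\<tau> t + k * \<sigma> t))\<^sup>2) * indicator J t
          \<le> ennreal 2 * ennreal ((?f t - ?t t)\<^sup>2) + ennreal (2 * k\<^sup>2) * ennreal ((?g t - ?s t)\<^sup>2)"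
        by (auto simp: indicator_def ennreal_plus ennreal_mult simp del: ennreal_numeral)
    qed
    also have "\<dots> = ennreal 2 * ?A s + ennreal (2 * k\<^sup>2) * ?B s"
    proof -
      have m: "(\<lambda>t. ennreal ((?f t - ?t t)\<^sup>2)) \<in> borel_measurable lborel"
        "(\<lambda>t. ennreal ((?g t - ?s t)\<^sup>2)) \<in> borel_measurable lborel" by measurable
      show ?thesis
        unfolding A B nn_integral_cmult[OF m(1), symmetric] nn_integral_cmult[OF m(2), symmetric]
        by (rule nn_integral_add) (use m in measurable)
    qed
    finally show ?thesis .
  qed
  have sub: "at c within I - (N \<union> M) \<le> at c within I - N" "at c within I - (N \<union> M) \<le> at c within I - M"
    by (auto intro: at_le)
  have "((\<lambda>s. ennreal 2 * ?A s + ennreal (2 * k\<^sup>2) * ?B s) \<longlongrightarrow> ennreal 2 * 0 + ennreal (2 * k\<^sup>2) * 0) (at c within I - (N \<union> M))"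
    by (intro tendsto_add ennreal_tendsto_cmult tendsto_mono[OF sub(1) N(2)] tendsto_mono[OF sub(2) M(2)]) auto
  then have lim: "((\<lambda>s. ennreal 2 * ?A s + ennreal (2 * k\<^sup>2) * ?B s) \<longlongrightarrow> 0) (at c within I - (N \<union> M))" by simp
  have "(?C \<longlongrightarrow> 0) (at c within I - (N \<union> M))"
    by (rule tendsto_sandwich[OF _ _ tendsto_const lim]) (use ub in \<open>auto simp: eventually_at_filter\<close>)
  moreover have "N \<union> M \<in> null_sets lborel" using N(1) M(1) by auto
  moreover have "(\<lambda>t. \<tau> t + k * \<sigma> t) \<in> L2 J"
    using F G unfolding has_slice_trace_def by (intro L2_add L2_cmult) auto
  ultimately show ?thesis unfolding has_slice_trace_def by blast
qed

lemma has_slice_trace_unique: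
  assumes F: "has_slice_trace {a<..<b} J c F \<tau>" and G: "has_slice_trace {a<..<b} J c F \<sigma>" and J: "J \<in> sets lborel"
    and mF: "\<And>s. s \<in> {a<..<b} \<Longrightarrow> set_borel_measurable lborel J (F s)"
    and ab: "a < b" "c \<in> {a, b}"
  shows "AE t in lborel. t \<in> J \<longrightarrow> \<tau> t = \<sigma> t"
proof -
  \<comment> \<open>The slices of this combination vanish identically, so their distance to the
    trace is a constant; its limit being 0, the constant is 0.\<close>
  have "has_slice_trace {a<..<b} J c (\<lambda>s t. F s t + (-1) * F s t) (\<lambda>t. \<tau> t + (-1) * \<sigma> t)"
    by (rule has_slice_trace_add_cmult[OF F G J mF mF])
  then obtain N where N: "N \<in> null_sets lborel"
    "((\<lambda>s. \<integral>\<^sup>+t\<in>J. ennreal ((\<tau> t - \<sigma> t)\<^sup>2) \<partial>lborel) \<longlongrightarrow> 0) (at c within {a<..<b} - N)"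
    and L: "(\<lambda>t. \<tau> t - \<sigma> t) \<in> L2 J"
    unfolding has_slice_trace_def by (auto simp: power2_commute)
  have "(\<integral>\<^sup>+t\<in>J. ennreal ((\<tau> t - \<sigma> t)\<^sup>2) \<partial>lborel) = 0"
    using N(2) null_set_at_within_nontrivial[OF ab N(1)] by (simp add: tendsto_const_iff)
  moreover have "(\<integral>\<^sup>+t\<in>J. ennreal ((\<tau> t - \<sigma> t)\<^sup>2) \<partial>lborel) = (\<integral>\<^sup>+t. ennreal (indicator J t *\<^sub>R (\<tau> t - \<sigma> t)\<^sup>2) \<partial>lborel)"
    by (intro nn_integral_cong) (auto simp: indicator_def)
  moreover have "(\<lambda>t. indicator J t *\<^sub>R (\<tau> t - \<sigma> t)\<^sup>2) \<in> borel_measurable lborel"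
    using L unfolding L2_def set_integrable_def by auto
  ultimately have "AE t in lborel. ennreal (indicator J t *\<^sub>R (\<tau> t - \<sigma> t)\<^sup>2) = 0"
    by (subst nn_integral_0_iff_AE[symmetric]) auto
  then show ?thesis by (auto simp: indicator_def elim!: eventually_mono)
qed

lemma L2_sections:
  fixes g :: "real \<times> real \<Rightarrow> real"
  assumes "g \<in> L2 (I \<times> J)"
  shows "AE x in lborel. x \<in> I \<longrightarrow> (\<lambda>z. g (x, z)) \<in> L2 J"
    and "AE z in lborel. z \<in> J \<longrightarrow> (\<lambda>x. g (x, z)) \<in> L2 I"
proof -
  have *: "AE x in lborel. x \<in> I \<longrightarrow> (\<lambda>z. g (x, z)) \<in> L2 J" if "g \<in> L2 (I \<times> J)" for g :: "real \<times> real \<Rightarrow> real" and I J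
  proof -
    have "set_integrable lborel (I \<times> J) (\<lambda>y. (g y)\<^sup>2)" using that unfolding L2_def by auto
    from set_integrable_Times_fst(1)[OF this] show ?thesis
      using that set_borel_measurable_section[of I J g] unfolding L2_def by (auto elim!: eventually_mono)
  qed
  from *[OF assms] show "AE x in lborel. x \<in> I \<longrightarrow> (\<lambda>z. g (x, z)) \<in> L2 J" .
  from *[OF L2_swap[OF assms]] show "AE z in lborel. z \<in> J \<longrightarrow> (\<lambda>x. g (x, z)) \<in> L2 I" by simp
qed

text \<open>By Cauchy-Schwarz on the segment between the slice and the side, the squared deviation
  from the trace is at most the distance to the side times the integral of g^2 along the line. At
  the far side the rest of the line integral is used.\<close>

lemma slice_traces_of_primitive:
  fixes f g :: "real \<times> real \<Rightarrow> real"
  assumes ab: "a < b" and J: "open J" "bounded J" and c: "c \<in> L2 J" and g: "g \<in> L2 ({a<..<b} \<times> J)"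
    and rep: "AE y in lborel. y \<in> {a<..<b} \<times> J \<longrightarrow> f y = c (snd y) + primitive_from a g y"
  shows "has_slice_trace {a<..<b} J a (\<lambda>s t. f (s, t)) c"
    and "has_slice_trace {a<..<b} J b (\<lambda>s t. f (s, t)) (\<lambda>t. c t + (LINT s:{a<..<b}|lborel. g (s, t)))"
proof -
  let ?I = "{a<..<b}"
  let ?G = "\<lambda>t. LINT s:?I|lborel. (g (s, t))\<^sup>2"
  have G: "set_integrable lborel J ?G"
    using set_integrable_Times_snd(2)[of ?I J "\<lambda>y. (g y)\<^sup>2"] g unfolding L2_def by auto
  note rep' = AE_Times_fst[OF rep] and sec = L2_sections(2)[OF g]
  show "has_slice_trace ?I J a (\<lambda>s t. f (s, t)) c"
  proof (rule has_slice_traceI[OF c G])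
    show "AE s in lborel. s \<in> ?I \<longrightarrow> (AE t in lborel. t \<in> J \<longrightarrow> (f (s, t) - c t)\<^sup>2 \<le> \<bar>s - a\<bar> * ?G t)"
      using rep'
    proof (eventually_elim, intro impI)
      fix s assume s: "s \<in> ?I \<longrightarrow> (AE t in lborel. t \<in> J \<longrightarrow> f (s, t) = c (snd (s, t)) + primitive_from a g (s, t))" "s \<in> ?I"
      then have "AE t in lborel. t \<in> J \<longrightarrow> f (s, t) = c (snd (s, t)) + primitive_from a g (s, t)" by blast
      then show "AE t in lborel. t \<in> J \<longrightarrow> (f (s, t) - c t)\<^sup>2 \<le> \<bar>s - a\<bar> * ?G t"
        using sec
      proof eventually_elim
        case (elim t)
        then show ?case using L2_interval_integral_le[of "\<lambda>s. g (s, t)" a b a s] s(2)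
          by (auto simp: primitive_from_def)
      qed
    qed
  qed
  show "has_slice_trace ?I J b (\<lambda>s t. f (s, t)) (\<lambda>t. c t + (LINT s:?I|lborel. g (s, t)))"
  proof (rule has_slice_traceI[OF _ G])
    show "(\<lambda>t. c t + (LINT s:?I|lborel. g (s, t))) \<in> L2 J"
      using L2_integral_snd(1)[OF L2_swap[OF g] J(2,1), unfolded o_def] by (intro L2_add c) auto
    show "AE s in lborel. s \<in> ?I \<longrightarrow> (AE t in lborel. t \<in> J \<longrightarrow>
        (f (s, t) - (c t + (LINT s:?I|lborel. g (s, t))))\<^sup>2 \<le> \<bar>s - b\<bar> * ?G t)"
      using rep'
    proof (eventually_elim, intro impI)
      fix s assume s: "s \<in> ?I \<longrightarrow> (AE t in lborel. t \<in> J \<longrightarrow> f (s, t) = c (snd (s, t)) + primitive_from a g (s, t))" "s \<in> ?I"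
      then have "AE t in lborel. t \<in> J \<longrightarrow> f (s, t) = c (snd (s, t)) + primitive_from a g (s, t)" by blast
      then show "AE t in lborel. t \<in> J \<longrightarrow> (f (s, t) - (c t + (LINT s:?I|lborel. g (s, t))))\<^sup>2 \<le> \<bar>s - b\<bar> * ?G t"
        using sec
      proof (eventually_elim, intro impI)
        fix t assume t: "t \<in> J \<longrightarrow> f (s, t) = c (snd (s, t)) + primitive_from a g (s, t)"
          "t \<in> J \<longrightarrow> (\<lambda>x. g (x, t)) \<in> L2 ?I" "t \<in> J"
        then have gt: "(\<lambda>x. g (x, t)) \<in> L2 ?I" by blast
        have "f (s, t) - (c t + (LINT s:?I|lborel. g (s, t))) = - (LINT s:{s<..<b}|lborel. g (s, t))"
          using t s(2) set_integral_split[OF L2_integrable[OF _ _ gt], of s] by (auto simp: primitive_from_def)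
        then show "(f (s, t) - (c t + (LINT s:?I|lborel. g (s, t))))\<^sup>2 \<le> \<bar>s - b\<bar> * ?G t"
          using L2_interval_integral_le[OF gt, of s b] s(2) by simp
      qed
    qed
  qed
qed

text \<open>Square integrability of \<open>c\<close> is read off from a single good slice, on which
  \<open>c\<close> is the difference of \<open>f\<close> and the primitive, both square integrable
  in z.\<close>

lemma weak_partial_representation_L2:
  assumes ab: "a < b" and J: "open J" "bounded J"
    and f: "f \<in> L2 ({a<..<b} \<times> J)" and g: "g \<in> L2 ({a<..<b} \<times> J)"
    and w: "has_weak_partial ({a<..<b} \<times> J) (1, 0) f g"
  obtains c where "c \<in> L2 J"
    "AE y in lborel. y \<in> {a<..<b} \<times> J \<longrightarrow> f y = c (snd y) + primitive_from a g y"
proof -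
  let ?I = "{a<..<b}"
  have R: "bounded (?I \<times> J)" "open (?I \<times> J)" using J by (auto intro: bounded_Times open_Times)
  obtain c where c: "set_integrable lborel J c"
    "AE y in lborel. y \<in> ?I \<times> J \<longrightarrow> f y = c (snd y) + primitive_from a g y"
    using weak_partial_representation[OF ab J L2_integrable[OF R f] L2_integrable[OF R g] w] by blast
  have G: "set_integrable lborel J (\<lambda>t. LINT s:?I|lborel. (g (s, t))\<^sup>2)"
    using set_integrable_Times_snd(2)[of ?I J "\<lambda>y. (g y)\<^sup>2"] g unfolding L2_def by auto
  obtain x where x: "x \<in> ?I" "(\<lambda>z. f (x, z)) \<in> L2 J"
    "AE z in lborel. z \<in> J \<longrightarrow> f (x, z) = c (snd (x, z)) + primitive_from a g (x, z)"
  proof (rule AE_imp_ex[OF _ ab])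
    show "AE x in lborel. x \<in> ?I \<longrightarrow> (\<lambda>z. f (x, z)) \<in> L2 J \<and>
        (AE z in lborel. z \<in> J \<longrightarrow> f (x, z) = c (snd (x, z)) + primitive_from a g (x, z))"
      using L2_sections(1)[OF f] AE_Times_fst[OF c(2)] by eventually_elim auto
  qed (use that in blast)
  have "(\<lambda>z. primitive_from a g (x, z)) \<in> L2 J"
  proof -
    have m: "set_borel_measurable lborel J (\<lambda>z. primitive_from a g (x, z))"
      using primitive_from_measurable[of a b J g] g J(1) x(1) unfolding L2_def
      by (intro set_borel_measurable_section[of ?I]) auto
    have "set_integrable lborel J (\<lambda>z. (b - a) * (LINT s:?I|lborel. (g (s, z))\<^sup>2))" using G by auto
    then have "set_integrable lborel J (\<lambda>z. (primitive_from a g (x, z))\<^sup>2)"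
    proof (rule set_integrable_bound)
      show "set_borel_measurable lborel J (\<lambda>z. (primitive_from a g (x, z))\<^sup>2)"
        unfolding power2_eq_square by (rule set_borel_measurable_mult[OF m m])
      show "AE z in lborel. z \<in> J \<longrightarrow> norm ((primitive_from a g (x, z))\<^sup>2) \<le> norm ((b - a) * (LINT s:?I|lborel. (g (s, z))\<^sup>2))"
        using L2_sections(2)[OF g]
      proof (eventually_elim, intro impI)
        fix z assume "z \<in> J \<longrightarrow> (\<lambda>x. g (x, z)) \<in> L2 ?I" "z \<in> J"
        then have gz: "(\<lambda>x. g (x, z)) \<in> L2 ?I" by blast
        have "(primitive_from a g (x, z))\<^sup>2 \<le> (x - a) * (LINT s:?I|lborel. (g (s, z))\<^sup>2)"
          using L2_interval_integral_le[OF gz, of a x] x(1) by (simp add: primitive_from_def)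
        also have "\<dots> \<le> (b - a) * (LINT s:?I|lborel. (g (s, z))\<^sup>2)"
          using x(1) by (intro mult_right_mono) (auto simp: set_lebesgue_integral_def)
        finally show "norm ((primitive_from a g (x, z))\<^sup>2) \<le> norm ((b - a) * (LINT s:?I|lborel. (g (s, z))\<^sup>2))"
          by simp
      qed
    qed
    then show ?thesis using m unfolding L2_def by auto
  qed
  then have "(\<lambda>z. f (x, z) - primitive_from a g (x, z)) \<in> L2 J" by (rule L2_diff[OF x(2)])
  then have "c \<in> L2 J"
    by (rule L2_cong) (use set_integrable_imp_measurable[OF c(1)] x(3) in \<open>auto elim!: eventually_mono\<close>)
  then show ?thesis using that c(2) by blast
qed

lemma has_weak_partial_swap:
  fixes f g :: "real \<times> real \<Rightarrow> real"
  assumes B: "(u, v) \<in> Basis" and w: "has_weak_partial (I \<times> J) (u, v) f g"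
    and f: "set_integrable lborel (I \<times> J) f" and g: "set_integrable lborel (I \<times> J) g"
  shows "has_weak_partial (J \<times> I) (v, u) (f \<circ> prod.swap) (g \<circ> prod.swap)"
  unfolding has_weak_partial_def
proof (intro conjI allI impI)
  show "locally_integrable (J \<times> I) (f \<circ> prod.swap)" "locally_integrable (J \<times> I) (g \<circ> prod.swap)"
    using f g by (auto intro!: set_integrable_imp_locally_integrable set_integrable_swap)
  fix \<phi> :: "real \<times> real \<Rightarrow> real" assume p: "test_function (J \<times> I) \<phi>"
  let ?q = "\<phi> \<circ> prod.swap"
  have q: "test_function (I \<times> J) ?q" by (rule test_function_swap(1)[OF p])
  have d: "test_function (I \<times> J) (\<lambda>y. frechet_derivative ?q (at y) (u, v))" by (rule test_function_deriv[OF q B])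
  have l: "locally_integrable (I \<times> J) f" "locally_integrable (I \<times> J) g" using w unfolding has_weak_partial_def by auto
  have "(LINT y:J \<times> I|lborel. (f \<circ> prod.swap) y * frechet_derivative \<phi> (at y) (v, u))
      = (LINT y:J \<times> I|lborel. ((\<lambda>y. f y * frechet_derivative ?q (at y) (u, v)) \<circ> prod.swap) y)"
    using test_function_swap(2)[OF p] by (simp add: o_def)
  also have "\<dots> = (LINT y:I \<times> J|lborel. f y * frechet_derivative ?q (at y) (u, v))"
    by (rule set_integrable_swap(2)[OF locally_integrable_mult_test[OF l(1) d]])
  also have "\<dots> = - (LINT y:I \<times> J|lborel. g y * ?q y)"
    using w q unfolding has_weak_partial_def by blast
  also have "(LINT y:I \<times> J|lborel. g y * ?q y) = (LINT y:J \<times> I|lborel. ((\<lambda>y. g y * ?q y) \<circ> prod.swap) y)"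
    by (rule set_integrable_swap(2)[OF locally_integrable_mult_test[OF l(2) q], symmetric])
  also have "\<dots> = (LINT y:J \<times> I|lborel. (g \<circ> prod.swap) y * \<phi> y)" by (simp add: o_def)
  finally show "(LINT y:J \<times> I|lborel. (f \<circ> prod.swap) y * frechet_derivative \<phi> (at y) (v, u))
      = - (LINT y:J \<times> I|lborel. (g \<circ> prod.swap) y * \<phi> y)" .
qed

lemma H1_weak_partial:
  assumes S: "open S" "bounded S" and f: "f \<in> H1 S" and i: "i \<in> Basis"
  shows "has_weak_partial S i f (weak_partial S i f)" "weak_partial S i f \<in> L2 S"
proof -
  obtain g where g: "g \<in> L2 S" "has_weak_partial S i f g" using f i unfolding H1_def by blast
  show w: "has_weak_partial S i f (weak_partial S i f)" by (rule weak_partial_works[OF g(2)])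
  then have "set_borel_measurable lborel S (weak_partial S i f)"
    using locally_integrable_measurable[OF S(1)] unfolding has_weak_partial_def by blast
  then show "weak_partial S i f \<in> L2 S"
    using weak_partial_AE_eq[OF S(1) i g(2)] by (rule L2_cong[OF g(1)])
qed

lemma H1_L2: "f \<in> H1 S \<Longrightarrow> f \<in> L2 S"
  unfolding H1_def by auto

lemma Basis_real_pair: "(Basis :: (real \<times> real) set) = {(1, 0), (0, 1)}"
  by (auto simp: Basis_prod_def)

lemma H1_add_cmult:
  assumes S: "open S" "bounded S" and f: "f \<in> H1 S" and g: "g \<in> H1 S"
  shows "(\<lambda>y. f y + k * g y) \<in> H1 S"
    and "\<And>i. i \<in> Basis \<Longrightarrow> AE y in lborel. y \<in> S \<longrightarrow>
      weak_partial S i (\<lambda>y. f y + k * g y) y = weak_partial S i f y + k * weak_partial S i g y"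
proof -
  have w: "has_weak_partial S i (\<lambda>y. f y + k * g y) (\<lambda>y. weak_partial S i f y + k * weak_partial S i g y)"
    if "i \<in> Basis" for i
    by (intro has_weak_partial_add has_weak_partial_cmult H1_weak_partial[OF S] f g that)
  show "(\<lambda>y. f y + k * g y) \<in> H1 S"
    unfolding H1_def
  proof (intro CollectI conjI ballI)
    show "(\<lambda>y. f y + k * g y) \<in> L2 S" by (intro L2_add L2_cmult H1_L2 f g)
    show "\<exists>h\<in>L2 S. has_weak_partial S i (\<lambda>y. f y + k * g y) h" if "i \<in> Basis" for i
      by (rule bexI[of _ "\<lambda>y. weak_partial S i f y + k * weak_partial S i g y"])
        (intro w L2_add L2_cmult H1_weak_partial[OF S] f g that)+
  qed
  show "AE y in lborel. y \<in> S \<longrightarrow> weak_partial S i (\<lambda>y. f y + k * g y) y = weak_partial S i f y + k * weak_partial S i g y"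
    if "i \<in> Basis" for i
    by (rule weak_partial_AE_eq[OF S(1) that w[OF that]])
qed

subsection \<open>Functions of one variable on a rectangle\<close>

lemma has_weak_partial_fst:
  fixes f g :: "real \<Rightarrow> real" and J :: "real set"
  assumes w: "has_weak_partial I 1 f g" and f: "set_integrable lborel I f" and g: "set_integrable lborel I g"
    and J: "open J" "bounded J"
  shows "has_weak_partial (I \<times> J) (1, 0) (\<lambda>y. f (fst y)) (\<lambda>y. g (fst y))"
  unfolding has_weak_partial_def
proof (intro conjI allI impI)
  show lf: "locally_integrable (I \<times> J) (\<lambda>y. f (fst y))" and lg: "locally_integrable (I \<times> J) (\<lambda>y. g (fst y))"
    using set_integrable_fst[OF f J(2,1)] set_integrable_fst[OF g J(2,1)]
    by (auto intro!: set_integrable_imp_locally_integrable)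
  fix \<phi> :: "real \<times> real \<Rightarrow> real" assume p: "test_function (I \<times> J) \<phi>"
  have d: "test_function (I \<times> J) (\<lambda>y. frechet_derivative \<phi> (at y) (1, 0))"
    by (rule test_function_deriv[OF p]) (simp add: Basis_real_pair)
  have "(LINT y:I \<times> J|lborel. f (fst y) * frechet_derivative \<phi> (at y) (1, 0))
      = (LINT z:J|lborel. LINT x:I|lborel. f x * frechet_derivative \<phi> (at (x, z)) (1, 0))"
    using set_integrable_Times_snd(3)[OF locally_integrable_mult_test[OF lf d]] by simp
  also have "\<dots> = (LINT z:J|lborel. - (LINT x:I|lborel. g x * \<phi> (x, z)))"
  proof -
    have "(LINT x:I|lborel. f x * frechet_derivative \<phi> (at (x, z)) (1, 0)) = - (LINT x:I|lborel. g x * \<phi> (x, z))" for z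
      using w[unfolded has_weak_partial_def, THEN conjunct2, THEN conjunct2, rule_format, OF test_function_slice(1)[OF p, of z]]
      unfolding test_function_slice(2)[OF p] .
    then show ?thesis by simp
  qed
  also have "\<dots> = - (LINT z:J|lborel. LINT x:I|lborel. g x * \<phi> (x, z))"
    by (simp add: set_lebesgue_integral_def)
  also have "\<dots> = - (LINT y:I \<times> J|lborel. g (fst y) * \<phi> y)"
    using set_integrable_Times_snd(3)[OF locally_integrable_mult_test[OF lg p]] by simp
  finally show "(LINT y:I \<times> J|lborel. f (fst y) * frechet_derivative \<phi> (at y) (1, 0))
      = - (LINT y:I \<times> J|lborel. g (fst y) * \<phi> y)" .
qed

lemma has_weak_partial_z_fst:
  fixes f :: "real \<Rightarrow> real" and c d :: real
  assumes f: "set_integrable lborel I f" and I: "open I" "bounded I"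
  shows "has_weak_partial (I \<times> {c<..<d}) (0, 1) (\<lambda>y. f (fst y)) (\<lambda>y. 0)"
proof -
  have z: "set_integrable lborel ({c<..<d} \<times> I) (\<lambda>y. 0)" by (simp add: set_integrable_def)
  \<comment> \<open>A function of the other variable is its value on the side plus the primitive of
    0; exchanging the coordinates gives the claim.\<close>
  have eq: "(\<lambda>y. f (snd y) + primitive_from c (\<lambda>y. 0) y) = (\<lambda>y. f (snd y))"
    by (simp add: primitive_from_def fun_eq_iff)
  have w: "has_weak_partial ({c<..<d} \<times> I) (1, 0) (\<lambda>y. f (snd y)) (\<lambda>y. 0)"
    using primitive_has_weak_partial[OF f z I] unfolding eq .
  have "has_weak_partial (I \<times> {c<..<d}) (0, 1) ((\<lambda>y. f (snd y)) \<circ> prod.swap) ((\<lambda>y. 0) \<circ> prod.swap)"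
    by (rule has_weak_partial_swap[OF _ w set_integrable_snd[OF f] z]) (auto simp: Basis_real_pair)
  then show ?thesis by (simp add: o_def)
qed

lemma H1_fst:
  fixes f :: "real \<Rightarrow> real" and c d :: real
  assumes I: "open I" "bounded I" and f: "f \<in> H1 I"
  shows "(\<lambda>y. f (fst y)) \<in> H1 (I \<times> {c<..<d})"
    and "AE y in lborel. y \<in> I \<times> {c<..<d} \<longrightarrow> wDx (I \<times> {c<..<d}) (\<lambda>y. f (fst y)) y = wD I f (fst y)"
    and "AE y in lborel. y \<in> I \<times> {c<..<d} \<longrightarrow> wDz (I \<times> {c<..<d}) (\<lambda>y. f (fst y)) y = 0"
proof -
  let ?R = "I \<times> {c<..<d}"
  have R: "open ?R" "bounded ?R" using I by (auto intro: open_Times bounded_Times)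
  note w = H1_weak_partial[OF I f, of 1, simplified]
  have i: "set_integrable lborel I f" "set_integrable lborel I (wD I f)"
    using L2_integrable[OF I(2,1)] w H1_L2[OF f] by auto
  have wx: "has_weak_partial ?R (1, 0) (\<lambda>y. f (fst y)) (\<lambda>y. wD I f (fst y))"
    by (rule has_weak_partial_fst[OF w(1) i]) auto
  have wz: "has_weak_partial ?R (0, 1) (\<lambda>y. f (fst y)) (\<lambda>y. 0)" by (rule has_weak_partial_z_fst[OF i(1) I])
  have l: "(\<lambda>y. f (fst y)) \<in> L2 ?R" "(\<lambda>y. wD I f (fst y)) \<in> L2 ?R"
    by (auto intro!: L2_fst H1_L2[OF f] w(2))
  show "(\<lambda>y. f (fst y)) \<in> H1 ?R"
    unfolding H1_def using l wx wz L2_const[OF R(2,1), of 0] by (auto simp: Basis_real_pair)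
  show "AE y in lborel. y \<in> ?R \<longrightarrow> wDx ?R (\<lambda>y. f (fst y)) y = wD I f (fst y)"
    by (rule weak_partial_AE_eq[OF R(1) _ wx]) (simp add: Basis_real_pair)
  show "AE y in lborel. y \<in> ?R \<longrightarrow> wDz ?R (\<lambda>y. f (fst y)) y = 0"
    by (rule weak_partial_AE_eq[OF R(1) _ wz]) (simp add: Basis_real_pair)
qed

text \<open>The two-variable representation is applied to a function constant in an artificial
  second variable from (0, 1) and then read at one value of that variable.\<close>

lemma H1_representation:
  assumes ab: "a < b" and f: "f \<in> H1 {a<..<b}"
  obtains C where "AE x in lborel. x \<in> {a<..<b} \<longrightarrow> f x = C + (LINT s:{a<..<x}|lborel. wD {a<..<b} f s)"
proof -
  let ?I = "{a<..<b}" and ?J = "{0<..<1::real}"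
  note w = H1_weak_partial[OF _ _ f, of 1, simplified]
  have i: "set_integrable lborel ?I f" "set_integrable lborel ?I (wD ?I f)"
    using L2_integrable[of ?I] w H1_L2[OF f] by auto
  obtain c where c: "AE y in lborel. y \<in> ?I \<times> ?J \<longrightarrow> f (fst y) = c (snd y) + primitive_from a (\<lambda>y. wD ?I f (fst y)) y"
    using weak_partial_representation[OF ab _ _ set_integrable_fst[OF i(1)] set_integrable_fst[OF i(2)]
        has_weak_partial_fst[OF w(1) i], of ?J] by auto
  obtain z where "AE x in lborel. x \<in> ?I \<longrightarrow> f (fst (x, z)) = c (snd (x, z)) + primitive_from a (\<lambda>y. wD ?I f (fst y)) (x, z)"
    using AE_imp_ex[OF AE_Times_snd[OF c]] by auto
  then show ?thesis using that[of "c z"] by (simp add: primitive_from_def)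
qed

text \<open>Cauchy-Schwarz makes the primitive continuous up to the ends with the square root of the
  distance as modulus.\<close>

lemma primitive_limits:
  fixes g :: "real \<Rightarrow> real"
  assumes g: "g \<in> L2 {a<..<b}"
  shows "((\<lambda>x. LINT s:{a<..<x}|lborel. g s) \<longlongrightarrow> 0) (at a within {a<..<b})"
    and "((\<lambda>x. LINT s:{a<..<x}|lborel. g s) \<longlongrightarrow> (LINT s:{a<..<b}|lborel. g s)) (at b within {a<..<b})"
proof -
  let ?K = "LINT s:{a<..<b}|lborel. (g s)\<^sup>2"
  have l: "((\<lambda>x. sqrt (\<bar>x - e\<bar> * ?K)) \<longlongrightarrow> 0) (at e within {a<..<b})" for e
  proof -
    have "((\<lambda>x. sqrt (\<bar>x - e\<bar> * ?K)) \<longlongrightarrow> sqrt (\<bar>e - e\<bar> * ?K)) (at e within {a<..<b})"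
      by (intro tendsto_intros)
    then show ?thesis by simp
  qed
  have *: "\<bar>LINT s:{p<..<q}|lborel. g s\<bar> \<le> sqrt ((q - p) * ?K)" if "a \<le> p" "p \<le> q" "q \<le> b" for p q
    using L2_interval_integral_le[OF g that] by (intro real_le_rsqrt) simp
  show "((\<lambda>x. LINT s:{a<..<x}|lborel. g s) \<longlongrightarrow> 0) (at a within {a<..<b})"
    by (rule Lim_null_comparison[OF _ l]) (use * in \<open>auto simp: eventually_at_filter\<close>)
  have "((\<lambda>x. (LINT s:{a<..<x}|lborel. g s) - (LINT s:{a<..<b}|lborel. g s)) \<longlongrightarrow> 0) (at b within {a<..<b})"
  proof (rule Lim_null_comparison[OF _ l])
    have "norm ((LINT s:{a<..<x}|lborel. g s) - (LINT s:{a<..<b}|lborel. g s)) \<le> sqrt (\<bar>x - b\<bar> * ?K)"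
      if "x \<in> {a<..<b}" for x
      using set_integral_split[OF L2_integrable[OF _ _ g], of x] *[of x b] that by auto
    then show "\<forall>\<^sub>F x in at b within {a<..<b}. norm ((LINT s:{a<..<x}|lborel. g s) - (LINT s:{a<..<b}|lborel. g s)) \<le> sqrt (\<bar>x - b\<bar> * ?K)"
      by (auto simp: eventually_at_filter)
  qed
  then show "((\<lambda>x. LINT s:{a<..<x}|lborel. g s) \<longlongrightarrow> (LINT s:{a<..<b}|lborel. g s)) (at b within {a<..<b})"
    by (simp add: LIM_zero_iff)
qed

lemma vanishes_at_limit_unique:
  assumes ab: "a < b" "c \<in> {a, b}" and v: "vanishes_at {a<..<b} c \<psi>"
    and eq: "AE x in lborel. x \<in> {a<..<b} \<longrightarrow> \<psi> x = h x" and h: "(h \<longlongrightarrow> l) (at c within {a<..<b})"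
  shows "l = 0"
proof -
  obtain N where N: "N \<in> null_sets lborel" "(\<psi> \<longlongrightarrow> 0) (at c within {a<..<b} - N)"
    using v unfolding vanishes_at_def by blast
  obtain M where M: "M \<in> null_sets lborel" "\<And>x. x \<notin> M \<Longrightarrow> x \<in> {a<..<b} \<longrightarrow> \<psi> x = h x"
    using AE_lborel_null_set[OF eq] by blast
  let ?F = "at c within {a<..<b} - (N \<union> M)"
  have "(\<psi> \<longlongrightarrow> 0) ?F" by (rule tendsto_mono[OF _ N(2)]) (auto intro: at_le)
  moreover have "(\<psi> \<longlongrightarrow> l) ?F"
  proof (rule tendsto_cong[THEN iffD2])
    show "\<forall>\<^sub>F x in ?F. \<psi> x = h x" using M(2) by (auto simp: eventually_at_filter)
    show "(h \<longlongrightarrow> l) ?F" by (rule tendsto_mono[OF _ h]) (auto intro: at_le)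
  qed
  moreover have "?F \<noteq> bot" using N M by (intro null_set_at_within_nontrivial[OF ab]) auto
  ultimately show ?thesis using tendsto_unique by blast
qed

text \<open>The condition at the left end removes the constant of the representation, the one at the
  right end then annihilates the integral of the derivative. This mean-zero property is what later
  bounds a constant of integration.\<close>

lemma space_W_representation:
  assumes ab: "a < b" and f: "f \<in> space_W a b"
  shows "AE x in lborel. x \<in> {a<..<b} \<longrightarrow> f x = (LINT s:{a<..<x}|lborel. wD {a<..<b} f s)"
    and "(LINT s:{a<..<b}|lborel. wD {a<..<b} f s) = 0"
proof -
  have H: "f \<in> H1 {a<..<b}" and v: "vanishes_at {a<..<b} a f" "vanishes_at {a<..<b} b f"
    using f unfolding space_W_def by auto
  have g: "wD {a<..<b} f \<in> L2 {a<..<b}" using H1_weak_partial[OF _ _ H, of 1] by simp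
  obtain C where C: "AE x in lborel. x \<in> {a<..<b} \<longrightarrow> f x = C + (LINT s:{a<..<x}|lborel. wD {a<..<b} f s)"
    using H1_representation[OF ab H] by blast
  have "C + 0 = 0"
    by (rule vanishes_at_limit_unique[OF ab _ v(1) C tendsto_add[OF tendsto_const primitive_limits(1)[OF g]]]) simp
  then show "AE x in lborel. x \<in> {a<..<b} \<longrightarrow> f x = (LINT s:{a<..<x}|lborel. wD {a<..<b} f s)"
    using C by simp
  have "C + (LINT s:{a<..<b}|lborel. wD {a<..<b} f s) = 0"
    by (rule vanishes_at_limit_unique[OF ab _ v(2) C tendsto_add[OF tendsto_const primitive_limits(2)[OF g]]]) simp
  with \<open>C + 0 = 0\<close> show "(LINT s:{a<..<b}|lborel. wD {a<..<b} f s) = 0" by simp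
qed

lemma space_W_I:
  assumes f: "f \<in> H1 {a<..<b}"
    and rep: "AE x in lborel. x \<in> {a<..<b} \<longrightarrow> f x = (LINT s:{a<..<x}|lborel. wD {a<..<b} f s)"
    and zero: "(LINT s:{a<..<b}|lborel. wD {a<..<b} f s) = 0"
  shows "f \<in> space_W a b"
proof -
  have g: "wD {a<..<b} f \<in> L2 {a<..<b}" using H1_weak_partial[OF _ _ f, of 1] by simp
  obtain N where N: "N \<in> null_sets lborel" "\<And>x. x \<notin> N \<Longrightarrow> x \<in> {a<..<b} \<longrightarrow> f x = (LINT s:{a<..<x}|lborel. wD {a<..<b} f s)"
    using AE_lborel_null_set[OF rep] by blast
  have "vanishes_at {a<..<b} c f" if lim: "((\<lambda>x. LINT s:{a<..<x}|lborel. wD {a<..<b} f s) \<longlongrightarrow> 0) (at c within {a<..<b})" for c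
    unfolding vanishes_at_def
  proof (rule bexI[OF _ N(1)], rule tendsto_cong[THEN iffD2])
    show "\<forall>\<^sub>F x in at c within {a<..<b} - N. f x = (LINT s:{a<..<x}|lborel. wD {a<..<b} f s)"
      using N(2) by (auto simp: eventually_at_filter)
    show "((\<lambda>x. LINT s:{a<..<x}|lborel. wD {a<..<b} f s) \<longlongrightarrow> 0) (at c within {a<..<b} - N)"
      by (rule tendsto_mono[OF _ lim]) (auto intro: at_le)
  qed
  then show ?thesis using primitive_limits[OF g] f unfolding space_W_def zero by auto
qed

lemma space_W_add_cmult:
  assumes ab: "a < b" and f: "f \<in> space_W a b" and g: "g \<in> space_W a b"
  shows "(\<lambda>x. f x + k * g x) \<in> space_W a b"
    and "AE x in lborel. x \<in> {a<..<b} \<longrightarrow> wD {a<..<b} (\<lambda>x. f x + k * g x) x = wD {a<..<b} f x + k * wD {a<..<b} g x"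
proof -
  have H: "f \<in> H1 {a<..<b}" "g \<in> H1 {a<..<b}" using f g unfolding space_W_def by auto
  note lin = H1_add_cmult[OF _ _ H, simplified]
  show "AE x in lborel. x \<in> {a<..<b} \<longrightarrow> wD {a<..<b} (\<lambda>x. f x + k * g x) x = wD {a<..<b} f x + k * wD {a<..<b} g x"
    using lin(2)[of 1] by simp
  have *: "vanishes_at {a<..<b} c (\<lambda>x. f x + k * g x)" if fv: "vanishes_at {a<..<b} c f" and gv: "vanishes_at {a<..<b} c g" for c
  proof -
    obtain N where N: "N \<in> null_sets lborel" "(f \<longlongrightarrow> 0) (at c within {a<..<b} - N)"
      using fv unfolding vanishes_at_def by blast
    obtain M where M: "M \<in> null_sets lborel" "(g \<longlongrightarrow> 0) (at c within {a<..<b} - M)"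
      using gv unfolding vanishes_at_def by blast
    let ?F = "at c within {a<..<b} - (N \<union> M)"
    have "(f \<longlongrightarrow> 0) ?F" by (rule tendsto_mono[OF _ N(2)]) (auto intro: at_le)
    moreover have "(g \<longlongrightarrow> 0) ?F" by (rule tendsto_mono[OF _ M(2)]) (auto intro: at_le)
    ultimately have "((\<lambda>x. f x + k * g x) \<longlongrightarrow> 0 + k * 0) ?F" by (intro tendsto_intros)
    moreover have "N \<union> M \<in> null_sets lborel" using N(1) M(1) by auto
    ultimately show ?thesis unfolding vanishes_at_def by (intro bexI[of _ "N \<union> M"]) auto
  qed
  show "(\<lambda>x. f x + k * g x) \<in> space_W a b"
    using f g lin(1) * unfolding space_W_def by auto
qed

text \<open>Writing \<open>f\<close> as a primitive reduces differentiation under the integral to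
  Fubini: the z-integral of a primitive is the primitive of the z-integral.\<close>

lemma H1_integral_snd:
  fixes f :: "real \<times> real \<Rightarrow> real"
  assumes ab: "a < b" and J: "open J" "bounded J" and f: "f \<in> L2 ({a<..<b} \<times> J)" and g: "g \<in> L2 ({a<..<b} \<times> J)"
    and w: "has_weak_partial ({a<..<b} \<times> J) (1, 0) f g"
  shows "has_weak_partial {a<..<b} 1 (\<lambda>x. LINT z:J|lborel. f (x, z)) (\<lambda>x. LINT z:J|lborel. g (x, z))"
    and "(\<lambda>x. LINT z:J|lborel. f (x, z)) \<in> H1 {a<..<b}"
proof -
  let ?I = "{a<..<b}" and ?F = "\<lambda>x. LINT z:J|lborel. f (x, z)" and ?G = "\<lambda>x. LINT z:J|lborel. g (x, z)"
  have R: "bounded (?I \<times> J)" "open (?I \<times> J)" using J by (auto intro: bounded_Times open_Times)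
  have L: "?F \<in> L2 ?I" "?G \<in> L2 ?I"
    using L2_integral_snd(1)[OF f] L2_integral_snd(1)[OF g] J by auto
  have gi: "set_integrable lborel (?I \<times> J) g" by (rule L2_integrable[OF R g])
  obtain c where c: "c \<in> L2 J" "AE y in lborel. y \<in> ?I \<times> J \<longrightarrow> f y = c (snd y) + primitive_from a g y"
    using weak_partial_representation_L2[OF ab J f g w] by blast
  have ci: "set_integrable lborel J c" by (rule L2_integrable[OF J(2,1) c(1)])
  have rep: "AE x in lborel. x \<in> ?I \<longrightarrow> ?F x = (LINT z:J|lborel. c z) + (LINT s:{a<..<x}|lborel. ?G s)"
    using AE_Times_fst[OF c(2)] set_integrable_Times_fst(1)[OF L2_integrable[OF R f]]
      set_integrable_Times_fst(1)[OF primitive_from_integrable[OF gi J(1)]]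
  proof (eventually_elim, intro impI)
    fix x assume *: "x \<in> ?I \<longrightarrow> (AE z in lborel. z \<in> J \<longrightarrow> f (x, z) = c (snd (x, z)) + primitive_from a g (x, z))"
      "x \<in> ?I \<longrightarrow> set_integrable lborel J (\<lambda>z. f (x, z))"
      "x \<in> ?I \<longrightarrow> set_integrable lborel J (\<lambda>z. primitive_from a g (x, z))" "x \<in> ?I"
    have pi: "set_integrable lborel J (\<lambda>z. primitive_from a g (x, z))" and fi: "set_integrable lborel J (\<lambda>z. f (x, z))"
      using * by auto
    have "?F x = (LINT z:J|lborel. c z + primitive_from a g (x, z))"
    proof (rule set_integral_cong_AE_real)
      show "AE z in lborel. z \<in> J \<longrightarrow> f (x, z) = c z + primitive_from a g (x, z)" using * by auto
    qed (use fi pi ci in \<open>auto intro: set_integrable_imp_measurable set_integral_add\<close>)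
    also have "\<dots> = (LINT z:J|lborel. c z) + (LINT z:J|lborel. primitive_from a g (x, z))"
      using ci pi by (rule set_integral_add(2))
    also have "(LINT z:J|lborel. primitive_from a g (x, z)) = (LINT s:{a<..<x}|lborel. ?G s)"
    proof -
      have "{a<..<x} \<times> J \<subseteq> ?I \<times> J" using *(4) by auto
      then have "set_integrable lborel ({a<..<x} \<times> J) g"
        using gi J(1) by (auto intro!: set_integrable_subset[OF gi] simp: open_Times)
      from set_integrable_Times_fst(3)[OF this] set_integrable_Times_snd(3)[OF this]
      show ?thesis by (simp add: primitive_from_def)
    qed
    finally show "?F x = (LINT z:J|lborel. c z) + (LINT s:{a<..<x}|lborel. ?G s)" .
  qed
  show w: "has_weak_partial ?I 1 ?F ?G"
    unfolding has_weak_partial_def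
  proof (intro conjI allI impI)
    show lF: "locally_integrable ?I ?F" and "locally_integrable ?I ?G"
      using L by (auto intro!: L2_imp_locally_integrable)
    fix \<phi> :: "real \<Rightarrow> real" assume p: "test_function ?I \<phi>"
    have d: "test_function ?I (\<lambda>y. frechet_derivative \<phi> (at y) 1)" using test_function_deriv[OF p, of 1] by simp
    have Gi: "set_integrable lborel ?I ?G" using L by (auto intro: L2_integrable)
    let ?P = "\<lambda>y. (LINT s:{a<..<y}|lborel. ?G s)"
    have mF: "set_borel_measurable lborel ?I ?F" using L unfolding L2_def by auto
    have md: "set_borel_measurable lborel ?I (\<lambda>y. frechet_derivative \<phi> (at y) 1)"
      using test_function_borel[OF d] unfolding set_borel_measurable_def by (intro borel_measurable_scaleR) auto
    \<comment> \<open>Measurability of a one-variable primitive is obtained from the two-variable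
      statement with an artificial second variable in (0, 1), read at 1/2.\<close>
    have mP: "set_borel_measurable lborel ?I ?P"
      using set_borel_measurable_section[OF set_borel_measurable_swap[OF primitive_from_measurable[of a b "{0<..<1::real}" "\<lambda>y. ?G (fst y)"]], of "1/2"]
        set_borel_measurable_fst[OF set_integrable_imp_measurable[OF Gi], of "{0<..<1::real}"]
      by (auto simp: primitive_from_def)
    have mK: "set_borel_measurable lborel ?I (\<lambda>y. (LINT z:J|lborel. c z) + ?P y)"
      using L2_const[of ?I "LINT z:J|lborel. c z"] by (intro set_borel_measurable_add mP) (auto simp: L2_def)
    have "(LINT y:?I|lborel. ?F y * frechet_derivative \<phi> (at y) 1)
        = (LINT y:?I|lborel. ((LINT z:J|lborel. c z) + ?P y) * frechet_derivative \<phi> (at y) 1)"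
      by (rule set_integral_cong_AE_real[OF _ set_borel_measurable_mult[OF mF md] set_borel_measurable_mult[OF mK md]])
        (use rep in \<open>auto elim!: eventually_mono\<close>)
    also have "\<dots> = - (LINT y:?I|lborel. ?G y * \<phi> y)" by (rule primitive_by_parts[OF Gi p])
    finally show "(LINT y:?I|lborel. ?F y * frechet_derivative \<phi> (at y) 1) = - (LINT y:?I|lborel. ?G y * \<phi> y)" .
  qed
  show "?F \<in> H1 ?I" unfolding H1_def using L w by auto
qed

subsection \<open>Traces on horizontal sides\<close>

text \<open>After an exchange of coordinates the representation by primitives yields both horizontal
  traces at once. It is the source of existence, without which \<open>trace_z\<close> would be an
  arbitrary choice.\<close>

lemma H1_z_representation:
  fixes c d :: real
  assumes cd: "c < d" and X: "open X" "bounded X" and f: "f \<in> H1 (X \<times> {c<..<d})"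
  obtains \<tau> where "has_trace_z X {c<..<d} c f \<tau>"
    "has_trace_z X {c<..<d} d f (\<lambda>x. \<tau> x + (LINT z:{c<..<d}|lborel. wDz (X \<times> {c<..<d}) f (x, z)))"
    "AE y in lborel. y \<in> X \<times> {c<..<d} \<longrightarrow>
       f y = \<tau> (fst y) + (LINT s:{c<..<snd y}|lborel. wDz (X \<times> {c<..<d}) f (fst y, s))"
proof -
  let ?Z = "{c<..<d}" and ?g = "wDz (X \<times> {c<..<d}) f"
  have R: "open (X \<times> ?Z)" "bounded (X \<times> ?Z)" using X by (auto intro: open_Times bounded_Times)
  have w: "has_weak_partial (X \<times> ?Z) (0, 1) f ?g" "?g \<in> L2 (X \<times> ?Z)"
    using H1_weak_partial[OF R f, of "(0, 1)"] by (simp_all add: Basis_real_pair)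
  have sw: "has_weak_partial (?Z \<times> X) (1, 0) (f \<circ> prod.swap) (?g \<circ> prod.swap)"
    by (rule has_weak_partial_swap[OF _ w(1) L2_integrable[OF R(2,1) H1_L2[OF f]] L2_integrable[OF R(2,1) w(2)]])
      (simp add: Basis_real_pair)
  note L = L2_swap[OF H1_L2[OF f]] L2_swap[OF w(2)]
  obtain \<tau> where t: "\<tau> \<in> L2 X"
    "AE y in lborel. y \<in> ?Z \<times> X \<longrightarrow> (f \<circ> prod.swap) y = \<tau> (snd y) + primitive_from c (?g \<circ> prod.swap) y"
    using weak_partial_representation_L2[OF cd X L sw] by blast
  note tr = slice_traces_of_primitive[OF cd X t(1) L(2) t(2)]
  have "AE y in lborel. y \<in> X \<times> ?Z \<longrightarrow> f y = \<tau> (fst y) + (LINT s:{c<..<snd y}|lborel. ?g (fst y, s))"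
    using AE_swap[OF t(2)] by eventually_elim (auto simp: primitive_from_def)
  then show ?thesis using that tr by (simp add: has_trace_z_def)
qed

lemma trace_z_works:
  assumes "has_trace_z X Z e f \<tau>" shows "has_trace_z X Z e f (trace_z X Z e f)"
  unfolding trace_z_def by (rule someI[of "has_trace_z X Z e f", OF assms])

lemma has_trace_z_unique:
  fixes c d :: real
  assumes cd: "c < d" "e \<in> {c, d}" and X: "open X" and f: "set_borel_measurable lborel (X \<times> {c<..<d}) f"
    and t: "has_trace_z X {c<..<d} e f \<tau>" and s: "has_trace_z X {c<..<d} e f \<sigma>"
  shows "AE x in lborel. x \<in> X \<longrightarrow> \<tau> x = \<sigma> x"
proof (rule has_slice_trace_unique[OF t[unfolded has_trace_z_def] s[unfolded has_trace_z_def] _ _ cd])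
  show "X \<in> sets lborel" using X by simp
  show "set_borel_measurable lborel X (\<lambda>x. f (x, z))" if "z \<in> {c<..<d}" for z
    using set_borel_measurable_section[OF set_borel_measurable_swap[OF f] that] by simp
qed

lemma trace_z_eq:
  fixes c d :: real
  assumes cd: "c < d" "e \<in> {c, d}" and X: "open X" and f: "set_borel_measurable lborel (X \<times> {c<..<d}) f"
    and t: "has_trace_z X {c<..<d} e f \<tau>"
  shows "AE x in lborel. x \<in> X \<longrightarrow> trace_z X {c<..<d} e f x = \<tau> x"
  by (rule has_trace_z_unique[OF cd X f trace_z_works[OF t] t])

lemma has_trace_z_add_cmult:
  fixes c d :: real
  assumes X: "open X"
    and f: "set_borel_measurable lborel (X \<times> {c<..<d}) f" "has_trace_z X {c<..<d} e f \<tau>"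
    and g: "set_borel_measurable lborel (X \<times> {c<..<d}) g" "has_trace_z X {c<..<d} e g \<sigma>"
  shows "has_trace_z X {c<..<d} e (\<lambda>y. f y + k * g y) (\<lambda>x. \<tau> x + k * \<sigma> x)"
  unfolding has_trace_z_def
proof (rule has_slice_trace_add_cmult[OF f(2)[unfolded has_trace_z_def] g(2)[unfolded has_trace_z_def]])
  show "X \<in> sets lborel" using X by simp
  show "set_borel_measurable lborel X (\<lambda>x. f (x, z))" "set_borel_measurable lborel X (\<lambda>x. g (x, z))" if "z \<in> {c<..<d}" for z
    using set_borel_measurable_section[OF set_borel_measurable_swap[OF f(1)] that]
      set_borel_measurable_section[OF set_borel_measurable_swap[OF g(1)] that] by simp_all
qed

lemma trace_z_fst:
  fixes c d :: real
  assumes cd: "c < d" "e \<in> {c, d}" and X: "open X" and f: "f \<in> L2 X"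
  shows "has_trace_z X {c<..<d} e (\<lambda>y. f (fst y)) f"
    and "AE x in lborel. x \<in> X \<longrightarrow> trace_z X {c<..<d} e (\<lambda>y. f (fst y)) x = f x"
proof -
  have "{} \<in> null_sets (lborel :: real measure)" by simp
  then show t: "has_trace_z X {c<..<d} e (\<lambda>y. f (fst y)) f"
    unfolding has_trace_z_def has_slice_trace_def using f by (intro conjI bexI[of _ "{}"]) auto
  have "set_borel_measurable lborel (X \<times> {c<..<d}) (\<lambda>y. f (fst y))"
    using f by (intro set_borel_measurable_fst) (auto simp: L2_def)
  from trace_z_eq[OF cd X this t]
  show "AE x in lborel. x \<in> X \<longrightarrow> trace_z X {c<..<d} e (\<lambda>y. f (fst y)) x = f x" .
qed

subsection \<open>Functions vanishing on the lateral sides\<close>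

lemma space_V_H1: "f \<in> space_V a b Z \<Longrightarrow> f \<in> H1 ({a<..<b} \<times> Z)"
  unfolding space_V_def by auto

lemma space_V_representation:
  fixes c d :: real
  assumes ab: "a < b" and f: "f \<in> space_V a b {c<..<d}"
  shows "AE y in lborel. y \<in> {a<..<b} \<times> {c<..<d} \<longrightarrow> f y = primitive_from a (wDx ({a<..<b} \<times> {c<..<d}) f) y"
    and "AE z in lborel. z \<in> {c<..<d} \<longrightarrow> (LINT s:{a<..<b}|lborel. wDx ({a<..<b} \<times> {c<..<d}) f (s, z)) = 0"
proof -
  let ?I = "{a<..<b}" and ?Z = "{c<..<d}" let ?g = "wDx (?I \<times> ?Z) f"
  have H: "f \<in> H1 (?I \<times> ?Z)" by (rule space_V_H1[OF f])
  have R: "open (?I \<times> ?Z)" "bounded (?I \<times> ?Z)" by (auto intro: open_Times bounded_Times)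
  have w: "has_weak_partial (?I \<times> ?Z) (1, 0) f ?g" "?g \<in> L2 (?I \<times> ?Z)"
    using H1_weak_partial[OF R H, of "(1, 0)"] by (simp_all add: Basis_real_pair)
  obtain k where k: "k \<in> L2 ?Z" "AE y in lborel. y \<in> ?I \<times> ?Z \<longrightarrow> f y = k (snd y) + primitive_from a ?g y"
    using weak_partial_representation_L2[OF ab _ _ H1_L2[OF H] w(2,1)] by auto
  note tr = slice_traces_of_primitive[OF ab _ _ k(1) w(2) k(2), simplified]
  have m: "set_borel_measurable lborel ?Z (\<lambda>z. f (x, z))" if "x \<in> ?I" for x
    using H1_L2[OF H] by (intro set_borel_measurable_section[OF _ that]) (auto simp: L2_def)
  \<comment> \<open>Both \<open>k\<close> and 0 are traces of \<open>f\<close> on the left side;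
    likewise for the right side below.\<close>
  have "AE z in lborel. z \<in> ?Z \<longrightarrow> k z = 0"
    using f by (intro has_slice_trace_unique[OF tr(1) _ _ m ab]) (auto simp: space_V_def has_trace_x_def)
  moreover have "AE z in lborel. z \<in> ?Z \<longrightarrow> k z + (LINT s:?I|lborel. ?g (s, z)) = 0"
    using f by (intro has_slice_trace_unique[OF tr(2) _ _ m ab]) (auto simp: space_V_def has_trace_x_def)
  ultimately show "AE z in lborel. z \<in> ?Z \<longrightarrow> (LINT s:?I|lborel. ?g (s, z)) = 0"
    by eventually_elim auto
  have "AE y in lborel. y \<in> ?Z \<times> ?I \<longrightarrow> k (fst y) = 0"
    by (rule AE_Times_fstI) fact
  from AE_swap[OF this] k(2) show "AE y in lborel. y \<in> ?I \<times> ?Z \<longrightarrow> f y = primitive_from a ?g y"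
    by eventually_elim auto
qed

lemma space_V_add_cmult:
  fixes c d :: real
  assumes f: "f \<in> space_V a b {c<..<d}" and g: "g \<in> space_V a b {c<..<d}"
  shows "(\<lambda>y. f y + k * g y) \<in> space_V a b {c<..<d}"
proof -
  let ?I = "{a<..<b}" and ?Z = "{c<..<d}"
  have R: "open (?I \<times> ?Z)" "bounded (?I \<times> ?Z)" by (auto intro: open_Times bounded_Times)
  have H: "f \<in> H1 (?I \<times> ?Z)" "g \<in> H1 (?I \<times> ?Z)" using f g by (auto intro: space_V_H1)
  have m: "set_borel_measurable lborel ?Z (\<lambda>z. h (x, z))" if "x \<in> ?I" "h \<in> H1 (?I \<times> ?Z)" for x h
    using H1_L2[OF that(2)] by (intro set_borel_measurable_section[OF _ that(1)]) (auto simp: L2_def)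
  have "has_trace_x ?I ?Z e (\<lambda>y. f y + k * g y) (\<lambda>z. 0)" if "has_trace_x ?I ?Z e f (\<lambda>z. 0)" "has_trace_x ?I ?Z e g (\<lambda>z. 0)" for e
    using has_slice_trace_add_cmult[OF that[unfolded has_trace_x_def] _ m[OF _ H(1)] m[OF _ H(2)], of k]
    by (simp add: has_trace_x_def)
  then show ?thesis using f g H1_add_cmult(1)[OF R H] unfolding space_V_def by auto
qed

lemma space_V_fst:
  fixes c d :: real
  assumes f: "f \<in> space_W a b" shows "(\<lambda>y. f (fst y)) \<in> space_V a b {c<..<d}"
proof -
  have H: "f \<in> H1 {a<..<b}" using f unfolding space_W_def by auto
  have "has_trace_x {a<..<b} {c<..<d} e (\<lambda>y. f (fst y)) (\<lambda>z. 0)" if v: "vanishes_at {a<..<b} e f" for e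
  proof -
    obtain N where N: "N \<in> null_sets lborel" "(f \<longlongrightarrow> 0) (at e within {a<..<b} - N)"
      using v unfolding vanishes_at_def by blast
    have eq: "(\<integral>\<^sup>+z\<in>{c<..<d}. ennreal ((f x)\<^sup>2) \<partial>lborel) = ennreal ((f x)\<^sup>2 * measure lborel {c<..<d})" for x
      by (cases "c \<le> d") (auto simp: nn_integral_cmult_indicator ennreal_mult)
    have "((\<lambda>x. (f x)\<^sup>2 * measure lborel {c<..<d}) \<longlongrightarrow> 0\<^sup>2 * measure lborel {c<..<d}) (at e within {a<..<b} - N)"
      by (intro tendsto_intros N(2))
    then have "((\<lambda>x. ennreal ((f x)\<^sup>2 * measure lborel {c<..<d})) \<longlongrightarrow> ennreal 0) (at e within {a<..<b} - N)"
      by (intro tendsto_ennrealI) simp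
    then show ?thesis
      unfolding has_trace_x_def has_slice_trace_def using N(1) L2_const[of "{c<..<d}" 0]
      by (intro conjI bexI[OF _ N(1)]) (auto simp: eq)
  qed
  then show ?thesis using f H1_fst(1)[OF _ _ H, of c d] unfolding space_W_def space_V_def by auto
qed

text \<open>
  The average of \<open>C\<close> over a square at the corner is estimated through a path that first runs
  along the horizontal side and then turns to the lateral side, on which the function vanishes.
\<close>

lemma corner_estimate:
  fixes S Q :: "real set"
  assumes S: "open S" "bounded S" "measure lborel S = \<kappa>" and Q: "open Q" "bounded Q" "measure lborel Q = \<kappa>" and k: "\<kappa> > 0"
    and gx: "gx \<in> L2 (S \<times> Q)" and gz: "gz \<in> L2 (S \<times> Q)"
    and le: "AE y in lborel. y \<in> S \<times> Q \<longrightarrow>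
       C \<le> (LINT s:S|lborel. \<bar>gx (s, snd y)\<bar>) + (LINT s:Q|lborel. \<bar>gz (fst y, s)\<bar>) + D"
  shows "C \<le> L2_norm (S \<times> Q) (\<lambda>y. \<bar>gx y\<bar> + \<bar>gz y\<bar>) + D"
proof -
  let ?A = "\<lambda>z. LINT s:S|lborel. \<bar>gx (s, z)\<bar>" and ?B = "\<lambda>x. LINT s:Q|lborel. \<bar>gz (x, s)\<bar>"
  have R: "bounded (S \<times> Q)" "open (S \<times> Q)" using S Q by (auto intro: bounded_Times open_Times)
  have gi: "set_integrable lborel (S \<times> Q) (\<lambda>y. \<bar>gx y\<bar>)" "set_integrable lborel (S \<times> Q) (\<lambda>y. \<bar>gz y\<bar>)"
    using L2_integrable[OF R L2_abs[OF gx]] L2_integrable[OF R L2_abs[OF gz]] by auto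
  have A: "set_integrable lborel Q ?A" "(LINT z:Q|lborel. ?A z) = (LINT y:S \<times> Q|lborel. \<bar>gx y\<bar>)"
    using set_integrable_Times_snd[OF gi(1)] by auto
  have B: "set_integrable lborel S ?B" "(LINT x:S|lborel. ?B x) = (LINT y:S \<times> Q|lborel. \<bar>gz y\<bar>)"
    using set_integrable_Times_fst[OF gi(2)] by auto
  have AR: "set_integrable lborel (S \<times> Q) (\<lambda>y. ?A (snd y))" by (rule set_integrable_snd[OF A(1) S(2,1)])
  have BR: "set_integrable lborel (S \<times> Q) (\<lambda>y. ?B (fst y))" by (rule set_integrable_fst[OF B(1) Q(2,1)])
  have c: "set_integrable lborel (S \<times> Q) (\<lambda>y. E)" for E :: real by (rule L2_integrable[OF R L2_const[OF R]])
  have cS: "(LINT x:S|lborel. E) = \<kappa> * E" "(LINT x:Q|lborel. E) = \<kappa> * E" for E :: real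
    using S Q by (simp_all add: set_lebesgue_integral_def)
  have cI: "(LINT y:S \<times> Q|lborel. E) = \<kappa> * (\<kappa> * E)" for E :: real
    using set_integrable_Times_fst(3)[OF c[of E]] by (simp only: cS)
  have IA: "(LINT y:S \<times> Q|lborel. ?A (snd y)) = \<kappa> * (LINT y:S \<times> Q|lborel. \<bar>gx y\<bar>)"
    using set_integrable_Times_fst(3)[OF AR] by (simp add: cS A(2))
  have IB: "(LINT y:S \<times> Q|lborel. ?B (fst y)) = \<kappa> * (LINT y:S \<times> Q|lborel. \<bar>gz y\<bar>)"
    using set_integrable_Times_snd(3)[OF BR] by (simp add: cS B(2))
  have i2: "set_integrable lborel (S \<times> Q) (\<lambda>y. ?A (snd y) + ?B (fst y))" using AR BR by (rule set_integral_add)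
  have i3: "set_integrable lborel (S \<times> Q) (\<lambda>y. ?A (snd y) + ?B (fst y) + D)" using i2 c by (rule set_integral_add)
  have "(LINT y:S \<times> Q|lborel. C) \<le> (LINT y:S \<times> Q|lborel. ?A (snd y) + ?B (fst y) + D)"
    by (rule set_integral_mono_AE[OF c i3]) (use le in \<open>auto elim!: eventually_mono\<close>)
  also have "\<dots> = (LINT y:S \<times> Q|lborel. ?A (snd y)) + (LINT y:S \<times> Q|lborel. ?B (fst y)) + (LINT y:S \<times> Q|lborel. D)"
    unfolding set_integral_add(2)[OF i2 c] set_integral_add(2)[OF AR BR] ..
  also have "\<dots> = \<kappa> * ((LINT y:S \<times> Q|lborel. \<bar>gx y\<bar> + \<bar>gz y\<bar>) + \<kappa> * D)"
    unfolding IA IB cI set_integral_add(2)[OF gi] by (simp add: algebra_simps)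
  finally have "\<kappa> * (\<kappa> * C) \<le> \<kappa> * ((LINT y:S \<times> Q|lborel. \<bar>gx y\<bar> + \<bar>gz y\<bar>) + \<kappa> * D)" unfolding cI .
  then have "\<kappa> * C \<le> (LINT y:S \<times> Q|lborel. \<bar>gx y\<bar> + \<bar>gz y\<bar>) + \<kappa> * D" using k by simp
  \<comment> \<open>The square has measure \<kappa>^2, so Cauchy-Schwarz yields exactly the factor
    \<kappa> that is divided out, and the remaining norm over the square is small when the square
    shrinks.\<close>
  also have "(LINT y:S \<times> Q|lborel. \<bar>gx y\<bar> + \<bar>gz y\<bar>) \<le> \<kappa> * L2_norm (S \<times> Q) (\<lambda>y. \<bar>gx y\<bar> + \<bar>gz y\<bar>)"
  proof -
    have "measure lborel (S \<times> Q) = \<kappa> * \<kappa>"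
      using cI[of 1] R by (simp add: set_lebesgue_integral_def)
    then show ?thesis
      using L2_integral_le[OF R L2_add[OF L2_abs[OF gx] L2_abs[OF gz]]] k by simp
  qed
  finally have "\<kappa> * C \<le> \<kappa> * (L2_norm (S \<times> Q) (\<lambda>y. \<bar>gx y\<bar> + \<bar>gz y\<bar>) + D)" by (simp add: algebra_simps)
  then show ?thesis using k by simp
qed

text \<open>Dominated convergence; it suffices that every point is eventually left, the sets need
  not be nested.\<close>

lemma set_integral_shrinking_tendsto_0:
  fixes f :: "'a::euclidean_space \<Rightarrow> real"
  assumes f: "set_integrable lborel S f" and T: "\<And>n. T n \<subseteq> S" "\<And>n. T n \<in> sets borel"
    and ev: "\<And>y. eventually (\<lambda>n. y \<notin> T n) sequentially"
  shows "(\<lambda>n. LINT y:T n|lborel. f y) \<longlonglongrightarrow> 0"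
proof -
  have m: "(\<lambda>y. indicator S y *\<^sub>R f y) \<in> borel_measurable lborel"
    using set_integrable_imp_measurable[OF f] unfolding set_borel_measurable_def .
  have "(\<lambda>n. LINT y|lborel. indicator (T n) y *\<^sub>R (indicator S y *\<^sub>R f y)) \<longlonglongrightarrow> (LINT y|(lborel :: 'a measure). (0 :: real))"
  proof (rule integral_dominated_convergence[where w = "\<lambda>y. \<bar>indicator S y *\<^sub>R f y\<bar>"
        and s = "\<lambda>n y. indicator (T n) y *\<^sub>R (indicator S y *\<^sub>R f y)" and f = "\<lambda>y. 0"])
    show "(\<lambda>y. indicator (T n) y *\<^sub>R (indicator S y *\<^sub>R f y)) \<in> borel_measurable lborel" for n
      by (rule borel_measurable_scaleR[OF borel_measurable_indicator m]) (use T in simp)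
    show "integrable lborel (\<lambda>y. \<bar>indicator S y *\<^sub>R f y\<bar>)" using f unfolding set_integrable_def by auto
    show "AE y in lborel. (\<lambda>n. indicator (T n) y *\<^sub>R (indicator S y *\<^sub>R f y)) \<longlonglongrightarrow> 0"
    proof (rule AE_I2)
      fix y
      show "(\<lambda>n. indicator (T n) y *\<^sub>R (indicator S y *\<^sub>R f y)) \<longlonglongrightarrow> 0"
        by (rule tendsto_eventually) (use ev[of y] in \<open>auto elim!: eventually_mono\<close>)
    qed
    show "AE y in lborel. norm (indicator (T n) y *\<^sub>R (indicator S y *\<^sub>R f y)) \<le> \<bar>indicator S y *\<^sub>R f y\<bar>" for n
      by (auto simp: indicator_def)
  qed auto
  moreover have "(\<lambda>y. indicator (T n) y *\<^sub>R (indicator S y *\<^sub>R f y)) = (\<lambda>y. indicator (T n) y *\<^sub>R f y)" for n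
    using T(1)[of n] by (auto simp: indicator_def fun_eq_iff)
  ultimately show ?thesis by (simp add: set_lebesgue_integral_def)
qed

text \<open>This makes the interface traces admissible in the equations tested with
  \<open>space_W\<close> and gives their derivatives mean zero. An end value of the trace is
  compared with the vanishing lateral values through squares shrinking to the corner.\<close>

lemma trace_in_space_W:
  fixes a b c d :: real
  assumes ab: "a < b" and cd: "c < d" and f: "f \<in> space_V a b {c<..<d}"
    and t: "trace_z {a<..<b} {c<..<d} c f \<in> H1 {a<..<b}"
  shows "trace_z {a<..<b} {c<..<d} c f \<in> space_W a b"
proof -
  let ?I = "{a<..<b}" and ?Z = "{c<..<d}"
  let ?R = "?I \<times> ?Z" and ?t = "trace_z ?I ?Z c f"
  let ?gx = "wDx ?R f" and ?gz = "wDz ?R f" and ?w = "wD ?I ?t"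
  have R: "open ?R" "bounded ?R" by (auto intro: open_Times bounded_Times)
  have H: "f \<in> H1 ?R" by (rule space_V_H1[OF f])
  have L: "?gx \<in> L2 ?R" "?gz \<in> L2 ?R"
    using H1_weak_partial(2)[OF R H] by (auto simp: Basis_real_pair)
  have wL: "?w \<in> L2 ?I" using H1_weak_partial(2)[OF _ _ t, of 1] by auto
  have mf: "set_borel_measurable lborel ?R f" using H1_L2[OF H] by (auto simp: L2_def)
  note rx = space_V_representation[OF ab f]
  have rz: "AE y in lborel. y \<in> ?R \<longrightarrow> f y = ?t (fst y) + (LINT s:{c<..<snd y}|lborel. ?gz (fst y, s))"
  proof -
    obtain \<tau> where \<tau>: "has_trace_z ?I ?Z c f \<tau>"
      "AE y in lborel. y \<in> ?R \<longrightarrow> f y = \<tau> (fst y) + (LINT s:{c<..<snd y}|lborel. ?gz (fst y, s))"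
      using H1_z_representation[OF cd _ _ H] by auto
    have "AE x in lborel. x \<in> ?I \<longrightarrow> ?t x = \<tau> x" by (rule trace_z_eq[OF cd _ _ mf \<tau>(1)]) auto
    from AE_Times_fstI[OF this, of ?Z] \<tau>(2) show ?thesis by eventually_elim auto
  qed
  obtain C where C: "AE x in lborel. x \<in> ?I \<longrightarrow> ?t x = C + (LINT s:{a<..<x}|lborel. ?w s)"
    using H1_representation[OF ab t] by blast
  \<comment> \<open>Side lengths \<rho> / (n + 1) with this \<rho> keep all squares inside the
    rectangle.\<close>
  define \<rho> where "\<rho> = min (b - a) (d - c)"
  have rho: "0 < \<rho>" "\<rho> \<le> b - a" "\<rho> \<le> d - c" using ab cd by (auto simp: \<rho>_def)
  define \<kappa> where "\<kappa> n = \<rho> / real (Suc n)" for n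
  have kap: "0 < \<kappa> n" "\<kappa> n \<le> b - a" "\<kappa> n \<le> d - c" for n
  proof -
    have "\<kappa> n \<le> \<rho>" using rho(1) unfolding \<kappa>_def by (simp add: divide_le_eq)
    then show "0 < \<kappa> n" "\<kappa> n \<le> b - a" "\<kappa> n \<le> d - c" using rho by (auto simp: \<kappa>_def)
  qed
  have klim: "\<kappa> \<longlonglongrightarrow> 0"
    unfolding \<kappa>_def using tendsto_mult[OF tendsto_const[of \<rho>] LIMSEQ_inverse_real_of_nat] by (simp add: divide_inverse)
  \<comment> \<open>\<open>E\<close> is an end value of the trace and \<open>S n\<close> a strip at
    that end. There \<open>f\<close> is small by the lateral condition (\<open>px\<close>) and the
    trace is close to \<open>E\<close> (\<open>pt\<close>), while \<open>f\<close> and the trace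
    differ by an integral of the vertical derivative. So \<open>E\<close> is bounded by integrals
    over shrinking sets; both ends are instances.\<close>
  have key: "E = 0" if S: "\<And>n. S n \<subseteq> ?I" "\<And>n. open (S n)" "\<And>n. measure lborel (S n) = \<kappa> n"
      "\<And>x. eventually (\<lambda>n. x \<notin> S n) sequentially"
    and px: "\<And>n. AE y in lborel. y \<in> S n \<times> ?Z \<longrightarrow> \<bar>f y\<bar> \<le> (LINT s:S n|lborel. \<bar>?gx (s, snd y)\<bar>)"
    and pt: "\<And>n. AE x in lborel. x \<in> S n \<longrightarrow> \<bar>E - ?t x\<bar> \<le> (LINT s:S n|lborel. \<bar>?w s\<bar>)"
    for E S
  proof -
    let ?Q = "\<lambda>n. {c<..<c + \<kappa> n}"
    let ?N = "\<lambda>n. LINT y:S n \<times> ?Q n|lborel. (\<bar>?gx y\<bar> + \<bar>?gz y\<bar>)\<^sup>2"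
    have Q: "?Q n \<subseteq> ?Z" for n using kap(3)[of n] by auto
    have bS: "bounded (S n)" for n using S(1)[of n] bounded_subset[OF bounded_Ioo] by blast
    have sub: "S n \<times> ?Q n \<subseteq> ?R" for n using S(1)[of n] Q[of n] by blast
    have op: "open (S n \<times> ?Q n)" for n using S(2) by (auto intro: open_Times)
    have le: "\<bar>E\<bar> \<le> sqrt (?N n) + (LINT s:S n|lborel. \<bar>?w s\<bar>)" for n
    proof -
      have "\<bar>E\<bar> \<le> L2_norm (S n \<times> ?Q n) (\<lambda>y. \<bar>?gx y\<bar> + \<bar>?gz y\<bar>) + (LINT s:S n|lborel. \<bar>?w s\<bar>)"
      proof (rule corner_estimate[of "S n" "\<kappa> n" "?Q n"])
        show "?gx \<in> L2 (S n \<times> ?Q n)" "?gz \<in> L2 (S n \<times> ?Q n)"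
          using L sub[of n] op[of n] by (auto intro: L2_subset)
        have "AE x in lborel. x \<in> ?I \<longrightarrow> (\<lambda>z. ?gz (x, z)) \<in> L2 ?Z" by (rule L2_sections(1)[OF L(2)])
        from AE_Times_fstI[OF this, of ?Z] have sec: "AE y in lborel. y \<in> ?R \<longrightarrow> (\<lambda>z. ?gz (fst y, z)) \<in> L2 ?Z" .
        show "AE y in lborel. y \<in> S n \<times> ?Q n \<longrightarrow> \<bar>E\<bar> \<le>
            (LINT s:S n|lborel. \<bar>?gx (s, snd y)\<bar>) + (LINT s:?Q n|lborel. \<bar>?gz (fst y, s)\<bar>) + (LINT s:S n|lborel. \<bar>?w s\<bar>)"
          using px[of n] AE_Times_fstI[OF pt[of n], of ?Z] rz sec
        proof (eventually_elim, intro impI)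
          fix y assume *: "y \<in> S n \<times> ?Z \<longrightarrow> \<bar>f y\<bar> \<le> (LINT s:S n|lborel. \<bar>?gx (s, snd y)\<bar>)"
            "y \<in> S n \<times> ?Z \<longrightarrow> \<bar>E - ?t (fst y)\<bar> \<le> (LINT s:S n|lborel. \<bar>?w s\<bar>)"
            "y \<in> ?R \<longrightarrow> f y = ?t (fst y) + (LINT s:{c<..<snd y}|lborel. ?gz (fst y, s))"
            "y \<in> ?R \<longrightarrow> (\<lambda>z. ?gz (fst y, z)) \<in> L2 ?Z" and y: "y \<in> S n \<times> ?Q n"
          have y2: "y \<in> S n \<times> ?Z" "y \<in> ?R" using y Q[of n] S(1)[of n] by (auto simp: mem_Times_iff)
          have "set_integrable lborel ?Z (\<lambda>z. ?gz (fst y, z))" using *(4) y2 by (auto intro: L2_integrable)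
          then have "set_integrable lborel (?Q n) (\<lambda>z. ?gz (fst y, z))"
            by (rule set_integrable_subset) (use Q[of n] in auto)
          moreover have "{c<..<snd y} \<subseteq> ?Q n" using y by (auto simp: mem_Times_iff)
          ultimately have "\<bar>LINT s:{c<..<snd y}|lborel. ?gz (fst y, s)\<bar> \<le> (LINT s:?Q n|lborel. \<bar>?gz (fst y, s)\<bar>)"
            by (intro set_integral_abs_le_subset) auto
          then show "\<bar>E\<bar> \<le> (LINT s:S n|lborel. \<bar>?gx (s, snd y)\<bar>) + (LINT s:?Q n|lborel. \<bar>?gz (fst y, s)\<bar>) + (LINT s:S n|lborel. \<bar>?w s\<bar>)"
            using * y2 by linarith
        qed
      qed (use S bS kap[of n] in auto)
      then show ?thesis by (simp add: L2_norm_def)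
    qed
    have "?N \<longlonglongrightarrow> 0"
    proof (rule set_integral_shrinking_tendsto_0[of ?R])
      show "set_integrable lborel ?R (\<lambda>y. (\<bar>?gx y\<bar> + \<bar>?gz y\<bar>)\<^sup>2)"
        using L2_add[OF L2_abs[OF L(1)] L2_abs[OF L(2)]] by (simp add: L2_def)
      show "\<forall>\<^sub>F n in sequentially. y \<notin> S n \<times> ?Q n" for y
        using S(4)[of "fst y"] by eventually_elim (auto simp: mem_Times_iff)
    qed (use sub op in auto)
    moreover have "(\<lambda>n. LINT s:S n|lborel. \<bar>?w s\<bar>) \<longlonglongrightarrow> 0"
      by (rule set_integral_shrinking_tendsto_0[of ?I]) (use S L2_integrable[OF _ _ L2_abs[OF wL]] in auto)
    ultimately have "(\<lambda>n. sqrt (?N n) + (LINT s:S n|lborel. \<bar>?w s\<bar>)) \<longlonglongrightarrow> sqrt 0 + 0"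
      by (intro tendsto_intros)
    then have "\<bar>E\<bar> \<le> sqrt 0 + 0" by (rule LIMSEQ_le_const) (use le in auto)
    then show "E = 0" by simp
  qed
  have wi: "set_integrable lborel ?I ?w" by (rule L2_integrable[OF _ _ wL]) auto
  have gsec: "AE y in lborel. y \<in> ?R \<longrightarrow> set_integrable lborel ?I (\<lambda>s. ?gx (s, snd y))"
  proof -
    have "AE z in lborel. z \<in> ?Z \<longrightarrow> set_integrable lborel ?I (\<lambda>s. ?gx (s, z))"
      by (rule set_integrable_Times_snd(1)[OF L2_integrable[OF R(2,1) L(1)]])
    from AE_swap[OF AE_Times_fstI[OF this, of ?I]] show ?thesis by (auto elim!: eventually_mono)
  qed
  have gzero: "AE y in lborel. y \<in> ?R \<longrightarrow> (LINT s:?I|lborel. ?gx (s, snd y)) = 0"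
    using AE_swap[OF AE_Times_fstI[OF rx(2), of ?I]] by (auto elim!: eventually_mono)
  have C0: "C = 0"
  proof (rule key[of "\<lambda>n. {a<..<a + \<kappa> n}"])
    show "\<forall>\<^sub>F n in sequentially. x \<notin> {a<..<a + \<kappa> n}" for x
    proof (cases "a < x")
      case True
      then have "\<forall>\<^sub>F n in sequentially. \<kappa> n < x - a" using order_tendstoD(2)[OF klim] by auto
      then show ?thesis by eventually_elim auto
    qed auto
    fix n
    show sub: "{a<..<a + \<kappa> n} \<subseteq> ?I" using kap(2)[of n] by auto
    show "AE y in lborel. y \<in> {a<..<a + \<kappa> n} \<times> ?Z \<longrightarrow> \<bar>f y\<bar> \<le> (LINT s:{a<..<a + \<kappa> n}|lborel. \<bar>?gx (s, snd y)\<bar>)"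
      using rx(1) gsec
    proof (eventually_elim, intro impI)
      fix y assume *: "y \<in> ?R \<longrightarrow> f y = primitive_from a ?gx y" "y \<in> ?R \<longrightarrow> set_integrable lborel ?I (\<lambda>s. ?gx (s, snd y))"
        and y: "y \<in> {a<..<a + \<kappa> n} \<times> ?Z"
      then have "y \<in> ?R" using sub by (auto simp: mem_Times_iff)
      then have "set_integrable lborel {a<..<a + \<kappa> n} (\<lambda>s. ?gx (s, snd y))"
        using *(2) sub by (auto intro: set_integrable_subset)
      moreover have "{a<..<fst y} \<subseteq> {a<..<a + \<kappa> n}" using y by (auto simp: mem_Times_iff)
      ultimately have "\<bar>LINT s:{a<..<fst y}|lborel. ?gx (s, snd y)\<bar> \<le> (LINT s:{a<..<a + \<kappa> n}|lborel. \<bar>?gx (s, snd y)\<bar>)"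
        by (intro set_integral_abs_le_subset) auto
      then show "\<bar>f y\<bar> \<le> (LINT s:{a<..<a + \<kappa> n}|lborel. \<bar>?gx (s, snd y)\<bar>)"
        using *(1) \<open>y \<in> ?R\<close> y by (auto simp: primitive_from_def mem_Times_iff)
    qed
    show "AE x in lborel. x \<in> {a<..<a + \<kappa> n} \<longrightarrow> \<bar>C - ?t x\<bar> \<le> (LINT s:{a<..<a + \<kappa> n}|lborel. \<bar>?w s\<bar>)"
      using C
    proof (eventually_elim, intro impI)
      fix x assume *: "x \<in> ?I \<longrightarrow> ?t x = C + (LINT s:{a<..<x}|lborel. ?w s)" and x: "x \<in> {a<..<a + \<kappa> n}"
      have "set_integrable lborel {a<..<a + \<kappa> n} ?w" by (rule set_integrable_subset[OF wi]) (use sub in auto)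
      moreover have "{a<..<x} \<subseteq> {a<..<a + \<kappa> n}" using x by auto
      ultimately have "\<bar>LINT s:{a<..<x}|lborel. ?w s\<bar> \<le> (LINT s:{a<..<a + \<kappa> n}|lborel. \<bar>?w s\<bar>)"
        by (intro set_integral_abs_le_subset) auto
      then show "\<bar>C - ?t x\<bar> \<le> (LINT s:{a<..<a + \<kappa> n}|lborel. \<bar>?w s\<bar>)"
        using * x sub by auto
    qed
  qed (simp_all add: less_imp_le[OF kap(1)])
  have C1: "C + (LINT s:?I|lborel. ?w s) = 0"
  proof (rule key[of "\<lambda>n. {b - \<kappa> n<..<b}"])
    show "\<forall>\<^sub>F n in sequentially. x \<notin> {b - \<kappa> n<..<b}" for x
    proof (cases "x < b")
      case True
      then have "\<forall>\<^sub>F n in sequentially. \<kappa> n < b - x" using order_tendstoD(2)[OF klim] by auto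
      then show ?thesis by eventually_elim auto
    qed auto
    fix n
    show sub: "{b - \<kappa> n<..<b} \<subseteq> ?I" using kap(2)[of n] by auto
    show "AE y in lborel. y \<in> {b - \<kappa> n<..<b} \<times> ?Z \<longrightarrow> \<bar>f y\<bar> \<le> (LINT s:{b - \<kappa> n<..<b}|lborel. \<bar>?gx (s, snd y)\<bar>)"
      using rx(1) gsec gzero
    proof (eventually_elim, intro impI)
      fix y assume *: "y \<in> ?R \<longrightarrow> f y = primitive_from a ?gx y" "y \<in> ?R \<longrightarrow> set_integrable lborel ?I (\<lambda>s. ?gx (s, snd y))"
        "y \<in> ?R \<longrightarrow> (LINT s:?I|lborel. ?gx (s, snd y)) = 0"
        and y: "y \<in> {b - \<kappa> n<..<b} \<times> ?Z"
      then have yR: "y \<in> ?R" using sub by (auto simp: mem_Times_iff)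
      then have i: "set_integrable lborel ?I (\<lambda>s. ?gx (s, snd y))" using * by auto
      \<comment> \<open>At the right end \<open>f\<close> is expressed through the part of the line
        beyond the point, since the integral over the whole line vanishes.\<close>
      have "f y = - (LINT s:{fst y<..<b}|lborel. ?gx (s, snd y))"
        using set_integral_split[OF i, of "fst y"] * yR by (auto simp: primitive_from_def mem_Times_iff)
      moreover have "set_integrable lborel {b - \<kappa> n<..<b} (\<lambda>s. ?gx (s, snd y))"
        using i sub by (auto intro: set_integrable_subset)
      moreover have "{fst y<..<b} \<subseteq> {b - \<kappa> n<..<b}" using y by (auto simp: mem_Times_iff)
      ultimately have "\<bar>f y\<bar> = \<bar>LINT s:{fst y<..<b}|lborel. ?gx (s, snd y)\<bar>"
        "\<bar>LINT s:{fst y<..<b}|lborel. ?gx (s, snd y)\<bar> \<le> (LINT s:{b - \<kappa> n<..<b}|lborel. \<bar>?gx (s, snd y)\<bar>)"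
        by (simp, intro set_integral_abs_le_subset) auto
      then show "\<bar>f y\<bar> \<le> (LINT s:{b - \<kappa> n<..<b}|lborel. \<bar>?gx (s, snd y)\<bar>)" by simp
    qed
    show "AE x in lborel. x \<in> {b - \<kappa> n<..<b} \<longrightarrow> \<bar>C + (LINT s:?I|lborel. ?w s) - ?t x\<bar> \<le> (LINT s:{b - \<kappa> n<..<b}|lborel. \<bar>?w s\<bar>)"
      using C
    proof (eventually_elim, intro impI)
      fix x assume *: "x \<in> ?I \<longrightarrow> ?t x = C + (LINT s:{a<..<x}|lborel. ?w s)" and x: "x \<in> {b - \<kappa> n<..<b}"
      then have xI: "x \<in> ?I" using sub by auto
      have "C + (LINT s:?I|lborel. ?w s) - ?t x = (LINT s:{x<..<b}|lborel. ?w s)"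
        using set_integral_split[OF wi, of x] xI * by auto
      moreover have "set_integrable lborel {b - \<kappa> n<..<b} ?w" by (rule set_integrable_subset[OF wi]) (use sub in auto)
      moreover have "{x<..<b} \<subseteq> {b - \<kappa> n<..<b}" using x by auto
      ultimately have "\<bar>C + (LINT s:?I|lborel. ?w s) - ?t x\<bar> = \<bar>LINT s:{x<..<b}|lborel. ?w s\<bar>"
        "\<bar>LINT s:{x<..<b}|lborel. ?w s\<bar> \<le> (LINT s:{b - \<kappa> n<..<b}|lborel. \<bar>?w s\<bar>)"
        by (simp, intro set_integral_abs_le_subset) auto
      then show "\<bar>C + (LINT s:?I|lborel. ?w s) - ?t x\<bar> \<le> (LINT s:{b - \<kappa> n<..<b}|lborel. \<bar>?w s\<bar>)" by simp
    qed
  qed (simp_all add: less_imp_le[OF kap(1)])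
  show ?thesis
    by (rule space_W_I[OF t]) (use C C0 C1 in auto)
qed

section \<open>Lipschitz coefficients\<close>

text \<open>The Steklov averages of \<open>Q\<close> are continuously differentiable with derivative bounded by \<open>M\<close>.\<close>

lemma Lipschitz_by_parts_bound:
  fixes Q g :: "real \<Rightarrow> real"
  assumes Q: "\<And>x y. \<bar>Q x - Q y\<bar> \<le> M * \<bar>x - y\<bar>" and g: "set_integrable lborel {a<..<b} g"
    and zero: "(LINT s:{a<..<b}|lborel. g s) = 0"
    and P: "AE x in lborel. x \<in> {a<..<b} \<longrightarrow> P x = (LINT s:{a<..<x}|lborel. g s)" "set_integrable lborel {a<..<b} P"
  shows "\<bar>LINT x:{a<..<b}|lborel. Q x * g x\<bar> \<le> M * (LINT x:{a<..<b}|lborel. \<bar>P x\<bar>)"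
proof -
  let ?I = "{a<..<b}" and ?p = "\<lambda>x. LINT s:{a<..<x}|lborel. g s"
  have M: "0 \<le> M" using Q[of 1 0] by simp
  have cQ: "continuous_on UNIV Q"
  proof -
    have "M-lipschitz_on UNIV Q" using Q M by (auto simp: lipschitz_on_def dist_real_def)
    then show ?thesis by (rule lipschitz_on_continuous_on)
  qed
  then have "isCont Q x" for x by (simp add: continuous_on_eq_continuous_within)
  then obtain F where F: "\<And>x. (F has_vector_derivative Q x) (at x)"
    using einterval_antiderivative[of "-\<infinity>" "\<infinity>" Q] by auto
  have F': "(F has_real_derivative Q x) (at x)" for x
    using F[of x] by (simp add: has_real_derivative_iff_has_vector_derivative)
  have Qb: "Q \<in> borel_measurable borel" by (rule borel_measurable_continuous_onI[OF cQ])
  have gQ: "set_integrable lborel ?I (\<lambda>x. g x * Q x)"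
  proof (rule set_integrable_mult_bounded[OF g, where B = "\<bar>Q a\<bar> + M * \<bar>b - a\<bar>"])
    show "set_borel_measurable lborel ?I Q" using Qb by (simp add: set_borel_measurable_def)
    fix y assume "y \<in> ?I"
    then have "M * \<bar>y - a\<bar> \<le> M * \<bar>b - a\<bar>" using M by (intro mult_left_mono) auto
    then show "\<bar>Q y\<bar> \<le> \<bar>Q a\<bar> + M * \<bar>b - a\<bar>" using Q[of y a] by linarith
  qed
  \<comment> \<open>Replacing \<open>Q\<close> by its average \<open>A\<close> over (x - h, x)
    changes it by at most M h, and the derivative of \<open>A\<close> is a continuous difference
    quotient bounded by M. The error vanishes as h tends to 0.\<close>
  have approx: "\<bar>LINT x:?I|lborel. g x * Q x\<bar> \<le> M * (LINT x:?I|lborel. \<bar>P x\<bar>) + h * (M * (LINT x:?I|lborel. \<bar>g x\<bar>))" if h: "h > 0" for h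
  proof -
    define A where "A x = (F x - F (x - h)) / h" for x
    define d where "d x = (Q x - Q (x - h)) / h" for x
    have A: "(A has_real_derivative d x) (at x)" for x
      unfolding A_def[abs_def] d_def using h
      by (auto intro!: derivative_eq_intros F' DERIV_chain'[of "\<lambda>x. x - h" 1 _ _ F, simplified])
    have cd: "continuous_on UNIV d"
      unfolding d_def[abs_def] by (intro continuous_intros continuous_on_compose2[OF cQ] cQ) (use h in auto)
    have dM: "\<bar>d x\<bar> \<le> M" for x
      using Q[of x "x - h"] h by (simp add: d_def divide_le_eq)
    have AQ: "\<bar>A x - Q x\<bar> \<le> M * h" for x
    proof -
      obtain y where y: "x - h < y" "y < x" "F x - F (x - h) = (x - (x - h)) * Q y"
        using MVT2[of "x - h" x F Q] F' h by auto
      then have "A x = Q y" using h by (simp add: A_def)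
      moreover have "M * \<bar>y - x\<bar> \<le> M * h" using y M by (intro mult_left_mono) auto
      ultimately show ?thesis using Q[of y x] by linarith
    qed
    have Ab: "A \<in> borel_measurable borel"
      using A by (intro borel_measurable_continuous_onI) (meson DERIV_isCont continuous_at_imp_continuous_on)
    have gD: "set_integrable lborel ?I (\<lambda>x. g x * (A x - Q x))"
      by (rule set_integrable_mult_bounded[OF g _ AQ]) (use Ab Qb in \<open>simp add: set_borel_measurable_def\<close>)
    then have gA: "set_integrable lborel ?I (\<lambda>x. g x * A x)"
      using set_integral_add(1)[OF gD gQ] by (simp add: algebra_simps)
    note parts = primitive_by_parts_C1[OF g A cd]
    \<comment> \<open>The boundary term at \<open>b\<close> disappears because the integral of
      \<open>g\<close> is zero.\<close>
    have "(LINT x:?I|lborel. g x * A x) = - (LINT x:?I|lborel. P x * d x)"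
    proof -
      have "(LINT x:?I|lborel. ?p x * d x) = (LINT x:?I|lborel. P x * d x)"
      proof (rule set_integral_cong_AE_real)
        show "set_borel_measurable lborel ?I (\<lambda>x. ?p x * d x)" by (rule set_integrable_imp_measurable[OF parts(1)])
        show "set_borel_measurable lborel ?I (\<lambda>x. P x * d x)"
          using borel_measurable_continuous_onI[OF cd] set_integrable_imp_measurable[OF P(2)]
          by (intro set_borel_measurable_mult) (auto simp: set_borel_measurable_def)
      qed (use P(1) in \<open>auto elim!: eventually_mono\<close>)
      then show ?thesis using parts(2) zero by simp
    qed
    moreover have "\<bar>LINT x:?I|lborel. P x * d x\<bar> \<le> M * (LINT x:?I|lborel. \<bar>P x\<bar>)"
    proof -
      have i: "set_integrable lborel ?I (\<lambda>x. P x * d x)"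
        by (rule set_integrable_mult_bounded[OF P(2) _ dM])
          (use borel_measurable_continuous_onI[OF cd] in \<open>simp add: set_borel_measurable_def\<close>)
      have "\<bar>LINT x:?I|lborel. P x * d x\<bar> \<le> (LINT x:?I|lborel. \<bar>P x * d x\<bar>)"
        by (rule set_integral_abs_le_subset[OF i]) auto
      also have "\<dots> \<le> (LINT x:?I|lborel. M * \<bar>P x\<bar>)"
      proof (rule set_integral_mono)
        show "\<bar>P x * d x\<bar> \<le> M * \<bar>P x\<bar>" for x
          using mult_right_mono[OF dM[of x], of "\<bar>P x\<bar>"] by (simp add: abs_mult mult.commute)
      qed (use set_integrable_abs[OF i] set_integrable_abs[OF P(2)] in auto)
      finally show ?thesis by simp
    qed
    moreover have "\<bar>LINT x:?I|lborel. g x * (A x - Q x)\<bar> \<le> h * (M * (LINT x:?I|lborel. \<bar>g x\<bar>))"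
    proof -
      have "\<bar>LINT x:?I|lborel. g x * (A x - Q x)\<bar> \<le> (LINT x:?I|lborel. \<bar>g x * (A x - Q x)\<bar>)"
        by (rule set_integral_abs_le_subset[OF gD]) auto
      also have "\<dots> \<le> (LINT x:?I|lborel. (h * M) * \<bar>g x\<bar>)"
      proof (rule set_integral_mono)
        show "\<bar>g x * (A x - Q x)\<bar> \<le> (h * M) * \<bar>g x\<bar>" for x
          using mult_right_mono[OF AQ[of x], of "\<bar>g x\<bar>"] by (simp add: abs_mult mult.commute mult.left_commute)
      qed (use set_integrable_abs[OF gD] set_integrable_abs[OF g] in auto)
      also have "\<dots> = h * (M * (LINT x:?I|lborel. \<bar>g x\<bar>))" by (simp add: mult.assoc)
      finally show ?thesis .
    qed
    moreover have "(LINT x:?I|lborel. g x * (A x - Q x)) = (LINT x:?I|lborel. g x * A x) - (LINT x:?I|lborel. g x * Q x)"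
      using set_integral_diff(2)[OF gA gQ] by (simp add: right_diff_distrib)
    ultimately show ?thesis by linarith
  qed
  have "((\<lambda>h. M * (LINT x:?I|lborel. \<bar>P x\<bar>) + h * (M * (LINT x:?I|lborel. \<bar>g x\<bar>))) \<longlongrightarrow>
      M * (LINT x:?I|lborel. \<bar>P x\<bar>) + 0 * (M * (LINT x:?I|lborel. \<bar>g x\<bar>))) (at_right 0)"
    by (intro tendsto_intros)
  then have "\<bar>LINT x:?I|lborel. g x * Q x\<bar> \<le> M * (LINT x:?I|lborel. \<bar>P x\<bar>) + 0 * (M * (LINT x:?I|lborel. \<bar>g x\<bar>))"
    by (rule tendsto_lowerbound) (auto simp: eventually_at_right_field intro!: exI[of _ 1] approx)
  then show ?thesis by (simp add: mult.commute[of "Q _"])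
qed

text \<open>Clamping the upper limit extends the primitive of a bounded function to a Lipschitz
  function on the whole line, the form in which coefficients enter
  \<open>Lipschitz_by_parts_bound\<close>.\<close>

definition clamped_primitive :: "real \<Rightarrow> real \<Rightarrow> (real \<Rightarrow> real) \<Rightarrow> real \<Rightarrow> real" where
  "clamped_primitive a b g x = (LINT s:{a<..<max a (min b x)}|lborel. g s)"

lemma clamped_primitive_eq: "x \<in> {a<..<b} \<Longrightarrow> clamped_primitive a b g x = (LINT s:{a<..<x}|lborel. g s)"
  by (auto simp: clamped_primitive_def)

lemma clamped_primitive_Lipschitz:
  assumes ab: "a < b" and g: "set_integrable lborel {a<..<b} g"
    and M: "AE x in lborel. x \<in> {a<..<b} \<longrightarrow> \<bar>g x\<bar> \<le> M" "0 \<le> M"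
  shows "\<bar>clamped_primitive a b g x - clamped_primitive a b g y\<bar> \<le> M * \<bar>x - y\<bar>"
proof -
  have bnd: "\<bar>LINT s:{p<..<q}|lborel. g s\<bar> \<le> M * (q - p)" if "a \<le> p" "p \<le> q" "q \<le> b" for p q
  proof -
    have i: "set_integrable lborel {p<..<q} g" by (rule set_integrable_subset[OF g]) (use that in auto)
    have "\<bar>LINT s:{p<..<q}|lborel. g s\<bar> \<le> (LINT s:{p<..<q}|lborel. \<bar>g s\<bar>)"
      by (rule set_integral_abs_le_subset[OF i]) auto
    also have "\<dots> \<le> (LINT s:{p<..<q}|lborel. M)"
      by (rule set_integral_mono_AE[OF set_integrable_abs[OF i] L2_integrable[OF _ _ L2_const]])
        (use M that in \<open>auto elim!: eventually_mono\<close>)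
    also have "\<dots> = M * (q - p)" using that by (simp add: set_lebesgue_integral_def)
    finally show ?thesis .
  qed
  have le: "\<bar>clamped_primitive a b g x - clamped_primitive a b g y\<bar> \<le> M * \<bar>x - y\<bar>" if "x \<le> y" for x y
  proof -
    define p q where "p = max a (min b x)" and "q = max a (min b y)"
    have pq: "a \<le> p" "p \<le> q" "q \<le> b" and qp: "q - p \<le> \<bar>x - y\<bar>" using that ab by (auto simp: p_def q_def)
    have eq: "clamped_primitive a b g x = (LINT s:{a<..<p}|lborel. g s)" "clamped_primitive a b g y = (LINT s:{a<..<q}|lborel. g s)"
      by (simp_all add: clamped_primitive_def p_def q_def)
    have "\<bar>clamped_primitive a b g x - clamped_primitive a b g y\<bar> \<le> M * (q - p)"
    proof (cases "a < p \<and> p < q")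
      case True
      have "set_integrable lborel {a<..<q} g" by (rule set_integrable_subset[OF g]) (use pq in auto)
      from set_integral_split[OF this, of p] True
      show ?thesis using bnd[OF pq] unfolding eq by simp
    next
      case False
      then consider "p = a" | "p = q" using pq by linarith
      then show ?thesis
      proof cases
        case 1
        then have "(LINT s:{a<..<p}|lborel. g s) = 0" by (simp add: set_lebesgue_integral_def)
        then show ?thesis using bnd[OF pq] 1 unfolding eq by simp
      next
        case 2
        then show ?thesis unfolding eq by simp
      qed
    qed
    also have "\<dots> \<le> M * \<bar>x - y\<bar>" using qp M(2) by (rule mult_left_mono)
    finally show ?thesis .
  qed
  show ?thesis
  proof (cases "x \<le> y")
    case False
    then show ?thesis using le[of y x] by (simp add: abs_minus_commute)
  qed (rule le)
qed

lemma Lipschitz_mult: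
  fixes f g :: "real \<Rightarrow> real"
  assumes f: "\<And>x y. \<bar>f x - f y\<bar> \<le> Lf * \<bar>x - y\<bar>" "\<And>x. \<bar>f x\<bar> \<le> F"
    and g: "\<And>x y. \<bar>g x - g y\<bar> \<le> Lg * \<bar>x - y\<bar>" "\<And>x. \<bar>g x\<bar> \<le> G"
  shows "\<bar>f x * g x - f y * g y\<bar> \<le> (F * Lg + G * Lf) * \<bar>x - y\<bar>"
proof -
  have "f x * g x - f y * g y = f x * (g x - g y) + g y * (f x - f y)" by (simp add: algebra_simps)
  also have "\<bar>\<dots>\<bar> \<le> \<bar>f x\<bar> * \<bar>g x - g y\<bar> + \<bar>g y\<bar> * \<bar>f x - f y\<bar>"
    using abs_triangle_ineq[of "f x * (g x - g y)" "g y * (f x - f y)"] by (simp add: abs_mult)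
  also have "\<dots> \<le> F * (Lg * \<bar>x - y\<bar>) + G * (Lf * \<bar>x - y\<bar>)"
    using f g order_trans[OF abs_ge_zero f(2)] order_trans[OF abs_ge_zero g(2)] by (intro add_mono mult_mono) auto
  finally show ?thesis by (simp add: algebra_simps)
qed

text \<open>A lower bound of the denominator is known only almost everywhere in the interval; the
  maximum with \<open>m\<close> enforces it on the whole line.\<close>

lemma Lipschitz_inverse_max:
  fixes f :: "real \<Rightarrow> real"
  assumes f: "\<And>x y. \<bar>f x - f y\<bar> \<le> L * \<bar>x - y\<bar>" and m: "0 < m"
  shows "\<bar>inverse (max (f x) m) - inverse (max (f y) m)\<bar> \<le> (L / m\<^sup>2) * \<bar>x - y\<bar>"
    and "\<bar>inverse (max (f x) m)\<bar> \<le> inverse m"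
proof -
  let ?p = "max (f x) m" and ?q = "max (f y) m"
  have pq: "m \<le> ?p" "m \<le> ?q" by auto
  then have pos: "0 < ?p" "0 < ?q" using m by linarith+
  have "inverse ?p - inverse ?q = (?q - ?p) / (?p * ?q)"
    using pos by (simp add: field_simps)
  then have "\<bar>inverse ?p - inverse ?q\<bar> = \<bar>?q - ?p\<bar> / (?p * ?q)"
    using pos by (simp add: abs_mult)
  also have "\<dots> \<le> (L * \<bar>x - y\<bar>) / m\<^sup>2"
  proof (rule frac_le)
    show "\<bar>?q - ?p\<bar> \<le> L * \<bar>x - y\<bar>" using f[of x y] by (auto simp: max_def abs_if split: if_splits)
    show "m\<^sup>2 \<le> ?p * ?q" unfolding power2_eq_square using pq m by (intro mult_mono) auto
    show "0 < m\<^sup>2" using m by simp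
    show "0 \<le> L * \<bar>x - y\<bar>" using order_trans[OF abs_ge_zero f[of x y]] .
  qed
  finally show "\<bar>inverse ?p - inverse ?q\<bar> \<le> (L / m\<^sup>2) * \<bar>x - y\<bar>" by simp
  show "\<bar>inverse ?p\<bar> \<le> inverse m" using pos pq m by (simp add: le_imp_inverse_le)
qed

lemma clamped_primitive_diff_le:
  assumes ab: "a < b" and g: "set_integrable lborel {a<..<b} g"
    and M: "AE x in lborel. x \<in> {a<..<b} \<longrightarrow> \<bar>g x\<bar> \<le> M" "0 \<le> M"
  shows "\<bar>clamped_primitive a b g x - clamped_primitive a b g y\<bar> \<le> M * (b - a)"
proof -
  define p q where "p = max a (min b x)" and "q = max a (min b y)"
  have "max a (min b p) = p" "max a (min b q) = q" using ab by (auto simp: p_def q_def)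
  then have "clamped_primitive a b g x = clamped_primitive a b g p" "clamped_primitive a b g y = clamped_primitive a b g q"
    by (simp_all add: clamped_primitive_def flip: p_def q_def)
  then have "\<bar>clamped_primitive a b g x - clamped_primitive a b g y\<bar> \<le> M * \<bar>p - q\<bar>"
    using clamped_primitive_Lipschitz[OF ab g M, of p q] by simp
  also have "\<dots> \<le> M * (b - a)" using ab M(2) by (intro mult_left_mono) (auto simp: p_def q_def)
  finally show ?thesis .
qed

section \<open>Weak differentiability and bounds of the coefficients and data\<close>

lemma has_weak_partial_subset:
  assumes w: "has_weak_partial S i f g" and T: "T \<subseteq> S" and i: "i \<in> Basis"
  shows "has_weak_partial T i f g"
  unfolding has_weak_partial_def
proof (intro conjI allI impI)
  show "locally_integrable T f" "locally_integrable T g"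
    using w T unfolding has_weak_partial_def locally_integrable_def by (meson order_trans)+
  fix \<phi> assume p: "test_function T \<phi>"
  have d: "test_function T (\<lambda>y. frechet_derivative \<phi> (at y) i)" by (rule test_function_deriv[OF p i])
  have *: "(LINT y:T|lborel. h y * \<theta> y) = (LINT y:S|lborel. h y * \<theta> y)" if "test_function T \<theta>" for h \<theta>
    unfolding set_lebesgue_integral_def using test_function_outside[OF that] T
    by (intro Bochner_Integration.integral_cong) (auto simp: indicator_def)
  show "(LINT y:T|lborel. f y * frechet_derivative \<phi> (at y) i) = - (LINT y:T|lborel. g y * \<phi> y)"
    unfolding *[OF d] *[OF p] using w test_function_mono[OF p T] unfolding has_weak_partial_def by blast
qed

lemma AE_bounded_L2:
  assumes S: "open S" "bounded S" and f: "set_borel_measurable lborel S f" "AE y in lborel. y \<in> S \<longrightarrow> \<bar>f y\<bar> \<le> M"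
  shows "f \<in> L2 S"
  using L2_bounded_mult[OF L2_const[OF S(2,1), of 1] f] by simp

lemma W1inf_weak_partial:
  assumes S: "open S" "bounded S" and f: "f \<in> W1inf S" and i: "i \<in> Basis"
  obtains g M where "has_weak_partial S i f g" "AE y in lborel. y \<in> S \<longrightarrow> \<bar>g y\<bar> \<le> M"
    "AE y in lborel. y \<in> S \<longrightarrow> \<bar>f y\<bar> \<le> M" "f \<in> L2 S" "g \<in> L2 S" "0 \<le> M"
proof -
  obtain M where M: "W1inf_le S f M" using f unfolding W1inf_def by auto
  then obtain g where g: "has_weak_partial S i f g" "AE y in lborel. y \<in> S \<longrightarrow> \<bar>g y\<bar> \<le> M"
    using i unfolding W1inf_le_def by blast
  have bf: "AE y in lborel. y \<in> S \<longrightarrow> \<bar>f y\<bar> \<le> M" and mf: "set_borel_measurable lborel S f"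
    using M unfolding W1inf_le_def by auto
  have mg: "set_borel_measurable lborel S g"
    using locally_integrable_measurable[OF S(1)] g(1) unfolding has_weak_partial_def by blast
  show ?thesis
  proof (rule that[of g "max M 0"])
    show "AE y in lborel. y \<in> S \<longrightarrow> \<bar>g y\<bar> \<le> max M 0" using g(2) by eventually_elim auto
    show "AE y in lborel. y \<in> S \<longrightarrow> \<bar>f y\<bar> \<le> max M 0" using bf by eventually_elim auto
  qed (use g AE_bounded_L2[OF S mf bf] AE_bounded_L2[OF S mg g(2)] in auto)
qed

lemma H1_AE_bounded:
  fixes a b :: real
  assumes ab: "a < b" and f: "f \<in> H1 {a<..<b}"
  obtains B where "AE x in lborel. x \<in> {a<..<b} \<longrightarrow> \<bar>f x\<bar> \<le> B" "0 \<le> B"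
proof -
  obtain C where C: "AE x in lborel. x \<in> {a<..<b} \<longrightarrow> f x = C + (LINT s:{a<..<x}|lborel. wD {a<..<b} f s)"
    using H1_representation[OF ab f] by blast
  have i: "set_integrable lborel {a<..<b} (wD {a<..<b} f)"
    using H1_weak_partial(2)[OF _ _ f, of 1] by (intro L2_integrable) auto
  let ?K = "LINT s:{a<..<b}|lborel. \<bar>wD {a<..<b} f s\<bar>"
  have "AE x in lborel. x \<in> {a<..<b} \<longrightarrow> \<bar>f x\<bar> \<le> \<bar>C\<bar> + ?K"
    using C
  proof (eventually_elim, intro impI)
    fix x assume *: "x \<in> {a<..<b} \<longrightarrow> f x = C + (LINT s:{a<..<x}|lborel. wD {a<..<b} f s)" "x \<in> {a<..<b}"
    have "{a<..<x} \<subseteq> {a<..<b}" using *(2) by auto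
    then have "\<bar>LINT s:{a<..<x}|lborel. wD {a<..<b} f s\<bar> \<le> ?K" by (intro set_integral_abs_le_subset[OF i]) auto
    then show "\<bar>f x\<bar> \<le> \<bar>C\<bar> + ?K" using * by auto
  qed
  moreover have "0 \<le> \<bar>C\<bar> + ?K" unfolding set_lebesgue_integral_def by (intro add_nonneg_nonneg) auto
  ultimately show ?thesis using that by blast
qed

text \<open>Through this inclusion an equation tested with \<open>space_W\<close> can be read as the
  identification of a weak derivative.\<close>

lemma test_function_space_W:
  fixes a b :: real
  assumes p: "test_function {a<..<b} \<phi>"
  shows "\<phi> \<in> space_W a b"
    and "AE x in lborel. x \<in> {a<..<b} \<longrightarrow> wD {a<..<b} \<phi> x = frechet_derivative \<phi> (at x) 1"
proof -
  let ?I = "{a<..<b}" and ?d = "\<lambda>x. frechet_derivative \<phi> (at x) 1"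
  have d: "test_function ?I ?d" using test_function_deriv[OF p, of 1] by simp
  have L: "\<theta> \<in> L2 ?I" if t: "test_function ?I \<theta>" for \<theta>
  proof -
    obtain B where "\<And>y. \<bar>\<theta> y\<bar> \<le> B" using test_function_bounded[OF t] by blast
    then show ?thesis
      using test_function_borel[OF t] by (intro AE_bounded_L2[of _ _ B]) (auto simp: set_borel_measurable_def)
  qed
  have i: "set_integrable lborel ?I ?d" by (rule L2_integrable[OF _ _ L[OF d]]) auto
  have rep: "\<phi> x = (LINT s:{a<..<x}|lborel. ?d s)" if "x \<in> ?I" for x
    using FTC_Ioo(1)[of a x, OF _ frechet_derivative_1D[OF test_function_differentiable[OF p]] test_function_continuous[OF d]]
      that test_function_outside[OF p, of a] by simp
  have w: "has_weak_partial ?I 1 \<phi> ?d"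
    unfolding has_weak_partial_def
  proof (intro conjI allI impI)
    show "locally_integrable ?I \<phi>" "locally_integrable ?I ?d"
      using L[OF p] L[OF d] by (auto intro: L2_imp_locally_integrable)
    fix \<theta> :: "real \<Rightarrow> real" assume t: "test_function ?I \<theta>"
    have "(LINT y:?I|lborel. \<phi> y * frechet_derivative \<theta> (at y) 1)
        = (LINT y:?I|lborel. (0 + (LINT s:{a<..<y}|lborel. ?d s)) * frechet_derivative \<theta> (at y) 1)"
      by (rule set_lebesgue_integral_cong) (use rep in auto)
    also have "\<dots> = - (LINT y:?I|lborel. ?d y * \<theta> y)" by (rule primitive_by_parts[OF i t])
    finally show "(LINT y:?I|lborel. \<phi> y * frechet_derivative \<theta> (at y) 1) = - (LINT y:?I|lborel. ?d y * \<theta> y)" .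
  qed
  have H: "\<phi> \<in> H1 ?I" unfolding H1_def using L[OF p] L[OF d] w by auto
  show eq: "AE x in lborel. x \<in> ?I \<longrightarrow> wD ?I \<phi> x = ?d x" by (rule weak_partial_AE_eq[OF _ _ w]) auto
  have m: "set_borel_measurable lborel T (wD ?I \<phi>)" "set_borel_measurable lborel T ?d" if "T \<subseteq> ?I" "T \<in> sets borel" for T
    using L2_subset[OF H1_weak_partial(2)[OF _ _ H, of 1] that] L2_subset[OF L[OF d] that] by (auto simp: L2_def)
  have ieq: "(LINT s:T|lborel. wD ?I \<phi> s) = (LINT s:T|lborel. ?d s)" if "T \<subseteq> ?I" "T \<in> sets borel" for T
    by (rule set_integral_cong_AE_real[OF _ m[OF that]]) (use eq that in \<open>auto elim!: eventually_mono\<close>)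
  show "\<phi> \<in> space_W a b"
  proof (rule space_W_I[OF H])
    have "\<phi> x = (LINT s:{a<..<x}|lborel. wD ?I \<phi> s)" if x: "x \<in> ?I" for x
    proof -
      have "{a<..<x} \<subseteq> ?I" using x by auto
      from ieq[OF this] rep[OF x] show ?thesis by simp
    qed
    then show "AE x in lborel. x \<in> ?I \<longrightarrow> \<phi> x = (LINT s:{a<..<x}|lborel. wD ?I \<phi> s)" by simp
    have "(LINT s:?I|lborel. ?d s) = 0"
    proof (cases "a < b")
      case True
      then show ?thesis using test_function_FTC[OF p, of a] test_function_outside[OF p, of a] by simp
    qed (simp add: set_lebesgue_integral_def)
    then show "(LINT s:?I|lborel. wD ?I \<phi> s) = 0" using ieq[of ?I] by auto
  qed
qed

text \<open>Excludes a function of mean zero with a strict sign, which is how the constant of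
  integration in the next estimate is bounded.\<close>

lemma set_integral_pos:
  fixes h :: "real \<Rightarrow> real"
  assumes ab: "a < b" and h: "set_integrable lborel {a<..<b} h" and pos: "AE x in lborel. x \<in> {a<..<b} \<longrightarrow> 0 < h x"
  shows "(LINT x:{a<..<b}|lborel. h x) \<noteq> 0"
proof
  assume "(LINT x:{a<..<b}|lborel. h x) = 0"
  moreover have "AE x in lborel. 0 \<le> indicator {a<..<b} x *\<^sub>R h x"
    using pos by (auto simp: indicator_def elim!: eventually_mono)
  ultimately have "AE x in lborel. indicator {a<..<b} x *\<^sub>R h x = 0"
    using integral_nonneg_eq_0_iff_AE[OF h[unfolded set_integrable_def]]
    by (simp add: set_lebesgue_integral_def)
  then have "AE x in lborel. x \<in> {a<..<b} \<longrightarrow> False"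
    using pos by eventually_elim (auto simp: indicator_def)
  from AE_imp_ex[OF this ab] show False by blast
qed

lemma integral_snd_AE_bounded:
  fixes A :: "real \<times> real \<Rightarrow> real" and c d :: real
  assumes cd: "c \<le> d" and A: "set_integrable lborel (I \<times> {c<..<d}) A"
    and M: "AE y in lborel. y \<in> I \<times> {c<..<d} \<longrightarrow> \<bar>A y\<bar> \<le> M"
  shows "AE x in lborel. x \<in> I \<longrightarrow> \<bar>LINT z:{c<..<d}|lborel. A (x, z)\<bar> \<le> M * (d - c)"
  using AE_Times_fst[OF M] set_integrable_Times_fst(1)[OF A]
proof (eventually_elim, intro impI)
  fix x assume *: "x \<in> I \<longrightarrow> (AE z in lborel. z \<in> {c<..<d} \<longrightarrow> \<bar>A (x, z)\<bar> \<le> M)"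
    "x \<in> I \<longrightarrow> set_integrable lborel {c<..<d} (\<lambda>z. A (x, z))" and x: "x \<in> I"
  have i: "set_integrable lborel {c<..<d} (\<lambda>z. A (x, z))" using * x by blast
  have "\<bar>LINT z:{c<..<d}|lborel. A (x, z)\<bar> \<le> (LINT z:{c<..<d}|lborel. \<bar>A (x, z)\<bar>)"
    by (rule set_integral_abs_le_subset[OF i]) auto
  also have "\<dots> \<le> (LINT z:{c<..<d}|lborel. M)"
    by (rule set_integral_mono_AE[OF set_integrable_abs[OF i] L2_integrable[OF _ _ L2_const]]) (use *(1) x in auto)
  also have "\<dots> = M * (d - c)" using cd by (simp add: set_lebesgue_integral_def)
  finally show "\<bar>LINT z:{c<..<d}|lborel. A (x, z)\<bar> \<le> M * (d - c)" .
qed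

text \<open>The equation gives the product of \<sigma> and the z-integral of \<open>A\<close> the
  weak derivative h - F, F being the z-integral of \<open>f\<close>. As h - F is bounded, \<sigma>
  is a quotient of Lipschitz functions, and on almost every horizontal line A \<sigma> is Lipschitz;
  the derivative of \<xi> is then removed by parts. \<open>M\<close> is chosen before \<sigma>, so
  that it serves the limit solutions of all \<delta>.\<close>

lemma interior_flux_bound:
  fixes a b c d m M0 :: real and A gA f :: "real \<times> real \<Rightarrow> real" and h :: "real \<Rightarrow> real"
  defines "R \<equiv> {a<..<b} \<times> {c<..<d}"
  assumes ab: "a < b" and cd: "c < d"
    and A: "has_weak_partial R (1, 0) A gA" "A \<in> L2 R" "gA \<in> L2 R"
    and bA: "AE y in lborel. y \<in> R \<longrightarrow> \<bar>A y\<bar> \<le> M0" "AE y in lborel. y \<in> R \<longrightarrow> \<bar>gA y\<bar> \<le> M0"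
    and m: "0 < m" "AE y in lborel. y \<in> R \<longrightarrow> m \<le> A y" and M0: "0 \<le> M0"
    and f: "f \<in> H1 R" and h: "h \<in> H1 {a<..<b}"
  shows "\<exists>M\<ge>0. \<forall>\<sigma> \<xi>. \<sigma> \<in> L2 {a<..<b} \<longrightarrow> (LINT x:{a<..<b}|lborel. \<sigma> x) = 0 \<longrightarrow>
      (\<forall>\<psi>\<in>space_W a b. (LINT x:{a<..<b}|lborel. (LINT z:{c<..<d}|lborel. A (x, z)) * \<sigma> x * wD {a<..<b} \<psi> x) =
         (LINT x:{a<..<b}|lborel. (LINT z:{c<..<d}|lborel. f (x, z)) * \<psi> x) - (LINT x:{a<..<b}|lborel. h x * \<psi> x)) \<longrightarrow>
      \<xi> \<in> space_V a b {c<..<d} \<longrightarrow>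
      \<bar>LINT y:R|lborel. A y * \<sigma> (fst y) * wDx R \<xi> y\<bar> \<le> M * (LINT y:R|lborel. \<bar>\<xi> y\<bar>)"
proof -
  let ?I = "{a<..<b}" and ?J = "{c<..<d}"
  have R: "open R" "bounded R" unfolding R_def by (auto intro: open_Times bounded_Times)
  define a2 where "a2 = (\<lambda>x. LINT z:?J|lborel. A (x, z))"
  define F where "F = (\<lambda>x. LINT z:?J|lborel. f (x, z))"
  define La \<mu> where "La = M0 * (d - c)" and "\<mu> = m * (d - c)"
  have La: "0 \<le> La" and mu: "0 < \<mu>" using M0 m cd by (auto simp: La_def \<mu>_def)
  have Ai: "set_integrable lborel (?I \<times> ?J) A" and gAi: "set_integrable lborel (?I \<times> ?J) gA"
    using L2_integrable[OF R(2,1)] A unfolding R_def by auto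
  have cJ: "set_integrable lborel ?J (\<lambda>z. k)" for k :: real by (rule L2_integrable[OF _ _ L2_const]) auto
  have cJi: "(LINT z:?J|lborel. k) = k * (d - c)" for k :: real using cd by (simp add: set_lebesgue_integral_def)
  have wf: "has_weak_partial (?I \<times> ?J) (1, 0) f (wDx (?I \<times> ?J) f)" "wDx (?I \<times> ?J) f \<in> L2 (?I \<times> ?J)"
    using H1_weak_partial[OF R f, of "(1, 0)"] by (simp_all add: Basis_real_pair R_def)
  have a2H: "a2 \<in> H1 ?I" and a2w: "has_weak_partial ?I 1 a2 (\<lambda>x. LINT z:?J|lborel. gA (x, z))"
    using H1_integral_snd[OF ab, of ?J A gA] A unfolding R_def a2_def by auto
  have FH: "F \<in> H1 ?I"
    using H1_integral_snd(2)[OF ab _ _ H1_L2[OF f[unfolded R_def]] wf(2,1)] unfolding F_def by auto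
  have a2L: "a2 \<in> L2 ?I" by (rule H1_L2[OF a2H])
  have wa2': "AE x in lborel. x \<in> ?I \<longrightarrow> wD ?I a2 x = (LINT z:?J|lborel. gA (x, z))"
    by (rule weak_partial_AE_eq[OF _ _ a2w]) auto
  have wa2: "AE x in lborel. x \<in> ?I \<longrightarrow> \<bar>wD ?I a2 x\<bar> \<le> La"
    using wa2' integral_snd_AE_bounded[OF less_imp_le[OF cd] gAi bA(2)[unfolded R_def]]
    by eventually_elim (auto simp: La_def)
  have a2m: "AE x in lborel. x \<in> ?I \<longrightarrow> \<mu> \<le> a2 x \<and> \<bar>a2 x\<bar> \<le> La"
    using integral_snd_AE_bounded[OF less_imp_le[OF cd] Ai bA(1)[unfolded R_def]]
      AE_Times_fst[OF m(2)[unfolded R_def]] set_integrable_Times_fst(1)[OF Ai]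
  proof (eventually_elim, intro impI)
    fix x assume *: "x \<in> ?I \<longrightarrow> \<bar>LINT z:?J|lborel. A (x, z)\<bar> \<le> M0 * (d - c)"
      "x \<in> ?I \<longrightarrow> (AE z in lborel. z \<in> ?J \<longrightarrow> m \<le> A (x, z))"
      "x \<in> ?I \<longrightarrow> set_integrable lborel ?J (\<lambda>z. A (x, z))" and x: "x \<in> ?I"
    have "(LINT z:?J|lborel. m) \<le> a2 x"
      unfolding a2_def by (rule set_integral_mono_AE[OF cJ]) (use * x in blast)+
    then show "\<mu> \<le> a2 x \<and> \<bar>a2 x\<bar> \<le> La"
      using * x unfolding cJi \<mu>_def La_def a2_def by auto
  qed
  obtain Ca where Ca: "AE x in lborel. x \<in> ?I \<longrightarrow> a2 x = Ca + (LINT s:{a<..<x}|lborel. wD ?I a2 s)"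
    using H1_representation[OF ab a2H] by blast
  define \<alpha> where "\<alpha> x = Ca + clamped_primitive a b (wD ?I a2) x" for x
  have wa2i: "set_integrable lborel ?I (wD ?I a2)"
    using H1_weak_partial(2)[OF _ _ a2H, of 1] by (intro L2_integrable) auto
  have alip: "\<bar>\<alpha> x - \<alpha> y\<bar> \<le> La * \<bar>x - y\<bar>" for x y
    using clamped_primitive_Lipschitz[OF ab wa2i wa2 La, of x y] by (simp add: \<alpha>_def)
  \<comment> \<open>The maximum changes nothing inside the interval, up to a null set, but keeps the
    denominator positive on the whole line.\<close>
  have a2eq: "AE x in lborel. x \<in> ?I \<longrightarrow> a2 x = max (\<alpha> x) \<mu>"
    using Ca a2m by eventually_elim (auto simp: \<alpha>_def clamped_primitive_eq)
  define G where "G x = F x + (-1) * h x" for x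
  have GH: "G \<in> H1 ?I" unfolding G_def[abs_def] by (rule H1_add_cmult(1)[OF _ _ FH h]) auto
  obtain K where K: "AE x in lborel. x \<in> ?I \<longrightarrow> \<bar>G x\<bar> \<le> K" "0 \<le> K" using H1_AE_bounded[OF ab GH] by blast
  have Gi: "set_integrable lborel ?I G" using H1_L2[OF GH] by (intro L2_integrable) auto
  define H where "H = clamped_primitive a b G"
  have Hlip: "\<bar>H x - H y\<bar> \<le> K * \<bar>x - y\<bar>" for x y unfolding H_def by (rule clamped_primitive_Lipschitz[OF ab Gi K])
  define KH where "KH = K * (b - a)"
  have Hbnd: "\<bar>H x\<bar> \<le> KH" for x
  proof -
    have "H a = 0" using ab by (simp add: H_def clamped_primitive_def set_lebesgue_integral_def)
    then show ?thesis using clamped_primitive_diff_le[OF ab Gi K, of x a] by (simp add: H_def KH_def)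
  qed
  have KH0: "0 \<le> KH" using K(2) ab by (simp add: KH_def)
  \<comment> \<open>\<open>MA\<close> bounds the extended sections of \<open>A\<close>;
    \<open>LN\<close> and \<open>BN\<close> are Lipschitz constant and bound of (k - H) / a2, where
    |k - H| is at most 2 \<open>KH\<close>; \<open>M\<close> is the Lipschitz constant of the
    product, all by \<open>Lipschitz_mult\<close>.\<close>
  define MA LN BN where "MA = M0 + M0 * (b - a)" and "LN = 2 * KH * (La / \<mu>\<^sup>2) + inverse \<mu> * K" and "BN = 2 * KH * inverse \<mu>"
  define M where "M = MA * LN + BN * M0"
  have M: "0 \<le> M" unfolding M_def MA_def LN_def BN_def using M0 ab KH0 La mu K(2) by simp
  \<comment> \<open>On almost every horizontal line the coefficient agrees with a function that is
    Lipschitz and bounded on the whole real line, with constants common to all lines.\<close>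
  have Asec: "AE z in lborel. z \<in> ?J \<longrightarrow> (\<exists>Az. (\<forall>x y. \<bar>Az x - Az y\<bar> \<le> M0 * \<bar>x - y\<bar>) \<and> (\<forall>x. \<bar>Az x\<bar> \<le> MA) \<and>
      (AE x in lborel. x \<in> ?I \<longrightarrow> A (x, z) = Az x))"
  proof -
    obtain k where k: "AE y in lborel. y \<in> ?I \<times> ?J \<longrightarrow> A y = k (snd y) + primitive_from a gA y"
      using weak_partial_representation_L2[OF ab _ _ A(2,3,1)[unfolded R_def]] by auto
    show ?thesis
      using AE_Times_snd[OF k] AE_Times_snd[OF bA(1)[unfolded R_def]] AE_Times_snd[OF bA(2)[unfolded R_def]]
        set_integrable_Times_snd(1)[OF gAi]
    proof (eventually_elim, intro impI)
      fix z assume *: "z \<in> ?J \<longrightarrow> (AE x in lborel. x \<in> ?I \<longrightarrow> A (x, z) = k (snd (x, z)) + primitive_from a gA (x, z))"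
        "z \<in> ?J \<longrightarrow> (AE x in lborel. x \<in> ?I \<longrightarrow> \<bar>A (x, z)\<bar> \<le> M0)"
        "z \<in> ?J \<longrightarrow> (AE x in lborel. x \<in> ?I \<longrightarrow> \<bar>gA (x, z)\<bar> \<le> M0)"
        "z \<in> ?J \<longrightarrow> set_integrable lborel ?I (\<lambda>x. gA (x, z))" and z: "z \<in> ?J"
      have rep: "AE x in lborel. x \<in> ?I \<longrightarrow> A (x, z) = k z + primitive_from a gA (x, z)" using *(1) z by simp
      have bz: "AE x in lborel. x \<in> ?I \<longrightarrow> \<bar>A (x, z)\<bar> \<le> M0" "AE x in lborel. x \<in> ?I \<longrightarrow> \<bar>gA (x, z)\<bar> \<le> M0"
        and gz: "set_integrable lborel ?I (\<lambda>x. gA (x, z))" using * z by blast+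
      define Az where "Az x = k z + clamped_primitive a b (\<lambda>x. gA (x, z)) x" for x
      have eq: "AE x in lborel. x \<in> ?I \<longrightarrow> A (x, z) = Az x"
        using rep by eventually_elim (auto simp: Az_def clamped_primitive_eq primitive_from_def)
      have bAz: "AE x in lborel. x \<in> ?I \<longrightarrow> \<bar>Az x\<bar> \<le> M0" using eq bz(1) by eventually_elim auto
      \<comment> \<open>The bound \<open>M0\<close> holds almost everywhere only. One good point and
        the oscillation of the primitive, at most M0 (b - a), give the bound \<open>MA\<close>
        everywhere.\<close>
      obtain x0 where x0: "\<bar>Az x0\<bar> \<le> M0" using AE_imp_ex[OF bAz ab] by blast
      have "\<bar>Az x\<bar> \<le> MA" for x
        using clamped_primitive_diff_le[OF ab gz bz(2) M0, of x x0] x0 unfolding Az_def MA_def by linarith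
      moreover have "\<bar>Az x - Az y\<bar> \<le> M0 * \<bar>x - y\<bar>" for x y
        using clamped_primitive_Lipschitz[OF ab gz bz(2) M0, of x y] by (simp add: Az_def)
      ultimately show "\<exists>Az. (\<forall>x y. \<bar>Az x - Az y\<bar> \<le> M0 * \<bar>x - y\<bar>) \<and> (\<forall>x. \<bar>Az x\<bar> \<le> MA) \<and>
          (AE x in lborel. x \<in> ?I \<longrightarrow> A (x, z) = Az x)" using eq by blast
    qed
  qed
  have main: "\<bar>LINT y:R|lborel. A y * \<sigma> (fst y) * wDx R \<xi> y\<bar> \<le> M * (LINT y:R|lborel. \<bar>\<xi> y\<bar>)"
    if s: "\<sigma> \<in> L2 ?I" "(LINT x:?I|lborel. \<sigma> x) = 0"
      and eq: "\<And>\<psi>. \<psi> \<in> space_W a b \<Longrightarrow> (LINT x:?I|lborel. a2 x * \<sigma> x * wD ?I \<psi> x) =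
         (LINT x:?I|lborel. F x * \<psi> x) - (LINT x:?I|lborel. h x * \<psi> x)"
      and xi: "\<xi> \<in> space_V a b ?J" for \<sigma> \<xi>
  proof -
    define B where "B = (\<lambda>x. a2 x * \<sigma> x)"
    have ma2: "set_borel_measurable lborel ?I a2" using a2L by (auto simp: L2_def)
    have BL: "B \<in> L2 ?I"
      unfolding B_def by (rule L2_bounded_mult[OF s(1) ma2, of La]) (use a2m in \<open>auto elim!: eventually_mono\<close>)
    have GL: "(\<lambda>x. - G x) \<in> L2 ?I" using L2_cmult[OF H1_L2[OF GH], of "-1"] by simp
    \<comment> \<open>Tested with smooth functions, the equation says precisely that the weak
      derivative of \<open>B\<close> is -G, where G = F - h.\<close>
    have Bw: "has_weak_partial ?I 1 B (\<lambda>x. - G x)"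
      unfolding has_weak_partial_def
    proof (intro conjI allI impI)
      show "locally_integrable ?I B" "locally_integrable ?I (\<lambda>x. - G x)"
        using BL GL by (auto intro: L2_imp_locally_integrable)
      fix \<phi> :: "real \<Rightarrow> real" assume p: "test_function ?I \<phi>"
      have pW: "\<phi> \<in> space_W a b" by (rule test_function_space_W(1)[OF p])
      have pH: "\<phi> \<in> H1 ?I" using pW by (auto simp: space_W_def)
      have d: "test_function ?I (\<lambda>y. frechet_derivative \<phi> (at y) 1)" using test_function_deriv[OF p, of 1] by simp
      have mB: "set_borel_measurable lborel ?I B" using BL by (auto simp: L2_def)
      have "(LINT y:?I|lborel. B y * frechet_derivative \<phi> (at y) 1) = (LINT y:?I|lborel. B y * wD ?I \<phi> y)"
      proof (rule set_integral_cong_AE_real)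
        show "set_borel_measurable lborel ?I (\<lambda>y. B y * frechet_derivative \<phi> (at y) 1)"
          using test_function_borel[OF d] by (intro set_borel_measurable_mult[OF mB]) (simp add: set_borel_measurable_def)
        show "set_borel_measurable lborel ?I (\<lambda>y. B y * wD ?I \<phi> y)"
          using H1_weak_partial(2)[OF _ _ pH, of 1] by (intro set_borel_measurable_mult[OF mB]) (auto simp: L2_def)
      qed (use test_function_space_W(2)[OF p] in \<open>auto elim!: eventually_mono\<close>)
      also have "\<dots> = (LINT x:?I|lborel. F x * \<phi> x) - (LINT x:?I|lborel. h x * \<phi> x)"
        using eq[OF pW] by (simp add: B_def)
      also have "\<dots> = (LINT x:?I|lborel. F x * \<phi> x - h x * \<phi> x)"
        by (rule set_integral_diff(2)[symmetric]) (intro L2_integrable_mult H1_L2 FH h pH)+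
      also have "\<dots> = (LINT y:?I|lborel. - ((- G y) * \<phi> y))"
        by (simp add: G_def left_diff_distrib)
      also have "\<dots> = - (LINT y:?I|lborel. (- G y) * \<phi> y)"
        by (simp only: set_lebesgue_integral_def scaleR_minus_right Bochner_Integration.integral_minus)
      finally show "(LINT y:?I|lborel. B y * frechet_derivative \<phi> (at y) 1) = - (LINT y:?I|lborel. (- G y) * \<phi> y)" .
    qed
    have BH: "B \<in> H1 ?I" unfolding H1_def using BL GL Bw by auto
    obtain k where k: "AE x in lborel. x \<in> ?I \<longrightarrow> B x = k + (LINT s:{a<..<x}|lborel. wD ?I B s)"
      using H1_representation[OF ab BH] by blast
    have wB: "AE x in lborel. x \<in> ?I \<longrightarrow> wD ?I B x = - G x" by (rule weak_partial_AE_eq[OF _ _ Bw]) auto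
    have kH: "AE x in lborel. x \<in> ?I \<longrightarrow> B x = k - H x"
      using k
    proof (eventually_elim, intro impI)
      fix x assume *: "x \<in> ?I \<longrightarrow> B x = k + (LINT s:{a<..<x}|lborel. wD ?I B s)" "x \<in> ?I"
      have sub: "{a<..<x} \<subseteq> ?I" using *(2) by auto
      have "(LINT s:{a<..<x}|lborel. wD ?I B s) = (LINT s:{a<..<x}|lborel. - G s)"
      proof (rule set_integral_cong_AE_real)
        show "set_borel_measurable lborel {a<..<x} (wD ?I B)" "set_borel_measurable lborel {a<..<x} (\<lambda>s. - G s)"
          using L2_subset[OF H1_weak_partial(2)[OF _ _ BH, of 1] sub] L2_subset[OF GL sub] by (auto simp: L2_def)
      qed (use wB sub in \<open>auto elim!: eventually_mono\<close>)
      then show "B x = k - H x"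
        using * by (simp add: H_def clamped_primitive_eq) (simp add: set_lebesgue_integral_def)
    qed
    \<comment> \<open>The Lipschitz representative of \<sigma> = B / a2, with B = k - H from
      integrating the previous identity.\<close>
    define N where "N x = (k - H x) * inverse (max (\<alpha> x) \<mu>)" for x
    have sN: "AE x in lborel. x \<in> ?I \<longrightarrow> \<sigma> x = N x"
      using kH a2eq
    proof (eventually_elim, intro impI)
      fix x assume *: "x \<in> ?I \<longrightarrow> B x = k - H x" "x \<in> ?I \<longrightarrow> a2 x = max (\<alpha> x) \<mu>" "x \<in> ?I"
      have "max (\<alpha> x) \<mu> > 0" using mu by auto
      moreover have "max (\<alpha> x) \<mu> * \<sigma> x = k - H x" using * by (simp add: B_def)
      ultimately show "\<sigma> x = N x" unfolding N_def by (simp add: field_simps)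
    qed
    \<comment> \<open>If |k| exceeded the bound of \<open>H\<close>, then k - H and with it \<sigma>
      would have a strict sign almost everywhere, contradicting its vanishing integral. So the
      constant of integration is bounded by the data alone.\<close>
    have kb: "\<bar>k\<bar> \<le> KH"
    proof (rule ccontr)
      assume "\<not> \<bar>k\<bar> \<le> KH"
      then consider "k > KH" | "- k > KH" by linarith
      then have "\<exists>e. (LINT x:?I|lborel. e * \<sigma> x) \<noteq> 0"
      proof cases
        case 1
        have "AE x in lborel. x \<in> ?I \<longrightarrow> 0 < 1 * \<sigma> x"
          using sN
        proof (eventually_elim, intro impI)
          fix x assume *: "x \<in> ?I \<longrightarrow> \<sigma> x = N x" "x \<in> ?I"
          have "k - H x > 0" using Hbnd[of x] 1 by linarith
          moreover have "inverse (max (\<alpha> x) \<mu>) > 0" using mu by auto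
          ultimately show "0 < 1 * \<sigma> x" using * by (simp add: N_def)
        qed
        with s(1) show ?thesis
          by (intro exI[of _ 1] set_integral_pos[OF ab]) (auto intro!: L2_integrable)
      next
        case 2
        have "AE x in lborel. x \<in> ?I \<longrightarrow> 0 < (-1) * \<sigma> x"
          using sN
        proof (eventually_elim, intro impI)
          fix x assume *: "x \<in> ?I \<longrightarrow> \<sigma> x = N x" "x \<in> ?I"
          have "H x - k > 0" using Hbnd[of x] 2 by linarith
          moreover have "inverse (max (\<alpha> x) \<mu>) > 0" using mu by auto
          ultimately have "0 < (H x - k) * inverse (max (\<alpha> x) \<mu>)" by (rule mult_pos_pos)
          then show "0 < (-1) * \<sigma> x" using * by (simp add: N_def algebra_simps)
        qed
        moreover have "set_integrable lborel ?I (\<lambda>x. (-1) * \<sigma> x)"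
          by (rule L2_integrable[OF _ _ L2_cmult[OF s(1)]]) auto
        ultimately show ?thesis by (intro exI[of _ "-1"] set_integral_pos[OF ab])
      qed
      then show False using s(2) by (simp only: set_integral_mult_right) simp
    qed
    have Nlip: "\<bar>N x - N y\<bar> \<le> LN * \<bar>x - y\<bar>" for x y
      unfolding N_def LN_def
    proof (rule Lipschitz_mult)
      show "\<bar>k - H x - (k - H y)\<bar> \<le> K * \<bar>x - y\<bar>" for x y using Hlip[of y x] by (simp add: abs_minus_commute)
      show "\<bar>k - H x\<bar> \<le> 2 * KH" for x using kb Hbnd[of x] by linarith
    qed (rule Lipschitz_inverse_max[OF alip mu])+
    have Nbnd: "\<bar>N x\<bar> \<le> BN" for x
      unfolding N_def BN_def abs_mult
    proof (rule mult_mono)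
      show "\<bar>k - H x\<bar> \<le> 2 * KH" using kb Hbnd[of x] by linarith
      show "\<bar>inverse (max (\<alpha> x) \<mu>)\<bar> \<le> inverse \<mu>" by (rule Lipschitz_inverse_max(2)[OF alip mu])
    qed (use KH0 in auto)

    \<comment> \<open>Integration by parts on almost every horizontal line\<close>
    have xH: "\<xi> \<in> H1 (?I \<times> ?J)" by (rule space_V_H1[OF xi])
    have wL: "wDx R \<xi> \<in> L2 (?I \<times> ?J)"
      using H1_weak_partial(2)[OF R, of \<xi> "(1, 0)"] xH by (simp add: R_def Basis_real_pair)
    have wi: "set_integrable lborel (?I \<times> ?J) (wDx R \<xi>)" using L2_integrable[OF R(2,1)] wL by (simp add: R_def)
    have xii: "set_integrable lborel (?I \<times> ?J) \<xi>" using L2_integrable[OF R(2,1)] H1_L2[OF xH] by (simp add: R_def)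
    have sL: "(\<lambda>y. \<sigma> (fst y)) \<in> L2 (?I \<times> ?J)" by (rule L2_fst[OF s(1)]) auto
    have mA: "set_borel_measurable lborel (?I \<times> ?J) A" using A(2) by (simp add: R_def L2_def)
    have AsL: "(\<lambda>y. A y * \<sigma> (fst y)) \<in> L2 (?I \<times> ?J)" by (rule L2_bounded_mult[OF sL mA bA(1)[unfolded R_def]])
    have int: "set_integrable lborel (?I \<times> ?J) (\<lambda>y. A y * \<sigma> (fst y) * wDx R \<xi> y)"
      by (rule L2_integrable_mult[OF AsL wL])
    note V = space_V_representation[OF ab xi, folded R_def]
    have slice: "AE z in lborel. z \<in> ?J \<longrightarrow>
        \<bar>LINT x:?I|lborel. A (x, z) * \<sigma> x * wDx R \<xi> (x, z)\<bar> \<le> M * (LINT x:?I|lborel. \<bar>\<xi> (x, z)\<bar>)"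
      using Asec AE_Times_snd[OF V(1)[unfolded R_def]] V(2) set_integrable_Times_snd(1)[OF wi]
        set_integrable_Times_snd(1)[OF xii] set_integrable_Times_snd(1)[OF int]
    proof (eventually_elim, intro impI)
      fix z assume *: "z \<in> ?J \<longrightarrow> (\<exists>Az. (\<forall>x y. \<bar>Az x - Az y\<bar> \<le> M0 * \<bar>x - y\<bar>) \<and> (\<forall>x. \<bar>Az x\<bar> \<le> MA) \<and>
          (AE x in lborel. x \<in> ?I \<longrightarrow> A (x, z) = Az x))"
        "z \<in> ?J \<longrightarrow> (AE x in lborel. x \<in> ?I \<longrightarrow> \<xi> (x, z) = primitive_from a (wDx (?I \<times> ?J) \<xi>) (x, z))"
        "z \<in> ?J \<longrightarrow> (LINT s:?I|lborel. wDx R \<xi> (s, z)) = 0"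
        "z \<in> ?J \<longrightarrow> set_integrable lborel ?I (\<lambda>x. wDx R \<xi> (x, z))"
        "z \<in> ?J \<longrightarrow> set_integrable lborel ?I (\<lambda>x. \<xi> (x, z))"
        "z \<in> ?J \<longrightarrow> set_integrable lborel ?I (\<lambda>x. A (x, z) * \<sigma> (fst (x, z)) * wDx R \<xi> (x, z))" and z: "z \<in> ?J"
      obtain Az where Az: "\<And>x y. \<bar>Az x - Az y\<bar> \<le> M0 * \<bar>x - y\<bar>" "\<And>x. \<bar>Az x\<bar> \<le> MA"
        "AE x in lborel. x \<in> ?I \<longrightarrow> A (x, z) = Az x" using *(1) z by blast
      have Qlip: "\<bar>Az x * N x - Az y * N y\<bar> \<le> M * \<bar>x - y\<bar>" for x y
        unfolding M_def by (rule Lipschitz_mult[OF Az(1,2) Nlip Nbnd])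
      have gz: "set_integrable lborel ?I (\<lambda>x. wDx R \<xi> (x, z))" using *(4) z by blast
      have cQ: "continuous_on UNIV (\<lambda>x. Az x * N x)"
      proof -
        have "M-lipschitz_on UNIV (\<lambda>x. Az x * N x)" using Qlip M by (auto simp: lipschitz_on_def dist_real_def)
        then show ?thesis by (rule lipschitz_on_continuous_on)
      qed
      have "(LINT x:?I|lborel. A (x, z) * \<sigma> x * wDx R \<xi> (x, z)) = (LINT x:?I|lborel. (Az x * N x) * wDx R \<xi> (x, z))"
      proof (rule set_integral_cong_AE_real)
        show "AE x in lborel. x \<in> ?I \<longrightarrow> A (x, z) * \<sigma> x * wDx R \<xi> (x, z) = (Az x * N x) * wDx R \<xi> (x, z)"
          using Az(3) sN by eventually_elim auto
        show "set_borel_measurable lborel ?I (\<lambda>x. A (x, z) * \<sigma> x * wDx R \<xi> (x, z))"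
          using set_integrable_imp_measurable[of lborel ?I "\<lambda>x. A (x, z) * \<sigma> (fst (x, z)) * wDx R \<xi> (x, z)"] *(6) z by simp
        show "set_borel_measurable lborel ?I (\<lambda>x. (Az x * N x) * wDx R \<xi> (x, z))"
          using borel_measurable_continuous_onI[OF cQ]
          by (intro set_borel_measurable_mult[OF _ set_integrable_imp_measurable[OF gz]]) (simp add: set_borel_measurable_def)
      qed
      also have "\<bar>\<dots>\<bar> \<le> M * (LINT x:?I|lborel. \<bar>\<xi> (x, z)\<bar>)"
      proof (rule Lipschitz_by_parts_bound[OF Qlip gz])
        show "(LINT s:?I|lborel. wDx R \<xi> (s, z)) = 0" using *(3) z by blast
        show "set_integrable lborel ?I (\<lambda>x. \<xi> (x, z))" using *(5) z by blast
        have "AE x in lborel. x \<in> ?I \<longrightarrow> \<xi> (x, z) = primitive_from a (wDx (?I \<times> ?J) \<xi>) (x, z)" using *(2) z by blast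
        then show "AE x in lborel. x \<in> ?I \<longrightarrow> \<xi> (x, z) = (LINT s:{a<..<x}|lborel. wDx R \<xi> (s, z))"
          by (simp add: primitive_from_def R_def)
      qed
      finally show "\<bar>LINT x:?I|lborel. A (x, z) * \<sigma> x * wDx R \<xi> (x, z)\<bar> \<le> M * (LINT x:?I|lborel. \<bar>\<xi> (x, z)\<bar>)" .
    qed
    have i1: "set_integrable lborel ?J (\<lambda>z. LINT x:?I|lborel. A (x, z) * \<sigma> x * wDx R \<xi> (x, z))"
      using set_integrable_Times_snd(2)[OF int] by simp
    have i2: "set_integrable lborel ?J (\<lambda>z. LINT x:?I|lborel. \<bar>\<xi> (x, z)\<bar>)"
      using set_integrable_Times_snd(2)[OF set_integrable_abs[OF xii]] by simp
    have "(LINT y:R|lborel. A y * \<sigma> (fst y) * wDx R \<xi> y) = (LINT z:?J|lborel. LINT x:?I|lborel. A (x, z) * \<sigma> x * wDx R \<xi> (x, z))"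
      using set_integrable_Times_snd(3)[OF int] by (simp add: R_def)
    also have "\<bar>\<dots>\<bar> \<le> (LINT z:?J|lborel. \<bar>LINT x:?I|lborel. A (x, z) * \<sigma> x * wDx R \<xi> (x, z)\<bar>)"
      by (rule set_integral_abs_le_subset[OF i1]) auto
    also have "\<dots> \<le> (LINT z:?J|lborel. M * (LINT x:?I|lborel. \<bar>\<xi> (x, z)\<bar>))"
      by (rule set_integral_mono_AE) (use set_integrable_abs[OF i1] i2 slice in auto)
    also have "\<dots> = M * (LINT y:R|lborel. \<bar>\<xi> y\<bar>)"
      using set_integrable_Times_snd(3)[OF set_integrable_abs[OF xii]] by (simp add: R_def)
    finally show ?thesis .
  qed
  show ?thesis
    by (rule exI[of _ M]) (use M main in \<open>auto simp: a2_def F_def\<close>)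
qed

section \<open>Comparison of the two models\<close>

definition L2_inner :: "'a::euclidean_space set \<Rightarrow> ('a \<Rightarrow> real) \<Rightarrow> ('a \<Rightarrow> real) \<Rightarrow> real" where
  "L2_inner S f g = (LINT y:S|lborel. f y * g y)"

lemma L2_inner_commute: "L2_inner S f g = L2_inner S g f"
  by (simp add: L2_inner_def mult.commute)

lemma L2_inner_self: "L2_inner S f f = (L2_norm S f)\<^sup>2"
  unfolding L2_inner_def L2_norm_power2 by (simp add: power2_eq_square)

lemma L2_inner_add_left:
  assumes "f \<in> L2 S" "g \<in> L2 S" "h \<in> L2 S"
  shows "L2_inner S (\<lambda>y. f y + g y) h = L2_inner S f h + L2_inner S g h"
  using set_integral_add(2)[OF L2_integrable_mult[OF assms(1,3)] L2_integrable_mult[OF assms(2,3)]]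
  by (simp add: L2_inner_def distrib_right)

lemma L2_inner_cmult_left: "L2_inner S (\<lambda>y. c * f y) h = c * L2_inner S f h"
  by (simp add: L2_inner_def mult.assoc)

lemma L2_inner_diff_left:
  assumes "f \<in> L2 S" "g \<in> L2 S" "h \<in> L2 S"
  shows "L2_inner S (\<lambda>y. f y - g y) h = L2_inner S f h - L2_inner S g h"
  using set_integral_diff(2)[OF L2_integrable_mult[OF assms(1,3)] L2_integrable_mult[OF assms(2,3)]]
  by (simp add: L2_inner_def left_diff_distrib)

lemma L2_inner_add_right:
  assumes "f \<in> L2 S" "g \<in> L2 S" "h \<in> L2 S"
  shows "L2_inner S h (\<lambda>y. f y + g y) = L2_inner S h f + L2_inner S h g"
  using L2_inner_add_left[OF assms] by (simp add: L2_inner_commute)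

lemma L2_inner_cong:
  assumes "f \<in> L2 S" "f' \<in> L2 S" "g \<in> L2 S" "g' \<in> L2 S"
    "AE y in lborel. y \<in> S \<longrightarrow> f y = f' y" "AE y in lborel. y \<in> S \<longrightarrow> g y = g' y"
  shows "L2_inner S f g = L2_inner S f' g'"
  unfolding L2_inner_def
proof (rule set_integral_cong_AE_real)
  show "AE y in lborel. y \<in> S \<longrightarrow> f y * g y = f' y * g' y" using assms(5,6) by eventually_elim auto
qed (use assms in \<open>auto simp: L2_def intro!: set_borel_measurable_mult\<close>)

lemma L2_inner_le: "f \<in> L2 S \<Longrightarrow> g \<in> L2 S \<Longrightarrow> \<bar>L2_inner S f g\<bar> \<le> L2_norm S f * L2_norm S g"
  unfolding L2_inner_def by (rule L2_Cauchy_Schwarz)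

lemma L2_norm_triangle:
  assumes f: "f \<in> L2 S" and g: "g \<in> L2 S"
  shows "L2_norm S (\<lambda>y. f y + g y) \<le> L2_norm S f + L2_norm S g"
proof (rule power2_le_imp_le)
  have fg: "(\<lambda>y. f y + g y) \<in> L2 S" by (rule L2_add[OF f g])
  have "(L2_norm S (\<lambda>y. f y + g y))\<^sup>2 = L2_inner S f f + 2 * L2_inner S f g + L2_inner S g g"
    unfolding L2_inner_self[symmetric] L2_inner_add_left[OF f g fg] L2_inner_add_right[OF f g f] L2_inner_add_right[OF f g g]
    by (simp add: L2_inner_commute)
  also have "\<dots> \<le> (L2_norm S f + L2_norm S g)\<^sup>2"
    using L2_inner_le[OF f g] by (simp add: L2_inner_self power2_sum)
  finally show "(L2_norm S (\<lambda>y. f y + g y))\<^sup>2 \<le> (L2_norm S f + L2_norm S g)\<^sup>2" .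
qed (simp add: L2_norm_nonneg)

lemma L2_norm_cmult: "L2_norm S (\<lambda>y. c * f y) = \<bar>c\<bar> * L2_norm S f"
  by (simp add: L2_norm_def power_mult_distrib real_sqrt_mult)

lemma L2_norm_cong:
  assumes "f \<in> L2 S" "g \<in> L2 S" "AE y in lborel. y \<in> S \<longrightarrow> f y = g y"
  shows "L2_norm S f = L2_norm S g"
  using assms by (intro L2_norm_cong_AE) (auto simp: L2_def)

lemma L2_inner_fst:
  fixes p :: "real \<times> real \<Rightarrow> real" and g :: "real \<Rightarrow> real"
  assumes p: "p \<in> L2 (I \<times> J)" and g: "g \<in> L2 I" and J: "bounded J" "open J"
  shows "L2_inner (I \<times> J) p (\<lambda>y. g (fst y)) = L2_inner I (\<lambda>x. LINT z:J|lborel. p (x, z)) g"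
  using set_integrable_Times_fst(3)[OF L2_integrable_mult[OF p L2_fst[OF g J]]]
  by (simp add: L2_inner_def)

lemma L2_norm_fst:
  fixes g :: "real \<Rightarrow> real" and J :: "real set"
  assumes g: "g \<in> L2 I" and J: "bounded J" "open J"
  shows "L2_norm (I \<times> J) (\<lambda>y. g (fst y)) = sqrt (measure lborel J) * L2_norm I g"
proof -
  have "(LINT y:I \<times> J|lborel. (g (fst y))\<^sup>2) = (LINT x:I|lborel. LINT z:J|lborel. (g x)\<^sup>2)"
    using set_integrable_Times_fst(3)[of I J "\<lambda>y. (g (fst y))\<^sup>2"] L2_fst[OF g J] by (simp add: L2_def)
  also have "\<dots> = measure lborel J * (LINT x:I|lborel. (g x)\<^sup>2)"
    using J by (simp add: set_lebesgue_integral_def[of _ J] mult.commute)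
  finally show ?thesis by (simp add: L2_norm_def real_sqrt_mult)
qed

lemma L2_inner_weight_ge:
  assumes h: "h \<in> L2 S" and k: "set_borel_measurable lborel S k" "AE y in lborel. y \<in> S \<longrightarrow> \<bar>k y\<bar> \<le> M"
    and m: "AE y in lborel. y \<in> S \<longrightarrow> m \<le> k y"
  shows "m * (L2_norm S h)\<^sup>2 \<le> L2_inner S (\<lambda>y. k y * h y) h"
proof -
  have "(LINT y:S|lborel. m * (h y)\<^sup>2) \<le> (LINT y:S|lborel. k y * h y * h y)"
  proof (rule set_integral_mono_AE)
    show "set_integrable lborel S (\<lambda>y. m * (h y)\<^sup>2)" using h by (auto simp: L2_def)
    show "set_integrable lborel S (\<lambda>y. k y * h y * h y)" by (rule L2_integrable_mult[OF L2_bounded_mult[OF h k] h])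
    show "AE y\<in>S in lborel. m * (h y)\<^sup>2 \<le> k y * h y * h y"
      using m by eventually_elim (auto simp: power2_eq_square mult.assoc intro!: mult_right_mono)
  qed
  then show ?thesis by (simp add: L2_inner_def L2_norm_power2)
qed

lemma boundary_flux_eq:
  assumes "open R" "bounded R" and p: "p \<in> L2 R" and q: "q \<in> L2 R" and h: "h \<in> L2 R" and \<psi>: "\<psi> \<in> H1 R"
  shows "boundary_flux R p q h \<psi> = L2_inner R p (wDx R \<psi>) + L2_inner R q (wDz R \<psi>) - L2_inner R h \<psi>"
proof -
  have w: "wDx R \<psi> \<in> L2 R" "wDz R \<psi> \<in> L2 R"
    using H1_weak_partial(2)[OF assms(1,2) \<psi>] by (auto simp: Basis_real_pair)
  note i = L2_integrable_mult[OF p w(1)] L2_integrable_mult[OF q w(2)] L2_integrable_mult[OF h H1_L2[OF \<psi>]]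
  show ?thesis
    unfolding boundary_flux_def L2_inner_def
    using set_integral_diff(2)[OF set_integral_add(1)[OF i(1,2)] i(3)] set_integral_add(2)[OF i(1,2)] by simp
qed

lemma H1_subset:
  assumes f: "f \<in> H1 S" and T: "T \<subseteq> S" "open T" shows "f \<in> H1 T"
  unfolding H1_def
proof (intro CollectI conjI ballI)
  have L: "g \<in> L2 T" if "g \<in> L2 S" for g by (rule L2_subset[OF that T(1)]) (use T(2) in simp)
  show "f \<in> L2 T" by (rule L[OF H1_L2[OF f]])
  fix i :: 'a assume i: "i \<in> Basis"
  then obtain g where "g \<in> L2 S" "has_weak_partial S i f g" using f unfolding H1_def by blast
  then show "\<exists>g\<in>L2 T. has_weak_partial T i f g" using L has_weak_partial_subset[OF _ T(1) i] by blast
qed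

text \<open>Serves to differentiate the constraints of the two models, which hold almost everywhere
  only.\<close>

lemma weak_partial_of_zero:
  assumes S: "open S" and i: "i \<in> Basis" and w: "has_weak_partial S i f g"
    and f: "AE y in lborel. y \<in> S \<longrightarrow> f y = 0"
  shows "AE y in lborel. y \<in> S \<longrightarrow> g y = 0"
proof (rule has_weak_partial_unique[OF S i w])
  have lf: "locally_integrable S f" using w unfolding has_weak_partial_def by blast
  show "has_weak_partial S i f (\<lambda>y. 0)"
    unfolding has_weak_partial_def
  proof (intro conjI allI impI)
    show "locally_integrable S (\<lambda>y. 0)" by (simp add: locally_integrable_def set_integrable_def)
    fix \<phi> assume p: "test_function S \<phi>"
    have "(LINT y:S|lborel. f y * frechet_derivative \<phi> (at y) i) = (LINT y:S|lborel. 0)"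
      using f set_integrable_imp_measurable[OF locally_integrable_mult_test[OF lf test_function_deriv[OF p i]]]
      by (intro set_integral_cong_AE_real) (auto simp: set_borel_measurable_def elim!: eventually_mono)
    then show "(LINT y:S|lborel. f y * frechet_derivative \<phi> (at y) i) = - (LINT y:S|lborel. 0 * \<phi> y)" by simp
  qed (rule lf)
qed

text \<open>With zero trace at z = d the function is minus the integral of its vertical derivative
  from z up to d. Applied below the interface it bounds the second fluctuation, and its trace on the
  side where g_- acts, by the one derivative that carries the weight 1 / \<delta>.\<close>

lemma Poincare_zero_top_trace:
  fixes c d :: real
  assumes cd: "c < d" and X: "open X" "bounded X" and f: "f \<in> H1 (X \<times> {c<..<d})"
    and t: "has_trace_z X {c<..<d} d f (\<lambda>x. 0)"
  shows "L2_norm (X \<times> {c<..<d}) f \<le> (d - c) * L2_norm (X \<times> {c<..<d}) (wDz (X \<times> {c<..<d}) f)"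
    and "L2_norm X (trace_z X {c<..<d} c f) \<le> sqrt (d - c) * L2_norm (X \<times> {c<..<d}) (wDz (X \<times> {c<..<d}) f)"
    and "has_trace_z X {c<..<d} c f (trace_z X {c<..<d} c f)"
proof -
  let ?Z = "{c<..<d}" let ?R = "X \<times> ?Z" let ?g = "wDz ?R f"
  have R: "open ?R" "bounded ?R" using X by (auto intro: open_Times bounded_Times)
  have g: "?g \<in> L2 ?R" using H1_weak_partial(2)[OF R f] by (simp add: Basis_real_pair)
  have mf: "set_borel_measurable lborel ?R f" using H1_L2[OF f] by (simp add: L2_def)
  obtain \<tau> where \<tau>: "has_trace_z X ?Z c f \<tau>"
    "has_trace_z X ?Z d f (\<lambda>x. \<tau> x + (LINT z:?Z|lborel. ?g (x, z)))"
    "AE y in lborel. y \<in> ?R \<longrightarrow> f y = \<tau> (fst y) + (LINT s:{c<..<snd y}|lborel. ?g (fst y, s))"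
    using H1_z_representation[OF cd X f] by blast
  show tr: "has_trace_z X ?Z c f (trace_z X ?Z c f)" by (rule trace_z_works[OF \<tau>(1)])
  have z: "AE x in lborel. x \<in> X \<longrightarrow> \<tau> x + (LINT z:?Z|lborel. ?g (x, z)) = 0"
    by (rule has_trace_z_unique[OF cd _ X(1) mf \<tau>(2) t]) simp
  have tL: "trace_z X ?Z c f \<in> L2 X" using tr by (simp add: has_trace_z_def has_slice_trace_def)
  have gL: "(\<lambda>x. LINT z:?Z|lborel. ?g (x, z)) \<in> L2 X" by (rule L2_integral_snd(1)[OF g X(2,1)]) auto
  have "L2_norm X (trace_z X ?Z c f) = L2_norm X (\<lambda>x. (-1) * (LINT z:?Z|lborel. ?g (x, z)))"
  proof (rule L2_norm_cong[OF tL L2_cmult[OF gL]])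
    show "AE x in lborel. x \<in> X \<longrightarrow> trace_z X ?Z c f x = (-1) * (LINT z:?Z|lborel. ?g (x, z))"
      using trace_z_eq[OF cd _ X(1) mf \<tau>(1), simplified] z by eventually_elim auto
  qed
  also have "\<dots> \<le> sqrt (d - c) * L2_norm ?R ?g"
    unfolding L2_norm_cmult using L2_integral_snd(2)[OF g X(2,1)] cd by simp
  finally show "L2_norm X (trace_z X ?Z c f) \<le> sqrt (d - c) * L2_norm ?R ?g" .
  let ?G = "\<lambda>x. LINT s:?Z|lborel. (?g (x, s))\<^sup>2"
  have Gi: "set_integrable lborel X ?G" "(LINT x:X|lborel. ?G x) = (LINT y:?R|lborel. (?g y)\<^sup>2)"
    using set_integrable_Times_fst[of X ?Z "\<lambda>y. (?g y)\<^sup>2"] g by (simp_all add: L2_def)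
  have GR: "set_integrable lborel ?R (\<lambda>y. ?G (fst y))" by (rule set_integrable_fst[OF Gi(1)]) auto
  have le: "AE y in lborel. y \<in> ?R \<longrightarrow> (f y)\<^sup>2 \<le> (d - c) * ?G (fst y)"
    using \<tau>(3) AE_Times_fstI[OF z, of ?Z] AE_Times_fstI[OF L2_sections(1)[OF g], of ?Z]
  proof (eventually_elim, intro impI)
    fix y assume *: "y \<in> ?R \<longrightarrow> f y = \<tau> (fst y) + (LINT s:{c<..<snd y}|lborel. ?g (fst y, s))"
      "y \<in> ?R \<longrightarrow> \<tau> (fst y) + (LINT z:?Z|lborel. ?g (fst y, z)) = 0"
      "y \<in> ?R \<longrightarrow> (\<lambda>z. ?g (fst y, z)) \<in> L2 ?Z" and y: "y \<in> ?R"
    have gy: "(\<lambda>z. ?g (fst y, z)) \<in> L2 ?Z" using * y by blast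
    have yz: "c < snd y" "snd y < d" using y by (auto simp: mem_Times_iff)
    have "f y = - (LINT s:{snd y<..<d}|lborel. ?g (fst y, s))"
      using set_integral_split[OF L2_integrable[OF _ _ gy], of "snd y"] yz * y by auto
    then have "(f y)\<^sup>2 \<le> (d - snd y) * ?G (fst y)"
      using L2_interval_integral_le[OF gy, of "snd y" d] yz by simp
    also have "\<dots> \<le> (d - c) * ?G (fst y)"
      using yz by (intro mult_right_mono) (auto simp: set_lebesgue_integral_def)
    finally show "(f y)\<^sup>2 \<le> (d - c) * ?G (fst y)" .
  qed
  have "(LINT y:?R|lborel. (f y)\<^sup>2) \<le> (LINT y:?R|lborel. (d - c) * ?G (fst y))"
    by (rule set_integral_mono_AE) (use H1_L2[OF f] GR le in \<open>auto simp: L2_def\<close>)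
  also have "\<dots> = (d - c) * ((d - c) * (LINT y:?R|lborel. (?g y)\<^sup>2))"
  proof -
    have "(LINT y:?R|lborel. ?G (fst y)) = (LINT x:X|lborel. LINT z:?Z|lborel. ?G x)"
      using set_integrable_Times_fst(3)[OF GR] by simp
    also have "\<dots> = (d - c) * (LINT x:X|lborel. ?G x)"
      using cd by (simp add: set_lebesgue_integral_def[of _ ?Z "\<lambda>z. _::real"])
    finally show ?thesis by (simp add: Gi(2))
  qed
  finally have "(L2_norm ?R f)\<^sup>2 \<le> ((d - c) * L2_norm ?R ?g)\<^sup>2"
    by (simp add: L2_norm_power2 power_mult_distrib) (simp add: power2_eq_square mult.assoc)
  then show "L2_norm ?R f \<le> (d - c) * L2_norm ?R ?g"
    by (rule power2_le_imp_le) (use cd in \<open>simp add: L2_norm_nonneg\<close>)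
qed

lemma L2_divide:
  assumes "f \<in> L2 S" shows "(\<lambda>y. f y / c) \<in> L2 S"
  using L2_cmult[OF assms, of "inverse c"] by (simp add: divide_inverse mult.commute)

text \<open>Takes the place of the equation below the interface, which the limit model does not
  contain: integrated over z and with zero flux through the interface, only the data
  \<open>f\<close> and \<open>gm\<close> from below remain. Neither \<epsilon> nor a flux above the
  interface survives the subtraction.\<close>

lemma AP_L_lower_equation:
  fixes xm xp zm zi zp M0 :: real
  defines "X \<equiv> {xm<..<xp}" and "Z1 \<equiv> {zi<..<zp}" and "Z2 \<equiv> {zm<..<zi}"
  defines "R \<equiv> {xm<..<xp} \<times> {zm<..<zp}" and "R1 \<equiv> {xm<..<xp} \<times> {zi<..<zp}"
  assumes x: "xm < xp" and z: "zm < zi" "zi < zp"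
    and sol: "AP_L_solution xm xp zm zi zp Ax Az f gp gm \<epsilon> v v1 \<zeta>"
    and A: "set_borel_measurable lborel R Ax" "AE y in lborel. y \<in> R \<longrightarrow> \<bar>Ax y\<bar> \<le> M0"
    and q: "set_borel_measurable lborel R1 (\<lambda>y. Az y / \<epsilon> (snd y))"
      "AE y in lborel. y \<in> R1 \<longrightarrow> \<bar>Az y / \<epsilon> (snd y)\<bar> \<le> N0"
    and f: "f \<in> H1 R" and g: "gp \<in> L2 X" "gm \<in> L2 X" and \<psi>: "\<psi> \<in> space_W xm xp"
  shows "L2_inner X (\<lambda>x. (LINT z:Z2|lborel. Ax (x, z)) * (wD X v x + wD X (trace_z X Z1 zi v1) x)) (wD X \<psi>)
      = L2_inner X (\<lambda>x. LINT z:Z2|lborel. f (x, z)) \<psi> - L2_inner X gm \<psi>"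
proof -
  define L where "L = zp - zm"
  define t where "t = trace_z X Z1 zi v1"
  define R2 where "R2 = X \<times> Z2"
  have Lpos: "L > 0" using z by (simp add: L_def)
  have R1': "R1 = X \<times> Z1" by (simp add: R1_def X_def Z1_def)
  have ob: "open X" "bounded X" "open Z1" "bounded Z1" "open Z2" "bounded Z2" by (auto simp: X_def Z1_def Z2_def)
  have obR: "open R" "bounded R" "open R1" "bounded R1" "open R2" "bounded R2"
    using ob unfolding R_def R1' R2_def by (auto intro: open_Times bounded_Times)
  have sub: "R1 \<subseteq> R" "R2 \<subseteq> R" using z by (auto simp: R_def R1_def R2_def X_def Z2_def)
  have RT: "R = X \<times> {zm<..<zp}" by (simp add: R_def X_def)
  let ?S = "\<lambda>x. (LINT z:Z1|lborel. z_fluct zm zp Ax (x, z) * wDx R1 v1 (x, z)) + (LINT z:Z2|lborel. z_fluct zm zp Ax (x, z) * wD X t x)"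
  let ?p = "\<lambda>y. Ax y * (wDx R1 v1 y + wD X v (fst y))"
  let ?q = "\<lambda>y. Az y / \<epsilon> (snd y) * wDz R1 v1 y"
  have sv: "v \<in> space_W xm xp" "v1 \<in> space_V xm xp Z1" "t \<in> H1 X"
    and mean: "mean_equation xm xp L (z_mean zm zp Ax) (\<lambda>x. z_mean zm zp f x + gp x / L - gm x / L) ?S v"
    and up: "\<And>\<psi>. \<psi> \<in> space_V xm xp Z1 \<Longrightarrow> boundary_flux R1 ?p ?q f \<psi> = (LINT x:X|lborel. gp x * trace_z X Z1 zp \<psi> x)"
    and con: "AE x in lborel. x \<in> X \<longrightarrow> (LINT z:Z1|lborel. v1 (x, z)) + (zi - zm) * t x = 0"
    using sol unfolding AP_L_solution_def Let_def X_def[symmetric] Z1_def[symmetric] Z2_def[symmetric]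
      t_def[symmetric] L_def[symmetric] R1'[symmetric] by auto
  have H: "v \<in> H1 X" "v1 \<in> H1 R1" "\<psi> \<in> H1 X"
    using sv \<psi> space_V_H1[of v1 xm xp Z1] unfolding space_W_def R1_def X_def Z1_def by auto
  have w: "wD X v \<in> L2 X" "wD X t \<in> L2 X" "wD X \<psi> \<in> L2 X" "wDx R1 v1 \<in> L2 R1" "wDz R1 v1 \<in> L2 R1"
    using H1_weak_partial(2)[OF ob(1,2) H(1), of 1] H1_weak_partial(2)[OF ob(1,2) sv(3), of 1]
      H1_weak_partial(2)[OF ob(1,2) H(3), of 1] H1_weak_partial(2)[OF obR(3,4) H(2)] by (auto simp: Basis_real_pair)
  have pL2: "\<psi> \<in> L2 X" by (rule H1_L2[OF H(3)])
  have Ab: "Ax \<in> L2 R" by (rule AE_bounded_L2[OF obR(1,2) A])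
  have fL: "f \<in> L2 R" "f \<in> L2 R1" "f \<in> L2 R2" using H1_L2[OF f] L2_subset[OF H1_L2[OF f]] sub obR by auto
  have Ai: "set_integrable lborel (X \<times> {zm<..<zp}) Ax" "set_integrable lborel (X \<times> {zm<..<zp}) f"
    using L2_integrable[OF obR(2,1)] Ab fL(1) unfolding RT by auto
  define mA where "mA = z_mean zm zp Ax"
  define \<alpha>1 \<alpha>2 where "\<alpha>1 = (\<lambda>x. LINT z:Z1|lborel. Ax (x, z))" and "\<alpha>2 = (\<lambda>x. LINT z:Z2|lborel. Ax (x, z))"
  define F1 F2 where "F1 = (\<lambda>x. LINT z:Z1|lborel. f (x, z))" and "F2 = (\<lambda>x. LINT z:Z2|lborel. f (x, z))"
  define P where "P = (\<lambda>x. LINT z:Z1|lborel. ?p (x, z))"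
  define D1 where "D1 = (\<lambda>x. LINT z:Z1|lborel. wDx R1 v1 (x, z))"
  define \<sigma> where "\<sigma> = (\<lambda>x. wD X v x + wD X t x)"
  have \<sigma>L: "\<sigma> \<in> L2 X" unfolding \<sigma>_def by (intro L2_add w)
  have A1: "set_borel_measurable lborel R1 Ax" "AE y in lborel. y \<in> R1 \<longrightarrow> \<bar>Ax y\<bar> \<le> M0"
    and A2: "set_borel_measurable lborel R2 Ax" "AE y in lborel. y \<in> R2 \<longrightarrow> \<bar>Ax y\<bar> \<le> M0"
    using set_borel_measurable_subset[OF A(1)] A(2) sub obR by (auto elim!: eventually_mono)
  have A12: "Ax \<in> L2 R1" "Ax \<in> L2 R2" using AE_bounded_L2[OF obR(3,4) A1] AE_bounded_L2[OF obR(5,6) A2] by auto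
  have pL: "?p \<in> L2 R1"
    by (rule L2_bounded_mult[OF L2_add[OF w(4)] A1]) (use L2_fst[OF w(1) ob(4,3)] in \<open>simp add: R1'\<close>)
  have qL: "?q \<in> L2 R1" by (rule L2_bounded_mult[OF w(5) q])
  have split: "AE x in lborel. x \<in> X \<longrightarrow> (LINT z:{zm<..<zp}|lborel. h (x, z)) = (LINT z:Z1|lborel. h (x, z)) + (LINT z:Z2|lborel. h (x, z))"
    if "set_integrable lborel (X \<times> {zm<..<zp}) h" for h :: "real \<times> real \<Rightarrow> real"
    using set_integrable_Times_fst(1)[OF that]
  proof (eventually_elim, intro impI)
    fix x assume "x \<in> X \<longrightarrow> set_integrable lborel {zm<..<zp} (\<lambda>z. h (x, z))" "x \<in> X"
    then have "set_integrable lborel {zm<..<zp} (\<lambda>z. h (x, z))" by blast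
    from set_integral_split[OF this z]
    show "(LINT z:{zm<..<zp}|lborel. h (x, z)) = (LINT z:Z1|lborel. h (x, z)) + (LINT z:Z2|lborel. h (x, z))"
      by (simp add: Z1_def Z2_def)
  qed
  have s1: "AE x in lborel. x \<in> X \<longrightarrow> L * mA x = \<alpha>1 x + \<alpha>2 x" "AE x in lborel. x \<in> X \<longrightarrow> L * z_mean zm zp f x = F1 x + F2 x"
    using split[OF Ai(1)] split[OF Ai(2)] Lpos
    by (auto simp: mA_def z_mean_def \<alpha>1_def \<alpha>2_def F1_def F2_def L_def elim!: eventually_mono)
  have zL: "z_mean zm zp h \<in> L2 X" if h: "h \<in> L2 R" for h
    unfolding z_mean_def[abs_def]
    by (rule L2_cmult[OF L2_integral_snd(1)[OF h[unfolded RT] ob(2,1)]]) auto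
  have mAL: "mA \<in> L2 X" and mfL: "z_mean zm zp f \<in> L2 X" unfolding mA_def using zL Ab fL(1) by auto
  have mAb: "AE x in lborel. x \<in> X \<longrightarrow> \<bar>mA x\<bar> \<le> M0"
  proof -
    have "AE x in lborel. x \<in> X \<longrightarrow> \<bar>LINT z:{zm<..<zp}|lborel. Ax (x, z)\<bar> \<le> M0 * (zp - zm)"
      by (rule integral_snd_AE_bounded[OF _ Ai(1) A(2)[unfolded RT]]) (use z in auto)
    then show ?thesis
      by eventually_elim (use Lpos in \<open>auto simp: mA_def z_mean_def L_def abs_mult divide_le_eq\<close>)
  qed
  have mAm: "set_borel_measurable lborel X mA" using mAL by (simp add: L2_def)
  have fl: "set_borel_measurable lborel R (z_fluct zm zp Ax)" "AE y in lborel. y \<in> R \<longrightarrow> \<bar>z_fluct zm zp Ax y\<bar> \<le> 2 * M0"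
  proof -
    have "(\<lambda>y. mA (fst y)) \<in> L2 R" unfolding RT by (rule L2_fst[OF mAL]) auto
    from L2_diff[OF Ab this] show "set_borel_measurable lborel R (z_fluct zm zp Ax)"
      by (simp add: L2_def z_fluct_def[abs_def] mA_def)
    show "AE y in lborel. y \<in> R \<longrightarrow> \<bar>z_fluct zm zp Ax y\<bar> \<le> 2 * M0"
      using A(2) AE_Times_fstI[OF mAb, of "{zm<..<zp}"] by eventually_elim (auto simp: z_fluct_def mA_def RT)
  qed
  have fl1: "(\<lambda>y. z_fluct zm zp Ax y * wDx R1 v1 y) \<in> L2 R1"
    using fl sub obR by (intro L2_bounded_mult[OF w(4), of _ "2 * M0"] set_borel_measurable_subset[OF fl(1)]) (auto elim!: eventually_mono)
  have fl2: "(\<lambda>y. z_fluct zm zp Ax y * wD X t (fst y)) \<in> L2 R2"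
  proof (rule L2_bounded_mult[of _ _ _ "2 * M0"])
    show "(\<lambda>y. wD X t (fst y)) \<in> L2 R2" unfolding R2_def by (rule L2_fst[OF w(2) ob(6,5)])
  qed (use fl sub obR in \<open>auto intro!: set_borel_measurable_subset[OF fl(1)] elim!: eventually_mono\<close>)
  have SL: "?S \<in> L2 X"
    using L2_integral_snd(1)[OF fl1[unfolded R1']] L2_integral_snd(1)[OF fl2[unfolded R2_def]] ob
    by (intro L2_add) (auto simp: R1')
  have PL: "P \<in> L2 X" unfolding P_def using L2_integral_snd(1)[OF pL[unfolded R1']] ob by (auto simp: R1')
  have F12: "F1 \<in> L2 X" "F2 \<in> L2 X"
    unfolding F1_def F2_def using L2_integral_snd(1)[OF fL(2)[unfolded R1']] L2_integral_snd(1)[OF fL(3)[unfolded R2_def]] ob by auto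
  have \<alpha>2L: "\<alpha>2 \<in> L2 X" unfolding \<alpha>2_def using L2_integral_snd(1)[OF A12(2)[unfolded R2_def]] ob by auto
  have \<alpha>\<sigma>: "(\<lambda>x. \<alpha>2 x * \<sigma> x) \<in> L2 X"
  proof (rule L2_bounded_mult[OF \<sigma>L])
    show "set_borel_measurable lborel X \<alpha>2" using \<alpha>2L by (simp add: L2_def)
    show "AE x in lborel. x \<in> X \<longrightarrow> \<bar>\<alpha>2 x\<bar> \<le> M0 * (zi - zm)"
      unfolding \<alpha>2_def Z2_def using L2_integrable[OF obR(6,5) A12(2)] A2(2) z
      by (intro integral_snd_AE_bounded) (auto simp: R2_def Z2_def)
  qed
  \<comment> \<open>The constraint, differentiated in x.\<close>
  have s3: "AE x in lborel. x \<in> X \<longrightarrow> D1 x + (zi - zm) * wD X t x = 0"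
  proof (rule weak_partial_of_zero[OF ob(1) _ _ con])
    have "has_weak_partial R1 (1, 0) v1 (wDx R1 v1)" using H1_weak_partial(1)[OF obR(3,4) H(2)] by (simp add: Basis_real_pair)
    then have "has_weak_partial X 1 (\<lambda>x. LINT z:Z1|lborel. v1 (x, z)) D1"
      using H1_integral_snd(1)[OF x ob(3,4)] H1_L2[OF H(2)] w(4) unfolding D1_def R1' X_def by auto
    then show "has_weak_partial X 1 (\<lambda>x. (LINT z:Z1|lborel. v1 (x, z)) + (zi - zm) * t x) (\<lambda>x. D1 x + (zi - zm) * wD X t x)"
      using H1_weak_partial(1)[OF ob(1,2) sv(3), of 1] by (intro has_weak_partial_add has_weak_partial_cmult) auto
  qed auto
  \<comment> \<open>The left side is \<open>L\<close> times the flux of the mean equation. With the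
    fluctuation written as \<open>Ax\<close> minus its mean, the terms carrying the mean combine to
    the differentiated constraint and vanish. There remain the upper flux integrated over z,
    \<open>P\<close>, and the flux \<open>\<alpha>2 x * \<sigma> x\<close> below the
    interface.\<close>
  have s2: "AE x in lborel. x \<in> X \<longrightarrow> L * (mA x * wD X v x) + ?S x = P x + \<alpha>2 x * \<sigma> x"
    using s1(1) s3 set_integrable_Times_fst(1)[OF L2_integrable[OF obR(4,3) w(4), unfolded R1']]
      set_integrable_Times_fst(1)[OF L2_integrable[OF obR(4,3) A12(1), unfolded R1']]
      set_integrable_Times_fst(1)[OF L2_integrable[OF obR(6,5) A12(2), unfolded R2_def]]
      set_integrable_Times_fst(1)[OF L2_integrable_mult[OF A12(1) w(4), unfolded R1']]
  proof (eventually_elim, intro impI)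
    fix x assume *: "x \<in> X \<longrightarrow> L * mA x = \<alpha>1 x + \<alpha>2 x" "x \<in> X \<longrightarrow> D1 x + (zi - zm) * wD X t x = 0"
      "x \<in> X \<longrightarrow> set_integrable lborel Z1 (\<lambda>z. wDx (X \<times> Z1) v1 (x, z))"
      "x \<in> X \<longrightarrow> set_integrable lborel Z1 (\<lambda>z. Ax (x, z))" "x \<in> X \<longrightarrow> set_integrable lborel Z2 (\<lambda>z. Ax (x, z))"
      "x \<in> X \<longrightarrow> set_integrable lborel Z1 (\<lambda>z. Ax (x, z) * wDx (X \<times> Z1) v1 (x, z))" and x: "x \<in> X"
    let ?J = "LINT z:Z1|lborel. Ax (x, z) * wDx R1 v1 (x, z)"
    have i: "set_integrable lborel Z1 (\<lambda>z. wDx R1 v1 (x, z))" "set_integrable lborel Z1 (\<lambda>z. Ax (x, z))"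
      "set_integrable lborel Z2 (\<lambda>z. Ax (x, z))" "set_integrable lborel Z1 (\<lambda>z. Ax (x, z) * wDx R1 v1 (x, z))"
      using * x unfolding R1' by auto
    have c2: "set_integrable lborel Z2 (\<lambda>z. mA x)" "(LINT z:Z2|lborel. mA x) = mA x * (zi - zm)"
      using L2_integrable[OF ob(6,5) L2_const[OF ob(6,5)]] z by (simp_all add: set_lebesgue_integral_def Z2_def)
    have "(LINT z:Z1|lborel. z_fluct zm zp Ax (x, z) * wDx R1 v1 (x, z)) = (LINT z:Z1|lborel. Ax (x, z) * wDx R1 v1 (x, z) - mA x * wDx R1 v1 (x, z))"
      by (simp add: z_fluct_def mA_def left_diff_distrib)
    also have "\<dots> = ?J - mA x * D1 x"
      using set_integral_diff(2)[OF i(4) set_integrable_mult_right[OF i(1), of "mA x"]] by (simp add: D1_def)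
    finally have S1: "(LINT z:Z1|lborel. z_fluct zm zp Ax (x, z) * wDx R1 v1 (x, z)) = ?J - mA x * D1 x" .
    have "(LINT z:Z2|lborel. z_fluct zm zp Ax (x, z) * wD X t x) = (LINT z:Z2|lborel. Ax (x, z) - mA x) * wD X t x"
      by (simp add: z_fluct_def mA_def)
    also have "(LINT z:Z2|lborel. Ax (x, z) - mA x) = \<alpha>2 x - mA x * (zi - zm)"
      using set_integral_diff(2)[OF i(3) c2(1)] c2(2) by (simp add: \<alpha>2_def)
    finally have S2: "(LINT z:Z2|lborel. z_fluct zm zp Ax (x, z) * wD X t x) = (\<alpha>2 x - mA x * (zi - zm)) * wD X t x" .
    have "P x = (LINT z:Z1|lborel. Ax (x, z) * wDx R1 v1 (x, z) + Ax (x, z) * wD X v x)"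
      by (simp add: P_def distrib_left)
    also have "\<dots> = ?J + \<alpha>1 x * wD X v x"
      using set_integral_add(2)[OF i(4) set_integrable_mult_left[OF i(2), of "wD X v x"]] by (simp add: \<alpha>1_def)
    finally have P: "P x = ?J + \<alpha>1 x * wD X v x" .
    have e: "L * mA x = \<alpha>1 x + \<alpha>2 x" "D1 x + (zi - zm) * wD X t x = 0" using * x by auto
    have "L * (mA x * wD X v x) + ?S x - (P x + \<alpha>2 x * \<sigma> x) =
        (L * mA x - \<alpha>1 x - \<alpha>2 x) * wD X v x - mA x * (D1 x + (zi - zm) * wD X t x)"
      unfolding S1 S2 P \<sigma>_def by (simp add: algebra_simps)
    then show "L * (mA x * wD X v x) + ?S x = P x + \<alpha>2 x * \<sigma> x" using e by simp
  qed

  \<comment> \<open>Testing the mean equation and the equation above the interface with a function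
    of x\<close>
  have mAv: "(\<lambda>x. mA x * wD X v x) \<in> L2 X" by (rule L2_bounded_mult[OF w(1) mAm mAb])
  have gL: "(\<lambda>x. gp x / L) \<in> L2 X" "(\<lambda>x. gm x / L) \<in> L2 X" using L2_divide[OF g(1)] L2_divide[OF g(2)] by auto
  let ?h = "\<lambda>x. z_mean zm zp f x + gp x / L - gm x / L"
  have hL: "?h \<in> L2 X" by (intro L2_diff L2_add mfL gL)
  have m: "L2_inner X (\<lambda>x. mA x * wD X v x) (wD X \<psi>) = L2_inner X ?h \<psi> - (1 / L) * L2_inner X ?S (wD X \<psi>)"
    using mean \<psi> unfolding mean_equation_def L2_inner_def mA_def X_def by blast
  have "L2_inner X (\<lambda>x. P x + \<alpha>2 x * \<sigma> x) (wD X \<psi>) = L2_inner X (\<lambda>x. L * (mA x * wD X v x) + ?S x) (wD X \<psi>)"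
    using s2 by (intro L2_inner_cong L2_add L2_cmult PL \<alpha>\<sigma> mAv SL w) (auto elim!: eventually_mono)
  also have "\<dots> = L * L2_inner X (\<lambda>x. mA x * wD X v x) (wD X \<psi>) + L2_inner X ?S (wD X \<psi>)"
    unfolding L2_inner_add_left[OF L2_cmult[OF mAv] SL w(3)] L2_inner_cmult_left ..
  also have "\<dots> = L2_inner X (\<lambda>x. L * ?h x) \<psi>"
    unfolding m L2_inner_cmult_left using Lpos by (simp add: algebra_simps)
  also have "\<dots> = L2_inner X (\<lambda>x. F1 x + F2 x + gp x - gm x) \<psi>"
  proof (rule L2_inner_cong[OF L2_cmult[OF hL] _ pL2 pL2])
    show "(\<lambda>x. F1 x + F2 x + gp x - gm x) \<in> L2 X" by (intro L2_diff L2_add F12 g)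
    show "AE x in lborel. x \<in> X \<longrightarrow> L * ?h x = F1 x + F2 x + gp x - gm x"
      using s1(2) by eventually_elim (use Lpos in \<open>auto simp: algebra_simps\<close>)
  qed auto
  also have "\<dots> = L2_inner X F1 \<psi> + L2_inner X F2 \<psi> + L2_inner X gp \<psi> - L2_inner X gm \<psi>"
    unfolding L2_inner_diff_left[OF L2_add[OF L2_add[OF F12] g(1)] g(2) pL2] L2_inner_add_left[OF L2_add[OF F12] g(1) pL2]
      L2_inner_add_left[OF F12 pL2] ..
  finally have e1: "L2_inner X P (wD X \<psi>) + L2_inner X (\<lambda>x. \<alpha>2 x * \<sigma> x) (wD X \<psi>)
      = L2_inner X F1 \<psi> + L2_inner X F2 \<psi> + L2_inner X gp \<psi> - L2_inner X gm \<psi>"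
    unfolding L2_inner_add_left[OF PL \<alpha>\<sigma> w(3)] .
  \<comment> \<open>Being constant in z, this test function does not see the vertical flux, so the
    upper equation becomes an equation in x for \<open>P\<close>; subtracting it leaves the part
    below the interface.\<close>
  let ?\<psi> = "\<lambda>y. \<psi> (fst y)"
  note F = H1_fst[OF ob(1,2) H(3), of zi zp, folded Z1_def, folded R1']
  have F\<psi>: "?\<psi> \<in> space_V xm xp Z1" unfolding Z1_def by (rule space_V_fst[OF \<psi>])
  have wF: "wDx R1 ?\<psi> \<in> L2 R1" "wDz R1 ?\<psi> \<in> L2 R1"
    using H1_weak_partial(2)[OF obR(3,4) F(1)] by (auto simp: Basis_real_pair)
  have b: "boundary_flux R1 ?p ?q f ?\<psi> = L2_inner R1 ?p (wDx R1 ?\<psi>) + L2_inner R1 ?q (wDz R1 ?\<psi>) - L2_inner R1 f ?\<psi>"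
    by (rule boundary_flux_eq[OF obR(3,4) pL qL fL(2) F(1)])
  have "L2_inner R1 ?p (wDx R1 ?\<psi>) = L2_inner R1 ?p (\<lambda>y. wD X \<psi> (fst y))"
    using L2_fst[OF w(3) ob(4,3)] by (intro L2_inner_cong pL wF F) (auto simp: R1')
  also have "\<dots> = L2_inner X P (wD X \<psi>)"
    unfolding P_def R1' by (rule L2_inner_fst[OF pL[unfolded R1'] w(3) ob(4,3)])
  finally have b1: "L2_inner R1 ?p (wDx R1 ?\<psi>) = L2_inner X P (wD X \<psi>)" .
  have "L2_inner R1 ?q (wDz R1 ?\<psi>) = L2_inner R1 ?q (\<lambda>y. 0)"
    using L2_const[OF obR(4,3)] by (intro L2_inner_cong qL wF F) auto
  then have b2: "L2_inner R1 ?q (wDz R1 ?\<psi>) = 0" by (simp add: L2_inner_def)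
  have b3: "L2_inner R1 f ?\<psi> = L2_inner X F1 \<psi>"
    unfolding F1_def R1' by (rule L2_inner_fst[OF fL(2)[unfolded R1'] pL2 ob(4,3)])
  have tr: "has_trace_z X Z1 zp ?\<psi> \<psi>" "AE x in lborel. x \<in> X \<longrightarrow> trace_z X Z1 zp ?\<psi> x = \<psi> x"
    unfolding Z1_def by (rule trace_z_fst[OF z(2) _ ob(1) pL2]; simp)+
  have trL: "trace_z X Z1 zp ?\<psi> \<in> L2 X"
    using trace_z_works[OF tr(1)] by (simp add: has_trace_z_def has_slice_trace_def)
  have "L2_inner X gp (trace_z X Z1 zp ?\<psi>) = L2_inner X gp \<psi>"
    by (rule L2_inner_cong[OF g(1) g(1) trL pL2 _ tr(2)]) simp
  then have "boundary_flux R1 ?p ?q f ?\<psi> = L2_inner X gp \<psi>"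
    using up[OF F\<psi>] by (simp add: L2_inner_def)
  then have "L2_inner X P (wD X \<psi>) - L2_inner X F1 \<psi> = L2_inner X gp \<psi>" using b b1 b2 b3 by simp
  then show ?thesis using e1 unfolding \<alpha>2_def \<sigma>_def F2_def t_def by simp
qed

text \<open>
  The test functions \<open>\<psi>1\<close> and \<open>\<psi>2\<close> in the proof are the parts above and below the interface of the
  difference of the reassembled solutions \<open>(u + u1, u + t + \<xi>)\<close> and \<open>(v + v1, v + s)\<close>.
\<close>

lemma AP_difference_estimate:
  fixes xm xp zm zi zp M0 N0 M mx mz \<delta> :: real
    and f :: "real \<times> real \<Rightarrow> real" and gp gm :: "real \<Rightarrow> real"
  defines "X \<equiv> {xm<..<xp}" and "Z1 \<equiv> {zi<..<zp}" and "Z2 \<equiv> {zm<..<zi}"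
  defines "R \<equiv> {xm<..<xp} \<times> {zm<..<zp}" and "R1 \<equiv> {xm<..<xp} \<times> {zi<..<zp}" and "R2 \<equiv> {xm<..<xp} \<times> {zm<..<zi}"
  defines "K \<equiv> (zi - zm) * L2_norm R2 f + M * (sqrt (measure lborel R2) * (zi - zm)) + sqrt (zi - zm) * L2_norm X gm"
  defines "C0 \<equiv> K / (2 * sqrt (mz * mx))"
  defines "C1 \<equiv> (sqrt (zp - zi) * C0 + sqrt (zi - zm) * C0) / (zp - zm)"
  assumes x: "xm < xp" and z: "zm < zi" "zi < zp"
    and ap: "AP_AP_solution xm xp zm zi zp Ax Az f gp gm \<epsilon> u u1 \<xi>"
    and al: "AP_L_solution xm xp zm zi zp Ax Az f gp gm \<epsilon> v v1 \<zeta>"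
    and A: "set_borel_measurable lborel R Ax" "AE y in lborel. y \<in> R \<longrightarrow> \<bar>Ax y\<bar> \<le> M0"
      "AE y in lborel. y \<in> R \<longrightarrow> mx \<le> Ax y"
    and q: "set_borel_measurable lborel R (\<lambda>y. Az y / \<epsilon> (snd y))"
      "AE y in lborel. y \<in> R \<longrightarrow> \<bar>Az y / \<epsilon> (snd y)\<bar> \<le> N0"
      "AE y in lborel. y \<in> R1 \<longrightarrow> mz \<le> Az y / \<epsilon> (snd y)"
      "AE y in lborel. y \<in> R2 \<longrightarrow> mz / \<delta> \<le> Az y / \<epsilon> (snd y)"
    and pos: "0 < mx" "0 < mz" "0 < \<delta>" "0 \<le> M"
    and f: "f \<in> H1 R" and g: "gp \<in> L2 X" "gm \<in> L2 X"
    and flux: "\<And>\<sigma> \<xi>. \<sigma> \<in> L2 X \<Longrightarrow> (LINT x:X|lborel. \<sigma> x) = 0 \<Longrightarrow>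
      (\<And>\<psi>. \<psi> \<in> space_W xm xp \<Longrightarrow> (LINT x:X|lborel. (LINT z:Z2|lborel. Ax (x, z)) * \<sigma> x * wD X \<psi> x) =
         (LINT x:X|lborel. (LINT z:Z2|lborel. f (x, z)) * \<psi> x) - (LINT x:X|lborel. gm x * \<psi> x)) \<Longrightarrow>
      \<xi> \<in> space_V xm xp Z2 \<Longrightarrow>
      \<bar>LINT y:R2|lborel. Ax y * \<sigma> (fst y) * wDx R2 \<xi> y\<bar> \<le> M * (LINT y:R2|lborel. \<bar>\<xi> y\<bar>)"
  shows "L2_norm X (wD X (\<lambda>x. u x - v x)) \<le> C1 * sqrt \<delta>"
    and "L2_norm R1 (wDx R1 (\<lambda>y. u1 y - v1 y)) \<le> (C0 + sqrt (zp - zi) * C1) * sqrt \<delta>"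
    and "L2_norm R1 (wDz R1 (\<lambda>y. u1 y - v1 y)) \<le> K / (2 * mz) * sqrt \<delta>"
proof -
  let ?\<kappa> = "\<lambda>y. Az y / \<epsilon> (snd y)"
  have R1': "R1 = X \<times> Z1" and R2': "R2 = X \<times> Z2" by (simp_all add: R1_def R2_def X_def Z1_def Z2_def)
  have ob: "open X" "bounded X" "open Z1" "bounded Z1" "open Z2" "bounded Z2" by (auto simp: X_def Z1_def Z2_def)
  have obR: "open R" "bounded R" "open R1" "bounded R1" "open R2" "bounded R2"
    using ob unfolding R_def R1' R2' by (auto intro: open_Times bounded_Times)
  have sub: "R1 \<subseteq> R" "R2 \<subseteq> R" using z by (auto simp: R_def R1_def R2_def)
  have sR: "R1 \<in> sets lborel" "R2 \<in> sets lborel" using obR by auto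
  have mZ: "measure lborel Z1 = zp - zi" "measure lborel Z2 = zi - zm" using z by (simp_all add: Z1_def Z2_def)
  define t s where "t = trace_z X Z1 zi u1" and "s = trace_z X Z1 zi v1"
  let ?pu = "\<lambda>y. Ax y * (wDx R1 u1 y + wD X u (fst y))"
  let ?qu = "\<lambda>y. Az y / \<epsilon> (snd y) * wDz R1 u1 y"
  let ?p2 = "\<lambda>y. Ax y * (wDx R2 \<xi> y + wD X t (fst y) + wD X u (fst y))"
  let ?q2 = "\<lambda>y. Az y / \<epsilon> (snd y) * wDz R2 \<xi> y"
  let ?pv = "\<lambda>y. Ax y * (wDx R1 v1 y + wD X v (fst y))"
  let ?qv = "\<lambda>y. Az y / \<epsilon> (snd y) * wDz R1 v1 y"
  have su: "u \<in> space_W xm xp" "u1 \<in> space_V xm xp Z1" "\<xi> \<in> space_V0 xm xp Z2 zi" "t \<in> H1 X"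
    and couple: "\<And>\<psi>1 \<psi>2. \<psi>1 \<in> space_V xm xp Z1 \<Longrightarrow> \<psi>2 \<in> space_V xm xp Z2 \<Longrightarrow>
       (AE x in lborel. x \<in> X \<longrightarrow> trace_z X Z1 zi \<psi>1 x = trace_z X Z2 zi \<psi>2 x) \<Longrightarrow>
       (LINT x:X|lborel. gp x * trace_z X Z1 zp \<psi>1 x) - boundary_flux R1 ?pu ?qu f \<psi>1 =
       boundary_flux R2 ?p2 ?q2 f \<psi>2 + (LINT x:X|lborel. gm x * trace_z X Z2 zm \<psi>2 x)"
    and conu: "AE x in lborel. x \<in> X \<longrightarrow> (LINT z:Z1|lborel. u1 (x, z)) + (zi - zm) * t x + (LINT z:Z2|lborel. \<xi> (x, z)) = 0"
    using ap unfolding AP_AP_solution_def Let_def X_def[symmetric] Z1_def[symmetric] Z2_def[symmetric]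
      t_def[symmetric] R1'[symmetric] R2'[symmetric] by auto
  have sv: "v \<in> space_W xm xp" "v1 \<in> space_V xm xp Z1" "s \<in> H1 X"
    and up: "\<And>\<psi>. \<psi> \<in> space_V xm xp Z1 \<Longrightarrow> boundary_flux R1 ?pv ?qv f \<psi> = (LINT x:X|lborel. gp x * trace_z X Z1 zp \<psi> x)"
    and conv: "AE x in lborel. x \<in> X \<longrightarrow> (LINT z:Z1|lborel. v1 (x, z)) + (zi - zm) * s x = 0"
    using al unfolding AP_L_solution_def Let_def X_def[symmetric] Z1_def[symmetric] Z2_def[symmetric]
      s_def[symmetric] R1'[symmetric] by auto
  have sx: "\<xi> \<in> space_V xm xp Z2" "has_trace_z X Z2 zi \<xi> (\<lambda>x. 0)" using su(3) unfolding space_V0_def X_def by auto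
  \<comment> \<open>With both traces in \<open>space_W\<close>, \<tau> and \<eta> become admissible
    test functions and \<sigma> acquires mean zero.\<close>
  have tW: "t \<in> space_W xm xp" "s \<in> space_W xm xp"
    using trace_in_space_W[OF x z(2)] su sv unfolding t_def s_def X_def Z1_def by auto
  \<comment> \<open>\<eta> is the common interface value of the two parts of the difference.
    Differences are written as sums with the factor -1, the form in which the linearity lemmas are
    stated.\<close>
  define w w1 \<tau> \<eta> where "w = (\<lambda>x. u x + (-1) * v x)" and "w1 = (\<lambda>y. u1 y + (-1) * v1 y)"
    and "\<tau> = (\<lambda>x. t x + (-1) * s x)" and "\<eta> = (\<lambda>x. u x + (-1) * v x + 1 * (t x + (-1) * s x))"
  define \<psi>1 \<psi>2 where "\<psi>1 = (\<lambda>y. w1 y + 1 * w (fst y))" and "\<psi>2 = (\<lambda>y. \<xi> y + 1 * \<eta> (fst y))"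
  define \<sigma> where "\<sigma> = (\<lambda>x. wD X v x + wD X s x)"
  have wW: "w \<in> space_W xm xp" "\<tau> \<in> space_W xm xp" "\<eta> \<in> space_W xm xp"
    unfolding w_def \<tau>_def \<eta>_def by (intro space_W_add_cmult(1)[OF x] su sv tW)+
  have Dw: "AE x in lborel. x \<in> X \<longrightarrow> wD X w x = wD X u x + (-1) * wD X v x"
    "AE x in lborel. x \<in> X \<longrightarrow> wD X \<tau> x = wD X t x + (-1) * wD X s x"
    unfolding w_def \<tau>_def X_def by (intro space_W_add_cmult(2)[OF x] su sv tW)+
  have "AE x in lborel. x \<in> X \<longrightarrow> wD X \<eta> x = wD X w x + 1 * wD X \<tau> x"
    using space_W_add_cmult(2)[OF x wW(1,2), of 1] unfolding \<eta>_def w_def \<tau>_def X_def .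
  with Dw have D\<eta>: "AE x in lborel. x \<in> X \<longrightarrow> wD X \<eta> x = wD X u x - wD X v x + wD X t x - wD X s x"
    by eventually_elim auto
  have HW: "h \<in> H1 X" "h \<in> L2 X" "wD X h \<in> L2 X" if "h \<in> space_W xm xp" for h
    using that H1_weak_partial(2)[OF ob(1,2), of h 1] H1_L2[of h X] unfolding space_W_def X_def by auto
  note Wd = HW(3)[OF su(1)] HW(3)[OF sv(1)] HW(3)[OF tW(1)] HW(3)[OF tW(2)] HW(3)[OF wW(1)] HW(3)[OF wW(3)]
  have \<sigma>L: "\<sigma> \<in> L2 X" unfolding \<sigma>_def by (intro L2_add Wd)
  have V1: "w1 \<in> space_V xm xp Z1" "(\<lambda>y. w (fst y)) \<in> space_V xm xp Z1" "\<psi>1 \<in> space_V xm xp Z1"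
  proof -
    show 1: "w1 \<in> space_V xm xp Z1" unfolding w1_def Z1_def by (rule space_V_add_cmult[OF su(2)[unfolded Z1_def] sv(2)[unfolded Z1_def]])
    show 2: "(\<lambda>y. w (fst y)) \<in> space_V xm xp Z1" unfolding Z1_def by (rule space_V_fst[OF wW(1)])
    show "\<psi>1 \<in> space_V xm xp Z1" using space_V_add_cmult[OF 1[unfolded Z1_def] 2[unfolded Z1_def]] unfolding \<psi>1_def Z1_def .
  qed
  have V2: "(\<lambda>y. \<eta> (fst y)) \<in> space_V xm xp Z2" "\<psi>2 \<in> space_V xm xp Z2"
  proof -
    show 2: "(\<lambda>y. \<eta> (fst y)) \<in> space_V xm xp Z2" unfolding Z2_def by (rule space_V_fst[OF wW(3)])
    show "\<psi>2 \<in> space_V xm xp Z2" using space_V_add_cmult[OF sx(1)[unfolded Z2_def] 2[unfolded Z2_def]] unfolding \<psi>2_def Z2_def .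
  qed
  have HV1: "h \<in> H1 R1" "h \<in> L2 R1" "wDx R1 h \<in> L2 R1" "wDz R1 h \<in> L2 R1" if "h \<in> space_V xm xp Z1" for h
  proof -
    show H: "h \<in> H1 R1" using space_V_H1[OF that] by (simp add: R1' X_def)
    show "h \<in> L2 R1" by (rule H1_L2[OF H])
    show "wDx R1 h \<in> L2 R1" "wDz R1 h \<in> L2 R1" using H1_weak_partial(2)[OF obR(3,4) H] by (auto simp: Basis_real_pair)
  qed
  have HV2: "h \<in> H1 R2" "h \<in> L2 R2" "wDx R2 h \<in> L2 R2" "wDz R2 h \<in> L2 R2" if "h \<in> space_V xm xp Z2" for h
  proof -
    show H: "h \<in> H1 R2" using space_V_H1[OF that] by (simp add: R2' X_def)
    show "h \<in> L2 R2" by (rule H1_L2[OF H])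
    show "wDx R2 h \<in> L2 R2" "wDz R2 h \<in> L2 R2" using H1_weak_partial(2)[OF obR(5,6) H] by (auto simp: Basis_real_pair)
  qed
  note L1 = HV1[OF su(2)] HV1[OF sv(2)] HV1[OF V1(1)] HV1[OF V1(3)]
  note L2' = HV2[OF sx(1)] HV2[OF V2(2)]
  have B: "(1, 0) \<in> (Basis :: (real \<times> real) set)" "(0, 1) \<in> (Basis :: (real \<times> real) set)" by (auto simp: Basis_real_pair)
  have fst1: "(\<lambda>y. h (fst y)) \<in> L2 R1" if "h \<in> L2 X" for h unfolding R1' by (rule L2_fst[OF that ob(4,3)])
  have fst2: "(\<lambda>y. h (fst y)) \<in> L2 R2" if "h \<in> L2 X" for h unfolding R2' by (rule L2_fst[OF that ob(6,5)])

  \<comment> \<open>Derivatives of the two test functions\<close>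
  note Fw = H1_fst[OF ob(1,2) HW(1)[OF wW(1)], of zi zp, folded Z1_def, folded R1']
  note F\<eta> = H1_fst[OF ob(1,2) HW(1)[OF wW(3)], of zm zi, folded Z2_def, folded R2']
  have dw1: "AE y in lborel. y \<in> R1 \<longrightarrow> wDx R1 w1 y = wDx R1 u1 y + (-1) * wDx R1 v1 y"
    "AE y in lborel. y \<in> R1 \<longrightarrow> wDz R1 w1 y = wDz R1 u1 y + (-1) * wDz R1 v1 y"
    unfolding w1_def by (intro H1_add_cmult(2)[OF obR(3,4)] L1 B)+
  have d\<psi>1: "AE y in lborel. y \<in> R1 \<longrightarrow> wDx R1 \<psi>1 y = wDx R1 w1 y + wD X w (fst y)"
    "AE y in lborel. y \<in> R1 \<longrightarrow> wDz R1 \<psi>1 y = wDz R1 w1 y"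
  proof -
    note e = H1_add_cmult(2)[OF obR(3,4) L1(9) Fw(1), of _ 1, folded \<psi>1_def]
    show "AE y in lborel. y \<in> R1 \<longrightarrow> wDx R1 \<psi>1 y = wDx R1 w1 y + wD X w (fst y)"
      using e[OF B(1)] Fw(2) by eventually_elim auto
    show "AE y in lborel. y \<in> R1 \<longrightarrow> wDz R1 \<psi>1 y = wDz R1 w1 y"
      using e[OF B(2)] Fw(3) by eventually_elim auto
  qed
  have d\<psi>2: "AE y in lborel. y \<in> R2 \<longrightarrow> wDx R2 \<psi>2 y = wDx R2 \<xi> y + wD X \<eta> (fst y)"
    "AE y in lborel. y \<in> R2 \<longrightarrow> wDz R2 \<psi>2 y = wDz R2 \<xi> y"
  proof -
    note e = H1_add_cmult(2)[OF obR(5,6) L2'(1) F\<eta>(1), of _ 1, folded \<psi>2_def]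
    show "AE y in lborel. y \<in> R2 \<longrightarrow> wDx R2 \<psi>2 y = wDx R2 \<xi> y + wD X \<eta> (fst y)"
      using e[OF B(1)] F\<eta>(2) by eventually_elim auto
    show "AE y in lborel. y \<in> R2 \<longrightarrow> wDz R2 \<psi>2 y = wDz R2 \<xi> y"
      using e[OF B(2)] F\<eta>(3) by eventually_elim auto
  qed

  \<comment> \<open>Coefficients on the two rectangles\<close>
  have restr: "AE y in lborel. y \<in> T \<longrightarrow> P y" if "AE y in lborel. y \<in> R \<longrightarrow> P y" "T \<subseteq> R" for T P
    using that by (auto elim!: eventually_mono)
  have mA1: "set_borel_measurable lborel R1 Ax" "AE y in lborel. y \<in> R1 \<longrightarrow> \<bar>Ax y\<bar> \<le> M0" "AE y in lborel. y \<in> R1 \<longrightarrow> mx \<le> Ax y"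
    and mA2: "set_borel_measurable lborel R2 Ax" "AE y in lborel. y \<in> R2 \<longrightarrow> \<bar>Ax y\<bar> \<le> M0" "AE y in lborel. y \<in> R2 \<longrightarrow> mx \<le> Ax y"
    using set_borel_measurable_subset[OF A(1) sR(1) sub(1)] set_borel_measurable_subset[OF A(1) sR(2) sub(2)]
      restr[OF A(2) sub(1)] restr[OF A(2) sub(2)] restr[OF A(3) sub(1)] restr[OF A(3) sub(2)] by auto
  have mq1: "set_borel_measurable lborel R1 ?\<kappa>" "AE y in lborel. y \<in> R1 \<longrightarrow> \<bar>?\<kappa> y\<bar> \<le> N0"
    and mq2: "set_borel_measurable lborel R2 ?\<kappa>" "AE y in lborel. y \<in> R2 \<longrightarrow> \<bar>?\<kappa> y\<bar> \<le> N0"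
    using set_borel_measurable_subset[OF q(1) sR(1) sub(1)] set_borel_measurable_subset[OF q(1) sR(2) sub(2)]
      restr[OF q(2) sub(1)] restr[OF q(2) sub(2)] by auto
  have A1: "(\<lambda>y. Ax y * h y) \<in> L2 R1" and q1: "(\<lambda>y. ?\<kappa> y * h y) \<in> L2 R1" if "h \<in> L2 R1" for h
    by (rule L2_bounded_mult[OF that mA1(1,2)], rule L2_bounded_mult[OF that mq1])
  have A2: "(\<lambda>y. Ax y * h y) \<in> L2 R2" and q2: "(\<lambda>y. ?\<kappa> y * h y) \<in> L2 R2" if "h \<in> L2 R2" for h
    by (rule L2_bounded_mult[OF that mA2(1,2)], rule L2_bounded_mult[OF that mq2])
  have fL: "f \<in> L2 R1" "f \<in> L2 R2" using L2_subset[OF H1_L2[OF f]] sub sR by auto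

  \<comment> \<open>Fluxes of the difference above the interface\<close>
  have puL: "?pu \<in> L2 R1" "?pv \<in> L2 R1" "?p2 \<in> L2 R2" "?qu \<in> L2 R1" "?qv \<in> L2 R1" "?q2 \<in> L2 R2"
    by (intro A1 A2 q1 q2 L2_add L1 L2' fst1 fst2 Wd)+
  let ?a = "wDx R1 \<psi>1" and ?b = "wDz R1 \<psi>1" and ?c = "wDx R2 \<psi>2" and ?d = "wDz R2 \<xi>"
  have bfu: "boundary_flux R1 ?pu ?qu f \<psi>1 = L2_inner R1 ?pu ?a + L2_inner R1 ?qu ?b - L2_inner R1 f \<psi>1"
    by (rule boundary_flux_eq[OF obR(3,4) puL(1,4) fL(1) L1(13)])
  have bfv: "boundary_flux R1 ?pv ?qv f \<psi>1 = L2_inner R1 ?pv ?a + L2_inner R1 ?qv ?b - L2_inner R1 f \<psi>1"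
    by (rule boundary_flux_eq[OF obR(3,4) puL(2,5) fL(1) L1(13)])
  have "L2_inner R1 ?pu ?a - L2_inner R1 ?pv ?a = L2_inner R1 (\<lambda>y. ?pu y - ?pv y) ?a"
    by (rule L2_inner_diff_left[OF puL(1,2) L1(15), symmetric])
  also have "\<dots> = L2_inner R1 (\<lambda>y. Ax y * ?a y) ?a"
  proof (rule L2_inner_cong[OF L2_diff[OF puL(1,2)] A1[OF L1(15)] L1(15) L1(15)])
    show "AE y in lborel. y \<in> R1 \<longrightarrow> ?pu y - ?pv y = Ax y * ?a y"
      using d\<psi>1(1) dw1(1) AE_Times_fstI[OF Dw(1), of Z1]
    proof (eventually_elim, intro impI)
      fix y assume "y \<in> R1 \<longrightarrow> ?a y = wDx R1 w1 y + wD X w (fst y)"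
        "y \<in> R1 \<longrightarrow> wDx R1 w1 y = wDx R1 u1 y + (-1) * wDx R1 v1 y"
        "y \<in> X \<times> Z1 \<longrightarrow> wD X w (fst y) = wD X u (fst y) + (-1) * wD X v (fst y)" "y \<in> R1"
      then have "?a y = (wDx R1 u1 y + wD X u (fst y)) - (wDx R1 v1 y + wD X v (fst y))" by (simp add: R1')
      then show "?pu y - ?pv y = Ax y * ?a y" by (simp only: right_diff_distrib)
    qed
  qed simp
  finally have e1: "L2_inner R1 ?pu ?a - L2_inner R1 ?pv ?a = L2_inner R1 (\<lambda>y. Ax y * ?a y) ?a" .
  have "L2_inner R1 ?qu ?b - L2_inner R1 ?qv ?b = L2_inner R1 (\<lambda>y. ?qu y - ?qv y) ?b"
    by (rule L2_inner_diff_left[OF puL(4,5) L1(16), symmetric])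
  also have "\<dots> = L2_inner R1 (\<lambda>y. ?\<kappa> y * ?b y) ?b"
  proof (rule L2_inner_cong[OF L2_diff[OF puL(4,5)] q1[OF L1(16)] L1(16) L1(16)])
    show "AE y in lborel. y \<in> R1 \<longrightarrow> ?qu y - ?qv y = ?\<kappa> y * ?b y"
      using d\<psi>1(2) dw1(2)
    proof (eventually_elim, intro impI)
      fix y assume "y \<in> R1 \<longrightarrow> ?b y = wDz R1 w1 y"
        "y \<in> R1 \<longrightarrow> wDz R1 w1 y = wDz R1 u1 y + (-1) * wDz R1 v1 y" "y \<in> R1"
      then have "?b y = wDz R1 u1 y - wDz R1 v1 y" by simp
      then show "?qu y - ?qv y = ?\<kappa> y * ?b y" by (simp only: right_diff_distrib)
    qed
  qed simp
  finally have e2: "L2_inner R1 ?qu ?b - L2_inner R1 ?qv ?b = L2_inner R1 (\<lambda>y. ?\<kappa> y * ?b y) ?b" .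

  \<comment> \<open>Fluxes below the interface\<close>
  have bf2: "boundary_flux R2 ?p2 ?q2 f \<psi>2 = L2_inner R2 ?p2 ?c + L2_inner R2 ?q2 (wDz R2 \<psi>2) - L2_inner R2 f \<psi>2"
    by (rule boundary_flux_eq[OF obR(5,6) puL(3,6) fL(2) L2'(5)])
  have \<sigma>2: "(\<lambda>y. Ax y * \<sigma> (fst y)) \<in> L2 R2" by (intro A2 fst2 \<sigma>L)
  \<comment> \<open>Below the interface u + t + \<xi> is \<psi>2 plus v + s. The limit part leaves
    the extra flux A_x \<sigma>, which is the residual to be estimated.\<close>
  have "L2_inner R2 ?p2 ?c = L2_inner R2 (\<lambda>y. Ax y * ?c y + Ax y * \<sigma> (fst y)) ?c"
  proof (rule L2_inner_cong[OF puL(3) _ L2'(7) L2'(7)])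
    show "(\<lambda>y. Ax y * ?c y + Ax y * \<sigma> (fst y)) \<in> L2 R2" by (intro L2_add A2 L2' \<sigma>2 fst2 \<sigma>L)
    show "AE y in lborel. y \<in> R2 \<longrightarrow> ?p2 y = Ax y * ?c y + Ax y * \<sigma> (fst y)"
      using d\<psi>2(1) AE_Times_fstI[OF D\<eta>, of Z2]
    proof (eventually_elim, intro impI)
      fix y assume "y \<in> R2 \<longrightarrow> ?c y = wDx R2 \<xi> y + wD X \<eta> (fst y)"
        "y \<in> X \<times> Z2 \<longrightarrow> wD X \<eta> (fst y) = wD X u (fst y) - wD X v (fst y) + wD X t (fst y) - wD X s (fst y)" "y \<in> R2"
      then have "wDx R2 \<xi> y + wD X t (fst y) + wD X u (fst y) = ?c y + \<sigma> (fst y)" by (simp add: R2' \<sigma>_def)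
      then show "?p2 y = Ax y * ?c y + Ax y * \<sigma> (fst y)" by (simp only: distrib_left)
    qed
  qed simp
  also have "\<dots> = L2_inner R2 (\<lambda>y. Ax y * ?c y) ?c + L2_inner R2 (\<lambda>y. Ax y * \<sigma> (fst y)) ?c"
    by (rule L2_inner_add_left[OF A2[OF L2'(7)] \<sigma>2 L2'(7)])
  also have "L2_inner R2 (\<lambda>y. Ax y * \<sigma> (fst y)) ?c = L2_inner R2 (\<lambda>y. Ax y * \<sigma> (fst y)) (\<lambda>y. wDx R2 \<xi> y + wD X \<eta> (fst y))"
    by (rule L2_inner_cong[OF \<sigma>2 \<sigma>2 L2'(7) L2_add[OF L2'(3) fst2[OF Wd(6)]] _ d\<psi>2(1)]) simp
  also have "\<dots> = L2_inner R2 (\<lambda>y. Ax y * \<sigma> (fst y)) (wDx R2 \<xi>) + L2_inner R2 (\<lambda>y. Ax y * \<sigma> (fst y)) (\<lambda>y. wD X \<eta> (fst y))"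
    by (rule L2_inner_add_right[OF L2'(3) fst2[OF Wd(6)] \<sigma>2])
  also have "L2_inner R2 (\<lambda>y. Ax y * \<sigma> (fst y)) (\<lambda>y. wD X \<eta> (fst y)) = L2_inner X (\<lambda>x. (LINT z:Z2|lborel. Ax (x, z)) * \<sigma> x) (wD X \<eta>)"
    using L2_inner_fst[OF \<sigma>2[unfolded R2'] Wd(6) ob(6,5)] by (simp add: R2')
  finally have e3: "L2_inner R2 ?p2 ?c = L2_inner R2 (\<lambda>y. Ax y * ?c y) ?c
      + (L2_inner R2 (\<lambda>y. Ax y * \<sigma> (fst y)) (wDx R2 \<xi>) + L2_inner X (\<lambda>x. (LINT z:Z2|lborel. Ax (x, z)) * \<sigma> x) (wD X \<eta>))" .
  have e4: "L2_inner R2 ?q2 (wDz R2 \<psi>2) = L2_inner R2 (\<lambda>y. ?\<kappa> y * ?d y) ?d"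
    by (rule L2_inner_cong[OF puL(6) puL(6) L2'(8) L2'(4) _ d\<psi>2(2)]) simp
  have \<eta>L: "\<eta> \<in> L2 X" by (rule HW(2)[OF wW(3)])
  have "L2_inner R2 f \<psi>2 = L2_inner R2 f \<xi> + L2_inner R2 f (\<lambda>y. \<eta> (fst y))"
    using L2_inner_add_right[OF L2'(2) fst2[OF \<eta>L] fL(2)] by (simp add: \<psi>2_def)
  also have "L2_inner R2 f (\<lambda>y. \<eta> (fst y)) = L2_inner X (\<lambda>x. LINT z:Z2|lborel. f (x, z)) \<eta>"
    unfolding R2' by (rule L2_inner_fst[OF fL(2)[unfolded R2'] \<eta>L ob(6,5)])
  finally have e5: "L2_inner R2 f \<psi>2 = L2_inner R2 f \<xi> + L2_inner X (\<lambda>x. LINT z:Z2|lborel. f (x, z)) \<eta>" .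

  \<comment> \<open>Limit equation below the interface and traces of the test functions\<close>
  have lower: "L2_inner X (\<lambda>x. (LINT z:Z2|lborel. Ax (x, z)) * \<sigma> x) (wD X \<psi>)
      = L2_inner X (\<lambda>x. LINT z:Z2|lborel. f (x, z)) \<psi> - L2_inner X gm \<psi>" if "\<psi> \<in> space_W xm xp" for \<psi>
    using AP_L_lower_equation[OF x z al A(1,2)[unfolded R_def] mq1[unfolded R1_def] f[unfolded R_def] g[unfolded X_def] that]
    unfolding \<sigma>_def s_def X_def Z1_def Z2_def .

  have m2: "set_borel_measurable lborel (X \<times> {zm<..<zi}) \<xi>" using L2'(2) by (simp add: L2_def R2' Z2_def)
  note P = Poincare_zero_top_trace[OF z(1) ob(1,2), of \<xi>, folded Z2_def, folded R2', OF L2'(1) sx(2)]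
  define r where "r = trace_z X Z2 zm \<xi>"
  have rL: "r \<in> L2 X" using P(3) by (simp add: has_trace_z_def has_slice_trace_def r_def)
  have mf2: "set_borel_measurable lborel (X \<times> {zm<..<zi}) (\<lambda>y. \<eta> (fst y))" "set_borel_measurable lborel (X \<times> {zm<..<zi}) \<psi>2"
    using fst2[OF \<eta>L] L2'(6) by (auto simp: L2_def R2' Z2_def)
  have mf1: "set_borel_measurable lborel (X \<times> {zi<..<zp}) h" if "h \<in> L2 R1" for h
    using that by (simp add: L2_def R1' Z1_def)
  have tr2: "has_trace_z X Z2 zm \<psi>2 (\<lambda>x. r x + 1 * \<eta> x)" "has_trace_z X Z2 zi \<psi>2 (\<lambda>x. 0 + 1 * \<eta> x)"
    unfolding \<psi>2_def Z2_def r_def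
    by (rule has_trace_z_add_cmult[OF ob(1) m2 _ mf2(1) trace_z_fst(1)[OF z(1) _ ob(1) \<eta>L]];
        use P(3) sx(2) in \<open>simp add: Z2_def\<close>)+
  have trm: "AE x in lborel. x \<in> X \<longrightarrow> trace_z X Z2 zm \<psi>2 x = r x + 1 * \<eta> x"
    "AE x in lborel. x \<in> X \<longrightarrow> trace_z X Z2 zi \<psi>2 x = 0 + 1 * \<eta> x"
    unfolding Z2_def by (rule trace_z_eq[OF z(1) _ ob(1) mf2(2) tr2(1)[unfolded Z2_def]], simp)
      (rule trace_z_eq[OF z(1) _ ob(1) mf2(2) tr2(2)[unfolded Z2_def]], simp)
  have has: "has_trace_z X Z1 zi h (trace_z X Z1 zi h)" if h: "h \<in> H1 R1" for h
  proof -
    obtain k where "has_trace_z X {zi<..<zp} zi h k"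
      using H1_z_representation[OF z(2) ob(1,2) h[unfolded R1' Z1_def]] by blast
    then show ?thesis unfolding Z1_def by (rule trace_z_works)
  qed
  have tru: "has_trace_z X Z1 zi u1 t" "has_trace_z X Z1 zi v1 s"
    unfolding t_def s_def by (rule has[OF L1(1)], rule has[OF L1(5)])
  have trw1: "has_trace_z X Z1 zi w1 (\<lambda>x. t x + (-1) * s x)"
    unfolding w1_def Z1_def
    by (rule has_trace_z_add_cmult[OF ob(1) mf1[OF L1(2)] tru(1)[unfolded Z1_def] mf1[OF L1(6)] tru(2)[unfolded Z1_def]])
  have tr1: "has_trace_z X Z1 zi \<psi>1 (\<lambda>x. t x + (-1) * s x + 1 * w x)"
    unfolding \<psi>1_def Z1_def
    by (rule has_trace_z_add_cmult[OF ob(1) mf1[OF L1(10)] trw1[unfolded Z1_def] mf1[OF fst1[OF HW(2)[OF wW(1)]]]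
          trace_z_fst(1)[OF z(2) _ ob(1) HW(2)[OF wW(1)]]]) simp
  have "AE x in lborel. x \<in> X \<longrightarrow> trace_z X Z1 zi \<psi>1 x = t x + (-1) * s x + 1 * w x"
    unfolding Z1_def by (rule trace_z_eq[OF z(2) _ ob(1) mf1[OF L1(14)] tr1[unfolded Z1_def]]) simp
  \<comment> \<open>Equal interface traces make the pair \<psi>1, \<psi>2 admissible in the
    condition that couples the fluxes at the interface.\<close>
  with trm(2) have same: "AE x in lborel. x \<in> X \<longrightarrow> trace_z X Z1 zi \<psi>1 x = trace_z X Z2 zi \<psi>2 x"
    by eventually_elim (auto simp: \<eta>_def w_def)
  have trL: "trace_z X Z2 zm \<psi>2 \<in> L2 X" using trace_z_works[OF tr2(1)] by (simp add: has_trace_z_def has_slice_trace_def)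
  have "L2_inner X gm (trace_z X Z2 zm \<psi>2) = L2_inner X gm (\<lambda>x. r x + 1 * \<eta> x)"
    by (rule L2_inner_cong[OF g(2) g(2) trL L2_add[OF rL L2_cmult[OF \<eta>L]] _ trm(1)]) simp
  also have "\<dots> = L2_inner X gm r + L2_inner X gm \<eta>"
    using L2_inner_add_right[OF rL \<eta>L g(2)] by simp
  finally have e6: "(LINT x:X|lborel. gm x * trace_z X Z2 zm \<psi>2 x) = L2_inner X gm r + L2_inner X gm \<eta>"
    by (simp add: L2_inner_def)
  let ?EA = "L2_inner R1 (\<lambda>y. Ax y * ?a y) ?a" and ?EB = "L2_inner R1 (\<lambda>y. ?\<kappa> y * ?b y) ?b"
    and ?EC = "L2_inner R2 (\<lambda>y. Ax y * ?c y) ?c" and ?ED = "L2_inner R2 (\<lambda>y. ?\<kappa> y * ?d y) ?d"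
  \<comment> \<open>The coupling condition minus the upper limit equation gives the energy and the
    residual tested with \<psi>2 = \<xi> + \<eta>. The limit equation below the interface, tested
    with \<eta>, cancels the \<eta> part, so that only \<xi>, which vanishes on the interface,
    remains.\<close>
  have energy: "?EA + ?EB + ?EC + ?ED = L2_inner R2 f \<xi> - L2_inner R2 (\<lambda>y. Ax y * \<sigma> (fst y)) (wDx R2 \<xi>) - L2_inner X gm r"
    using couple[OF V1(3) V2(2) same] up[OF V1(3)] bfu bfv bf2 e1 e2 e3 e4 e5 e6 lower[OF wW(3)] by linarith

  \<comment> \<open>Energy estimate of order \<delta>\<close>
  define y where "y = L2_norm R2 ?d"
  have y0: "0 \<le> y" by (simp add: y_def L2_norm_nonneg)
  have \<xi>y: "L2_norm R2 \<xi> \<le> (zi - zm) * y" using P(1) by (simp add: y_def)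
  have b1: "\<bar>L2_inner R2 f \<xi>\<bar> \<le> (zi - zm) * L2_norm R2 f * y"
    using order_trans[OF L2_inner_le[OF fL(2) L2'(2)] mult_left_mono[OF \<xi>y L2_norm_nonneg[of R2 f]]] by (simp add: mult_ac)
  have b2: "\<bar>L2_inner X gm r\<bar> \<le> sqrt (zi - zm) * L2_norm X gm * y"
    using order_trans[OF L2_inner_le[OF g(2) rL] mult_left_mono[OF P(2)[folded r_def y_def] L2_norm_nonneg[of X gm]]]
    by (simp add: mult_ac)
  \<comment> \<open>Both v and the interface trace of v1 vanish at the ends of the interval.\<close>
  have \<sigma>0: "(LINT x:X|lborel. \<sigma> x) = 0"
  proof -
    have "(LINT x:X|lborel. \<sigma> x) = (LINT x:X|lborel. wD X v x) + (LINT x:X|lborel. wD X s x)"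
      unfolding \<sigma>_def by (rule set_integral_add(2)) (intro L2_integrable ob Wd)+
    also have "\<dots> = 0" using space_W_representation(2)[OF x sv(1)] space_W_representation(2)[OF x tW(2)] by (simp add: X_def)
    finally show ?thesis .
  qed
  have b3: "\<bar>L2_inner R2 (\<lambda>y. Ax y * \<sigma> (fst y)) (wDx R2 \<xi>)\<bar> \<le> M * (sqrt (measure lborel R2) * (zi - zm)) * y"
  proof -
    have "(LINT y:R2|lborel. \<bar>\<xi> y\<bar>) \<le> sqrt (measure lborel R2) * L2_norm R2 \<xi>"
      using L2_integral_le[OF obR(6,5) L2_abs[OF L2'(2)]] by (simp add: L2_norm_def)
    also have "\<dots> \<le> sqrt (measure lborel R2) * ((zi - zm) * y)" by (rule mult_left_mono[OF \<xi>y]) simp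
    finally have i: "(LINT y:R2|lborel. \<bar>\<xi> y\<bar>) \<le> sqrt (measure lborel R2) * ((zi - zm) * y)" .
    have "\<bar>L2_inner R2 (\<lambda>y. Ax y * \<sigma> (fst y)) (wDx R2 \<xi>)\<bar> \<le> M * (LINT y:R2|lborel. \<bar>\<xi> y\<bar>)"
      unfolding L2_inner_def by (rule flux[OF \<sigma>L \<sigma>0 _ sx(1)]) (use lower in \<open>simp add: L2_inner_def\<close>)
    also have "\<dots> \<le> M * (sqrt (measure lborel R2) * ((zi - zm) * y))" by (rule mult_left_mono[OF i pos(4)])
    finally show ?thesis by (simp add: mult.assoc)
  qed
  \<comment> \<open>The three summands of \<open>K\<close> come from the volume term, the residual
    flux and the datum on the lower side.\<close>
  have Ky: "?EA + ?EB + ?EC + ?ED \<le> K * y"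
    unfolding energy K_def using b1 b2 b3 by (simp add: distrib_right)
  have lbA: "mx * (L2_norm R1 ?a)\<^sup>2 \<le> ?EA" by (rule L2_inner_weight_ge[OF L1(15) mA1])
  have lbB: "mz * (L2_norm R1 ?b)\<^sup>2 \<le> ?EB" by (rule L2_inner_weight_ge[OF L1(16) mq1 q(3)])
  have lbC: "mx * (L2_norm R2 ?c)\<^sup>2 \<le> ?EC" by (rule L2_inner_weight_ge[OF L2'(7) mA2])
  \<comment> \<open>Only this term of the energy carries the factor 1 / \<delta>; it is the source
    of the rate.\<close>
  have lbD: "mz / \<delta> * y\<^sup>2 \<le> ?ED" unfolding y_def by (rule L2_inner_weight_ge[OF L2'(4) mq2 q(4)])
  \<comment> \<open>Young's inequality as a completed square: the left side is largest at y = K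
    \<delta> / (2 mz). Hence each of the other three energy terms is at most the right side.\<close>
  have young: "K * y - mz / \<delta> * y\<^sup>2 \<le> K\<^sup>2 * \<delta> / (4 * mz)"
  proof -
    have "0 \<le> (mz / \<delta>) * (y - K * \<delta> / (2 * mz))\<^sup>2" using pos by simp
    also have "\<dots> = mz / \<delta> * y\<^sup>2 - K * y + K\<^sup>2 * \<delta> / (4 * mz)"
      using pos by (simp add: power2_eq_square field_simps)
    finally show ?thesis by simp
  qed
  have K0: "0 \<le> K" unfolding K_def using z pos(4) by (intro add_nonneg_nonneg mult_nonneg_nonneg L2_norm_nonneg) auto
  have nn: "0 \<le> mx * (L2_norm R1 ?a)\<^sup>2" "0 \<le> mz * (L2_norm R1 ?b)\<^sup>2" "0 \<le> mx * (L2_norm R2 ?c)\<^sup>2" using pos by simp_all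
  \<comment> \<open>Solving for the norm. With m = mx this gives \<open>C0\<close>, with m = mz the
    constant K / (2 mz) for the vertical derivative.\<close>
  have bnd: "n \<le> K / (2 * sqrt (mz * m)) * sqrt \<delta>" if n: "m * n\<^sup>2 \<le> K\<^sup>2 * \<delta> / (4 * mz)" and m: "0 < m" for n m
  proof (rule power2_le_imp_le)
    have "n\<^sup>2 \<le> K\<^sup>2 * \<delta> / (4 * mz) / m" using n unfolding pos_le_divide_eq[OF m] mult.commute[of "n\<^sup>2" m] .
    also have "\<dots> = (K / (2 * sqrt (mz * m)) * sqrt \<delta>)\<^sup>2"
      using pos m by (simp add: power_mult_distrib power_divide)
    finally show "n\<^sup>2 \<le> (K / (2 * sqrt (mz * m)) * sqrt \<delta>)\<^sup>2" .
    show "0 \<le> K / (2 * sqrt (mz * m)) * sqrt \<delta>" using K0 pos m by simp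
  qed
  have na: "L2_norm R1 ?a \<le> C0 * sqrt \<delta>" unfolding C0_def by (rule bnd) (use Ky lbA lbB lbC lbD young nn pos in linarith)+
  have nc: "L2_norm R2 ?c \<le> C0 * sqrt \<delta>" unfolding C0_def by (rule bnd) (use Ky lbA lbB lbC lbD young nn pos in linarith)+
  have nb: "L2_norm R1 ?b \<le> K / (2 * mz) * sqrt \<delta>"
  proof -
    have "L2_norm R1 ?b \<le> K / (2 * sqrt (mz * mz)) * sqrt \<delta>" by (rule bnd) (use Ky lbA lbB lbC lbD young nn pos in linarith)+
    then show ?thesis using pos by simp
  qed

  \<comment> \<open>Separation of the mean from the fluctuation\<close>
  define Ia where "Ia = (\<lambda>x. LINT z:Z1|lborel. ?a (x, z))"
  define Ic where "Ic = (\<lambda>x. LINT z:Z2|lborel. ?c (x, z))"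
  have Iac: "Ia \<in> L2 X" "Ic \<in> L2 X" "L2_norm X Ia \<le> sqrt (zp - zi) * L2_norm R1 ?a" "L2_norm X Ic \<le> sqrt (zi - zm) * L2_norm R2 ?c"
    using L2_integral_snd[OF L1(15)[unfolded R1'] ob(2,1,4,3)] L2_integral_snd[OF L2'(7)[unfolded R2'] ob(2,1,6,5)]
    unfolding Ia_def Ic_def R1' R2' mZ by auto
  have wI: "has_weak_partial X 1 (\<lambda>x. LINT z:Z1|lborel. h (x, z)) (\<lambda>x. LINT z:Z1|lborel. wDx R1 h (x, z))" if "h \<in> space_V xm xp Z1" for h
    using H1_integral_snd(1)[OF x ob(3,4), of h "wDx R1 h"] HV1[OF that] H1_weak_partial(1)[OF obR(3,4) HV1(1)[OF that] B(1)]
    unfolding R1' X_def by simp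
  have wI2: "has_weak_partial X 1 (\<lambda>x. LINT z:Z2|lborel. \<xi> (x, z)) (\<lambda>x. LINT z:Z2|lborel. wDx R2 \<xi> (x, z))"
    using H1_integral_snd(1)[OF x ob(5,6), of \<xi> "wDx R2 \<xi>"] L2' H1_weak_partial(1)[OF obR(5,6) L2'(1) B(1)]
    unfolding R2' X_def by simp
  have wt: "has_weak_partial X 1 t (wD X t)" "has_weak_partial X 1 s (wD X s)"
    using H1_weak_partial(1)[OF ob(1,2) su(4), of 1] H1_weak_partial(1)[OF ob(1,2) sv(3), of 1] by auto
  have cu: "AE x in lborel. x \<in> X \<longrightarrow> (LINT z:Z1|lborel. wDx R1 u1 (x, z)) + (zi - zm) * wD X t x + (LINT z:Z2|lborel. wDx R2 \<xi> (x, z)) = 0"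
    by (rule weak_partial_of_zero[where i = 1, OF ob(1) _ _ conu], simp)
      (intro has_weak_partial_add has_weak_partial_cmult wI wI2 wt su; simp)
  have cv: "AE x in lborel. x \<in> X \<longrightarrow> (LINT z:Z1|lborel. wDx R1 v1 (x, z)) + (zi - zm) * wD X s x = 0"
    by (rule weak_partial_of_zero[where i = 1, OF ob(1) _ _ conv], simp)
      (intro has_weak_partial_add has_weak_partial_cmult wI wt sv; simp)
  note sec = set_integrable_Times_fst(1)[OF L2_integrable[OF obR(4,3) L1(3), unfolded R1']]
    set_integrable_Times_fst(1)[OF L2_integrable[OF obR(4,3) L1(7), unfolded R1']]
    set_integrable_Times_fst(1)[OF L2_integrable[OF obR(4,3) L1(15), unfolded R1']]
    set_integrable_Times_fst(1)[OF L2_integrable[OF obR(6,5) L2'(3), unfolded R2']]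
    set_integrable_Times_fst(1)[OF L2_integrable[OF obR(6,5) L2'(7), unfolded R2']]
  have a_eq: "AE y in lborel. y \<in> R1 \<longrightarrow> ?a y = wDx R1 u1 y - wDx R1 v1 y + wD X w (fst y)"
    using d\<psi>1(1) dw1(1) by eventually_elim auto
  \<comment> \<open>Integrating the x-derivatives of \<psi>1 and \<psi>2 over their z-intervals, the
    fluctuations add up to the difference of the two differentiated constraints, that is to zero;
    the mean part appears zp - zm times. This is where \<open>C1\<close> comes from.\<close>
  have "AE x in lborel. x \<in> X \<longrightarrow> wD X w x = (1 / (zp - zm)) * (Ia x + Ic x)"
    using cu cv sec AE_Times_fst[OF a_eq[unfolded R1']] AE_Times_fst[OF d\<psi>2(1)[unfolded R2']] D\<eta> Dw(1)
  proof (eventually_elim, intro impI)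
    fix x assume *: "x \<in> X \<longrightarrow> (LINT z:Z1|lborel. wDx R1 u1 (x, z)) + (zi - zm) * wD X t x + (LINT z:Z2|lborel. wDx R2 \<xi> (x, z)) = 0"
      "x \<in> X \<longrightarrow> (LINT z:Z1|lborel. wDx R1 v1 (x, z)) + (zi - zm) * wD X s x = 0"
      "x \<in> X \<longrightarrow> set_integrable lborel Z1 (\<lambda>z. wDx (X \<times> Z1) u1 (x, z))"
      "x \<in> X \<longrightarrow> set_integrable lborel Z1 (\<lambda>z. wDx (X \<times> Z1) v1 (x, z))"
      "x \<in> X \<longrightarrow> set_integrable lborel Z1 (\<lambda>z. wDx (X \<times> Z1) \<psi>1 (x, z))"
      "x \<in> X \<longrightarrow> set_integrable lborel Z2 (\<lambda>z. wDx (X \<times> Z2) \<xi> (x, z))"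
      "x \<in> X \<longrightarrow> set_integrable lborel Z2 (\<lambda>z. wDx (X \<times> Z2) \<psi>2 (x, z))"
      "x \<in> X \<longrightarrow> (AE z in lborel. z \<in> Z1 \<longrightarrow> wDx (X \<times> Z1) \<psi>1 (x, z) =
          wDx (X \<times> Z1) u1 (x, z) - wDx (X \<times> Z1) v1 (x, z) + wD X w (fst (x, z)))"
      "x \<in> X \<longrightarrow> (AE z in lborel. z \<in> Z2 \<longrightarrow> wDx (X \<times> Z2) \<psi>2 (x, z) = wDx (X \<times> Z2) \<xi> (x, z) + wD X \<eta> (fst (x, z)))"
      "x \<in> X \<longrightarrow> wD X \<eta> x = wD X u x - wD X v x + wD X t x - wD X s x"
      "x \<in> X \<longrightarrow> wD X w x = wD X u x + (-1) * wD X v x" and x: "x \<in> X"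
    have i: "set_integrable lborel Z1 (\<lambda>z. wDx R1 u1 (x, z))" "set_integrable lborel Z1 (\<lambda>z. wDx R1 v1 (x, z))"
      "set_integrable lborel Z1 (\<lambda>z. ?a (x, z))" "set_integrable lborel Z2 (\<lambda>z. wDx R2 \<xi> (x, z))" "set_integrable lborel Z2 (\<lambda>z. ?c (x, z))"
      using * x unfolding R1' R2' by auto
    have c: "set_integrable lborel Z1 (\<lambda>z. k)" "set_integrable lborel Z2 (\<lambda>z. k)"
      "(LINT z:Z1|lborel. k) = k * (zp - zi)" "(LINT z:Z2|lborel. k) = k * (zi - zm)" for k :: real
      using L2_integrable[OF ob(4,3) L2_const[OF ob(4,3)]] L2_integrable[OF ob(6,5) L2_const[OF ob(6,5)]] z
      by (simp_all add: set_lebesgue_integral_def Z1_def Z2_def)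
    have "Ia x = (LINT z:Z1|lborel. wDx R1 u1 (x, z) - wDx R1 v1 (x, z) + wD X w x)"
      unfolding Ia_def using * x i c
      by (intro set_integral_cong_AE_real set_integrable_imp_measurable set_integral_add(1) set_integral_diff(1)) (auto simp: R1')
    then have Ia: "Ia x = (LINT z:Z1|lborel. wDx R1 u1 (x, z)) - (LINT z:Z1|lborel. wDx R1 v1 (x, z)) + wD X w x * (zp - zi)"
      by (simp add: set_integral_add(2)[OF set_integral_diff(1)[OF i(1,2)] c(1)] set_integral_diff(2)[OF i(1,2)] c)
    have "Ic x = (LINT z:Z2|lborel. wDx R2 \<xi> (x, z) + wD X \<eta> x)"
      unfolding Ic_def using * x i c
      by (intro set_integral_cong_AE_real set_integrable_imp_measurable set_integral_add(1)) (auto simp: R2')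
    then have Ic: "Ic x = (LINT z:Z2|lborel. wDx R2 \<xi> (x, z)) + wD X \<eta> x * (zi - zm)"
      by (simp add: set_integral_add(2)[OF i(4) c(2)] c)
    have h: "wD X \<eta> x = wD X w x + wD X t x - wD X s x" using * x by simp
    have 1: "(LINT z:Z1|lborel. wDx R1 u1 (x, z)) + (zi - zm) * wD X t x + (LINT z:Z2|lborel. wDx R2 \<xi> (x, z)) = 0"
      and 2: "(LINT z:Z1|lborel. wDx R1 v1 (x, z)) + (zi - zm) * wD X s x = 0" using * x by auto
    have "Ia x + Ic x = wD X w x * (zp - zm) + ((LINT z:Z1|lborel. wDx R1 u1 (x, z)) + (zi - zm) * wD X t x + (LINT z:Z2|lborel. wDx R2 \<xi> (x, z)))
       - ((LINT z:Z1|lborel. wDx R1 v1 (x, z)) + (zi - zm) * wD X s x)"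
      unfolding Ia Ic h by (simp add: algebra_simps)
    then have "Ia x + Ic x = wD X w x * (zp - zm)" unfolding 1 2 by simp
    then show "wD X w x = (1 / (zp - zm)) * (Ia x + Ic x)" using z by simp
  qed
  then have "L2_norm X (wD X w) = L2_norm X (\<lambda>x. (1 / (zp - zm)) * (Ia x + Ic x))"
    by (rule L2_norm_cong[OF Wd(5) L2_cmult[OF L2_add[OF Iac(1,2)]]])
  also have "\<dots> = L2_norm X (\<lambda>x. Ia x + Ic x) / (zp - zm)"
    unfolding L2_norm_cmult using z by simp
  also have "\<dots> \<le> (sqrt (zp - zi) * (C0 * sqrt \<delta>) + sqrt (zi - zm) * (C0 * sqrt \<delta>)) / (zp - zm)"
  proof (rule divide_right_mono)
    have "L2_norm X (\<lambda>x. Ia x + Ic x) \<le> L2_norm X Ia + L2_norm X Ic" by (rule L2_norm_triangle[OF Iac(1,2)])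
    also have "\<dots> \<le> sqrt (zp - zi) * L2_norm R1 ?a + sqrt (zi - zm) * L2_norm R2 ?c" using Iac(3,4) by simp
    also have "\<dots> \<le> sqrt (zp - zi) * (C0 * sqrt \<delta>) + sqrt (zi - zm) * (C0 * sqrt \<delta>)"
      using z na nc by (intro add_mono mult_left_mono) auto
    finally show "L2_norm X (\<lambda>x. Ia x + Ic x) \<le> sqrt (zp - zi) * (C0 * sqrt \<delta>) + sqrt (zi - zm) * (C0 * sqrt \<delta>)" .
  qed (use z in simp)
  also have "\<dots> = C1 * sqrt \<delta>" by (simp add: C1_def distrib_right)
  finally have nw: "L2_norm X (wD X w) \<le> C1 * sqrt \<delta>" .
  then show "L2_norm X (wD X (\<lambda>x. u x - v x)) \<le> C1 * sqrt \<delta>" by (simp add: w_def)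
  \<comment> \<open>The mean, already estimated, is subtracted from \<psi>1; as a function of x
    alone it picks up the square root of the height zp - zi.\<close>
  have "L2_norm R1 (wDx R1 w1) = L2_norm R1 (\<lambda>y. ?a y + (-1) * wD X w (fst y))"
    using d\<psi>1(1) by (intro L2_norm_cong L2_add L2_cmult fst1 L1 Wd) (auto elim!: eventually_mono)
  also have "\<dots> \<le> L2_norm R1 ?a + L2_norm R1 (\<lambda>y. (-1) * wD X w (fst y))"
    by (intro L2_norm_triangle L2_cmult fst1 L1 Wd)
  also have "L2_norm R1 (\<lambda>y. (-1) * wD X w (fst y)) = sqrt (zp - zi) * L2_norm X (wD X w)"
    unfolding L2_norm_cmult using L2_norm_fst[OF Wd(5) ob(4,3)] by (simp add: R1' mZ)
  also have "L2_norm R1 ?a + sqrt (zp - zi) * L2_norm X (wD X w) \<le> C0 * sqrt \<delta> + sqrt (zp - zi) * (C1 * sqrt \<delta>)"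
    using z na nw by (intro add_mono mult_left_mono) auto
  finally show "L2_norm R1 (wDx R1 (\<lambda>y. u1 y - v1 y)) \<le> (C0 + sqrt (zp - zi) * C1) * sqrt \<delta>"
    by (simp add: w1_def distrib_right)
  have "L2_norm R1 (wDz R1 w1) = L2_norm R1 ?b"
    using d\<psi>1(2) by (intro L2_norm_cong L1) (auto elim!: eventually_mono)
  then show "L2_norm R1 (wDz R1 (\<lambda>y. u1 y - v1 y)) \<le> K / (2 * mz) * sqrt \<delta>"
    using nb by (simp add: w1_def)
qed

theorem theorem3p3:
  fixes xm xp zm zi zp \<delta>0 \<epsilon>M :: real
    and Ax Az f :: "real \<times> real \<Rightarrow> real"
    and gp gm :: "real \<Rightarrow> real"
    and \<epsilon> :: "real \<Rightarrow> real \<Rightarrow> real"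
    and u v :: "real \<Rightarrow> real \<Rightarrow> real"
    and u1 \<xi>2 v1 :: "real \<Rightarrow> real \<times> real \<Rightarrow> real"
  defines "X \<equiv> {xm<..<xp}"
  defines "R1 \<equiv> {xm<..<xp} \<times> {zi<..<zp}"
  assumes "xm < xp" and "zm < zi" and "zi < zp" and "0 < \<delta>0"
    and "\<And>\<delta>. \<delta> \<in> {0<..\<delta>0} \<Longrightarrow> \<epsilon> \<delta> zi = \<delta>"
    and "\<And>\<delta>. \<delta> \<in> {0<..\<delta>0} \<Longrightarrow>
           hypothesis_B {xm<..<xp} {zm<..<zp} Ax Az f gp gm (\<epsilon> \<delta>) \<epsilon>M"
    and "\<And>\<delta>. \<delta> \<in> {0<..\<delta>0} \<Longrightarrow>
           AP_AP_solution xm xp zm zi zp Ax Az f gp gm (\<epsilon> \<delta>) (u \<delta>) (u1 \<delta>) (\<xi>2 \<delta>)"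
    and "\<And>\<delta>. \<delta> \<in> {0<..\<delta>0} \<Longrightarrow>
           AP_L_solution xm xp zm zi zp Ax Az f gp gm (\<epsilon> \<delta>) (v \<delta>) (v1 \<delta>) (\<lambda>y. 0)"
  shows "((\<lambda>\<delta>. W_norm X (\<lambda>x. u \<delta> x - v \<delta> x)) \<longlongrightarrow> 0) (at_right 0)
       \<and> ((\<lambda>\<delta>. V_norm R1 (\<lambda>y. u1 \<delta> y - v1 \<delta> y)) \<longlongrightarrow> 0) (at_right 0)
       \<and> ((\<forall>\<delta>\<in>{0<..\<delta>0}. trace_z X {zi<..<zp} zi (u1 \<delta>) \<in> H2 X) \<longrightarrow>
           (\<exists>c>0. \<forall>\<delta>\<in>{0<..\<delta>0}.
              L2_norm X (wD X (\<lambda>x. u \<delta> x - v \<delta> x))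
              + L2_norm R1 (wDx R1 (\<lambda>y. u1 \<delta> y - v1 \<delta> y))
              + L2_norm R1 (wDz R1 (\<lambda>y. u1 \<delta> y - v1 \<delta> y))
              \<le> c * sqrt (\<epsilon> \<delta> zi)))"
proof -
  let ?Z1 = "{zi<..<zp}" and ?Z2 = "{zm<..<zi}" and ?R = "{xm<..<xp} \<times> {zm<..<zp}" and ?R2 = "{xm<..<xp} \<times> {zm<..<zi}"
  note x = assms(3) and z = assms(4,5) and d0 = assms(6) and eps = assms(7) and hyp = assms(8) and ap = assms(9) and al = assms(10)
  \<comment> \<open>Bounds of the fixed coefficients and data are extracted at one parameter, so
    that the constants built from them do not depend on \<delta>.\<close>
  have HB: "hypothesis_B {xm<..<xp} {zm<..<zp} Ax Az f gp gm (\<epsilon> \<delta>0) \<epsilon>M" using hyp[of \<delta>0] d0 by simp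
  obtain mx Mx mz Mz where m: "0 < mx" "AE y in lborel. y \<in> ?R \<longrightarrow> mx \<le> Ax y \<and> Ax y \<le> Mx"
    "0 < mz" "AE y in lborel. y \<in> ?R \<longrightarrow> mz \<le> Az y \<and> Az y \<le> Mz"
    using HB unfolding hypothesis_B_def by blast
  have W: "Ax \<in> W1inf ?R" "Az \<in> W1inf ?R" and f: "f \<in> H1 ?R" and g: "gp \<in> H1 {xm<..<xp}" "gm \<in> H1 {xm<..<xp}"
    using HB unfolding hypothesis_B_def by blast+
  have obR: "open ?R" "bounded ?R" "open ?R2" "bounded ?R2" by (auto intro: open_Times bounded_Times)
  have sub: "?R2 \<subseteq> ?R" "R1 \<subseteq> ?R" using z by (auto simp: R1_def)
  obtain gA M0 where A: "has_weak_partial ?R (1, 0) Ax gA" "AE y in lborel. y \<in> ?R \<longrightarrow> \<bar>gA y\<bar> \<le> M0"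
    "AE y in lborel. y \<in> ?R \<longrightarrow> \<bar>Ax y\<bar> \<le> M0" "Ax \<in> L2 ?R" "gA \<in> L2 ?R" "0 \<le> M0"
    using W1inf_weak_partial[OF obR(1,2) W(1), of "(1, 0)"] by (auto simp: Basis_real_pair)
  have AzL: "Az \<in> L2 ?R" using W1inf_weak_partial[OF obR(1,2) W(2), of "(1, 0)"] by (auto simp: Basis_real_pair)
  have mA: "AE y in lborel. y \<in> ?R \<longrightarrow> mx \<le> Ax y" using m(2) by eventually_elim auto
  have restr: "AE y in lborel. y \<in> ?R2 \<longrightarrow> P y" if "AE y in lborel. y \<in> ?R \<longrightarrow> P y" for P
    using that sub(1) by (auto elim!: eventually_mono)
  have A2: "Ax \<in> L2 ?R2" "gA \<in> L2 ?R2" "f \<in> H1 ?R2"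
    using L2_subset[OF A(4) sub(1)] L2_subset[OF A(5) sub(1)] H1_subset[OF f sub(1) obR(3)] obR(3) by auto
  have wA2: "has_weak_partial ?R2 (1, 0) Ax gA" by (rule has_weak_partial_subset[OF A(1) sub(1)]) (simp add: Basis_real_pair)
  \<comment> \<open>Fixed before any solution is considered: it depends only on the coefficient and
    the data below the interface.\<close>
  obtain M where M: "0 \<le> M" and flux: "\<And>\<sigma> \<xi>. \<sigma> \<in> L2 {xm<..<xp} \<Longrightarrow> (LINT x:{xm<..<xp}|lborel. \<sigma> x) = 0 \<Longrightarrow>
      (\<And>\<psi>. \<psi> \<in> space_W xm xp \<Longrightarrow> (LINT x:{xm<..<xp}|lborel. (LINT z:?Z2|lborel. Ax (x, z)) * \<sigma> x * wD {xm<..<xp} \<psi> x) =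
         (LINT x:{xm<..<xp}|lborel. (LINT z:?Z2|lborel. f (x, z)) * \<psi> x) - (LINT x:{xm<..<xp}|lborel. gm x * \<psi> x)) \<Longrightarrow>
      \<xi> \<in> space_V xm xp ?Z2 \<Longrightarrow>
      \<bar>LINT y:?R2|lborel. Ax y * \<sigma> (fst y) * wDx ?R2 \<xi> y\<bar> \<le> M * (LINT y:?R2|lborel. \<bar>\<xi> y\<bar>)"
    using interior_flux_bound[OF x z(1) wA2 A2(1,2) restr[OF A(3)] restr[OF A(2)] m(1) restr[OF mA] A(6) A2(3) g(2)] by blast
  define K where "K = (zi - zm) * L2_norm ?R2 f + M * (sqrt (measure lborel ?R2) * (zi - zm)) + sqrt (zi - zm) * L2_norm {xm<..<xp} gm"
  define C0 where "C0 = K / (2 * sqrt (mz * mx))"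
  define C1 where "C1 = (sqrt (zp - zi) * C0 + sqrt (zi - zm) * C0) / (zp - zm)"
  define C2 where "C2 = C0 + sqrt (zp - zi) * C1"
  define C3 where "C3 = K / (2 * mz)"

  \<comment> \<open>The estimate for one \<delta>, with constants independent of it\<close>
  have est: "L2_norm X (wD X (\<lambda>x. u \<delta> x - v \<delta> x)) \<le> C1 * sqrt \<delta> \<and>
      L2_norm R1 (wDx R1 (\<lambda>y. u1 \<delta> y - v1 \<delta> y)) \<le> C2 * sqrt \<delta> \<and>
      L2_norm R1 (wDz R1 (\<lambda>y. u1 \<delta> y - v1 \<delta> y)) \<le> C3 * sqrt \<delta>" if \<delta>: "\<delta> \<in> {0<..\<delta>0}" for \<delta>
  proof -
    have hd: "hypothesis_B {xm<..<xp} {zm<..<zp} Ax Az f gp gm (\<epsilon> \<delta>) \<epsilon>M" by (rule hyp[OF \<delta>])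
    have mono: "strict_mono_on {zm<..<zp} (\<epsilon> \<delta>)" and me: "set_borel_measurable lborel {zm<..<zp} (\<epsilon> \<delta>)"
      using hd unfolding hypothesis_B_def W1inf_le_def by auto
    obtain e0 e1 where e: "0 < e0" "e1 \<le> 1" "\<And>z. z \<in> {zm<..<zp} \<Longrightarrow> e0 \<le> \<epsilon> \<delta> z \<and> \<epsilon> \<delta> z \<le> e1"
      using hd unfolding hypothesis_B_def by blast
    let ?k = "\<lambda>y. Az y / \<epsilon> \<delta> (snd y)"
    have me': "set_borel_measurable lborel ?R (\<lambda>y. inverse (\<epsilon> \<delta> (snd y)))"
    proof -
      have "(\<lambda>z. inverse (indicator {zm<..<zp} z *\<^sub>R \<epsilon> \<delta> z)) \<in> borel_measurable lborel"
        using me unfolding set_borel_measurable_def by (rule borel_measurable_inverse)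
      also have "(\<lambda>z. inverse (indicator {zm<..<zp} z *\<^sub>R \<epsilon> \<delta> z)) = (\<lambda>z. indicator {zm<..<zp} z *\<^sub>R inverse (\<epsilon> \<delta> z))"
        by (auto simp: indicator_def fun_eq_iff)
      finally have "set_borel_measurable lborel {zm<..<zp} (\<lambda>z. inverse (\<epsilon> \<delta> z))" unfolding set_borel_measurable_def .
      from set_borel_measurable_swap[OF set_borel_measurable_fst[OF this, of "{xm<..<xp}"]] show ?thesis by (simp add: o_def)
    qed
    have mk: "set_borel_measurable lborel ?R ?k"
      using set_borel_measurable_mult[OF _ me', of Az] AzL by (simp add: L2_def divide_inverse)
    \<comment> \<open>This bound degenerates with the minimum of \<epsilon> and may depend on
      \<delta>. It only ensures integrability and enters none of the constants.\<close>
    have kb: "AE y in lborel. y \<in> ?R \<longrightarrow> \<bar>?k y\<bar> \<le> Mz / e0"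
      using m(4)
    proof (eventually_elim, intro impI)
      fix y assume "y \<in> ?R \<longrightarrow> mz \<le> Az y \<and> Az y \<le> Mz" and y: "y \<in> ?R"
      then have a: "0 < Az y" "Az y \<le> Mz" using m(3) by auto
      have b: "e0 \<le> \<epsilon> \<delta> (snd y)" using e(3)[of "snd y"] y by (auto simp: mem_Times_iff)
      have "Az y / \<epsilon> \<delta> (snd y) \<le> Mz / e0" using a b e(1) by (intro frac_le) auto
      moreover have "0 < Az y / \<epsilon> \<delta> (snd y)" using a b e(1) by (intro divide_pos_pos) auto
      ultimately show "\<bar>?k y\<bar> \<le> Mz / e0" by simp
    qed
    \<comment> \<open>Above the interface \<epsilon> is merely known to be at most 1, which gives
      coercivity with a constant independent of \<delta>.\<close>
    have k1: "AE y in lborel. y \<in> R1 \<longrightarrow> mz \<le> ?k y"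
      using m(4)
    proof (eventually_elim, intro impI)
      fix y assume *: "y \<in> ?R \<longrightarrow> mz \<le> Az y \<and> Az y \<le> Mz" and y: "y \<in> R1"
      then have yR: "y \<in> ?R" using sub by auto
      have b: "0 < \<epsilon> \<delta> (snd y)" "\<epsilon> \<delta> (snd y) \<le> 1" using e(1,2) e(3)[of "snd y"] yR by (auto simp: mem_Times_iff)
      have "mz * \<epsilon> \<delta> (snd y) \<le> mz * 1" using b m(3) by (intro mult_left_mono) auto
      then show "mz \<le> ?k y" using b * yR by (simp add: le_divide_eq)
    qed
    \<comment> \<open>Monotonicity puts \<epsilon> below its interface value \<delta>, hence the
      large factor 1 / \<delta> in the vertical coefficient.\<close>
    have k2: "AE y in lborel. y \<in> ?R2 \<longrightarrow> mz / \<delta> \<le> ?k y"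
      using m(4)
    proof (eventually_elim, intro impI)
      fix y assume *: "y \<in> ?R \<longrightarrow> mz \<le> Az y \<and> Az y \<le> Mz" and y: "y \<in> ?R2"
      then have yR: "y \<in> ?R" using sub by auto
      have "\<epsilon> \<delta> (snd y) < \<epsilon> \<delta> zi"
        by (rule strict_mono_onD[OF mono]) (use y z in \<open>auto simp: mem_Times_iff\<close>)
      then have b: "\<epsilon> \<delta> (snd y) \<le> \<delta>" using eps[OF \<delta>] by simp
      have c: "0 < \<epsilon> \<delta> (snd y)" using e(1) e(3)[of "snd y"] yR by (auto simp: mem_Times_iff)
      show "mz / \<delta> \<le> ?k y" using b c * yR m(3) by (intro frac_le) auto
    qed
    have mAx: "set_borel_measurable lborel ?R Ax" using A(4) by (simp add: L2_def)
    have d: "0 < \<delta>" using \<delta> by simp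
    note E = AP_difference_estimate[OF x z ap[OF \<delta>] al[OF \<delta>] mAx A(3) mA mk kb k1[unfolded R1_def] k2 m(1,3) d M
        f H1_L2[OF g(1)] H1_L2[OF g(2)]]
    show ?thesis
      unfolding X_def R1_def C3_def C2_def C1_def C0_def K_def
      by (intro conjI; rule E; rule flux; assumption)
  qed

  \<comment> \<open>Convergence and rate\<close>
  have lim: "((\<lambda>\<delta>. c * sqrt \<delta>) \<longlongrightarrow> 0) (at_right 0)" for c :: real
  proof -
    have "((\<lambda>\<delta>. c * sqrt \<delta>) \<longlongrightarrow> c * sqrt 0) (at_right 0)" by (intro tendsto_intros)
    then show ?thesis by simp
  qed
  have ev: "\<forall>\<^sub>F \<delta> in at_right 0. \<delta> \<in> {0<..\<delta>0}"
    using d0 by (auto simp: eventually_at_right_field intro!: exI[of _ \<delta>0])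
  have "((\<lambda>\<delta>. W_norm X (\<lambda>x. u \<delta> x - v \<delta> x)) \<longlongrightarrow> 0) (at_right 0)"
  proof (rule Lim_null_comparison[OF _ lim[of C1]])
    show "\<forall>\<^sub>F \<delta> in at_right 0. norm (W_norm X (\<lambda>x. u \<delta> x - v \<delta> x)) \<le> C1 * sqrt \<delta>"
      using ev by eventually_elim (use est in \<open>auto simp: W_norm_def L2_norm_nonneg\<close>)
  qed
  moreover have "((\<lambda>\<delta>. V_norm R1 (\<lambda>y. u1 \<delta> y - v1 \<delta> y)) \<longlongrightarrow> 0) (at_right 0)"
  proof (rule Lim_null_comparison[OF _ lim[of "C2 + C3"]])
    show "\<forall>\<^sub>F \<delta> in at_right 0. norm (V_norm R1 (\<lambda>y. u1 \<delta> y - v1 \<delta> y)) \<le> (C2 + C3) * sqrt \<delta>"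
      using ev
    proof eventually_elim
      case (elim \<delta>)
      have "norm (V_norm R1 (\<lambda>y. u1 \<delta> y - v1 \<delta> y)) \<le>
          L2_norm R1 (wDx R1 (\<lambda>y. u1 \<delta> y - v1 \<delta> y)) + L2_norm R1 (wDz R1 (\<lambda>y. u1 \<delta> y - v1 \<delta> y))"
        unfolding V_norm_def using sqrt_add_le_add_sqrt[of "(L2_norm R1 (wDx R1 (\<lambda>y. u1 \<delta> y - v1 \<delta> y)))\<^sup>2" "(L2_norm R1 (wDz R1 (\<lambda>y. u1 \<delta> y - v1 \<delta> y)))\<^sup>2"]
        by (simp add: L2_norm_nonneg)
      then show ?case using est[OF elim] by (simp add: distrib_right)
    qed
  qed
  moreover have "\<exists>c>0. \<forall>\<delta>\<in>{0<..\<delta>0}.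
              L2_norm X (wD X (\<lambda>x. u \<delta> x - v \<delta> x))
              + L2_norm R1 (wDx R1 (\<lambda>y. u1 \<delta> y - v1 \<delta> y))
              + L2_norm R1 (wDz R1 (\<lambda>y. u1 \<delta> y - v1 \<delta> y))
              \<le> c * sqrt (\<epsilon> \<delta> zi)"
  \<comment> \<open>The absolute value and the added 1 make the constant strictly positive even when
    all data vanish.\<close>
  proof (intro exI[of _ "\<bar>C1 + C2 + C3\<bar> + 1"] conjI ballI)
    fix \<delta> assume \<delta>: "\<delta> \<in> {0<..\<delta>0}"
    have "L2_norm X (wD X (\<lambda>x. u \<delta> x - v \<delta> x)) + L2_norm R1 (wDx R1 (\<lambda>y. u1 \<delta> y - v1 \<delta> y))
        + L2_norm R1 (wDz R1 (\<lambda>y. u1 \<delta> y - v1 \<delta> y)) \<le> (C1 + C2 + C3) * sqrt \<delta>"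
      using est[OF \<delta>] by (simp add: distrib_right)
    also have "\<dots> \<le> (\<bar>C1 + C2 + C3\<bar> + 1) * sqrt \<delta>" using \<delta> by (intro mult_right_mono) auto
    finally show "L2_norm X (wD X (\<lambda>x. u \<delta> x - v \<delta> x)) + L2_norm R1 (wDx R1 (\<lambda>y. u1 \<delta> y - v1 \<delta> y))
        + L2_norm R1 (wDz R1 (\<lambda>y. u1 \<delta> y - v1 \<delta> y)) \<le> (\<bar>C1 + C2 + C3\<bar> + 1) * sqrt (\<epsilon> \<delta> zi)"
      using eps[OF \<delta>] by simp
  qed simp
  ultimately show ?thesis by blast
qed

end
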